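(* Let $\nu>0$ and let $A_\nu^\pm := r^{-1}(h_\nu-(1\pm i0))^{-1}r^{-1}$ be the boundary values at energy $1$ of the weighted resolvent of the Bessel operator $h_\nu$ in $L^2:=L^2((0,\infty))$. Then: (i) $\displaystyle \|\operatorname{Im} A_\nu^\pm\|_{L^2\to L^2}=\frac{\pi}{4\nu}$; (ii) $\displaystyle \|A_\nu^\pm\|_{L^2\to L^2}=\frac{1}{\nu^2}$ if $0<\nu\le\frac12$; (iii) $\displaystyle \|A_\nu^\pm\|_{L^2\to L^2}=\frac1\nu+O(\nu^{-3/2})$ as $\nu\to\infty$; (iv) $\|A_\nu^\pm\|_{L^2\to L^2}\le \mathcal{C}(\nu)$, where $$\mathcal{C}(\nu):=\begin{cases}1/\nu^2, & 0<\nu\le\frac12,\\ 2/\nu, & \frac12<\nu\le\frac{1}{\sqrt3},\\ 1/\sqrt{\nu^2-\frac14}, & \frac1{\sqrt3}<\nu.\end{cases}$$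
   Context: $L^2:=L^2((0,\infty))$. For $\nu>0$, $h_\nu$ is the Friedrichs extension in $L^2$ of the operator $-\frac{d^2}{dr^2}+\frac{\nu^2-1/4}{r^2}$ initially defined on $C_0^\infty((0,\infty))$; it is self-adjoint and non-negative with spectrum $[0,\infty)$. Here $r^{-1}$ denotes the operator of multiplication by $1/r$. For $z\in\mathbb{C}\setminus[0,\infty)$, $r^{-1}(h_\nu-z)^{-1}r^{-1}$ extends to a bounded operator on $L^2$. $A_\nu^\pm$ is the bounded operator on $L^2$ which is the (weak) limit as $\varepsilon\to0^+$ of $r^{-1}(h_\nu-(1\pm i\varepsilon))^{-1}r^{-1}$; explicitly, $A_\nu^+$ is the integral operator with kernel $\frac{i\pi}{2}(rR)^{-1/2}J_\nu(\min(r,R))\,H^{(1)}_\nu(\max(r,R))$ and $A_\nu^-$ is the integral operator with the complex conjugate kernel, where $J_\nu,Y_\nu$ are the Bessel functions of the first and second kind and $H^{(1)}_\nu=J_\nu+iY_\nu$. For a bounded operator $T$, $\operatorname{Im}T:=\frac{1}{2i}(T-T^* )$. Both signs $\pm$ are covered. *)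

theory Defs
  imports "HOL-Analysis.Analysis" "HOL-Library.Landau_Symbols"
begin

section \<open>The complex Hilbert space \<open>L\<^sup>2((0,\<infinity>))\<close>\<close>

abbreviation half_line :: "real measure" where
  "half_line \<equiv> restrict_space lborel {0<..}"

definition square_integrable :: "(real \<Rightarrow> complex) \<Rightarrow> bool" where
  "square_integrable f \<longleftrightarrow>
     f \<in> borel_measurable half_line \<and> integrable half_line (\<lambda>r. (cmod (f r))\<^sup>2)"

definition L2_eq :: "(real \<Rightarrow> complex) \<Rightarrow> (real \<Rightarrow> complex) \<Rightarrow> bool" where
  "L2_eq f g \<longleftrightarrow> square_integrable f \<and> square_integrable g \<and> (AE r in half_line. f r = g r)"

lemma square_integrable_zero: "square_integrable (\<lambda>_. 0)"
  by (simp add: square_integrable_def)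

lemma square_integrable_measurable [measurable_dest]:
  "square_integrable f \<Longrightarrow> f \<in> borel_measurable half_line"
  by (simp add: square_integrable_def)

lemma square_integrable_mult:
  assumes "square_integrable f"
  shows "square_integrable (\<lambda>r. c * f r)"
  using assms by (auto simp: square_integrable_def norm_mult power_mult_distrib)

lemma square_integrable_add:
  assumes "square_integrable f" "square_integrable g"
  shows "square_integrable (\<lambda>r. f r + g r)"
proof -
  have [measurable]: "f \<in> borel_measurable half_line" "g \<in> borel_measurable half_line"
    using assms by (auto simp: square_integrable_def)
  have bound: "(cmod (a + b))\<^sup>2 \<le> 2 * (cmod a)\<^sup>2 + 2 * (cmod b)\<^sup>2" for a b :: complex
  proof -
    have "(cmod (a + b))\<^sup>2 \<le> (cmod a + cmod b)\<^sup>2"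
      by (intro power_mono norm_triangle_ineq) auto
    also have "\<dots> \<le> 2 * (cmod a)\<^sup>2 + 2 * (cmod b)\<^sup>2"
      using zero_le_power2[of "cmod a - cmod b"] by (simp add: power2_eq_square algebra_simps)
    finally show ?thesis .
  qed
  have "integrable half_line (\<lambda>r. 2 * (cmod (f r))\<^sup>2 + 2 * (cmod (g r))\<^sup>2)"
    using assms by (auto simp: square_integrable_def)
  then have "integrable half_line (\<lambda>r. (cmod (f r + g r))\<^sup>2)"
    by (rule Bochner_Integration.integrable_bound) (use bound in auto)
  then show ?thesis
    by (simp add: square_integrable_def)
qed

lemma square_integrable_diff:
  assumes "square_integrable f" "square_integrable g"
  shows "square_integrable (\<lambda>r. f r - g r)"
  using square_integrable_add[OF assms(1) square_integrable_mult[OF assms(2), of "-1"]] by simp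

lemma square_integrable_product:
  assumes "square_integrable f" "square_integrable g"
  shows "integrable half_line (\<lambda>r. f r * cnj (g r))"
proof -
  have [measurable]: "f \<in> borel_measurable half_line" "g \<in> borel_measurable half_line"
    using assms by (auto simp: square_integrable_def)
  have bound: "cmod a * cmod b \<le> (cmod a)\<^sup>2 + (cmod b)\<^sup>2" for a b :: complex
  proof -
    have "2 * (cmod a * cmod b) \<le> (cmod a)\<^sup>2 + (cmod b)\<^sup>2"
      using zero_le_power2[of "cmod a - cmod b"] by (simp add: power2_eq_square algebra_simps)
    moreover have "0 \<le> cmod a * cmod b"
      by simp
    ultimately show ?thesis
      by linarith
  qed
  have "integrable half_line (\<lambda>r. (cmod (f r))\<^sup>2 + (cmod (g r))\<^sup>2)"
    using assms by (auto simp: square_integrable_def)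
  then show ?thesis
  proof (rule Bochner_Integration.integrable_bound)
    have "(\<lambda>r. cnj (g r)) \<in> borel_measurable half_line"
      by (rule measurable_compose[OF _ borel_measurable_continuous_onI]) (auto intro: continuous_intros)
    then show "(\<lambda>r. f r * cnj (g r)) \<in> borel_measurable half_line"
      by measurable
  qed (use bound in \<open>auto simp: norm_mult\<close>)
qed

quotient_type L2 = "real \<Rightarrow> complex" / partial: L2_eq
proof (rule part_equivpI)
  show "\<exists>f. L2_eq f f"
    using square_integrable_zero by (auto simp: L2_eq_def)
  show "symp L2_eq"
    by (auto simp: symp_def L2_eq_def)
  show "transp L2_eq"
    by (rule transpI) (auto simp: L2_eq_def elim: eventually_elim2)
qed

lift_definition cinner_L2 :: "L2 \<Rightarrow> L2 \<Rightarrow> complex" is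
  "\<lambda>f g. integral\<^sup>L half_line (\<lambda>r. f r * cnj (g r))"
proof -
  fix f f' g g' assume fg: "L2_eq f f'" "L2_eq g g'"
  have "AE r in half_line. f r = f' r" "AE r in half_line. g r = g' r"
    using fg by (auto simp: L2_eq_def)
  then have "AE r in half_line. f r * cnj (g r) = f' r * cnj (g' r)"
    by eventually_elim simp
  moreover have "(\<lambda>r. f r * cnj (g r)) \<in> borel_measurable half_line"
    "(\<lambda>r. f' r * cnj (g' r)) \<in> borel_measurable half_line"
    using fg square_integrable_product borel_measurable_integrable by (auto simp: L2_eq_def)
  ultimately show "(\<integral>r. f r * cnj (g r) \<partial>half_line) = (\<integral>r. f' r * cnj (g' r) \<partial>half_line)"
    by (intro integral_cong_AE) auto
qed

lift_definition scaleC_L2 :: "complex \<Rightarrow> L2 \<Rightarrow> L2" is "\<lambda>c f r. c * f r"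
  by (auto simp: L2_eq_def square_integrable_mult)

instantiation L2 :: real_vector
begin

lift_definition zero_L2 :: L2 is "\<lambda>_. 0"
  by (auto simp: L2_eq_def square_integrable_zero)

lift_definition plus_L2 :: "L2 \<Rightarrow> L2 \<Rightarrow> L2" is "\<lambda>f g r. f r + g r"
  by (auto simp: L2_eq_def square_integrable_add elim: eventually_elim2)

lift_definition minus_L2 :: "L2 \<Rightarrow> L2 \<Rightarrow> L2" is "\<lambda>f g r. f r - g r"
  by (auto simp: L2_eq_def square_integrable_diff elim: eventually_elim2)

definition uminus_L2 :: "L2 \<Rightarrow> L2" where
  "- f = scaleC_L2 (-1) f"

definition scaleR_L2 :: "real \<Rightarrow> L2 \<Rightarrow> L2" where
  "t *\<^sub>R f = scaleC_L2 (complex_of_real t) f"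

instance
proof
  fix a b c :: L2 and s t :: real
  show "a + b + c = a + (b + c)"
    by transfer (auto simp: L2_eq_def add.assoc intro!: square_integrable_add)
  show "a + b = b + a"
    by transfer (auto simp: L2_eq_def add.commute intro!: square_integrable_add)
  show "0 + a = a"
    by transfer (auto simp: L2_eq_def)
  show "- a + a = 0"
    unfolding uminus_L2_def
    by transfer (auto simp: L2_eq_def square_integrable_zero)
  show "a - b = a + - b"
    unfolding uminus_L2_def
    using square_integrable_diff by transfer (auto simp: L2_eq_def)
  show "t *\<^sub>R (a + b) = t *\<^sub>R a + t *\<^sub>R b"
    unfolding scaleR_L2_def
    by transfer (auto simp: L2_eq_def distrib_left distrib_right intro!: square_integrable_add square_integrable_mult)
  show "(s + t) *\<^sub>R a = s *\<^sub>R a + t *\<^sub>R a"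
    unfolding scaleR_L2_def
    by transfer (auto simp: L2_eq_def distrib_left distrib_right intro!: square_integrable_add square_integrable_mult)
  show "s *\<^sub>R t *\<^sub>R a = (s * t) *\<^sub>R a"
    unfolding scaleR_L2_def
    by transfer (auto simp: L2_eq_def mult.assoc intro!: square_integrable_mult)
  show "1 *\<^sub>R a = a"
    unfolding scaleR_L2_def by transfer (auto simp: L2_eq_def)
qed

end

instantiation L2 :: real_inner
begin

definition inner_L2 :: "L2 \<Rightarrow> L2 \<Rightarrow> real" where
  "inner f g = Re (cinner_L2 f g)"

definition norm_L2 :: "L2 \<Rightarrow> real" where
  "norm_L2 f = sqrt (inner f f)"

definition sgn_L2 :: "L2 \<Rightarrow> L2" where
  "sgn_L2 f = f /\<^sub>R sqrt (inner f f)"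

definition dist_L2 :: "L2 \<Rightarrow> L2 \<Rightarrow> real" where
  "dist_L2 f g = sqrt (inner (f - g) (f - g))"

definition uniformity_L2 :: "(L2 \<times> L2) filter" where
  "uniformity_L2 = (INF e\<in>{0<..}. principal {(f, g). sqrt (inner (f - g) (f - g)) < e})"

definition open_L2 :: "L2 set \<Rightarrow> bool" where
  "open_L2 U \<longleftrightarrow> (\<forall>f\<in>U. eventually (\<lambda>(f', g). f' = f \<longrightarrow> g \<in> U)
     (INF e\<in>{0<..}. principal {(f, g). sqrt (inner (f - g) (f - g)) < e}))"

instance
proof
  fix a b c :: L2 and t :: real
  show "dist a b = norm (a - b)" "sgn a = a /\<^sub>R norm a" "norm a = sqrt (inner a a)"
    by (simp_all add: dist_L2_def sgn_L2_def norm_L2_def)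
  show "uniformity = (INF e\<in>{0<..}. principal {(f::L2, g). dist f g < e})"
    by (simp add: uniformity_L2_def dist_L2_def)
  show "open U \<longleftrightarrow> (\<forall>f\<in>U. eventually (\<lambda>(f', g). f' = f \<longrightarrow> g \<in> U) uniformity)" for U :: "L2 set"
    by (simp add: open_L2_def uniformity_L2_def)
  show "inner a b = inner b a"
    unfolding inner_L2_def
  proof transfer
    fix f g :: "real \<Rightarrow> complex"
    have "(\<integral>r. g r * cnj (f r) \<partial>half_line) = (\<integral>r. cnj (f r * cnj (g r)) \<partial>half_line)"
      by (simp add: mult.commute)
    also have "\<dots> = cnj (\<integral>r. f r * cnj (g r) \<partial>half_line)"
      by (simp only: Bochner_Integration.integral_cnj)
    finally show "Re (\<integral>r. f r * cnj (g r) \<partial>half_line) = Re (\<integral>r. g r * cnj (f r) \<partial>half_line)"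
      by simp
  qed
  show "inner (a + b) c = inner a c + inner b c"
    unfolding inner_L2_def
    by transfer (auto simp: L2_eq_def distrib_right square_integrable_product)
  show "inner (t *\<^sub>R a) b = t * inner a b"
    unfolding inner_L2_def scaleR_L2_def
    by transfer (auto simp: L2_eq_def mult.assoc)
  have self: "Re (\<integral>r. f r * cnj (f r) \<partial>half_line) = (\<integral>r. (cmod (f r))\<^sup>2 \<partial>half_line)"
    for f :: "real \<Rightarrow> complex"
    by (simp only: complex_norm_square [symmetric] integral_complex_of_real Re_complex_of_real)
  show "0 \<le> inner a a"
    unfolding inner_L2_def by transfer (simp add: self)
  show "inner a a = 0 \<longleftrightarrow> a = 0"
    unfolding inner_L2_def
    by transfer (auto simp: self L2_eq_def square_integrable_zero square_integrable_def
        integral_nonneg_eq_0_iff_AE)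
qed

end


section \<open>Bounded operators\<close>

definition bounded_clinear :: "(L2 \<Rightarrow> L2) \<Rightarrow> bool" where
  "bounded_clinear T \<longleftrightarrow>
     bounded_linear T \<and> (\<forall>c f. T (scaleC_L2 c f) = scaleC_L2 c (T f))"

definition cadjoint :: "(L2 \<Rightarrow> L2) \<Rightarrow> (L2 \<Rightarrow> L2)" where
  "cadjoint T = (THE S. bounded_clinear S \<and> (\<forall>f g. cinner_L2 (T f) g = cinner_L2 f (S g)))"

definition Im_op :: "(L2 \<Rightarrow> L2) \<Rightarrow> (L2 \<Rightarrow> L2)" where
  "Im_op T = (\<lambda>f. scaleC_L2 (1 / (2 * \<i>)) (T f - cadjoint T f))"


section \<open>Unbounded operators\<close>

text \<open>A possibly unbounded operator is represented by its graph.\<close>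

type_synonym L2_graph = "(L2 \<times> L2) set"

definition adjoint_graph :: "L2_graph \<Rightarrow> L2_graph" where
  "adjoint_graph S = {(u, w). \<forall>(x, y)\<in>S. cinner_L2 y u = cinner_L2 x w}"

text \<open>
  For a symmetric, densely defined, non-negative operator \<open>S\<close>, the domain of the closure of the
  quadratic form \<open>x \<mapsto> \<langle>S x, x\<rangle>\<close>: limits in \<open>L\<^sup>2\<close> of sequences that are Cauchy
  for the form.
\<close>

definition form_domain :: "L2_graph \<Rightarrow> L2 set" where
  "form_domain S = {u. \<exists>x y. (\<forall>n. (x n, y n) \<in> S) \<and> x \<longlonglongrightarrow> u \<and>
     (\<forall>e>0. \<exists>N::nat. \<forall>m\<ge>N. \<forall>n\<ge>N. cmod (cinner_L2 (y m - y n) (x m - x n)) < e)}"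

definition friedrichs :: "L2_graph \<Rightarrow> L2_graph" where
  "friedrichs S = {(u, w) \<in> adjoint_graph S. u \<in> form_domain S}"

definition resolvent_graph :: "L2_graph \<Rightarrow> complex \<Rightarrow> L2_graph" where
  "resolvent_graph H z = {(w - scaleC_L2 z u, u) | u w. (u, w) \<in> H}"


section \<open>The Bessel operator\<close>

definition vderiv :: "(real \<Rightarrow> complex) \<Rightarrow> real \<Rightarrow> complex" where
  "vderiv \<phi> = (\<lambda>r. vector_derivative \<phi> (at r))"

text \<open>\<open>C\<^sub>0\<^sup>\<infinity>((0,\<infinity>))\<close>, with functions extended by zero to the whole line.\<close>

definition test_function :: "(real \<Rightarrow> complex) \<Rightarrow> bool" where
  "test_function \<phi> \<longleftrightarrow>
     (\<forall>n r. (vderiv ^^ n) \<phi> differentiable (at r)) \<and>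
     (\<exists>a b. 0 < a \<and> (\<forall>r. r \<notin> {a..b} \<longrightarrow> \<phi> r = 0))"

text \<open>\<^const>\<open>abs_L2\<close> maps a square integrable function to its class modulo null sets.\<close>

definition bessel_minimal :: "real \<Rightarrow> L2_graph" where
  "bessel_minimal \<nu> =
     {(abs_L2 \<phi>, abs_L2 (\<lambda>r. - vderiv (vderiv \<phi>) r + of_real ((\<nu>\<^sup>2 - 1/4) / r\<^sup>2) * \<phi> r)) | \<phi>.
        test_function \<phi>}"

definition bessel_operator :: "real \<Rightarrow> L2_graph" where
  "bessel_operator \<nu> = friedrichs (bessel_minimal \<nu>)"

definition mult_inverse_r :: L2_graph where
  "mult_inverse_r = {(f, g). AE r in half_line. rep_L2 g r = rep_L2 f r / of_real r}"

text \<open>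
  The bounded extension to \<open>L\<^sup>2\<close> of \<open>r\<^sup>-\<^sup>1(h\<^sub>\<nu> - z)\<^sup>-\<^sup>1r\<^sup>-\<^sup>1\<close>.  It is unique because
  the composition is defined, by Hardy's inequality, on the dense set of all \<open>f\<close> with \<open>f / r\<close> in \<open>L\<^sup>2\<close>.
\<close>

definition weighted_resolvent :: "real \<Rightarrow> complex \<Rightarrow> (L2 \<Rightarrow> L2)" where
  "weighted_resolvent \<nu> z = (THE B. bounded_clinear B \<and>
     (\<forall>(f, g) \<in> mult_inverse_r O resolvent_graph (bessel_operator \<nu>) z O mult_inverse_r. B f = g))"

text \<open>
  \<open>A\<^sub>\<nu>\<^sup>+\<close> and \<open>A\<^sub>\<nu>\<^sup>-\<close> are \<open>boundary_resolvent \<nu> 1\<close> and \<open>boundary_resolvent \<nu> (-1)\<close>.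
\<close>

definition boundary_resolvent :: "real \<Rightarrow> real \<Rightarrow> (L2 \<Rightarrow> L2)" where
  "boundary_resolvent \<nu> \<sigma> = (THE A. bounded_clinear A \<and>
     (\<forall>f g. ((\<lambda>\<epsilon>. cinner_L2 (weighted_resolvent \<nu> (Complex 1 (\<sigma> * \<epsilon>)) f) g)
               \<longlongrightarrow> cinner_L2 (A f) g) (at_right 0)))"

definition C_bound :: "real \<Rightarrow> real" where
  "C_bound \<nu> = (if \<nu> \<le> 1/2 then 1 / \<nu>\<^sup>2
                else if \<nu> \<le> 1 / sqrt 3 then 2 / \<nu>
                else 1 / sqrt (\<nu>\<^sup>2 - 1/4))"

end

theory Submission
  imports Defs
begin

text \<open>
  Write \<open>a = \<nu> - 1/2\<close> and \<open>z = - q\<^sup>2\<close> with \<open>Re q > 0\<close>.  The weighted resolvent has the Green kernel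
  \<open>f(min(r,R)) g(max(r,R)) / (r R)\<close>, where \<open>f\<close> is a multiple of \<open>r\<^sup>1\<^sup>/\<^sup>2 I\<^sub>\<nu>(q r)\<close> and \<open>g\<close> one of
  \<open>r\<^sup>1\<^sup>/\<^sup>2 K\<^sub>\<nu>(q r)\<close>; both are continuous up to \<open>q = -i\<sigma>\<close>, which yields the boundary values.

  The upper bound holds uniformly in \<open>q\<close>: multiply the equation for \<open>u = r A f\<close> by \<open>r\<close> times the conjugate of
  \<open>u' + q u\<close>, integrate the real part, and use Hardy's inequality for \<open>u' + q u\<close>.  For \<open>0 < \<tau> \<le> 1\<close>,
  \<open>\<tau> < 4 \<nu>\<^sup>2\<close> this gives \<open>\<tau> (\<nu>\<^sup>2 - \<tau>/4) \<parallel>A f\<parallel>\<^sup>2 \<le> \<parallel>f\<parallel>\<^sup>2\<close>; take \<open>\<tau> = min(1, 2 \<nu>\<^sup>2)\<close>.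

  The imaginary part has rank one, spanned by \<open>r\<^sup>-\<^sup>1\<^sup>/\<^sup>2 J\<^sub>\<nu>\<close>, and the inner products of these functions
  for different indices are read off the Wronskian.

  For the lower bounds, \<open>u = r\<^sup>1\<^sup>/\<^sup>2 (J\<^sub>\<mu> + i\<sigma> J\<^sub>\<mu>\<^sub>+\<^sub>1)\<close> is outgoing, so that \<open>A\<close> maps
  \<open>r\<^sup>-\<^sup>1\<^sup>/\<^sup>2 ((\<nu>\<^sup>2 - \<mu>\<^sup>2) J\<^sub>\<mu> + i\<sigma> (\<nu>\<^sup>2 - (\<mu>+1)\<^sup>2) J\<^sub>\<mu>\<^sub>+\<^sub>1)\<close> to \<open>u / r\<close>.  Both norms are explicit;
  \<open>\<mu> \<rightarrow> 0\<close> gives \<open>\<parallel>A\<parallel> \<ge> 1/\<nu>\<^sup>2\<close>, and \<open>\<mu> = \<nu> - 1/2\<close> gives \<open>\<parallel>A\<parallel> \<ge> 1/(\<nu> + 1/4)\<close>.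
\<close>

section \<open>The Hilbert space\<close>

text \<open>The multiplier is effective because \<open>w = u' + q u\<close> obeys a first order
  equation, u'' - q^2 u = (d/dr - q) w, and is small at infinity even where \<open>u\<close> stops
  decaying; an estimate in \<open>w\<close> does not degenerate as Re q tends to 0. It is carried
  out for Re q > 0 and test data, where all boundary terms vanish visibly, and is then moved to all
  of L^2 and to the boundary by Fatou's lemma. The parameter \<tau> divides |w|^2 between Young's
  inequality for the right-hand side, which gets the share \<tau>, and Hardy's inequality, which
  gets the rest.

  The operators are definite descriptions over abstract graphs. The kernel operator is tied to the
  Friedrichs graph by duality: explicit solutions for q and for its conjugate, with the symmetry of
  that graph, leave no room for another value.

  In the trial functions the step from \<mu> to \<mu>+1 turns the phase at infinity by pi/2, which
  makes the combination outgoing. With \<mu> = \<nu> - 1/2 the index \<nu> lies midway, so that both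
  coefficients have modulus close to \<nu>; for \<mu> near 0 the first term dominates because its
  norm blows up.\<close>

lemma half_line_measurable_continuous:
  "continuous_on {0<..} f \<Longrightarrow> (f :: real \<Rightarrow> 'a::topological_space) \<in> borel_measurable half_line"
  using borel_measurable_continuous_on_restrict[of "{0<..}" f]
  by (simp add: measurable_cong_sets[OF sets_restrict_space_cong[OF sets_lborel] refl])

lemma space_half_line [simp]: "space half_line = {0<..}"
  by (simp add: space_restrict_space)

lemma AE_half_lineI: "(\<And>r. r > 0 \<Longrightarrow> P r) \<Longrightarrow> AE r in half_line. P r"
  by (rule AE_I2) auto

lemma abs_L2_eq_iff:
  assumes "square_integrable f" "square_integrable g"
  shows "abs_L2 f = abs_L2 g \<longleftrightarrow> (AE r in half_line. f r = g r)"
  using Quotient3_rel[OF Quotient3_L2, of f g] assms by (auto simp: L2_eq_def)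

lemma rep_L2_square_integrable [simp]: "square_integrable (rep_L2 F)"
  using Quotient3_rep_reflp[OF Quotient3_L2, of F] by (auto simp: L2_eq_def)

lemma abs_rep_L2 [simp]: "abs_L2 (rep_L2 F) = F"
  by (rule Quotient3_abs_rep[OF Quotient3_L2])

lemma rep_abs_L2:
  assumes "square_integrable f"
  shows "AE r in half_line. rep_L2 (abs_L2 f) r = f r"
  using abs_L2_eq_iff[of "rep_L2 (abs_L2 f)" f] assms by simp

lemma plus_abs_L2: "square_integrable f \<Longrightarrow> square_integrable g \<Longrightarrow>
    abs_L2 f + abs_L2 g = abs_L2 (\<lambda>r. f r + g r)"
  by (simp add: plus_L2.abs_eq L2_eq_def)

lemma minus_abs_L2: "square_integrable f \<Longrightarrow> square_integrable g \<Longrightarrow>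
    abs_L2 f - abs_L2 g = abs_L2 (\<lambda>r. f r - g r)"
  by (simp add: minus_L2.abs_eq L2_eq_def)

lemma scaleC_abs_L2: "square_integrable f \<Longrightarrow> scaleC_L2 c (abs_L2 f) = abs_L2 (\<lambda>r. c * f r)"
  by (simp add: scaleC_L2.abs_eq L2_eq_def)

lemma cinner_abs_L2: "square_integrable f \<Longrightarrow> square_integrable g \<Longrightarrow>
    cinner_L2 (abs_L2 f) (abs_L2 g) = (\<integral>r. f r * cnj (g r) \<partial>half_line)"
  by (simp add: cinner_L2.abs_eq L2_eq_def)

lemma cinner_L2_rep: "cinner_L2 F G = (\<integral>r. rep_L2 F r * cnj (rep_L2 G r) \<partial>half_line)"
  using cinner_abs_L2[of "rep_L2 F" "rep_L2 G"] by simp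

lemma cinner_L2_self: "cinner_L2 F F = of_real ((norm F)\<^sup>2)"
proof -
  have *: "cinner_L2 F F = of_real (\<integral>r. (cmod (rep_L2 F r))\<^sup>2 \<partial>half_line)"
    by (simp only: cinner_L2_rep complex_norm_square [symmetric] integral_complex_of_real)
  have "(norm F)\<^sup>2 = inner F F"
    by (rule power2_norm_eq_inner)
  then show ?thesis
    unfolding inner_L2_def by (simp add: *)
qed

lemma norm_abs_L2:
  assumes "square_integrable f"
  shows "(norm (abs_L2 f))\<^sup>2 = (\<integral>r. (cmod (f r))\<^sup>2 \<partial>half_line)"
proof -
  have "complex_of_real ((norm (abs_L2 f))\<^sup>2) = of_real (\<integral>r. (cmod (f r))\<^sup>2 \<partial>half_line)"
    by (simp only: cinner_L2_self [symmetric] cinner_abs_L2[OF assms assms]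
        complex_norm_square [symmetric] integral_complex_of_real)
  then show ?thesis
    by (simp only: of_real_eq_iff)
qed

lemma nn_norm_abs_L2:
  assumes "square_integrable f"
  shows "(\<integral>\<^sup>+r. ennreal ((cmod (f r))\<^sup>2) \<partial>half_line) = ennreal ((norm (abs_L2 f))\<^sup>2)"
  using assms by (subst nn_integral_eq_integral) (auto simp: norm_abs_L2 square_integrable_def)

section \<open>Sesquilinearity and Cauchy-Schwarz for the complex inner product\<close>

lemma cinner_L2_add_left: "cinner_L2 (a + b) c = cinner_L2 a c + cinner_L2 b c"
  by transfer (auto simp: L2_eq_def distrib_right square_integrable_product)

lemma cinner_L2_diff_left: "cinner_L2 (a - b) c = cinner_L2 a c - cinner_L2 b c"
  by transfer (auto simp: L2_eq_def left_diff_distrib square_integrable_product)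

lemma cinner_L2_scaleC_left: "cinner_L2 (scaleC_L2 k a) c = k * cinner_L2 a c"
  by transfer (auto simp: L2_eq_def mult.assoc)

lemma cinner_L2_commute: "cinner_L2 a b = cnj (cinner_L2 b a)"
proof transfer
  fix f g :: "real \<Rightarrow> complex"
  have "(\<integral>r. f r * cnj (g r) \<partial>half_line) = (\<integral>r. cnj (g r * cnj (f r)) \<partial>half_line)"
    by (simp add: mult.commute)
  then show "(\<integral>r. f r * cnj (g r) \<partial>half_line) = cnj (\<integral>r. g r * cnj (f r) \<partial>half_line)"
    by (simp only: Bochner_Integration.integral_cnj)
qed

lemma cinner_L2_add_right: "cinner_L2 c (a + b) = cinner_L2 c a + cinner_L2 c b"
  by (subst (1 2 3) cinner_L2_commute) (simp add: cinner_L2_add_left)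

lemma cinner_L2_diff_right: "cinner_L2 c (a - b) = cinner_L2 c a - cinner_L2 c b"
  by (subst (1 2 3) cinner_L2_commute) (simp add: cinner_L2_diff_left)

lemma cinner_L2_scaleC_right: "cinner_L2 c (scaleC_L2 k a) = cnj k * cinner_L2 c a"
  by (subst (1 2) cinner_L2_commute) (simp add: cinner_L2_scaleC_left)

lemmas cinner_L2_simps = cinner_L2_add_left cinner_L2_add_right cinner_L2_diff_left
  cinner_L2_diff_right cinner_L2_scaleC_left cinner_L2_scaleC_right

lemma norm_scaleC_L2: "norm (scaleC_L2 k a) = cmod k * norm a"
proof -
  have "complex_of_real ((norm (scaleC_L2 k a))\<^sup>2) = of_real ((cmod k * norm a)\<^sup>2)"
    unfolding cinner_L2_self [symmetric] cinner_L2_simps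
    by (simp add: cinner_L2_self power_mult_distrib mult_ac flip: complex_norm_square)
  then have "(norm (scaleC_L2 k a))\<^sup>2 = (cmod k * norm a)\<^sup>2"
    by (simp only: of_real_eq_iff)
  then show ?thesis
    by (simp add: power2_eq_iff_nonneg)
qed

lemma cinner_L2_bound: "cmod (cinner_L2 a b) \<le> norm a * norm b"
proof (cases "cinner_L2 a b = 0")
  case False
  \<comment> \<open>The unit \<open>k\<close> rotates the inner product onto the non-negative reals,
    where it coincides with the real \<open>inner\<close> and the real Cauchy-Schwarz inequality
    applies.\<close>
  define k where "k = cnj (cinner_L2 a b) / cmod (cinner_L2 a b)"
  have k: "cmod k = 1"
    using False by (simp add: k_def norm_divide)
  have "k * cinner_L2 a b = cmod (cinner_L2 a b)"
    using False by (simp add: k_def complex_norm_square [symmetric] power2_eq_square mult.commute)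
  then have "cmod (cinner_L2 a b) = inner (scaleC_L2 k a) b"
    by (simp add: inner_L2_def cinner_L2_simps)
  also have "\<dots> \<le> norm (scaleC_L2 k a) * norm b"
    by (rule norm_cauchy_schwarz)
  finally show ?thesis
    by (simp add: norm_scaleC_L2 k)
qed simp

lemma cinner_L2_eqI:
  assumes "\<And>g. cinner_L2 a g = cinner_L2 b g"
  shows "a = b"
proof -
  have "cinner_L2 (a - b) (a - b) = 0"
    by (simp only: cinner_L2_diff_left assms diff_self)
  then show ?thesis
    by (simp add: cinner_L2_self)
qed

lemma scaleR_scaleC_L2: "t *\<^sub>R f = scaleC_L2 (complex_of_real t) f"
  by (rule scaleR_L2_def)

lemma continuous_cinner_left: "f \<longlonglongrightarrow> l \<Longrightarrow> (\<lambda>n. cinner_L2 (f n) g) \<longlonglongrightarrow> cinner_L2 l g"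
proof -
  assume "f \<longlonglongrightarrow> l"
  then have "(\<lambda>n. norm (f n - l) * norm g) \<longlonglongrightarrow> 0"
    by (intro tendsto_mult_left_zero tendsto_norm_zero) (simp add: LIM_zero)
  then have "(\<lambda>n. cinner_L2 (f n) g - cinner_L2 l g) \<longlonglongrightarrow> 0"
    by (rule Lim_null_comparison[rotated]) (use cinner_L2_bound in \<open>auto simp: cinner_L2_diff_left [symmetric]\<close>)
  then show ?thesis
    by (rule LIM_zero_cancel)
qed

lemma continuous_cinner_right: "f \<longlonglongrightarrow> l \<Longrightarrow> (\<lambda>n. cinner_L2 g (f n)) \<longlonglongrightarrow> cinner_L2 g l"
  using tendsto_cnj[OF continuous_cinner_left[of f l g]] by (simp add: cinner_L2_commute [symmetric])

section \<open>Bounded operators and dense sets\<close>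

lemma bounded_clinearI:
  assumes "\<And>f g. T (f + g) = T f + T g" "\<And>c f. T (scaleC_L2 c f) = scaleC_L2 c (T f)"
    "\<And>f. norm (T f) \<le> C * norm f"
  shows "bounded_clinear T"
  unfolding bounded_clinear_def using assms
  by (auto simp: scaleR_scaleC_L2 mult.commute intro!: bounded_linear_intro[where K = C])

text \<open>Gives the uniqueness that resolves the definite description of
  \<open>weighted_resolvent\<close>, with the classes of test functions as \<open>D\<close>.\<close>

lemma bounded_clinear_eqI:
  assumes "bounded_clinear S" "bounded_clinear T" "closure D = UNIV" "\<And>f. f \<in> D \<Longrightarrow> S f = T f"
  shows "S = T"
proof
  fix f
  have "f \<in> closure D" using assms(3) by simp
  then obtain d where d: "\<And>n. d n \<in> D" "d \<longlonglongrightarrow> f"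
    unfolding closure_sequential by blast
  have "(\<lambda>n. S (d n)) \<longlonglongrightarrow> S f" "(\<lambda>n. T (d n)) \<longlonglongrightarrow> T f"
    using assms(1,2) d(2) by (auto simp: bounded_clinear_def intro: bounded_linear.tendsto)
  moreover have "S (d n) = T (d n)" for n
    using assms(4) d(1) by blast
  ultimately show "S f = T f"
    using LIMSEQ_unique[of "\<lambda>n. S (d n)" "S f" "T f"] by simp
qed

lemma L2_orthogonal_dense:
  assumes "closure D = UNIV" "\<And>g. g \<in> D \<Longrightarrow> cinner_L2 a g = 0"
  shows "a = 0"
proof -
  have "a \<in> closure D" using assms(1) by simp
  then obtain d where d: "\<And>n. d n \<in> D" "d \<longlonglongrightarrow> a"
    unfolding closure_sequential by blast
  have "(\<lambda>n. cinner_L2 a (d n)) \<longlonglongrightarrow> cinner_L2 a a"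
    using d(2) by (rule continuous_cinner_right)
  then have "cinner_L2 a a = 0"
    using assms(2) d(1) by (simp add: LIMSEQ_const_iff)
  then show ?thesis
    by (simp add: cinner_L2_self)
qed

lemma square_integrableI_bounded:
  assumes "f \<in> borel_measurable half_line" "square_integrable g"
    "AE r in half_line. cmod (f r) \<le> cmod (g r)"
  shows "square_integrable f"
  unfolding square_integrable_def
proof
  show "integrable half_line (\<lambda>r. (cmod (f r))\<^sup>2)"
  proof (rule Bochner_Integration.integrable_bound)
    show "integrable half_line (\<lambda>r. (cmod (g r))\<^sup>2)"
      using assms(2) by (simp add: square_integrable_def)
    show "AE r in half_line. norm ((cmod (f r))\<^sup>2) \<le> norm ((cmod (g r))\<^sup>2)"
      using assms(3) by eventually_elim (simp add: power_mono)
  qed (use assms(1) in measurable)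
qed (fact assms(1))

text \<open>Of the limit only measurability is assumed; its square integrability comes out together
  with the bound. Truncated solutions, images of approximating data and kernels on the boundary are
  all brought into L^2 in this way.\<close>

lemma L2_Fatou:
  assumes f: "f \<in> borel_measurable half_line"
    and fn: "\<And>n. square_integrable (fn n)"
    and lim: "AE r in half_line. (\<lambda>n. fn n r) \<longlonglongrightarrow> f r"
    and bound: "\<And>n. norm (abs_L2 (fn n)) \<le> C n" and C: "C \<longlonglongrightarrow> c"
  shows "square_integrable f \<and> norm (abs_L2 f) \<le> c"
proof -
  have c0: "0 \<le> c"
    by (rule LIMSEQ_le_const[OF C]) (meson bound norm_ge_zero order_trans)
  have [measurable]: "\<And>n. fn n \<in> borel_measurable half_line"
    using fn by (simp add: square_integrable_def)
  note f [measurable]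
  have "(\<integral>\<^sup>+r. ennreal ((cmod (f r))\<^sup>2) \<partial>half_line)
      = (\<integral>\<^sup>+r. liminf (\<lambda>n. ennreal ((cmod (fn n r))\<^sup>2)) \<partial>half_line)"
  proof (rule nn_integral_cong_AE)
    show "AE r in half_line. ennreal ((cmod (f r))\<^sup>2) = liminf (\<lambda>n. ennreal ((cmod (fn n r))\<^sup>2))"
      using lim
    proof eventually_elim
      case (elim r)
      then have "(\<lambda>n. ennreal ((cmod (fn n r))\<^sup>2)) \<longlonglongrightarrow> ennreal ((cmod (f r))\<^sup>2)"
        by (intro tendsto_ennrealI tendsto_intros)
      from lim_imp_Liminf[OF trivial_limit_sequentially this] show ?case
        by (rule sym)
    qed
  qed
  also have "\<dots> \<le> liminf (\<lambda>n. \<integral>\<^sup>+r. ennreal ((cmod (fn n r))\<^sup>2) \<partial>half_line)"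
    by (rule nn_integral_liminf) measurable
  also have "\<dots> = liminf (\<lambda>n. ennreal ((norm (abs_L2 (fn n)))\<^sup>2))"
    by (simp add: nn_norm_abs_L2[OF fn])
  also have "\<dots> \<le> liminf (\<lambda>n. ennreal ((C n)\<^sup>2))"
    by (rule Liminf_mono) (auto intro!: always_eventually ennreal_leI power_mono bound)
  also have "\<dots> = ennreal (c\<^sup>2)"
    by (rule lim_imp_Liminf) (auto intro!: tendsto_ennrealI tendsto_intros C)
  finally have le: "(\<integral>\<^sup>+r. ennreal ((cmod (f r))\<^sup>2) \<partial>half_line) \<le> ennreal (c\<^sup>2)" .
  then have si: "square_integrable f"
    unfolding square_integrable_def
    by (intro conjI f integrableI_bounded) (auto intro: le_less_trans)
  then have "ennreal ((norm (abs_L2 f))\<^sup>2) \<le> ennreal (c\<^sup>2)"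
    using le by (simp add: nn_norm_abs_L2)
  then have "norm (abs_L2 f) \<le> c"
    using c0 by (simp add: power2_le_iff_abs_le)
  with si show ?thesis by simp
qed

lemma L2_dominated:
  assumes f: "f \<in> borel_measurable half_line" and g: "square_integrable g"
    and fn: "\<And>n. fn n \<in> borel_measurable half_line"
    and lim: "AE r in half_line. (\<lambda>n. fn n r) \<longlonglongrightarrow> f r"
    and bound: "\<And>n. AE r in half_line. cmod (fn n r) \<le> cmod (g r)"
  shows "square_integrable f" "\<And>n. square_integrable (fn n)" "(\<lambda>n. abs_L2 (fn n)) \<longlonglongrightarrow> abs_L2 f"
proof -
  show sin: "square_integrable (fn n)" for n
    by (rule square_integrableI_bounded[OF fn g bound])
  have fb: "AE r in half_line. cmod (f r) \<le> cmod (g r)"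
  proof -
    have "AE r in half_line. \<forall>n. cmod (fn n r) \<le> cmod (g r)"
      using bound by (simp add: AE_all_countable)
    with lim show ?thesis
    proof eventually_elim
      case (elim r)
      have "(\<lambda>n. cmod (fn n r)) \<longlonglongrightarrow> cmod (f r)"
        using elim by (intro tendsto_norm)
      then show ?case
        by (rule LIMSEQ_le_const2) (use elim in auto)
    qed
  qed
  show si: "square_integrable f"
    by (rule square_integrableI_bounded[OF f g fb])
  note f [measurable] fn [measurable]
  have "(\<lambda>n. \<integral>r. (cmod (fn n r - f r))\<^sup>2 \<partial>half_line) \<longlonglongrightarrow> (\<integral>r. 0 \<partial>half_line)"
  proof (rule integral_dominated_convergence)
    show "integrable half_line (\<lambda>r. (2 * cmod (g r))\<^sup>2)"
      using g by (auto simp: square_integrable_def power_mult_distrib)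
    show "AE r in half_line. (\<lambda>n. (cmod (fn n r - f r))\<^sup>2) \<longlonglongrightarrow> 0"
      using lim
    proof eventually_elim
      case (elim r)
      have "(\<lambda>n. (cmod (fn n r - f r))\<^sup>2) \<longlonglongrightarrow> (cmod (f r - f r))\<^sup>2"
        by (intro tendsto_intros elim)
      then show ?case by simp
    qed
    show "AE r in half_line. norm ((cmod (fn n r - f r))\<^sup>2) \<le> (2 * cmod (g r))\<^sup>2" for n
      using bound[of n] fb
    proof eventually_elim
      case (elim r)
      have "cmod (fn n r - f r) \<le> 2 * cmod (g r)"
        using norm_triangle_ineq4[of "fn n r" "f r"] elim by linarith
      then show ?case
        by (simp only: real_norm_def abs_power2 power_mono norm_ge_zero)
    qed
  qed measurable
  then have "(\<lambda>n. (norm (abs_L2 (fn n) - abs_L2 f))\<^sup>2) \<longlonglongrightarrow> 0"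
    by (simp add: minus_abs_L2 sin si norm_abs_L2 square_integrable_diff)
  then have "(\<lambda>n. sqrt ((norm (abs_L2 (fn n) - abs_L2 f))\<^sup>2)) \<longlonglongrightarrow> sqrt 0"
    by (rule tendsto_real_sqrt)
  then show "(\<lambda>n. abs_L2 (fn n)) \<longlonglongrightarrow> abs_L2 f"
    by (simp only: real_sqrt_abs abs_norm_cancel real_sqrt_zero tendsto_norm_zero_iff LIM_zero_iff)
qed

section \<open>Smooth functions and density of test functions\<close>

text \<open>Peeling off the first derivative matches the product and chain rules, whose proofs
  induct on \<open>n\<close> for all functions at once. The set \<open>S\<close> stays a parameter
  because the powers of 1/r are smooth only on the open half line.\<close>

primrec csm :: "nat \<Rightarrow> real set \<Rightarrow> (real \<Rightarrow> complex) \<Rightarrow> bool" where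
  "csm 0 S f \<longleftrightarrow> True"
| "csm (Suc n) S f \<longleftrightarrow> (\<forall>r\<in>S. f differentiable (at r)) \<and> csm n S (vderiv f)"

definition csmooth_on :: "real set \<Rightarrow> (real \<Rightarrow> complex) \<Rightarrow> bool" where
  "csmooth_on S f \<longleftrightarrow> (\<forall>n. csm n S f)"

lemma vderiv_eqI: "(f has_vector_derivative d) (at r) \<Longrightarrow> vderiv f r = d"
  by (simp add: vderiv_def vector_derivative_at)

lemma has_vderiv: "f differentiable (at r) \<Longrightarrow> (f has_vector_derivative vderiv f r) (at r)"
  by (simp add: vderiv_def vector_derivative_works)

lemma has_vector_derivative_cong_open:
  assumes "open S" "r \<in> S" "\<And>x. x \<in> S \<Longrightarrow> f x = g x" "(f has_vector_derivative d) (at r)"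
  shows "(g has_vector_derivative d) (at r)"
  using has_vector_derivative_transform_within_open[OF assms(4,1,2)] assms(3) by blast

lemma differentiable_cong_open:
  assumes "open S" "r \<in> S" "\<And>x. x \<in> S \<Longrightarrow> f x = (g x :: complex)" "f differentiable (at (r::real))"
  shows "g differentiable (at r)" "vderiv g r = vderiv f r"
proof -
  have "(g has_vector_derivative vderiv f r) (at r)"
    by (rule has_vector_derivative_cong_open[OF assms(1-3) has_vderiv[OF assms(4)]])
  then show "g differentiable (at r)" "vderiv g r = vderiv f r"
    by (auto simp: vderiv_eqI intro: differentiableI_vector)
qed

lemma csm_cong:
  assumes "open S" "\<And>r. r \<in> S \<Longrightarrow> f r = g r" "csm n S f"
  shows "csm n S g"
  using assms(2,3)
proof (induction n arbitrary: f g)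
  case (Suc n)
  have "g differentiable (at r)" "vderiv f r = vderiv g r" if "r \<in> S" for r
    using differentiable_cong_open[OF assms(1) that, of f g] Suc.prems that by auto
  then show ?case
    using Suc by auto
qed auto

lemma csm_mono: "m \<le> n \<Longrightarrow> csm n S f \<Longrightarrow> csm m S f"
proof (induction m arbitrary: n f)
  case (Suc m)
  then obtain k where "n = Suc k" by (cases n) auto
  then show ?case using Suc by auto
qed auto

lemma csm_subset: "S \<subseteq> T \<Longrightarrow> csm n T f \<Longrightarrow> csm n S f"
  by (induction n arbitrary: f) auto

text \<open>A family that contains the derivatives of its members is its own induction invariant.
  Multiples of 1/r^n, and polynomials in 1/t times exp(-1/t), are treated in this way without
  formulas for higher derivatives.\<close>

lemma csmooth_onI:
  assumes "open S"
    and "\<And>f. f \<in> X \<Longrightarrow> \<exists>g\<in>X. \<forall>r\<in>S. (f has_vector_derivative g r) (at r)"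
    and "f \<in> X"
  shows "csmooth_on S f"
proof -
  have "csm n S f" for n
    using assms(3)
  proof (induction n arbitrary: f)
    case (Suc n)
    obtain g where g: "g \<in> X" "\<And>r. r \<in> S \<Longrightarrow> (f has_vector_derivative g r) (at r)"
      using assms(2) Suc.prems by blast
    have "csm n S (vderiv f)"
      by (rule csm_cong[OF assms(1) _ Suc.IH[OF g(1)]]) (rule vderiv_eqI[symmetric, OF g(2)])
    then show ?case
      using g(2) by (auto intro: differentiableI_vector)
  qed auto
  then show ?thesis by (simp add: csmooth_on_def)
qed

lemma csm_const: "open S \<Longrightarrow> csm n S (\<lambda>_. c)"
  using csmooth_onI[of S "range (\<lambda>c _. c)" "\<lambda>_. c"]
  by (force simp: csmooth_on_def intro!: derivative_eq_intros)

lemma csm_add: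
  assumes "open S" "csm n S f" "csm n S g"
  shows "csm n S (\<lambda>r. f r + g r)"
  using assms(2,3)
proof (induction n arbitrary: f g)
  case (Suc n)
  have d: "((\<lambda>r. f r + g r) has_vector_derivative vderiv f r + vderiv g r) (at r)" if "r \<in> S" for r
    using Suc.prems that by (intro has_vector_derivative_add has_vderiv) auto
  have "csm n S (vderiv (\<lambda>r. f r + g r))"
    by (rule csm_cong[OF assms(1) _ Suc.IH[of "vderiv f" "vderiv g"]])
      (use Suc.prems in \<open>auto intro: vderiv_eqI[symmetric] d\<close>)
  then show ?case
    using d by (auto intro: differentiableI_vector)
qed auto

lemma csm_mult:
  assumes "open S" "csm n S f" "csm n S g"
  shows "csm n S (\<lambda>r. f r * g r)"
  using assms(2,3)
proof (induction n arbitrary: f g)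
  case (Suc n)
  have d: "((\<lambda>r. f r * g r) has_vector_derivative f r * vderiv g r + vderiv f r * g r) (at r)"
    if "r \<in> S" for r
    using Suc.prems that by (intro has_vector_derivative_mult has_vderiv) auto
  have fg: "csm n S f" "csm n S g" "csm n S (vderiv f)" "csm n S (vderiv g)"
    using Suc.prems csm_mono[of n "Suc n" S] by (auto simp del: csm.simps) auto
  have "csm n S (vderiv (\<lambda>r. f r * g r))"
    by (rule csm_cong[OF assms(1) _ csm_add[OF assms(1) Suc.IH[OF fg(1,4)] Suc.IH[OF fg(3,2)]]])
      (rule vderiv_eqI[symmetric, OF d])
  then show ?case
    using d by (auto intro: differentiableI_vector)
qed auto

lemma csm_compose:
  assumes "open S" "\<And>r. r \<in> S \<Longrightarrow> (h has_real_derivative h' r) (at r)" "h ` S \<subseteq> T"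
    "csm n S (\<lambda>r. of_real (h' r))" "csm n T f"
  shows "csm n S (\<lambda>r. f (h r))"
  using assms(4,5)
proof (induction n arbitrary: f)
  case (Suc n)
  have d: "((\<lambda>r. f (h r)) has_vector_derivative of_real (h' r) * vderiv f (h r)) (at r)"
    if "r \<in> S" for r
  proof -
    have "(f has_vector_derivative vderiv f (h r)) (at (h r))"
      using Suc.prems assms(3) that by (intro has_vderiv) auto
    then have "(f \<circ> h has_vector_derivative h' r *\<^sub>R vderiv f (h r)) (at r)"
      using assms(2)[OF that] by (intro vector_diff_chain_at) (simp_all add: has_real_derivative_iff_has_vector_derivative)
    then show ?thesis
      by (simp add: o_def scaleR_conv_of_real)
  qed
  have h: "csm n S (\<lambda>r. of_real (h' r))"
    using Suc.prems csm_mono[of n "Suc n" S] by (auto simp del: csm.simps)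
  have "csm n S (vderiv (\<lambda>r. f (h r)))"
    by (rule csm_cong[OF assms(1) _ csm_mult[OF assms(1) h Suc.IH[OF h, of "vderiv f"]]])
      (use Suc.prems in \<open>auto intro: vderiv_eqI[symmetric] d\<close>)
  then show ?case
    using d by (auto intro: differentiableI_vector)
qed auto

lemma csmooth_on_of_real: "open S \<Longrightarrow> csmooth_on S of_real"
proof -
  assume S: "open S"
  have d: "(complex_of_real has_vector_derivative 1) (at r)" for r
    using has_vector_derivative_of_real[OF DERIV_ident] by simp
  have "csm n S complex_of_real" for n
  proof (cases n)
    case (Suc m)
    have "csm m S (vderiv complex_of_real)"
      by (rule csm_cong[OF S _ csm_const[OF S, of m 1]]) (rule vderiv_eqI[symmetric, OF d])
    then show ?thesis
      using d Suc by (auto intro: differentiableI_vector)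
  qed simp
  then show ?thesis by (simp add: csmooth_on_def)
qed

lemma csmooth_on_inverse_power: "csmooth_on {0<..} (\<lambda>r. k / of_real r ^ n)"
proof (rule csmooth_onI)
  show "(\<lambda>r. k / of_real r ^ n) \<in> {(\<lambda>r. k / of_real r ^ n) | k n. True}" by blast
  fix f :: "real \<Rightarrow> complex" assume "f \<in> {(\<lambda>r. k / of_real r ^ n) | k n. True}"
  then obtain k n where f: "f = (\<lambda>r. k / of_real r ^ n)" by blast
  have "(f has_vector_derivative (- of_nat n * k) / of_real r ^ Suc n) (at r)" if "r \<in> {0<..}" for r
  proof -
    define z where "z = complex_of_real r"
    have z: "z \<noteq> 0" using that by (simp add: z_def)
    have "((\<lambda>z. k / z ^ n) has_field_derivative (0 * z ^ n - k * (of_nat n * z ^ (n - 1))) / (z ^ n * z ^ n)) (at z)"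
      using z by (auto intro!: derivative_eq_intros)
    moreover have "(0 * z ^ n - k * (of_nat n * z ^ (n - 1))) / (z ^ n * z ^ n) = (- of_nat n * k) / z ^ Suc n"
      using z by (cases n) (simp_all add: divide_simps, simp add: algebra_simps)
    ultimately have "((\<lambda>z. k / z ^ n) has_field_derivative (- of_nat n * k) / of_real r ^ Suc n) (at (of_real r))"
      by (simp only: z_def)
    then show ?thesis
      unfolding f by (rule has_vector_derivative_real_field)
  qed
  then show "\<exists>g\<in>{(\<lambda>r. k / of_real r ^ n) | k n. True}. \<forall>r\<in>{0<..}. (f has_vector_derivative g r) (at r)"
    by (intro bexI[of _ "\<lambda>r. (- of_nat n * k) / of_real r ^ Suc n"] ballI) (blast+)
qed auto

section \<open>A smooth function that is flat at the origin\<close>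

lemma poly_exp_decay: "((\<lambda>y. poly p y * exp (- y)) \<longlongrightarrow> (0::real)) at_top"
proof -
  have "((\<lambda>y. \<Sum>i\<le>degree p. coeff p i * (y ^ i / exp y)) \<longlongrightarrow> (\<Sum>i\<le>degree p. coeff p i * 0)) at_top"
    by (intro tendsto_intros tendsto_power_div_exp_0)
  then show ?thesis
    by (simp add: poly_altdef sum_distrib_right sum_divide_distrib exp_minus field_simps)
qed

definition cutoff_exp :: "real \<Rightarrow> real" where
  "cutoff_exp t = (if t > 0 then exp (- 1 / t) else 0)"

lemma csmooth_on_cutoff_exp: "csmooth_on UNIV (\<lambda>t. of_real (cutoff_exp t))"
proof (rule csmooth_onI)
  define G where "G = (\<lambda>(p::real poly) t. if t > 0 then poly p (1/t) * exp (- 1 / t) else 0)"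
  show "(\<lambda>t. complex_of_real (cutoff_exp t)) \<in> range (\<lambda>p t. of_real (G p t))"
    by (rule image_eqI[of _ _ 1]) (auto simp: G_def cutoff_exp_def fun_eq_iff)
  fix f assume "f \<in> range (\<lambda>p t. complex_of_real (G p t))"
  then obtain p where f: "f = (\<lambda>t. of_real (G p t))" by blast
  \<comment> \<open>With y = 1/t, differentiating p(y) exp(-y) in t gives y^2 (p(y) - p'(y))
    exp(-y), so the family is closed under differentiation away from the origin.\<close>
  define p' where "p' = [:0,0,1:] * (p - pderiv p)"
  have "(G p has_real_derivative G p' t) (at t)" for t
  proof -
    consider "t > 0" | "t < 0" | "t = 0" by linarith
    then show ?thesis
    proof cases
      case 1
      have "((\<lambda>t. poly p (1/t) * exp (- 1 / t)) has_real_derivative G p' t) (at t)"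
        using 1 by (auto intro!: derivative_eq_intros DERIV_chain2[OF poly_DERIV]
            simp: G_def p'_def field_simps power2_eq_square)
      then show ?thesis
        by (rule has_field_derivative_transform_within_open[of _ _ _ "{0<..}"]) (use 1 in \<open>auto simp: G_def\<close>)
    next
      case 2
      have "((\<lambda>t. 0) has_real_derivative G p' t) (at t)"
        using 2 by (auto simp: G_def)
      then show ?thesis
        by (rule has_field_derivative_transform_within_open[of _ _ _ "{..<0}"]) (use 2 in \<open>auto simp: G_def\<close>)
    next
      case 3
      \<comment> \<open>At the origin the difference quotient is y p(y) exp(-y) with y = 1/h, again
        a polynomial times a decaying exponential.\<close>
      have lim: "((\<lambda>h. G p h / h) \<longlongrightarrow> 0) (at_right 0)"
      proof -
        have "((\<lambda>h. poly ([:0,1:] * p) (inverse h) * exp (- inverse h)) \<longlongrightarrow> 0) (at_right 0)"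
          by (rule filterlim_compose[OF poly_exp_decay filterlim_inverse_at_top_right])
        moreover have "eventually (\<lambda>h. poly ([:0,1:] * p) (inverse h) * exp (- inverse h) = G p h / h) (at_right 0)"
          unfolding eventually_at_right_field
          by (rule exI[of _ 1]) (auto simp: G_def field_simps)
        ultimately show ?thesis
          by (rule Lim_transform_eventually)
      qed
      moreover have "((\<lambda>h. G p h / h) \<longlongrightarrow> 0) (at_left 0)"
        by (rule tendsto_eventually) (auto simp: eventually_at_left_field G_def intro: exI[of _ "-1"])
      ultimately have "((\<lambda>h. G p h / h) \<longlongrightarrow> 0) (at 0)"
        by (simp add: filterlim_split_at)
      then show ?thesis
        using 3 by (simp only: DERIV_def) (simp add: G_def)
    qed
  qed
  then have "(f has_vector_derivative of_real (G p' t)) (at t)" for t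
    unfolding f by (rule has_vector_derivative_of_real)
  then show "\<exists>g\<in>range (\<lambda>p t. complex_of_real (G p t)). \<forall>t\<in>UNIV. (f has_vector_derivative g t) (at t)"
    by (intro bexI[of _ "\<lambda>t. of_real (G p' t)"]) auto
qed auto

lemma csm_UNIV_iff: "csm n UNIV f \<longleftrightarrow> (\<forall>m<n. \<forall>r. (vderiv ^^ m) f differentiable (at r))"
proof (induction n arbitrary: f)
  case (Suc n)
  have "(vderiv ^^ Suc m) f = (vderiv ^^ m) (vderiv f)" for m
    by (simp add: funpow_swap1)
  then show ?case
    using Suc[of "vderiv f"] by (auto simp: less_Suc_eq_0_disj simp del: funpow.simps(2))
qed auto

section \<open>Closure properties of test functions\<close>

lemma test_function_iff:
  "test_function f \<longleftrightarrow> csmooth_on UNIV f \<and> (\<exists>a b. 0 < a \<and> (\<forall>r. r \<notin> {a..b} \<longrightarrow> f r = 0))"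
  unfolding test_function_def csmooth_on_def csm_UNIV_iff by (auto intro: lessI)

lemma vderiv_support:
  fixes a b :: real
  assumes "\<And>r. r \<notin> {a..b} \<Longrightarrow> f r = 0" "r \<notin> {a..b}"
  shows "f differentiable (at r)" "vderiv f r = 0"
proof -
  have "open (- {a..b})" by (simp add: open_Compl)
  then have "(f has_vector_derivative 0) (at r)"
    using has_vector_derivative_cong_open[of "- {a..b}" r "\<lambda>_. 0" f 0] assms by auto
  then show "f differentiable (at r)" "vderiv f r = 0"
    by (auto simp: vderiv_eqI intro: differentiableI_vector)
qed

text \<open>Off the interval the function vanishes on an open set, and since \<open>0 < a\<close>
  this set contains the closed negative half line. Smoothness therefore has to be checked for
  positive arguments alone.\<close>

lemma test_functionI:
  assumes "csmooth_on {0<..} f" "0 < a" "\<And>r. r \<notin> {a..b} \<Longrightarrow> f r = 0"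
  shows "test_function f"
proof -
  have "csm n UNIV f" if "csm n {0<..} f" "\<And>r. r \<notin> {a..b} \<Longrightarrow> f r = 0" for n f
    using that
  proof (induction n arbitrary: f)
    case (Suc n)
    have "csm n UNIV (vderiv f)"
      using Suc.prems vderiv_support[of a b f] by (intro Suc.IH) auto
    moreover have "f differentiable (at r)" for r
      using Suc.prems vderiv_support[of a b f r] assms(2) by (cases "r \<in> {a..b}") auto
    ultimately show ?case by auto
  qed auto
  then show ?thesis
    using assms by (auto simp: test_function_iff csmooth_on_def)
qed

lemma test_function_smooth: "test_function f \<Longrightarrow> csmooth_on S f"
  unfolding test_function_iff csmooth_on_def using csm_subset[of S UNIV] by auto

lemma test_function_mult:
  assumes "test_function f" "csmooth_on {0<..} g"
  shows "test_function (\<lambda>r. g r * f r)"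
proof -
  obtain a b where "0 < a" "\<And>r. r \<notin> {a..b} \<Longrightarrow> f r = 0"
    using assms(1) unfolding test_function_def by blast
  then show ?thesis
    using csm_mult[of "{0<..}"] assms test_function_smooth[OF assms(1), of "{0<..}"]
    by (intro test_functionI[of _ a b]) (auto simp: csmooth_on_def)
qed

lemma test_function_times_r: "test_function f \<Longrightarrow> test_function (\<lambda>r. of_real r * f r)"
  by (rule test_function_mult) (auto intro: csmooth_on_of_real)

lemma test_function_divide_r: "test_function f \<Longrightarrow> test_function (\<lambda>r. f r / of_real r)"
  using test_function_mult[of f "\<lambda>r. 1 / of_real r ^ 1"] csmooth_on_inverse_power[of 1 1]
  by simp

lemma test_function_vderiv: "test_function f \<Longrightarrow> test_function (vderiv f)"
proof -
  assume f: "test_function f"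
  obtain a b where ab: "0 < a" "\<And>r. r \<notin> {a..b} \<Longrightarrow> f r = 0"
    using f unfolding test_function_def by blast
  have "csm n {0<..} (vderiv f)" for n
    using test_function_smooth[OF f, of "{0<..}"] unfolding csmooth_on_def by (auto dest: spec[of _ "Suc n"])
  then show ?thesis
    using ab vderiv_support[of a b f] by (intro test_functionI[of _ a b]) (auto simp: csmooth_on_def)
qed

lemma test_function_deriv: "test_function f \<Longrightarrow> (f has_vector_derivative vderiv f r) (at r)"
  unfolding test_function_def by (rule has_vderiv) (auto dest: spec[of _ 0])

lemma test_function_continuous: "test_function f \<Longrightarrow> continuous_on S f"
  by (intro continuous_at_imp_continuous_on ballI has_vector_derivative_continuous[OF test_function_deriv])

lemma test_function_diff: "test_function f \<Longrightarrow> test_function g \<Longrightarrow> test_function (\<lambda>r. f r - g r)"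
proof -
  assume fg: "test_function f" "test_function g"
  obtain a b where ab: "0 < a" "\<And>r. r \<notin> {a..b} \<Longrightarrow> f r = 0"
    using fg(1) unfolding test_function_def by blast
  obtain c d where cd: "0 < c" "\<And>r. r \<notin> {c..d} \<Longrightarrow> g r = 0"
    using fg(2) unfolding test_function_def by blast
  have "csm n {0<..} (\<lambda>r. f r + (-1) * g r)" for n
    using test_function_smooth[OF fg(1), of "{0<..}"] test_function_smooth[OF fg(2), of "{0<..}"]
    by (intro csm_add csm_mult csm_const) (auto simp: csmooth_on_def)
  then have sm: "csmooth_on {0<..} (\<lambda>r. f r - g r)"
    by (simp add: csmooth_on_def)
  show ?thesis
  proof (intro test_functionI[of _ "min a c" "max b d"])
    fix r assume "r \<notin> {min a c..max b d}"
    then have "r \<notin> {a..b}" "r \<notin> {c..d}" by auto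
    then show "f r - g r = 0" using ab cd by simp
  qed (use ab cd sm in auto)
qed

text \<open>Passage from the Lebesgue integral over \<open>half_line\<close> to the gauge integral
  over a compact interval, where the fundamental theorem of calculus and the exchange of integrals
  of continuous functions are at hand.\<close>

lemma half_line_integral_compact:
  fixes h :: "real \<Rightarrow> 'a::euclidean_space"
  assumes "continuous_on {a..b} h" "0 < a" "\<And>r. 0 < r \<Longrightarrow> r \<notin> {a..b} \<Longrightarrow> h r = 0"
  shows "integrable half_line h" "integral\<^sup>L half_line h = integral {a..b} h"
proof -
  have eq: "(\<lambda>r. indicator {0<..} r *\<^sub>R h r) = (\<lambda>r. indicator {a..b} r *\<^sub>R h r)"
    using assms(2,3) by (fastforce simp: indicator_def)
  have i: "set_integrable lborel {a..b} h"
    by (rule borel_integrable_atLeastAtMost'[OF assms(1)])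
  show "integrable half_line h"
    using i by (simp add: integrable_restrict_space eq set_integrable_def)
  have "integral\<^sup>L half_line h = (LINT r:{a..b}|lborel. h r)"
    by (simp add: integral_restrict_space eq set_lebesgue_integral_def)
  also have "\<dots> = integral {a..b} h"
    using i by (rule set_borel_integral_eq_integral)
  finally show "integral\<^sup>L half_line h = integral {a..b} h" .
qed

lemma square_integrable_compact:
  assumes "continuous_on {0<..} f" "0 < a" "\<And>r. 0 < r \<Longrightarrow> r \<notin> {a..b} \<Longrightarrow> f r = 0"
  shows "square_integrable f"
  unfolding square_integrable_def
proof
  show "f \<in> borel_measurable half_line"
    by (rule half_line_measurable_continuous[OF assms(1)])
  have "continuous_on {a..b} f"
    using assms(1,2) by (auto intro: continuous_on_subset)
  then show "integrable half_line (\<lambda>r. (cmod (f r))\<^sup>2)"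
    using assms by (intro half_line_integral_compact(1)[of a b] continuous_intros) auto
qed

lemma test_function_square_integrable: "test_function f \<Longrightarrow> square_integrable f"
proof -
  assume f: "test_function f"
  then obtain a b where "0 < a" "\<And>r. r \<notin> {a..b} \<Longrightarrow> f r = 0"
    unfolding test_function_def by blast
  then show ?thesis
    using f by (intro square_integrable_compact[of f a b] test_function_continuous) auto
qed

section \<open>Density of test functions in L^2\<close>

definition L2_test :: "L2 set" where
  "L2_test = abs_L2 ` Collect test_function"

lemma L2_test_add: "f \<in> L2_test \<Longrightarrow> g \<in> L2_test \<Longrightarrow> f + g \<in> L2_test"
proof -
  assume "f \<in> L2_test" "g \<in> L2_test"
  then obtain u v where uv: "f = abs_L2 u" "g = abs_L2 v" "test_function u" "test_function v"
    by (auto simp: L2_test_def)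
  have "test_function (\<lambda>r. u r - (-1) * v r)"
    by (intro test_function_diff uv test_function_mult) (simp add: csmooth_on_def csm_const)
  then show ?thesis
    using uv by (auto simp: L2_test_def plus_abs_L2 test_function_square_integrable)
qed

lemma L2_test_scaleC: "f \<in> L2_test \<Longrightarrow> scaleC_L2 k f \<in> L2_test"
proof -
  assume "f \<in> L2_test"
  then obtain u where u: "f = abs_L2 u" "test_function u"
    by (auto simp: L2_test_def)
  have "test_function (\<lambda>r. k * u r)"
    by (intro u test_function_mult) (simp add: csmooth_on_def csm_const)
  then show ?thesis
    using u by (auto simp: L2_test_def scaleC_abs_L2 test_function_square_integrable)
qed

lemma closure_L2_test_add:
  "f \<in> closure L2_test \<Longrightarrow> g \<in> closure L2_test \<Longrightarrow> f + g \<in> closure L2_test"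
  unfolding closure_sequential
proof safe
  fix x y assume "\<forall>n. x n \<in> L2_test" "x \<longlonglongrightarrow> f" "\<forall>n. y n \<in> L2_test" "y \<longlonglongrightarrow> g"
  then show "\<exists>z. (\<forall>n. z n \<in> L2_test) \<and> z \<longlonglongrightarrow> f + g"
    by (intro exI[of _ "\<lambda>n. x n + y n"]) (auto intro: L2_test_add tendsto_add)
qed

lemma closure_L2_test_scaleC:
  assumes "f \<in> closure L2_test" shows "scaleC_L2 k f \<in> closure L2_test"
proof -
  obtain x where x: "\<And>n. x n \<in> L2_test" "x \<longlonglongrightarrow> f"
    using assms unfolding closure_sequential by blast
  have "bounded_linear (scaleC_L2 k)"
    by (rule bounded_linear_intro[where K = "cmod k"])
      (auto simp: scaleR_scaleC_L2 norm_scaleC_L2 intro!: cinner_L2_eqI simp: cinner_L2_simps algebra_simps)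
  then have "(\<lambda>n. scaleC_L2 k (x n)) \<longlonglongrightarrow> scaleC_L2 k f"
    using x(2) by (rule bounded_linear.tendsto)
  then show ?thesis
    unfolding closure_sequential
    by (intro exI[of _ "\<lambda>n. scaleC_L2 k (x n)"]) (auto intro: x(1) L2_test_scaleC)
qed

text \<open>A predicate on functions rather than on classes, so that it can be carried through an
  induction over Borel sets and along simple functions.\<close>

definition test_approx :: "(real \<Rightarrow> complex) \<Rightarrow> bool" where
  "test_approx f \<longleftrightarrow> square_integrable f \<and> abs_L2 f \<in> closure L2_test"

lemma test_approx_test: "test_function f \<Longrightarrow> test_approx f"
  using closure_subset[of L2_test] by (auto simp: test_approx_def test_function_square_integrable L2_test_def)

lemma test_approx_add: "test_approx f \<Longrightarrow> test_approx g \<Longrightarrow> test_approx (\<lambda>r. f r + g r)"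
  using closure_L2_test_add[of "abs_L2 f" "abs_L2 g"]
  by (auto simp: test_approx_def square_integrable_add plus_abs_L2)

lemma test_approx_scale: "test_approx f \<Longrightarrow> test_approx (\<lambda>r. k * f r)"
  using closure_L2_test_scaleC[of "abs_L2 f" k]
  by (auto simp: test_approx_def square_integrable_mult scaleC_abs_L2)

lemma test_approx_0: "test_approx (\<lambda>_. 0)"
proof -
  have "csmooth_on {0<..} (\<lambda>_. 0)"
    unfolding csmooth_on_def by (auto intro: csm_const)
  then show ?thesis
    by (intro test_approx_test test_functionI[of _ 1 1]) auto
qed

lemma test_approx_sum: "(\<And>i. i \<in> I \<Longrightarrow> test_approx (f i)) \<Longrightarrow> test_approx (\<lambda>r. \<Sum>i\<in>I. f i r)"
  by (induction I rule: infinite_finite_induct) (auto simp: test_approx_0 test_approx_add)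

text \<open>The closure property that drives the density proof: it leads from smooth functions to
  intervals, from intervals to Borel sets, and from simple functions to all of L^2.\<close>

lemma test_approx_dominated:
  assumes "f \<in> borel_measurable half_line" "square_integrable g" "\<And>n. test_approx (fn n)"
    "AE r in half_line. (\<lambda>n. fn n r) \<longlonglongrightarrow> f r" "\<And>n. AE r in half_line. cmod (fn n r) \<le> cmod (g r)"
  shows "test_approx f"
proof -
  have m: "\<And>n. fn n \<in> borel_measurable half_line"
    using assms(3) by (auto simp: test_approx_def square_integrable_def)
  have "abs_L2 f \<in> closure L2_test"
    by (rule closed_sequentially[OF closed_closure _ L2_dominated(3)[OF assms(1,2) m assms(4,5)]])
      (use assms(3) in \<open>simp add: test_approx_def\<close>)
  then show ?thesis
    using L2_dominated(1)[OF assms(1,2) m assms(4,5)] by (simp add: test_approx_def)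
qed

lemma square_integrable_indicator:
  assumes "A \<in> sets borel" "A \<subseteq> {l..u}"
  shows "square_integrable (indicator A)"
proof -
  have "emeasure lborel ({0<..} \<inter> A) < \<infinity>"
    by (rule emeasure_bounded_finite) (rule bounded_subset[of "{l..u}"], use assms in auto)
  moreover have "(\<lambda>r. (cmod (indicator A r))\<^sup>2) = (indicator A :: real \<Rightarrow> real)"
    by (auto simp: indicator_def)
  moreover have "(\<lambda>r. indicator {0<..} r *\<^sub>R indicator A r) = (indicator ({0<..} \<inter> A) :: real \<Rightarrow> real)"
    by (auto simp: indicator_def)
  moreover have "(indicator A :: real \<Rightarrow> complex) \<in> borel_measurable half_line"
    by (rule measurable_restrict_space1) (use assms in measurable)
  ultimately show ?thesis
    using assms by (auto simp: square_integrable_def integrable_restrict_space)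
qed

lemma cutoff_exp_bounds: "0 \<le> cutoff_exp t" "cutoff_exp t \<le> 1"
  by (auto simp: cutoff_exp_def)

lemma cutoff_exp_scaled: "(\<lambda>n. cutoff_exp (real (Suc n) * t)) \<longlonglongrightarrow> (if t > 0 then 1 else 0)"
proof (cases "t > 0")
  case True
  have "(\<lambda>n. exp (- (1/t) * inverse (real (Suc n)))) \<longlonglongrightarrow> exp (- (1/t) * 0)"
    by (intro tendsto_intros LIMSEQ_inverse_real_of_nat)
  then show ?thesis
    using True by (simp add: cutoff_exp_def field_simps add_pos_nonneg)
qed (auto simp: cutoff_exp_def mult_le_0_iff zero_less_mult_iff)

lemma csm_cutoff_affine: "csm n UNIV (\<lambda>r. of_real (cutoff_exp (k * r + d)))"
  by (rule csm_compose[where f = "\<lambda>t. of_real (cutoff_exp t)" and h' = "\<lambda>_. k" and T = UNIV])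
    (use csmooth_on_cutoff_exp in \<open>auto intro!: derivative_eq_intros csm_const simp: csmooth_on_def\<close>)

lemma test_approx_interval:
  assumes "0 < a" "a < b"
  shows "test_approx (indicator {a<..<b})"
proof (rule test_approx_dominated)
  \<comment> \<open>The product of two stretched copies of \<open>cutoff_exp\<close> is smooth,
    vanishes outside the interval and tends to 1 inside it, staying between 0 and 1
    throughout.\<close>
  define f where "f = (\<lambda>n r. of_real (cutoff_exp (real (Suc n) * r + - real (Suc n) * a))
      * complex_of_real (cutoff_exp (- real (Suc n) * r + real (Suc n) * b)))"
  have f_eq: "f n r = of_real (cutoff_exp (real (Suc n) * (r - a)) * cutoff_exp (real (Suc n) * (b - r)))" for n r
  proof -
    have "real (Suc n) * r + - real (Suc n) * a = real (Suc n) * (r - a)"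
      "- real (Suc n) * r + real (Suc n) * b = real (Suc n) * (b - r)"
      by (simp_all add: algebra_simps)
    then show ?thesis by (simp only: f_def of_real_mult)
  qed
  have f0: "f n r = 0" if "r \<notin> {a<..<b}" for n r
    using that unfolding f_eq by (auto simp: cutoff_exp_def not_less zero_less_mult_iff)
  have "csm m UNIV (f n)" for m n
    unfolding f_def by (intro csm_mult csm_cutoff_affine) auto
  then have "csmooth_on {0<..} (f n)" for n
    unfolding csmooth_on_def using csm_subset[of "{0<..}" UNIV] by auto
  then show "test_approx (f n)" for n
    using assms f0 by (intro test_approx_test test_functionI[of _ a b]) auto
  show "square_integrable (indicator {a<..<b})"
    by (rule square_integrable_indicator[of _ a b]) auto
  show "AE r in half_line. cmod (f n r) \<le> cmod (indicator {a<..<b} r)" for n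
  proof (rule AE_half_lineI)
    fix r :: real
    show "cmod (f n r) \<le> cmod (indicator {a<..<b} r)"
      using f0[of r n] cutoff_exp_bounds
      by (cases "r \<in> {a<..<b}") (auto simp: f_eq norm_mult intro!: mult_le_one)
  qed
  show "AE r in half_line. (\<lambda>n. f n r) \<longlonglongrightarrow> indicator {a<..<b} r"
  proof (rule AE_half_lineI)
    fix r :: real
    have "(\<lambda>n. f n r) \<longlonglongrightarrow> of_real ((if r - a > 0 then 1 else 0) * (if b - r > 0 then 1 else 0))"
      unfolding f_eq by (intro tendsto_of_real tendsto_mult cutoff_exp_scaled)
    then show "(\<lambda>n. f n r) \<longlonglongrightarrow> indicator {a<..<b} r"
      by (auto simp: indicator_def split: if_splits)
  qed
  show "indicator {a<..<b} \<in> borel_measurable half_line"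
    by (rule measurable_restrict_space1) measurable
qed

text \<open>Induction over the intersection-stable generator of open intervals. Cutting every set
  with the fixed interval from \<open>l\<close> to \<open>u\<close> keeps complements and countable
  disjoint unions under one square integrable majorant.\<close>

lemma test_approx_indicator:
  assumes "A \<in> sets borel" "0 < l"
  shows "test_approx (indicator (A \<inter> {l<..<u}))"
proof -
  let ?G = "range (\<lambda>(a, b). {a<..<b::real})"
  have A: "A \<in> sigma_sets UNIV ?G"
    using assms(1) by (simp add: borel_eq_box)
  have bor: "B \<in> sets borel" if "B \<in> sigma_sets UNIV ?G" for B
    using that by (simp add: borel_eq_box)
  have int: "Int_stable ?G"
    unfolding Int_stable_def
  proof (safe)
    fix a b c d :: real
    show "{a<..<b} \<inter> {c<..<d} \<in> ?G"
      by (rule image_eqI[of _ _ "(max a c, min b d)"]) auto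
  qed
  have interv: "test_approx (indicator ({a<..<b} \<inter> {l<..<u}))" for a b
  proof (cases "max a l < min b u")
    case True
    then show ?thesis
      using test_approx_interval[of "max a l" "min b u"] assms(2) by (simp add: Int_greaterThanLessThan)
  next
    case False
    then have "{a<..<b} \<inter> {l<..<u} = {}" by auto
    then show ?thesis using test_approx_0 by (simp add: indicator_def[abs_def])
  qed
  have sub: "?G \<subseteq> Pow UNIV" by simp
  show ?thesis
    using int sub A
  proof (induction rule: sigma_sets_induct_disjoint)
    case (basic A)
    then show ?case using interv by auto
  next
    case empty
    then show ?case using test_approx_0 by (simp add: indicator_def[abs_def])
  next
    case (compl A)
    have I: "test_approx (indicator {l<..<u})"
      using interv[of l u] by simp
    have "test_approx (\<lambda>r. indicator {l<..<u} r + (-1) * indicator (A \<inter> {l<..<u}) r)"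
      by (intro test_approx_add test_approx_scale compl I)
    moreover have "(\<lambda>r. indicator {l<..<u} r + (-1) * indicator (A \<inter> {l<..<u}) r) =
        (indicator ((UNIV - A) \<inter> {l<..<u}) :: real \<Rightarrow> complex)"
      by (auto simp: indicator_def fun_eq_iff)
    ultimately show ?case by simp
  next
    case (union B)
    have B: "\<And>i. B i \<in> sets borel"
      using bor union(2) by blast
    have eq: "(\<Sum>i<n. indicator (B i \<inter> {l<..<u}) r) = (indicator ((\<Union>i<n. B i) \<inter> {l<..<u}) r :: complex)" for n r
    proof (induction n)
      case (Suc n)
      have "r \<notin> B n" if "r \<in> B i" "i < n" for i
        using union(1) that unfolding disjoint_family_on_def by (metis UNIV_I disjoint_iff less_irrefl)
      then show ?case
        unfolding sum.lessThan_Suc Suc by (auto simp: indicator_def lessThan_Suc)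
    qed (simp add: indicator_def)
    show ?case
    proof (rule test_approx_dominated)
      show "test_approx (\<lambda>r. \<Sum>i<n. indicator (B i \<inter> {l<..<u}) r)" for n
        by (intro test_approx_sum union)
      show "square_integrable (indicator {l<..<u})"
        by (rule square_integrable_indicator[of _ l u]) auto
      show "AE r in half_line. cmod (\<Sum>i<n. indicator (B i \<inter> {l<..<u}) r) \<le> cmod (indicator {l<..<u} r)" for n
        unfolding eq by (rule AE_half_lineI) (auto simp: indicator_def)
      show "indicator (\<Union> (range B) \<inter> {l<..<u}) \<in> borel_measurable half_line"
        using B by (intro measurable_restrict_space1 borel_measurable_indicator) auto
      show "AE r in half_line. (\<lambda>n. \<Sum>i<n. indicator (B i \<inter> {l<..<u}) r :: complex) \<longlonglongrightarrow> indicator (\<Union> (range B) \<inter> {l<..<u}) r"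
      proof (rule AE_half_lineI)
        fix r :: real
        show "(\<lambda>n. \<Sum>i<n. indicator (B i \<inter> {l<..<u}) r :: complex) \<longlonglongrightarrow> indicator (\<Union> (range B) \<inter> {l<..<u}) r"
        proof (cases "\<exists>i. r \<in> B i")
          case True
          then obtain i where "r \<in> B i" by blast
          then show ?thesis
            unfolding eq by (intro tendsto_eventually eventually_sequentiallyI[of "Suc i"]) (auto simp: indicator_def)
        next
          case False
          then show ?thesis unfolding eq by (auto simp: indicator_def)
        qed
      qed
    qed
  qed
qed

lemma test_approx_square_integrable:
  assumes f: "square_integrable f"
  shows "test_approx f"
proof -
  have fm: "f \<in> borel_measurable half_line"
    using f by (simp add: square_integrable_def)
  obtain F where F: "\<And>i. simple_function half_line (F i)"
      "\<And>x. x > 0 \<Longrightarrow> (\<lambda>i. F i x) \<longlonglongrightarrow> f x" "\<And>i x. x > 0 \<Longrightarrow> cmod (F i x) \<le> 2 * cmod (f x)"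
    using borel_measurable_implies_sequence_metric[OF fm, of 0] by (simp only: space_half_line dist_0_norm dist_norm diff_0_right) blast
  \<comment> \<open>Cutting to this interval makes every level set of the simple function a bounded
    set away from 0, as \<open>test_approx_indicator\<close> demands.\<close>
  define I where "I i = {1 / real (Suc i)<..<real (Suc i)}" for i
  define G where "G i r = (\<Sum>y\<in>F i ` {0<..}. y * indicator (F i -` {y} \<inter> {0<..} \<inter> I i) r)" for i r
  have fin: "finite (F i ` {0<..})" for i
    using F(1)[of i] by (simp add: simple_function_def)
  have G: "G i r = (if r \<in> I i then F i r else 0)" if "r > 0" for i r
  proof -
    have "G i r = (\<Sum>y\<in>F i ` {0<..}. if F i r = y then (if r \<in> I i then F i r else 0) else 0)"
      unfolding G_def by (rule sum.cong) (use that in \<open>auto simp: indicator_def\<close>)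
    then show ?thesis
      using that by (simp add: sum.delta' fin)
  qed
  show ?thesis
  proof (rule test_approx_dominated[OF fm square_integrable_mult[OF f, of 2]])
    show "test_approx (G i)" for i
      unfolding G_def
    proof (intro test_approx_sum test_approx_scale)
      fix y assume "y \<in> F i ` {0<..}"
      have "F i -` {y} \<inter> {0<..} \<in> sets half_line"
        using F(1)[of i] by (metis simple_functionD(2) space_half_line)
      then have "F i -` {y} \<inter> {0<..} \<in> sets borel"
        by (simp add: sets_restrict_space_iff)
      then show "test_approx (indicator (F i -` {y} \<inter> {0<..} \<inter> I i))"
        unfolding I_def by (rule test_approx_indicator) simp
    qed
    show "AE r in half_line. cmod (G i r) \<le> cmod (2 * f r)" for i
      by (rule AE_half_lineI) (use F(3) in \<open>auto simp: G norm_mult\<close>)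
    show "AE r in half_line. (\<lambda>i. G i r) \<longlonglongrightarrow> f r"
    proof (rule AE_half_lineI)
      fix r :: real assume r: "r > 0"
      obtain N where N: "real N > max r (1 / r)"
        using reals_Archimedean2 by blast
      have "r \<in> I i" if "i \<ge> N" for i
      proof -
        have "real (Suc i) > r" "real (Suc i) > 1 / r"
          using N that by auto
        then show ?thesis
          using r by (simp add: I_def field_simps)
      qed
      then have "eventually (\<lambda>i. F i r = G i r) sequentially"
        using r by (auto simp: G intro!: eventually_sequentiallyI[of N])
      then show "(\<lambda>i. G i r) \<longlonglongrightarrow> f r"
        using F(2)[OF r] by (rule Lim_transform_eventually[rotated])
    qed
  qed
qed

lemma closure_L2_test: "closure L2_test = UNIV"
proof -
  have "F \<in> closure L2_test" for F
    using test_approx_square_integrable[of "rep_L2 F"] by (simp add: test_approx_def)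
  then show ?thesis by blast
qed

section \<open>The decaying solution as a Laplace integral\<close>

lemma half_line_trunc:
  fixes f :: "real \<Rightarrow> 'a::euclidean_space"
  assumes "integrable half_line f" "continuous_on {0<..} f"
  shows "(\<lambda>n. integral {1 / real (Suc n)..real (Suc n)} f) \<longlonglongrightarrow> integral\<^sup>L half_line f"
proof -
  let ?I = "\<lambda>n. {1 / real (Suc n)..real (Suc n)}"
  have "(\<lambda>n. \<integral>r. indicator (?I n) r *\<^sub>R f r \<partial>half_line) \<longlonglongrightarrow> integral\<^sup>L half_line f"
  proof (rule integral_dominated_convergence)
    show fm: "f \<in> borel_measurable half_line" by (rule half_line_measurable_continuous[OF assms(2)])
    show "(\<lambda>r. indicator (?I n) r *\<^sub>R f r) \<in> borel_measurable half_line" for n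
      by (intro borel_measurable_scaleR fm measurable_restrict_space1 borel_measurable_indicator) auto
    show "integrable half_line (\<lambda>r. norm (f r))" using assms by auto
    show "AE r in half_line. norm (indicator (?I n) r *\<^sub>R f r) \<le> norm (f r)" for n
      by (rule AE_half_lineI) (auto simp: indicator_def)
    show "AE r in half_line. (\<lambda>n. indicator (?I n) r *\<^sub>R f r) \<longlonglongrightarrow> f r"
    proof (rule AE_half_lineI)
      fix r :: real assume r: "r > 0"
      obtain N where N: "real N > max r (1 / r)"
        using reals_Archimedean2 by blast
      have "r \<in> ?I n" if "n \<ge> N" for n
      proof -
        have "real (Suc n) > r" "real (Suc n) > 1 / r"
          using N that by auto
        then show ?thesis
          using r by (simp add: field_simps)
      qed
      then show "(\<lambda>n. indicator (?I n) r *\<^sub>R f r) \<longlonglongrightarrow> f r"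
        by (intro tendsto_eventually eventually_sequentiallyI[of N]) auto
    qed
  qed
  moreover have "(\<integral>r. indicator (?I n) r *\<^sub>R f r \<partial>half_line) = integral (?I n) f" for n
  proof -
    have c: "continuous_on (?I n) f"
      by (rule continuous_on_subset[OF assms(2)]) (auto intro: less_le_trans[of 0 "1 / (1 + real n)"] add_pos_nonneg)
    have "(\<lambda>r. indicator {0<..} r *\<^sub>R indicator (?I n) r *\<^sub>R f r) = (\<lambda>r. indicator (?I n) r *\<^sub>R f r)"
      by (auto simp: indicator_def fun_eq_iff intro: less_le_trans[of 0 "1 / (1 + real n)"] add_pos_nonneg)
    then have "(\<integral>r. indicator (?I n) r *\<^sub>R f r \<partial>half_line) = (LINT r:?I n|lborel. f r)"
      by (simp add: integral_restrict_space set_lebesgue_integral_def)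
    also have "\<dots> = integral (?I n) f"
      by (rule set_borel_integral_eq_integral(2)[OF borel_integrable_atLeastAtMost'[OF c]])
    finally show ?thesis .
  qed
  ultimately show ?thesis by simp
qed

lemma filterlim_inverse_Suc: "filterlim (\<lambda>n. 1 / real (Suc n)) (at_right 0) sequentially"
  unfolding filterlim_at
  using LIMSEQ_inverse_real_of_nat by (auto simp: inverse_eq_divide)

lemma filterlim_Suc_real: "filterlim (\<lambda>n. real (Suc n)) at_top sequentially"
  by (rule filterlim_compose[OF filterlim_real_sequentially filterlim_Suc])

text \<open>The two primitives need not agree at \<open>s\<close>: the integrand involves a Green
  kernel, whose formula changes on the diagonal, and the mismatch at \<open>s\<close> is what later
  reproduces the Wronskian.\<close>

lemma half_line_FTC_split:
  fixes F G f :: "real \<Rightarrow> 'a::euclidean_space"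
  assumes s: "s > 0"
    and F: "\<And>r. 0 < r \<Longrightarrow> r \<le> s \<Longrightarrow> (F has_vector_derivative f r) (at r)"
    and G: "\<And>r. s \<le> r \<Longrightarrow> (G has_vector_derivative f r) (at r)"
    and f: "continuous_on {0<..} f" "integrable half_line f"
    and lim: "(F \<longlongrightarrow> A) (at_right 0)" "(G \<longlongrightarrow> B) at_top"
  shows "integral\<^sup>L half_line f = (B - G s) + (F s - A)"
proof -
  have "eventually (\<lambda>n. 1 / real (Suc n) < s) sequentially"
    using order_tendstoD(2)[OF LIMSEQ_inverse_real_of_nat s] by (simp add: inverse_eq_divide)
  moreover have "eventually (\<lambda>n. s < real (Suc n)) sequentially"
    using filterlim_Suc_real unfolding filterlim_at_top_dense by blast
  ultimately have ev: "eventually (\<lambda>n. (G (real (Suc n)) - G s) + (F s - F (1 / real (Suc n))) = integral {1 / real (Suc n)..real (Suc n)} f) sequentially"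
  proof eventually_elim
    case (elim n)
    define l u where "l = 1 / real (Suc n)" and "u = real (Suc n)"
    have lu: "l < s" "s < u" "0 < l" using elim by (simp_all add: l_def u_def)
    have 1: "(f has_integral F s - F l) {l..s}"
      by (rule fundamental_theorem_of_calculus) (use lu F in \<open>auto intro: has_vector_derivative_at_within\<close>)
    have 2: "(f has_integral G u - G s) {s..u}"
      by (rule fundamental_theorem_of_calculus) (use lu G in \<open>auto intro: has_vector_derivative_at_within\<close>)
    have "(f has_integral (F s - F l) + (G u - G s)) {l..u}"
      by (rule has_integral_combine[OF _ _ 1 2]) (use lu in auto)
    then show ?case by (simp add: integral_unique l_def u_def)
  qed
  have "(\<lambda>n. (G (real (Suc n)) - G s) + (F s - F (1 / real (Suc n)))) \<longlonglongrightarrow> (B - G s) + (F s - A)"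
    by (intro tendsto_add tendsto_diff tendsto_const filterlim_compose[OF lim(2) filterlim_Suc_real]
        filterlim_compose[OF lim(1) filterlim_inverse_Suc])
  from Lim_transform_eventually[OF this ev]
  have "(\<lambda>n. integral {1 / real (Suc n)..real (Suc n)} f) \<longlonglongrightarrow> (B - G s) + (F s - A)" .
  then show ?thesis
    using LIMSEQ_unique[OF half_line_trunc[OF f(2,1)]] by simp
qed

lemma half_line_FTC:
  fixes F f :: "real \<Rightarrow> 'a::euclidean_space"
  assumes "\<And>r. r > 0 \<Longrightarrow> (F has_vector_derivative f r) (at r)"
    "continuous_on {0<..} f" "integrable half_line f"
    "(F \<longlongrightarrow> A) (at_right 0)" "(F \<longlongrightarrow> B) at_top"
  shows "integral\<^sup>L half_line f = B - A"
  using half_line_FTC_split[of 1 F f F A B] assms by simp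

text \<open>Along sequences, the mean value inequality dominates the remainder of the difference
  quotient by \<open>2 * w\<close>, so dominated convergence gives differentiation under the
  integral sign.\<close>

lemma has_vector_derivative_integral:
  fixes f :: "real \<Rightarrow> 's \<Rightarrow> complex"
  assumes \<delta>: "\<delta> > 0"
    and int: "\<And>t. \<bar>t - x\<bar> < \<delta> \<Longrightarrow> integrable M (f t)"
    and deriv: "\<And>t s. \<bar>t - x\<bar> < \<delta> \<Longrightarrow> s \<in> space M \<Longrightarrow> ((\<lambda>t. f t s) has_vector_derivative f' t s) (at t)"
    and bound: "\<And>t s. \<bar>t - x\<bar> < \<delta> \<Longrightarrow> s \<in> space M \<Longrightarrow> cmod (f' t s) \<le> w s"
    and w: "integrable M w" and meas: "f' x \<in> borel_measurable M"
  shows "((\<lambda>t. \<integral>s. f t s \<partial>M) has_vector_derivative (\<integral>s. f' x s \<partial>M)) (at x)"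
proof -
  have f'x: "integrable M (f' x)"
    by (rule Bochner_Integration.integrable_bound[OF w meas])
      (rule AE_I2, use bound[of x] \<delta> in \<open>force intro: order_trans[OF _ abs_ge_self]\<close>)
  have "(\<lambda>n. ((\<integral>s. f (X n) s \<partial>M) - (\<integral>s. f x s \<partial>M) - (X n - x) *\<^sub>R (\<integral>s. f' x s \<partial>M)) /\<^sub>R norm (X n - x)) \<longlonglongrightarrow> 0"
    if X: "\<forall>n. X n \<in> UNIV - {x}" "X \<longlonglongrightarrow> x" for X
  proof -
    have "eventually (\<lambda>n. \<bar>X n - x\<bar> < \<delta>) sequentially"
      using X(2) \<delta> by (auto simp: tendsto_iff dist_real_def)
    then obtain N where N: "\<And>n. n \<ge> N \<Longrightarrow> \<bar>X n - x\<bar> < \<delta>"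
      by (auto simp: eventually_sequentially)
    \<comment> \<open>Dropping finitely many terms puts the whole sequence into the
      \<delta>-neighbourhood.\<close>
    define Y where "Y n = X (n + N)" for n
    have Y: "\<bar>Y n - x\<bar> < \<delta>" "Y n \<noteq> x" for n
      using N X(1) by (auto simp: Y_def)
    have Ylim: "Y \<longlonglongrightarrow> x"
      unfolding Y_def using X(2) by (rule LIMSEQ_ignore_initial_segment)
    define g where "g n s = (f (Y n) s - f x s - (Y n - x) *\<^sub>R f' x s) /\<^sub>R norm (Y n - x)" for n s
    have gint: "integrable M (g n)" for n
      unfolding g_def using int Y \<delta> f'x by (intro integrable_scaleR_right Bochner_Integration.integrable_diff) auto
    have lim: "(\<lambda>n. \<integral>s. g n s \<partial>M) \<longlonglongrightarrow> (\<integral>s. 0 \<partial>M)"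
    proof (rule integral_dominated_convergence)
      show "integrable M (\<lambda>s. 2 * w s)" using w by simp
      show "AE s in M. (\<lambda>n. g n s) \<longlonglongrightarrow> 0"
      proof (rule AE_I2)
        fix s assume s: "s \<in> space M"
        have "((\<lambda>t. (f t s - f x s - (t - x) *\<^sub>R f' x s) /\<^sub>R norm (t - x)) \<longlongrightarrow> 0) (at x)"
          using deriv[of x s] s \<delta> by (simp add: has_vector_derivative_def has_derivative_at_within)
        then show "(\<lambda>n. g n s) \<longlonglongrightarrow> 0"
          using Y(2) Ylim unfolding tendsto_at_iff_sequentially g_def by (auto simp: o_def)
      qed
      show "AE s in M. norm (g n s) \<le> 2 * w s" for n
      proof (rule AE_I2)
        fix s assume s: "s \<in> space M"
        have "cmod (f (Y n) s - f x s) \<le> w s * norm (Y n - x)"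
        proof (rule differentiable_bound[where S = "{x - \<delta><..<x + \<delta>}" and f' = "\<lambda>t h. h *\<^sub>R f' t s"])
          fix t assume "t \<in> {x - \<delta><..<x + \<delta>}"
          then have t: "\<bar>t - x\<bar> < \<delta>" by auto
          show "((\<lambda>t. f t s) has_derivative (\<lambda>h. h *\<^sub>R f' t s)) (at t within {x - \<delta><..<x + \<delta>})"
            using deriv[OF t s] unfolding has_vector_derivative_def by (rule has_derivative_at_withinI)
          show "onorm (\<lambda>h. h *\<^sub>R f' t s) \<le> w s"
            using bound[OF t s] by (intro onorm_le) (auto intro: mult_mono simp: mult.commute mult_right_mono)
        qed (use Y(1)[of n] \<delta> in \<open>auto simp: abs_less_iff\<close>)
        then have "cmod (f (Y n) s - f x s - (Y n - x) *\<^sub>R f' x s) \<le> w s * norm (Y n - x) + norm (Y n - x) * w s"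
          using bound[of x s] s \<delta> norm_triangle_ineq4[of "f (Y n) s - f x s" "(Y n - x) *\<^sub>R f' x s"]
            mult_left_mono[of "cmod (f' x s)" "w s" "\<bar>Y n - x\<bar>"] by (simp add: mult.commute)
        then show "norm (g n s) \<le> 2 * w s"
          using Y(2)[of n] by (simp add: g_def divide_simps mult_ac)
      qed
    qed (use gint in \<open>auto dest: borel_measurable_integrable\<close>)
    have "(\<integral>s. g n s \<partial>M) = ((\<integral>s. f (Y n) s \<partial>M) - (\<integral>s. f x s \<partial>M) - (Y n - x) *\<^sub>R (\<integral>s. f' x s \<partial>M)) /\<^sub>R norm (Y n - x)" for n
      unfolding g_def using int Y \<delta> f'x
      by (simp add: Bochner_Integration.integral_diff Bochner_Integration.integrable_diff)
    then show ?thesis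
      using lim LIMSEQ_offset[where k = N] unfolding Y_def by simp
  qed
  then show ?thesis
    by (simp add: has_vector_derivative_def has_derivative_at_within tendsto_at_iff_sequentially o_def
        bounded_linear_scaleR_left)
qed

section \<open>The Laplace integral: bounds, continuity and contiguity relations\<close>

lemma integrable_powr_exp:
  assumes "b > -1"
  shows "integrable half_line (\<lambda>s. C * (s powr b * exp (- s)))"
proof -
  have "ennreal (Gamma (b + 1)) = nn_integral lborel (\<lambda>t. ennreal (indicator {0..} t * t powr b / exp t))"
    using Gamma_conv_nn_integral_real[of "b + 1"] assms by simp
  also have "\<dots> = nn_integral lborel (\<lambda>t. ennreal (norm (indicator {0<..} t *\<^sub>R (t powr b * exp (- t)))))"
    by (intro nn_integral_cong) (auto simp: indicator_def exp_minus divide_inverse)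
  finally have "integrable lborel (\<lambda>t. indicator {0<..} t *\<^sub>R (t powr b * exp (- t)))"
    by (intro integrableI_bounded) (auto, metis ennreal_less_top)
  then have "integrable half_line (\<lambda>s. s powr b * exp (- s))"
    by (simp add: integrable_restrict_space)
  then show ?thesis by simp
qed

text \<open>Taking the n-th power of x <= exp x at x = (1 + s)/n gives (1 + s)^n <= n^n exp(1 + s).
  For \<open>n = 0\<close> the constant reads 0^0 = 1.\<close>

lemma power_exp_bound: "(D + B * s) ^ n * exp (- s) \<le> (D + B) ^ n * (real n ^ n * exp 1)"
  if "D \<ge> 0" "B \<ge> 0" "s \<ge> 0" for D B s :: real
proof -
  have "(1 + s) ^ n \<le> real n ^ n * exp (1 + s)"
  proof (cases "n = 0")
    case False
    have "((1 + s) / n) ^ n \<le> exp ((1 + s) / n) ^ n"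
      using that by (intro power_mono order_trans[OF _ exp_ge_add_one_self]) auto
    also have "\<dots> = exp (1 + s)"
      using False by (simp flip: exp_of_nat_mult)
    finally show ?thesis
      using False by (simp add: power_divide field_simps)
  qed (use that in auto)
  moreover have "(D + B * s) ^ n \<le> ((D + B) * (1 + s)) ^ n"
    using that by (intro power_mono) (auto simp: algebra_simps)
  ultimately have "(D + B * s) ^ n \<le> (D + B) ^ n * (real n ^ n * exp (1 + s))"
    using that by (simp add: power_mult_distrib) (meson mult_left_mono order_trans zero_le_power add_nonneg_nonneg)
  then have "(D + B * s) ^ n * exp (- s) \<le> (D + B) ^ n * (real n ^ n * exp (1 + s)) * exp (- s)"
    by (rule mult_right_mono) simp
  then show ?thesis
    by (simp add: exp_add exp_minus field_simps)
qed

text \<open>The cross term 2 r s Re \<beta> in the squared modulus is non-negative, so r + \<beta> s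
  is bounded below by either part. Being in the open right half plane it avoids the branch cut of
  the principal power, also for imaginary \<beta>.\<close>

lemma norm_affine_bounds:
  assumes "r > 0" "Re \<beta> \<ge> 0" "s \<ge> 0"
  shows "r \<le> cmod (of_real r + \<beta> * of_real s)" "cmod \<beta> * s \<le> cmod (of_real r + \<beta> * of_real s)"
    "cmod (of_real r + \<beta> * of_real s) \<le> r + cmod \<beta> * s" "of_real r + \<beta> * of_real s \<notin> \<real>\<^sub>\<le>\<^sub>0"
proof -
  have re: "Re (of_real r + \<beta> * of_real s) = r + Re \<beta> * s" by simp
  show "r \<le> cmod (of_real r + \<beta> * of_real s)"
    using complex_Re_le_cmod[of "of_real r + \<beta> * of_real s"] mult_nonneg_nonneg[OF assms(2,3)] unfolding re by linarith
  show "of_real r + \<beta> * of_real s \<notin> \<real>\<^sub>\<le>\<^sub>0"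
    using assms by (auto simp: complex_nonpos_Reals_iff not_le add_pos_nonneg)
  have "(cmod \<beta> * s)\<^sup>2 \<le> (cmod (of_real r + \<beta> * of_real s))\<^sup>2"
  proof -
    have "(cmod (of_real r + \<beta> * of_real s))\<^sup>2 = (cmod \<beta> * s)\<^sup>2 + (r\<^sup>2 + 2 * r * (Re \<beta> * s))"
      unfolding power_mult_distrib cmod_power2 by (simp add: algebra_simps power2_eq_square)
    then show ?thesis using assms by simp
  qed
  then show "cmod \<beta> * s \<le> cmod (of_real r + \<beta> * of_real s)"
    by (rule power2_le_imp_le) simp
  show "cmod (of_real r + \<beta> * of_real s) \<le> r + cmod \<beta> * s"
    using norm_triangle_ineq[of "of_real r" "\<beta> * of_real s"] assms by (simp add: norm_mult)
qed

text \<open>With \<beta> = 1/q and t = 2 s this is the integrand of the classical formula K_nu(z) =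
  sqrt(pi/(2z)) exp(-z) / Gamma(nu + 1/2) times the integral of exp(-t) t^(nu - 1/2) (1 +
  t/(2z))^(nu - 1/2), at z = q r. The exponents \<open>b\<close> and \<open>p\<close> are
  independent because differentiation in \<open>r\<close> lowers \<open>p\<close> alone, while
  integration by parts shifts \<open>b\<close>.\<close>

definition lap_fun :: "complex \<Rightarrow> real \<Rightarrow> real \<Rightarrow> real \<Rightarrow> real \<Rightarrow> complex" where
  "lap_fun \<beta> b p r s = of_real (exp (- 2 * s) * s powr b) * (of_real r + \<beta> * of_real s) powr of_real p"

definition lap :: "complex \<Rightarrow> real \<Rightarrow> real \<Rightarrow> real \<Rightarrow> complex" where
  "lap \<beta> b p r = (\<integral>s. lap_fun \<beta> b p r s \<partial>half_line)"

lemma lap_fun_continuous: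
  assumes "r > 0" "Re \<beta> \<ge> 0"
  shows "continuous_on {0<..} (lap_fun \<beta> b p r)"
proof -
  have pos: "0 < Re (of_real r + \<beta> * of_real s)" if "s > 0" for s
    using assms that by (simp add: add_pos_nonneg)
  have "continuous_on {0<..} (\<lambda>s. (of_real r + \<beta> * of_real s) powr of_real p)"
  proof (rule continuous_on_powr_complex)
    show "{0<..} \<subseteq> {s. 0 \<le> Re (of_real r + \<beta> * of_real s) \<or> Im (of_real r + \<beta> * of_real s) \<noteq> 0}"
      using pos less_imp_le by blast
    fix s :: real assume "s \<in> {0<..}" "of_real r + \<beta> * of_real s = 0"
    then show "0 < Re (of_real p)"
      using pos[of s] by (metis greaterThan_iff less_irrefl zero_complex.sel(1))
  qed (intro continuous_intros)+
  moreover have "continuous_on {0<..} (\<lambda>s. complex_of_real (exp (- 2 * s) * s powr b))"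
    by (intro continuous_on_of_real continuous_on_mult continuous_on_exp continuous_on_powr continuous_intros) auto
  ultimately show ?thesis
    unfolding lap_fun_def by (intro continuous_on_mult)
qed

lemma lap_fun_measurable:
  "r > 0 \<Longrightarrow> Re \<beta> \<ge> 0 \<Longrightarrow> lap_fun \<beta> b p r \<in> borel_measurable half_line"
  by (intro half_line_measurable_continuous lap_fun_continuous)

text \<open>One factor exp(-s) of exp(-2 s) absorbs the growth of the power when \<open>p\<close> is
  non-negative; for negative \<open>p\<close> the lower bound \<delta> of the modulus suffices. The
  constant serves all parameters at once because limits in \<open>r\<close>, in \<open>q\<close> and
  in the index are all taken later.\<close>

lemma lap_fun_bound:
  assumes "\<delta> > 0"
  obtains C where "C \<ge> 0" "\<And>r \<beta> b p s. \<delta> \<le> r \<Longrightarrow> r \<le> D \<Longrightarrow> Re \<beta> \<ge> 0 \<Longrightarrow> cmod \<beta> \<le> B \<Longrightarrow> s > 0 \<Longrightarrow> \<bar>p\<bar> \<le> P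
    \<Longrightarrow> cmod (lap_fun \<beta> b p r s) \<le> C * (s powr b * exp (- s))"
proof
  define n where "n = nat \<lceil>\<bar>P\<bar>\<rceil>"
  define C where "C = (1 + \<bar>D\<bar> + \<bar>B\<bar>) ^ n * (real n ^ n * exp 1) + (1 + 1 / \<delta>) ^ n"
  show "C \<ge> 0" unfolding C_def using assms by (intro add_nonneg_nonneg mult_nonneg_nonneg) auto
  fix r s b p :: real and \<beta> assume A: "\<delta> \<le> r" "r \<le> D" "Re \<beta> \<ge> 0" "cmod \<beta> \<le> B" "s > 0" "\<bar>p\<bar> \<le> P"
  have pn: "\<bar>p\<bar> \<le> real n" using A(6) unfolding n_def by linarith
  have r: "r > 0" using A assms by linarith
  define z where "z = cmod (of_real r + \<beta> * of_real s)"
  have z: "\<delta> \<le> z" "z \<le> 1 + \<bar>D\<bar> + \<bar>B\<bar> * s"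
  proof -
    have "cmod \<beta> * s \<le> \<bar>B\<bar> * s" using A by (intro mult_right_mono) auto
    then show "\<delta> \<le> z" "z \<le> 1 + \<bar>D\<bar> + \<bar>B\<bar> * s"
      using norm_affine_bounds(1,3)[OF r A(3), of s] A unfolding z_def by linarith+
  qed
  have D1: "1 \<le> 1 + \<bar>D\<bar> + \<bar>B\<bar> * s" using A by (simp add: add_nonneg_nonneg)
  have "z powr p \<le> (1 + \<bar>D\<bar> + \<bar>B\<bar> * s) ^ n + (1 + 1 / \<delta>) ^ n"
  proof (cases "p \<ge> 0")
    case True
    have "z powr p \<le> (1 + \<bar>D\<bar> + \<bar>B\<bar> * s) powr p"
      using z True assms by (intro powr_mono2) auto
    also have "\<dots> \<le> (1 + \<bar>D\<bar> + \<bar>B\<bar> * s) powr real n"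
      using pn D1 by (intro powr_mono) auto
    finally show ?thesis
      using D1 assms by (simp add: powr_realpow add_increasing2)
  next
    case False
    have "z powr p \<le> \<delta> powr p"
      using z False assms by (intro powr_mono2') auto
    also have "\<dots> = (1 / \<delta>) powr (- p)"
      using assms by (simp add: powr_divide powr_minus_divide)
    also have "\<dots> \<le> (1 + 1 / \<delta>) powr (- p)"
      using assms False by (intro powr_mono2) auto
    also have "\<dots> \<le> (1 + 1 / \<delta>) powr real n"
      using pn assms by (intro powr_mono) auto
    finally show ?thesis
      using D1 assms by (simp add: powr_realpow add_increasing add_pos_pos)
  qed
  then have "z powr p * exp (- s) \<le> ((1 + \<bar>D\<bar> + \<bar>B\<bar> * s) ^ n + (1 + 1 / \<delta>) ^ n) * exp (- s)"
    by (rule mult_right_mono) simp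
  also have "\<dots> \<le> C"
    unfolding C_def distrib_right
  proof (rule add_mono)
    show "(1 + \<bar>D\<bar> + \<bar>B\<bar> * s) ^ n * exp (- s) \<le> (1 + \<bar>D\<bar> + \<bar>B\<bar>) ^ n * (real n ^ n * exp 1)"
      using A by (intro power_exp_bound) auto
    show "(1 + 1 / \<delta>) ^ n * exp (- s) \<le> (1 + 1 / \<delta>) ^ n"
      using A assms by (intro mult_left_le) auto
  qed
  finally have "z powr p * exp (- s) \<le> C" .
  then have "s powr b * exp (- s) * (z powr p * exp (- s)) \<le> s powr b * exp (- s) * C"
    by (intro mult_left_mono) auto
  moreover have "cmod (lap_fun \<beta> b p r s) = s powr b * exp (- s) * (z powr p * exp (- s))"
  proof -
    have "exp (- 2 * s) = exp (- s) * exp (- s)" by (simp flip: exp_add)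
    then show ?thesis
      by (simp add: lap_fun_def norm_mult z_def norm_powr_real_powr' del: of_real_add of_real_mult)
  qed
  ultimately show "cmod (lap_fun \<beta> b p r s) \<le> C * (s powr b * exp (- s))"
    by (simp add: mult_ac)
qed

lemma lap_fun_bound1:
  assumes "\<delta> > 0" "Re \<beta> \<ge> 0"
  obtains C where "C \<ge> 0" "\<And>r s. \<delta> \<le> r \<Longrightarrow> r \<le> D \<Longrightarrow> s > 0 \<Longrightarrow> cmod (lap_fun \<beta> b p r s) \<le> C * (s powr b * exp (- s))"
proof (rule lap_fun_bound[OF assms(1), of D "cmod \<beta>" "\<bar>p\<bar>"])
  fix C assume "C \<ge> 0" and C: "\<And>r \<beta>' b p' s. \<delta> \<le> r \<Longrightarrow> r \<le> D \<Longrightarrow> 0 \<le> Re \<beta>' \<Longrightarrow> cmod \<beta>' \<le> cmod \<beta> \<Longrightarrow> 0 < s \<Longrightarrow> \<bar>p'\<bar> \<le> \<bar>p\<bar>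
    \<Longrightarrow> cmod (lap_fun \<beta>' b p' r s) \<le> C * (s powr b * exp (- s))"
  show thesis
    by (rule that[OF \<open>C \<ge> 0\<close>]) (rule C, use assms in auto)
qed

lemma lap_integrable:
  assumes "r > 0" "Re \<beta> \<ge> 0" "b > -1"
  shows "integrable half_line (lap_fun \<beta> b p r)"
proof -
  obtain C where C: "\<And>s. s > 0 \<Longrightarrow> cmod (lap_fun \<beta> b p r s) \<le> C * (s powr b * exp (- s))"
    using lap_fun_bound1[OF assms(1,2), of r b p] by (metis order_refl)
  show ?thesis
    by (rule Bochner_Integration.integrable_bound[OF integrable_powr_exp[OF assms(3), of C] lap_fun_measurable[OF assms(1,2)]])
      (rule AE_half_lineI, use C in \<open>force intro: order_trans[OF _ abs_ge_self]\<close>)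
qed

text \<open>Joint continuity in everything: \<beta> moves in the limiting absorption argument, the
  exponents move when the index of a Bessel function is perturbed, and the limit \<beta>' = 0 yields
  the behaviour at infinity.\<close>

lemma lap_tendsto:
  assumes "\<delta> > 0" "\<And>n. \<delta> \<le> r n" "\<And>n. r n \<le> D" "\<And>n. Re (\<beta> n) \<ge> 0" "\<And>n. cmod (\<beta> n) \<le> B"
    "b0 > -1" "\<And>n. b0 \<le> b n" "\<And>n. b n \<le> b1" "\<And>n. \<bar>p n\<bar> \<le> P"
    "r \<longlonglongrightarrow> r'" "\<beta> \<longlonglongrightarrow> \<beta>'" "b \<longlonglongrightarrow> b'" "p \<longlonglongrightarrow> p'"
  shows "(\<lambda>n. lap (\<beta> n) (b n) (p n) (r n)) \<longlonglongrightarrow> lap \<beta>' b' p' r'"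
proof -
  obtain C where C0: "C \<ge> 0" and C: "\<And>r \<beta> b p s. \<delta> \<le> r \<Longrightarrow> r \<le> D \<Longrightarrow> Re \<beta> \<ge> 0 \<Longrightarrow> cmod \<beta> \<le> B \<Longrightarrow> s > 0 \<Longrightarrow> \<bar>p\<bar> \<le> P
    \<Longrightarrow> cmod (lap_fun \<beta> b p r s) \<le> C * (s powr b * exp (- s))"
    using lap_fun_bound[OF assms(1), of D B P] by blast
  have r': "r' > 0"
    using LIMSEQ_le_const[OF assms(10), of \<delta>] assms(1,2) by force
  have \<beta>': "Re \<beta>' \<ge> 0"
    using LIMSEQ_le_const[OF tendsto_Re[OF assms(11)], of 0] assms(4) by blast
  have rn: "r n > 0" for n using assms(1,2) by (meson less_le_trans)
  show ?thesis
    unfolding lap_def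
  proof (rule integral_dominated_convergence)
    show "integrable half_line (\<lambda>s. C * (s powr b0 * exp (- s)) + C * (s powr b1 * exp (- s)))"
      using assms(6) assms(7,8)[of 0] by (intro Bochner_Integration.integrable_add integrable_powr_exp) auto
    show "AE s in half_line. cmod (lap_fun (\<beta> n) (b n) (p n) (r n) s) \<le> C * (s powr b0 * exp (- s)) + C * (s powr b1 * exp (- s))" for n
    proof (rule AE_half_lineI)
      fix s :: real assume s: "s > 0"
      have "s powr b n \<le> s powr b0 + s powr b1"
      proof (cases "s \<le> 1")
        case True
        then show ?thesis using s powr_mono'[of b0 "b n" s] assms(7) by (simp add: add_increasing2)
      next
        case False
        then show ?thesis using powr_mono[of "b n" b1 s] assms(8) by (simp add: add_increasing)
      qed
      then have "C * (s powr b n * exp (- s)) \<le> C * ((s powr b0 + s powr b1) * exp (- s))"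
        using C0 by (intro mult_left_mono mult_right_mono) auto
      then show "cmod (lap_fun (\<beta> n) (b n) (p n) (r n) s) \<le> C * (s powr b0 * exp (- s)) + C * (s powr b1 * exp (- s))"
        using C[where r = "r n" and \<beta> = "\<beta> n" and s = s and p = "p n" and b = "b n"] assms(2-5,9) s
        by (simp add: algebra_simps)
    qed
    show "AE s in half_line. (\<lambda>n. lap_fun (\<beta> n) (b n) (p n) (r n) s) \<longlonglongrightarrow> lap_fun \<beta>' b' p' r' s"
    proof (rule AE_half_lineI)
      fix s :: real assume s: "s > 0"
      show "(\<lambda>n. lap_fun (\<beta> n) (b n) (p n) (r n) s) \<longlonglongrightarrow> lap_fun \<beta>' b' p' r' s"
        unfolding lap_fun_def using s norm_affine_bounds(4)[OF r' \<beta>', of s]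
        by (intro tendsto_intros assms tendsto_powr_complex) auto
    qed
  qed (use r' \<beta>' rn assms(4) lap_fun_measurable in auto)
qed

lemma lap_deriv:
  assumes "r > 0" "Re \<beta> \<ge> 0" "b > -1"
  shows "(lap \<beta> b p has_vector_derivative of_real p * lap \<beta> b (p - 1) r) (at r)"
proof -
  obtain C where C: "\<And>t s. r/2 \<le> t \<Longrightarrow> t \<le> 2*r \<Longrightarrow> s > 0 \<Longrightarrow> cmod (lap_fun \<beta> b (p-1) t s) \<le> C * (s powr b * exp (- s))"
    using lap_fun_bound1[OF half_gt_zero[OF assms(1)] assms(2), of "2*r" b "p-1"] by metis
  have "((\<lambda>t. \<integral>s. lap_fun \<beta> b p t s \<partial>half_line) has_vector_derivative
      (\<integral>s. of_real p * lap_fun \<beta> b (p - 1) r s \<partial>half_line)) (at r)"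
  proof (rule has_vector_derivative_integral[of "r/2" _ _ _ _ "\<lambda>s. \<bar>p\<bar> * (C * (s powr b * exp (- s)))"])
    fix t s assume t: "\<bar>t - r\<bar> < r/2" and "s \<in> space half_line"
    then have s: "s > 0" and t0: "t > 0" by (auto simp: abs_if split: if_splits)
    have "((\<lambda>z. of_real (exp (- 2 * s) * s powr b) * (z + \<beta> * of_real s) powr of_real p) has_field_derivative
        of_real p * lap_fun \<beta> b (p - 1) t s) (at (of_real t))"
      unfolding lap_fun_def using norm_affine_bounds(4)[OF t0 assms(2), of s] s
      by (auto intro!: derivative_eq_intros DERIV_chain2[OF has_field_derivative_powr])
    then show "((\<lambda>t. lap_fun \<beta> b p t s) has_vector_derivative of_real p * lap_fun \<beta> b (p - 1) t s) (at t)"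
      unfolding lap_fun_def by (rule has_vector_derivative_real_field)
    show "cmod (of_real p * lap_fun \<beta> b (p - 1) t s) \<le> \<bar>p\<bar> * (C * (s powr b * exp (- s)))"
      using C[of t s] t s by (auto simp: norm_mult abs_if intro!: mult_left_mono split: if_splits)
  qed (use assms lap_integrable integrable_powr_exp[OF assms(3), of C] lap_fun_measurable in
        \<open>auto simp: abs_if split: if_splits\<close>)
  then show ?thesis
    by (simp add: lap_def[abs_def])
qed

text \<open>Splits one factor r + \<beta> s off the power. Together with \<open>lap_by_parts\<close>
  this contiguity relation amounts to the differential equation of \<open>psi\<close>.\<close>

lemma lap_recurrence:
  assumes "r > 0" "Re \<beta> \<ge> 0" "b > -1"
  shows "lap \<beta> b p r = of_real r * lap \<beta> b (p - 1) r + \<beta> * lap \<beta> (b + 1) (p - 1) r"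
proof -
  have "lap_fun \<beta> b p r s = of_real r * lap_fun \<beta> b (p - 1) r s + \<beta> * lap_fun \<beta> (b + 1) (p - 1) r s" if "s > 0" for s
  proof -
    have z: "of_real r + \<beta> * of_real s \<noteq> 0"
      using norm_affine_bounds(4)[OF assms(1,2), of s] that by auto
    have "(of_real r + \<beta> * of_real s) powr of_real p = (of_real r + \<beta> * of_real s) powr (1 + of_real (p - 1))"
      by simp
    also have "\<dots> = (of_real r + \<beta> * of_real s) * (of_real r + \<beta> * of_real s) powr of_real (p - 1)"
      using z by (simp only: powr_add) simp
    finally show ?thesis
      using that by (simp add: lap_fun_def powr_add algebra_simps)
  qed
  then have "lap \<beta> b p r = (\<integral>s. of_real r * lap_fun \<beta> b (p - 1) r s + \<beta> * lap_fun \<beta> (b + 1) (p - 1) r s \<partial>half_line)"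
    unfolding lap_def by (intro Bochner_Integration.integral_cong) auto
  also have "\<dots> = of_real r * lap \<beta> b (p - 1) r + \<beta> * lap \<beta> (b + 1) (p - 1) r"
    unfolding lap_def using assms by (subst Bochner_Integration.integral_add) (auto intro!: lap_integrable)
  finally show ?thesis .
qed

text \<open>Integrates the derivative in \<open>s\<close> of exp(-2 s) s^(b+1) (r + \<beta> s)^p,
  which vanishes at both ends because \<open>b + 1\<close> is positive.\<close>

lemma lap_by_parts:
  assumes "r > 0" "Re \<beta> \<ge> 0" "b > -1"
  shows "2 * lap \<beta> (b + 1) p r = of_real (b + 1) * lap \<beta> b p r + of_real p * \<beta> * lap \<beta> (b + 1) (p - 1) r"
proof -
  let ?f = "\<lambda>s. - 2 * lap_fun \<beta> (b + 1) p r s + of_real (b + 1) * lap_fun \<beta> b p r s + of_real p * \<beta> * lap_fun \<beta> (b + 1) (p - 1) r s"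
  have i: "integrable half_line (lap_fun \<beta> (b + 1) p r)" "integrable half_line (lap_fun \<beta> b p r)"
    "integrable half_line (lap_fun \<beta> (b + 1) (p - 1) r)"
    using assms by (auto intro: lap_integrable)
  obtain C where C: "\<And>s. s > 0 \<Longrightarrow> cmod (lap_fun \<beta> (b + 1) p r s) \<le> C * (s powr (b + 1) * exp (- s))"
    using lap_fun_bound1[OF assms(1,2), of r "b + 1" p] by (metis order_refl)
  have "integral\<^sup>L half_line ?f = 0 - 0"
  proof (rule half_line_FTC)
    fix s :: real assume s: "s > 0"
    have z: "of_real r + \<beta> * of_real s \<notin> \<real>\<^sub>\<le>\<^sub>0"
      using norm_affine_bounds(4)[OF assms(1,2), of s] s by auto
    have 1: "((\<lambda>s. complex_of_real (exp (- 2 * s) * s powr (b + 1))) has_vector_derivative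
        of_real (- 2 * (exp (- 2 * s) * s powr (b + 1)) + (b + 1) * (exp (- 2 * s) * s powr b))) (at s)"
    proof (rule has_vector_derivative_of_real)
      have "((\<lambda>s. exp (- 2 * s)) has_real_derivative - 2 * exp (- 2 * s)) (at s)"
        by (auto intro!: derivative_eq_intros)
      moreover have "((\<lambda>s. s powr (b + 1)) has_real_derivative (b + 1) * s powr b) (at s)"
        using has_real_derivative_powr[OF s, of "b + 1"] by simp
      ultimately have "((\<lambda>s. exp (- 2 * s) * s powr (b + 1)) has_real_derivative
          - 2 * exp (- 2 * s) * s powr (b + 1) + (b + 1) * s powr b * exp (- 2 * s)) (at s)"
        by (rule DERIV_mult)
      then show "((\<lambda>s. exp (- 2 * s) * s powr (b + 1)) has_real_derivative
          - 2 * (exp (- 2 * s) * s powr (b + 1)) + (b + 1) * (exp (- 2 * s) * s powr b)) (at s)"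
        by (simp add: algebra_simps)
    qed
    have "((\<lambda>w. (of_real r + \<beta> * w) powr of_real p) has_field_derivative
       of_real p * \<beta> * (of_real r + \<beta> * of_real s) powr of_real (p - 1)) (at (of_real s))"
      using z by (auto intro!: derivative_eq_intros DERIV_chain2[OF has_field_derivative_powr])
    then have 2: "((\<lambda>s. (of_real r + \<beta> * of_real s) powr of_real p) has_vector_derivative
       of_real p * \<beta> * (of_real r + \<beta> * of_real s) powr of_real (p - 1)) (at s)"
      by (rule has_vector_derivative_real_field)
    show "(lap_fun \<beta> (b + 1) p r has_vector_derivative ?f s) (at s)"
      using has_vector_derivative_mult[OF 1 2] unfolding lap_fun_def
      by (rule has_vector_derivative_eq_rhs) (simp add: algebra_simps)
  next
    show "continuous_on {0<..} ?f"
      using assms by (intro continuous_intros lap_fun_continuous) auto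
    show "integrable half_line ?f"
      using i by simp
    have b1: "b + 1 > 0" using assms by simp
    have "((\<lambda>s. s powr (b + 1) * exp (- s)) \<longlongrightarrow> 0) at_top"
    proof (rule tendsto_sandwich[of "\<lambda>_. 0" _ _ "\<lambda>s. s ^ nat \<lceil>b + 1\<rceil> / exp s"])
      have "s powr (b + 1) * exp (- s) \<le> s ^ nat \<lceil>b + 1\<rceil> / exp s" if "s \<ge> 1" for s
      proof -
        have "b + 1 \<le> real (nat \<lceil>b + 1\<rceil>)" using b1 by linarith
        then have "s powr (b + 1) \<le> s powr real (nat \<lceil>b + 1\<rceil>)"
          using that by (intro powr_mono) auto
        then show ?thesis using that by (simp add: powr_realpow exp_minus divide_simps)
      qed
      then show "\<forall>\<^sub>F s in at_top. s powr (b + 1) * exp (- s) \<le> s ^ nat \<lceil>b + 1\<rceil> / exp s"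
        by (rule eventually_at_top_linorderI)
    qed (auto intro: tendsto_power_div_exp_0)
    then have "((\<lambda>s. C * (s powr (b + 1) * exp (- s))) \<longlongrightarrow> C * 0) at_top"
      by (intro tendsto_intros)
    then have lim1: "((\<lambda>s. C * (s powr (b + 1) * exp (- s))) \<longlongrightarrow> 0) at_top" by simp
    show "(lap_fun \<beta> (b + 1) p r \<longlongrightarrow> 0) at_top"
    proof (rule Lim_null_comparison[OF _ lim1])
      show "\<forall>\<^sub>F s in at_top. cmod (lap_fun \<beta> (b + 1) p r s) \<le> C * (s powr (b + 1) * exp (- s))"
        by (rule eventually_at_top_linorderI[of 1]) (simp add: C)
    qed
    have "((\<lambda>s::real. s powr (b + 1)) \<longlongrightarrow> 0 powr (b + 1)) (at_right 0)"
      by (rule tendsto_powr2) (use b1 in \<open>auto simp: eventually_at_filter\<close>)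
    then have "((\<lambda>s. C * (s powr (b + 1) * exp (- s))) \<longlongrightarrow> C * (0 powr (b + 1) * exp (- 0))) (at_right 0)"
      by (intro tendsto_mult tendsto_exp tendsto_minus tendsto_ident_at tendsto_const)
    then have lim2: "((\<lambda>s. C * (s powr (b + 1) * exp (- s))) \<longlongrightarrow> 0) (at_right 0)"
      using b1 by simp
    show "(lap_fun \<beta> (b + 1) p r \<longlongrightarrow> 0) (at_right 0)"
    proof (rule Lim_null_comparison[OF _ lim2])
      show "\<forall>\<^sub>F s in at_right 0. cmod (lap_fun \<beta> (b + 1) p r s) \<le> C * (s powr (b + 1) * exp (- s))"
        using eventually_at_right_less[of "0::real"] by (rule eventually_mono) (simp add: C)
    qed
  qed
  moreover have "integral\<^sup>L half_line ?f = - 2 * lap \<beta> (b + 1) p r + of_real (b + 1) * lap \<beta> b p r + of_real p * \<beta> * lap \<beta> (b + 1) (p - 1) r"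
    unfolding lap_def using i by simp
  ultimately show ?thesis
    by (simp add: add_eq_0_iff eq_neg_iff_add_eq_0 algebra_simps)
qed

text \<open>Uniform in the exponents as well, for the majorants that are needed when the index of a
  Bessel function varies.\<close>

lemma lap_uniform_bound:
  assumes "\<delta> > 0" "b0 > -1"
  shows "\<exists>C\<ge>0. \<forall>r \<beta> b p. \<delta> \<le> r \<longrightarrow> r \<le> D \<longrightarrow> Re \<beta> \<ge> 0 \<longrightarrow> cmod \<beta> \<le> B \<longrightarrow> b0 \<le> b \<longrightarrow> b \<le> b1 \<longrightarrow> \<bar>p\<bar> \<le> P
    \<longrightarrow> cmod (lap \<beta> b p r) \<le> C"
proof (rule lap_fun_bound[OF assms(1), of D B P])
  fix C assume C0: "C \<ge> 0" and C: "\<And>r \<beta> b p s. \<delta> \<le> r \<Longrightarrow> r \<le> D \<Longrightarrow> Re \<beta> \<ge> 0 \<Longrightarrow> cmod \<beta> \<le> B \<Longrightarrow> s > 0 \<Longrightarrow> \<bar>p\<bar> \<le> P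
    \<Longrightarrow> cmod (lap_fun \<beta> b p r s) \<le> C * (s powr b * exp (- s))"
  define K where "K = (\<integral>s. C * (s powr b0 * exp (- s)) + C * (s powr b1 * exp (- s)) \<partial>half_line)"
  have "cmod (lap \<beta> b p r) \<le> \<bar>K\<bar>"
    if A: "\<delta> \<le> r" "r \<le> D" "Re \<beta> \<ge> 0" "cmod \<beta> \<le> B" "b0 \<le> b" "b \<le> b1" "\<bar>p\<bar> \<le> P" for r \<beta> b p
  proof -
    have "cmod (lap \<beta> b p r) \<le> K"
      unfolding lap_def K_def
    proof (rule Bochner_Integration.integral_norm_bound_integral)
      show "integrable half_line (lap_fun \<beta> b p r)"
        using A assms by (intro lap_integrable) auto
      show "integrable half_line (\<lambda>s. C * (s powr b0 * exp (- s)) + C * (s powr b1 * exp (- s)))"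
        using A assms by (intro Bochner_Integration.integrable_add integrable_powr_exp) auto
      fix s :: real assume "s \<in> space half_line"
      then have s: "s > 0" by simp
      have "s powr b \<le> s powr b0 + s powr b1"
      proof (cases "s \<le> 1")
        case True
        then show ?thesis using s powr_mono'[of b0 b s] A by (simp add: add_increasing2)
      next
        case False
        then show ?thesis using powr_mono[of b b1 s] A by (simp add: add_increasing)
      qed
      then have "C * (s powr b * exp (- s)) \<le> C * ((s powr b0 + s powr b1) * exp (- s))"
        using C0 by (intro mult_left_mono mult_right_mono) auto
      then show "cmod (lap_fun \<beta> b p r s) \<le> C * (s powr b0 * exp (- s)) + C * (s powr b1 * exp (- s))"
        using C[OF A(1-4) s A(7), of b] by (simp add: algebra_simps)
    qed
    then show ?thesis by linarith
  qed
  then show ?thesis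
    by (intro exI[of _ "\<bar>K\<bar>"]) auto
qed

lemma lap_bound:
  assumes "b > -1"
  shows "\<exists>C\<ge>0. \<forall>\<beta>. Re \<beta> \<ge> 0 \<longrightarrow> cmod \<beta> \<le> B \<longrightarrow> cmod (lap \<beta> b p 1) \<le> C"
  using lap_uniform_bound[of 1 b 1 B b "\<bar>p\<bar>"] assms by (meson order_refl zero_less_one)

text \<open>Homogeneity moves \<open>r\<close> into the parameter: large \<open>r\<close> becomes a
  small parameter \<beta>/r at the fixed point 1, where \<open>lap\<close> is continuous.\<close>

lemma lap_scale:
  assumes "r > 0"
  shows "lap \<beta> b p r = of_real (r powr p) * lap (\<beta> / of_real r) b p 1"
proof -
  have "lap_fun \<beta> b p r s = of_real (r powr p) * lap_fun (\<beta> / of_real r) b p 1 s" for s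
  proof -
    have eq: "of_real r + \<beta> * of_real s = of_real r * (of_real 1 + \<beta> / of_real r * of_real s)"
      using assms by (simp add: field_simps)
    show ?thesis
      unfolding lap_fun_def eq using assms
      by (subst powr_times_real_left) (auto simp: powr_of_real algebra_simps)
  qed
  then show ?thesis by (simp add: lap_def)
qed

text \<open>Equal to Gamma(b+1) / 2^(b+1); kept as an integral, so that its continuity in
  \<open>b\<close> is an instance of \<open>lap_tendsto\<close>.\<close>

definition lap_norm :: "real \<Rightarrow> real" where
  "lap_norm b = (\<integral>s. exp (- 2 * s) * s powr b \<partial>half_line)"

lemma lap_0: "r > 0 \<Longrightarrow> lap 0 b p r = of_real (r powr p * lap_norm b)"
  unfolding lap_def lap_fun_def lap_norm_def
  by (simp add: powr_of_real mult.commute integral_complex_of_real[symmetric] del: integral_complex_of_real)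

lemma lap_norm_pos:
  assumes "b > -1"
  shows "lap_norm b > 0"
proof -
  have "integrable half_line (\<lambda>s. Re (lap_fun 0 b 0 1 s))"
    using lap_integrable[of 1 0 b 0] assms by auto
  then have int: "integrable half_line (\<lambda>s. exp (- 2 * s) * s powr b)"
    by (simp add: lap_fun_def)
  have "lap_norm b \<noteq> 0"
  proof
    assume "lap_norm b = 0"
    then have "AE s in half_line. exp (- 2 * s) * s powr b = 0"
      unfolding lap_norm_def using integral_nonneg_eq_0_iff_AE[OF int] by simp
    then have "AE s in lborel. s \<in> {0<..} \<longrightarrow> exp (- 2 * s) * s powr b = 0"
      by (subst (asm) AE_restrict_space_iff) auto
    then have "AE s in lborel. s \<notin> {1..2::real}"
      by eventually_elim auto
    then have "{s \<in> space lborel. \<not> s \<notin> {1..2::real}} \<in> null_sets lborel"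
      by (subst (asm) AE_iff_null) auto
    moreover have "{s \<in> space lborel. \<not> s \<notin> {1..2::real}} = {1..2}" by auto
    ultimately have "{1..2::real} \<in> null_sets lborel" by simp
    then show False by (simp add: null_sets_def)
  qed
  moreover have "lap_norm b \<ge> 0" unfolding lap_norm_def by (rule integral_nonneg_AE) auto
  ultimately show ?thesis by simp
qed

lemma lap_norm_tendsto:
  assumes "b0 > -1" "\<And>n. b0 \<le> b n" "\<And>n. b n \<le> b1" "b \<longlonglongrightarrow> b'"
  shows "(\<lambda>n. lap_norm (b n)) \<longlonglongrightarrow> lap_norm b'"
proof -
  have "(\<lambda>n. lap 0 (b n) 0 1) \<longlonglongrightarrow> lap 0 b' 0 1"
    by (rule lap_tendsto[of 1 "\<lambda>_. 1" 1 "\<lambda>_. 0" 0 b0 b b1 "\<lambda>_. 0" 0]) (use assms in auto)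
  from tendsto_Re[OF this] show ?thesis by (simp add: lap_0)
qed

text \<open>At r = 0 the integrand degenerates to exp(-2 s) s^(2a) \<beta>^a, integrable because 2a
  > -1. The second limit has the same majorant, since r |r + \<beta> s|^(a-1) is at most |r +
  \<beta> s|^a. Both limits serve to evaluate the Wronskian at the origin.\<close>

lemma lap_limit_0:
  assumes a: "a > -1/2" and \<beta>: "Re \<beta> \<ge> 0" "\<beta> \<noteq> 0"
  shows "(lap \<beta> a a \<longlongrightarrow> \<beta> powr of_real a * of_real (lap_norm (2 * a))) (at_right 0)"
    and "((\<lambda>r. of_real r * lap \<beta> a (a - 1) r) \<longlongrightarrow> 0) (at_right 0)"
proof -
  obtain C where C0: "C \<ge> 0" and C: "\<And>s. s > 0 \<Longrightarrow> (1 + cmod \<beta> * s) powr \<bar>a\<bar> * exp (- s) \<le> C"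
  proof -
    define n where "n = nat \<lceil>\<bar>a\<bar>\<rceil>"
    have n: "\<bar>a\<bar> \<le> real n" unfolding n_def by linarith
    show ?thesis
    proof (rule that)
      show "0 \<le> (1 + cmod \<beta>) ^ n * (real n ^ n * exp 1)" by simp
      fix s :: real assume s: "s > 0"
      have 1: "1 \<le> 1 + cmod \<beta> * s" using s by simp
      have "(1 + cmod \<beta> * s) powr \<bar>a\<bar> \<le> (1 + cmod \<beta> * s) powr real n"
        using n 1 by (intro powr_mono) auto
      also have "\<dots> = (1 + cmod \<beta> * s) ^ n"
        using 1 by (intro powr_realpow) linarith
      finally have "(1 + cmod \<beta> * s) powr \<bar>a\<bar> * exp (- s) \<le> (1 + cmod \<beta> * s) ^ n * exp (- s)"
        by (rule mult_right_mono) simp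
      also have "\<dots> \<le> (1 + cmod \<beta>) ^ n * (real n ^ n * exp 1)"
        using s by (intro power_exp_bound) auto
      finally show "(1 + cmod \<beta> * s) powr \<bar>a\<bar> * exp (- s) \<le> (1 + cmod \<beta>) ^ n * (real n ^ n * exp 1)" .
    qed
  qed
  \<comment> \<open>The first summand is the majorant for non-negative \<open>a\<close>, with
    \<open>r\<close> at most 1; the second is for negative \<open>a\<close>, where |r + \<beta> s|
    is replaced by |\<beta>| s.\<close>
  define w where "w s = C * (s powr a * exp (- s)) + cmod \<beta> powr a * (s powr (2 * a) * exp (- s))" for s
  have w: "integrable half_line w"
    unfolding w_def using a by (intro Bochner_Integration.integrable_add integrable_powr_exp) auto
  define z where "z r s = of_real r + \<beta> * complex_of_real s" for r s
  have zb: "exp (- 2 * s) * s powr a * cmod (z r s) powr a \<le> w s" if r: "0 < r" "r \<le> 1" and s: "s > 0" for r s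
  proof -
    note b = norm_affine_bounds[OF r(1) \<beta>(1), of s]
    have e2: "exp (- 2 * s) = exp (- s) * exp (- s)" by (simp flip: exp_add)
    have bs: "cmod \<beta> * s > 0" using \<beta> s by simp
    show ?thesis
    proof (cases "a \<ge> 0")
      case True
      have "cmod (z r s) powr a \<le> (1 + cmod \<beta> * s) powr \<bar>a\<bar>"
        using b(3) r s True by (auto simp: z_def intro!: powr_mono2)
      then have "cmod (z r s) powr a * exp (- s) \<le> (1 + cmod \<beta> * s) powr \<bar>a\<bar> * exp (- s)"
        by (rule mult_right_mono) simp
      also have "\<dots> \<le> C" by (rule C[OF s])
      finally have "(cmod (z r s) powr a * exp (- s)) * (s powr a * exp (- s)) \<le> C * (s powr a * exp (- s))"
        by (rule mult_right_mono) simp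
      then have "exp (- 2 * s) * s powr a * cmod (z r s) powr a \<le> C * (s powr a * exp (- s))"
        unfolding e2 by (simp only: mult_ac)
      then show ?thesis unfolding w_def by (simp add: add_increasing2)
    next
      case False
      have "cmod (z r s) powr a \<le> (cmod \<beta> * s) powr a"
        using b(2) s bs False by (auto simp: z_def intro!: powr_mono2')
      also have "\<dots> = cmod \<beta> powr a * s powr a"
        using s by (simp add: powr_mult)
      finally have "exp (- 2 * s) * s powr a * cmod (z r s) powr a \<le> exp (- 2 * s) * s powr a * (cmod \<beta> powr a * s powr a)"
        by (intro mult_left_mono) auto
      also have "\<dots> \<le> exp (- s) * s powr a * (cmod \<beta> powr a * s powr a)"
        using s by (intro mult_right_mono) auto
      also have "\<dots> = cmod \<beta> powr a * (s powr (2 * a) * exp (- s))"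
        by (simp add: powr_add[symmetric])
      finally show ?thesis
        unfolding w_def using C0 by (simp add: add_increasing)
    qed
  qed
  have nrm: "cmod (lap_fun \<beta> a p r s) = exp (- 2 * s) * s powr a * cmod (z r s) powr p" if "s > 0" for p r s
    using that by (simp add: lap_fun_def norm_mult z_def norm_powr_real_powr' del: of_real_add of_real_mult)
  have lim: "((\<lambda>n. lap \<beta> a a (X n)) \<longlonglongrightarrow> \<beta> powr of_real a * of_real (lap_norm (2 * a))) \<and>
    ((\<lambda>n. of_real (X n) * lap \<beta> a (a - 1) (X n)) \<longlonglongrightarrow> 0)"
    if X: "\<And>n. 0 < X n" "\<And>n. X n \<le> 1" "X \<longlonglongrightarrow> 0" for X
  proof
    have "(\<lambda>n. lap \<beta> a a (X n)) \<longlonglongrightarrow> (\<integral>s. \<beta> powr of_real a * of_real (exp (- 2 * s) * s powr (2 * a)) \<partial>half_line)"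
      unfolding lap_def
    proof (rule integral_dominated_convergence[OF _ _ w])
      show "(\<lambda>s. \<beta> powr of_real a * of_real (exp (- 2 * s) * s powr (2 * a))) \<in> borel_measurable half_line"
        by (intro half_line_measurable_continuous continuous_on_mult continuous_on_of_real continuous_on_exp
            continuous_on_powr continuous_intros) auto
      show "AE s in half_line. (\<lambda>n. lap_fun \<beta> a a (X n) s) \<longlonglongrightarrow> \<beta> powr of_real a * of_real (exp (- 2 * s) * s powr (2 * a))"
      proof (rule AE_half_lineI)
        fix s :: real assume s: "s > 0"
        have nz: "\<beta> * of_real s \<notin> \<real>\<^sub>\<le>\<^sub>0"
          using \<beta> s by (auto simp: complex_nonpos_Reals_iff complex_eq_iff mult_le_0_iff)
        have "(\<lambda>n. of_real (X n) + \<beta> * of_real s) \<longlonglongrightarrow> of_real 0 + \<beta> * of_real s"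
          by (intro tendsto_intros X)
        then have "(\<lambda>n. (of_real (X n) + \<beta> * of_real s) powr of_real a) \<longlonglongrightarrow> (\<beta> * of_real s) powr of_real a"
          using nz by (intro tendsto_powr_complex tendsto_const) auto
        moreover have "(\<beta> * of_real s) powr of_real a = \<beta> powr of_real a * of_real (s powr a)"
          using s powr_times_real_left[of "of_real s" \<beta> "of_real a"] by (simp add: mult.commute powr_of_real)
        ultimately have "(\<lambda>n. lap_fun \<beta> a a (X n) s) \<longlonglongrightarrow> of_real (exp (- 2 * s) * s powr a) * (\<beta> powr of_real a * of_real (s powr a))"
          unfolding lap_fun_def by (intro tendsto_mult tendsto_const) simp
        moreover have "s powr (2 * a) = s powr a * s powr a"
          by (simp add: powr_add[symmetric])
        ultimately show "(\<lambda>n. lap_fun \<beta> a a (X n) s) \<longlonglongrightarrow> \<beta> powr of_real a * of_real (exp (- 2 * s) * s powr (2 * a))"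
          by (simp add: mult_ac)
      qed
      show "AE s in half_line. cmod (lap_fun \<beta> a a (X n) s) \<le> w s" for n
        by (rule AE_half_lineI) (use nrm zb X in simp)
    qed (use X \<beta> lap_fun_measurable in auto)
    then show "(\<lambda>n. lap \<beta> a a (X n)) \<longlonglongrightarrow> \<beta> powr of_real a * of_real (lap_norm (2 * a))"
      by (simp add: lap_norm_def integral_complex_of_real[symmetric] del: integral_complex_of_real of_real_mult)
  next
    have "(\<lambda>n. \<integral>s. of_real (X n) * lap_fun \<beta> a (a - 1) (X n) s \<partial>half_line) \<longlonglongrightarrow> (\<integral>s. 0 \<partial>half_line)"
    proof (rule integral_dominated_convergence[OF _ _ w])
      show "AE s in half_line. cmod (of_real (X n) * lap_fun \<beta> a (a - 1) (X n) s) \<le> w s" for n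
      proof (rule AE_half_lineI)
        fix s :: real assume s: "s > 0"
        have zr: "X n \<le> cmod (z (X n) s)" "cmod (z (X n) s) > 0"
          using norm_affine_bounds(1)[OF X(1) \<beta>(1), of s n] s X(1)[of n] by (auto simp: z_def)
        have "X n * cmod (z (X n) s) powr (a - 1) \<le> cmod (z (X n) s) * cmod (z (X n) s) powr (a - 1)"
          using zr by (intro mult_right_mono) auto
        also have "\<dots> = cmod (z (X n) s) powr a"
          using zr by (simp add: powr_diff)
        finally have "exp (- 2 * s) * s powr a * (X n * cmod (z (X n) s) powr (a - 1)) \<le> exp (- 2 * s) * s powr a * cmod (z (X n) s) powr a"
          by (intro mult_left_mono) auto
        also have "\<dots> \<le> w s" by (rule zb[OF X(1,2) s])
        finally show "cmod (of_real (X n) * lap_fun \<beta> a (a - 1) (X n) s) \<le> w s"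
          using X(1)[of n] by (simp add: norm_mult nrm[OF s] mult_ac)
      qed
      show "AE s in half_line. (\<lambda>n. of_real (X n) * lap_fun \<beta> a (a - 1) (X n) s) \<longlonglongrightarrow> 0"
      proof (rule AE_half_lineI)
        fix s :: real assume s: "s > 0"
        have nz: "\<beta> * of_real s \<notin> \<real>\<^sub>\<le>\<^sub>0"
          using \<beta> s by (auto simp: complex_nonpos_Reals_iff complex_eq_iff mult_le_0_iff)
        have "(\<lambda>n. of_real (X n) + \<beta> * of_real s) \<longlonglongrightarrow> of_real 0 + \<beta> * of_real s"
          by (intro tendsto_intros X)
        then have "(\<lambda>n. of_real (X n) * lap_fun \<beta> a (a - 1) (X n) s) \<longlonglongrightarrow> of_real 0 * (of_real (exp (- 2 * s) * s powr a) * (\<beta> * of_real s) powr of_real (a - 1))"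
          unfolding lap_fun_def using nz by (intro tendsto_mult tendsto_of_real tendsto_powr_complex tendsto_const X) auto
        then show "(\<lambda>n. of_real (X n) * lap_fun \<beta> a (a - 1) (X n) s) \<longlonglongrightarrow> 0" by simp
      qed
    qed (use X \<beta> lap_fun_measurable in auto)
    then show "(\<lambda>n. of_real (X n) * lap \<beta> a (a - 1) (X n)) \<longlonglongrightarrow> 0"
      by (simp add: lap_def)
  qed
  have seq: "(f \<longlongrightarrow> l) (at_right 0)"
    if f: "\<And>X. (\<And>n. 0 < X n) \<Longrightarrow> (\<And>n. X n \<le> 1) \<Longrightarrow> X \<longlonglongrightarrow> 0 \<Longrightarrow> (\<lambda>n. f (X n)) \<longlonglongrightarrow> l"
    for f :: "real \<Rightarrow> complex" and l
    unfolding tendsto_at_iff_sequentially o_def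
  proof safe
    fix X :: "nat \<Rightarrow> real" assume X: "\<forall>i. X i \<in> {0<..} - {0}" "X \<longlonglongrightarrow> 0"
    then have "eventually (\<lambda>n. X n < 1) sequentially"
      by (intro order_tendstoD(2)[of X 0]) auto
    then obtain N where "\<And>n. n \<ge> N \<Longrightarrow> X n < 1"
      by (auto simp: eventually_sequentially)
    then have "(\<lambda>n. f (X (n + N))) \<longlonglongrightarrow> l"
      using X by (intro f LIMSEQ_ignore_initial_segment) (auto intro: less_imp_le)
    then show "(\<lambda>n. f (X n)) \<longlonglongrightarrow> l"
      by (rule LIMSEQ_offset)
  qed
  show "(lap \<beta> a a \<longlongrightarrow> \<beta> powr of_real a * of_real (lap_norm (2 * a))) (at_right 0)"
    by (rule seq) (use lim in blast)
  show "((\<lambda>r. of_real r * lap \<beta> a (a - 1) r) \<longlongrightarrow> 0) (at_right 0)"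
    by (rule seq) (use lim in blast)
qed

section \<open>The decaying solution and its asymptotics\<close>

lemma powr_has_vector_derivative:
  "r > 0 \<Longrightarrow> ((\<lambda>r. of_real (r powr e) :: complex) has_vector_derivative of_real e * of_real (r powr e) / of_real r) (at r)"
proof -
  assume r: "r > 0"
  have "((\<lambda>r. of_real (r powr e) :: complex) has_vector_derivative of_real (e * r powr (e - 1))) (at r)"
    by (rule has_vector_derivative_of_real[OF has_real_derivative_powr[OF r]])
  then show ?thesis using r by (simp add: powr_diff)
qed

lemma exp_has_vector_derivative:
  "((\<lambda>r. exp (k * of_real r) :: complex) has_vector_derivative k * exp (k * of_real r)) (at r)"
  by (rule has_vector_derivative_real_field) (auto intro!: derivative_eq_intros)

text \<open>
  \<open>psi a q r = (2 q r / \<pi>)\<^sup>1\<^sup>/\<^sup>2 K\<^sub>\<nu>(q r)\<close> with \<open>\<nu> = a + 1/2\<close>, normalised to be asymptotic to \<open>exp (- q r)\<close>;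
  the Laplace integral also makes sense on the boundary \<open>Re q = 0\<close>.
\<close>

definition psi :: "real \<Rightarrow> complex \<Rightarrow> real \<Rightarrow> complex" where
  "psi a q r = of_real (r powr (- a)) * exp (- q * of_real r) * lap (1 / q) a a r / of_real (lap_norm a)"

definition psi' :: "real \<Rightarrow> complex \<Rightarrow> real \<Rightarrow> complex" where
  "psi' a q r = of_real (r powr (- a)) * exp (- q * of_real r) *
     (of_real a * lap (1 / q) a (a - 1) r - (of_real a / of_real r + q) * lap (1 / q) a a r) / of_real (lap_norm a)"

lemma Re_one_over: "Re q \<ge> 0 \<Longrightarrow> Re (1 / q) \<ge> 0"
  by (simp add: Re_divide)

context
  fixes a :: real and q :: complex
  assumes a: "a > -1/2" and q: "Re q \<ge> 0" "q \<noteq> 0"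
begin

lemma psi_deriv:
  assumes r: "r > 0"
  shows "(psi a q has_vector_derivative psi' a q r) (at r)"
proof -
  have n: "(lap (1/q) a a has_vector_derivative of_real a * lap (1/q) a (a - 1) r) (at r)"
    using r a Re_one_over[OF q(1)] by (intro lap_deriv) auto
  have eq: "psi a q = (\<lambda>r. of_real (r powr - a) * exp (- q * of_real r) * lap (1 / q) a a r * (1 / of_real (lap_norm a)))"
    by (simp add: psi_def[abs_def])
  have "(psi a q has_vector_derivative
      (of_real (r powr - a) * exp (- q * of_real r) * (of_real a * lap (1 / q) a (a - 1) r) +
      (of_real (r powr - a) * (- q * exp (- q * of_real r)) + of_real (- a) * of_real (r powr - a) / of_real r *
      exp (- q * of_real r)) * lap (1 / q) a a r) * (1 / of_real (lap_norm a))) (at r)"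
    unfolding eq
    by (intro has_vector_derivative_mult_left has_vector_derivative_mult n powr_has_vector_derivative r exp_has_vector_derivative)
  then show ?thesis
    by (rule has_vector_derivative_eq_rhs)
      (simp add: psi'_def algebra_simps add_divide_distrib diff_divide_distrib)
qed

lemma psi'_deriv:
  assumes r: "r > 0"
  shows "(psi' a q has_vector_derivative (q\<^sup>2 + of_real (a * (a + 1)) / of_real r ^ 2) * psi a q r) (at r)"
proof -
  define \<beta> where "\<beta> = 1 / q"
  have \<beta>: "Re \<beta> \<ge> 0" "\<beta> * q = 1" using Re_one_over[OF q(1)] q(2) by (auto simp: \<beta>_def)
  define n where "n = lap \<beta> a a r"
  define n1 where "n1 = lap \<beta> a (a - 1) r"
  define n2 where "n2 = lap \<beta> a (a - 1 - 1) r"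
  define m1 where "m1 = lap \<beta> (a + 1) (a - 1) r"
  define m2 where "m2 = lap \<beta> (a + 1) (a - 1 - 1) r"
  define R where "R = complex_of_real r"
  have R: "R \<noteq> 0" using r by (simp add: R_def)
  have 1: "n = R * n1 + \<beta> * m1" "n1 = R * n2 + \<beta> * m2"
    "2 * m1 = (of_real a + 1) * n1 + (of_real a - 1) * \<beta> * m2"
    unfolding n_def n1_def m1_def n2_def m2_def R_def
    using lap_recurrence[OF r \<beta>(1), of a a] lap_recurrence[OF r \<beta>(1), of a "a - 1"] lap_by_parts[OF r \<beta>(1), of a "a - 1"] a
    by auto
  have qn: "q * n = q * R * n1 + m1"
    using 1(1) \<beta>(2) by (simp add: algebra_simps)
  \<comment> \<open>Eliminating the shifted integrals \<open>m1\<close> and \<open>m2\<close> leaves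
    a relation among \<open>n\<close>, \<open>n1\<close>, \<open>n2\<close>. Multiplied by
    \<open>a\<close> it says r n'' - 2 (a + q r) n' + 2 a q n = 0, which is the equation of
    \<open>psi\<close> after the factor r^(-a) exp(-q r) is removed.\<close>
  have key: "R * (of_real a - 1) * n2 - 2 * of_real a * n1 - 2 * q * R * n1 + 2 * q * n = 0"
  proof -
    have "R * n2 = n1 - \<beta> * m2" using 1(2) by simp
    then have "R * (of_real a - 1) * n2 = (of_real a - 1) * n1 - (of_real a - 1) * \<beta> * m2"
      by (metis (no_types, lifting) mult.assoc mult.commute right_diff_distrib)
    also have "\<dots> = 2 * of_real a * n1 - 2 * m1" using 1(3) by (simp add: algebra_simps)
    finally show ?thesis using qn by algebra
  qed
  have d0: "(lap \<beta> a a has_vector_derivative of_real a * n1) (at r)"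
    unfolding n1_def using r a \<beta> by (intro lap_deriv) auto
  have d1: "(lap \<beta> a (a - 1) has_vector_derivative of_real (a - 1) * n2) (at r)"
    unfolding n2_def using r a \<beta> by (intro lap_deriv) auto
  have dinv: "((\<lambda>r. of_real a / of_real r + q) has_vector_derivative - of_real a / R ^ 2) (at r)"
    unfolding R_def by (rule has_vector_derivative_real_field) (use r in \<open>auto intro!: derivative_eq_intros simp: power2_eq_square\<close>)
  have PE: "((\<lambda>r. of_real (r powr (- a)) * exp (- q * of_real r)) has_vector_derivative
       - (of_real a / R + q) * (of_real (r powr (- a)) * exp (- q * R))) (at r)"
    using has_vector_derivative_mult[OF powr_has_vector_derivative[OF r, of "-a"] exp_has_vector_derivative[of "-q" r]]
    by (rule has_vector_derivative_eq_rhs) (simp add: R_def field_simps)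
  have B: "((\<lambda>r. of_real a * lap \<beta> a (a - 1) r - (of_real a / of_real r + q) * lap \<beta> a a r) has_vector_derivative
      of_real a * (of_real (a - 1) * n2) - ((of_real a / R + q) * (of_real a * n1) + (- of_real a / R ^ 2) * n)) (at r)"
    using has_vector_derivative_diff[OF has_vector_derivative_mult_right[OF d1, of "of_real a"] has_vector_derivative_mult[OF dinv d0]]
    by (simp add: R_def n_def)
  define P where "P = complex_of_real (r powr (- a)) * exp (- q * R)"
  define g where "g = complex_of_real (lap_norm a)"
  have "((\<lambda>r. of_real (r powr (- a)) * exp (- q * of_real r) * (of_real a * lap \<beta> a (a - 1) r - (of_real a / of_real r + q) * lap \<beta> a a r) * (1 / g)) has_vector_derivative
      (P * (of_real a * (of_real (a - 1) * n2) - ((of_real a / R + q) * (of_real a * n1) + (- of_real a / R ^ 2) * n))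
       + (- (of_real a / R + q) * P) * (of_real a * n1 - (of_real a / R + q) * n)) * (1 / g)) (at r)"
    using has_vector_derivative_mult_left[OF has_vector_derivative_mult[OF PE B], of "1/g"]
    by (simp add: P_def R_def n_def n1_def)
  moreover have "(P * (of_real a * (of_real (a - 1) * n2) - ((of_real a / R + q) * (of_real a * n1) + (- of_real a / R ^ 2) * n))
       + (- (of_real a / R + q) * P) * (of_real a * n1 - (of_real a / R + q) * n)) * (1 / g)
       = (q\<^sup>2 + of_real (a * (a + 1)) / R ^ 2) * (P * n / g)"
  proof -
    have "of_real a * (of_real (a - 1) * n2) = of_real a * (2 * of_real a * n1 + 2 * q * R * n1 - 2 * q * n) / R"
    proof (subst nonzero_eq_divide_eq[OF R])
      show "of_real a * (of_real (a - 1) * n2) * R = of_real a * (2 * of_real a * n1 + 2 * q * R * n1 - 2 * q * n)"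
        unfolding of_real_diff of_real_1 using key by algebra
    qed
    moreover have dist: "(P * X1 + Y * P * X2) * h = P * (X1 + Y * X2) * h" for X1 X2 Y h
      by (simp add: algebra_simps)
    ultimately have "(of_real a * (of_real (a - 1) * n2) - ((of_real a / R + q) * (of_real a * n1) + (- of_real a / R ^ 2) * n))
       + (- (of_real a / R + q)) * (of_real a * n1 - (of_real a / R + q) * n)
       = (q\<^sup>2 + of_real (a * (a + 1)) / R ^ 2) * n"
      using R by (simp only:) (simp add: field_simps power2_eq_square)
    then show ?thesis
      by (simp only: dist R_def) simp
  qed
  moreover have "psi' a q = (\<lambda>r. of_real (r powr (- a)) * exp (- q * of_real r) * (of_real a * lap \<beta> a (a - 1) r - (of_real a / of_real r + q) * lap \<beta> a a r) * (1 / g))"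
    by (simp add: psi'_def[abs_def] \<beta>_def g_def)
  moreover have "psi a q r = P * n / g"
    by (simp add: psi_def P_def n_def g_def \<beta>_def R_def)
  ultimately show ?thesis
    by (simp only: R_def)
qed

text \<open>Once the exponential is split off, the combination psi' + q psi shows an explicit factor
  1/r. This is the radiation condition, and it persists for imaginary q, where \<open>psi\<close>
  itself no longer decays.\<close>

lemma psi_scaled:
  assumes r: "r > 0"
  shows "psi a q r = exp (- q * of_real r) * (lap (1 / (q * of_real r)) a a 1 / of_real (lap_norm a))"
    and "psi' a q r + q * psi a q r = exp (- q * of_real r) * (of_real (a / r) *
       (lap (1 / (q * of_real r)) a (a - 1) 1 - lap (1 / (q * of_real r)) a a 1) / of_real (lap_norm a))"
proof -
  have s: "lap (1/q) a a r = of_real (r powr a) * lap (1 / (q * of_real r)) a a 1"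
    "lap (1/q) a (a - 1) r = of_real (r powr a / r) * lap (1 / (q * of_real r)) a (a - 1) 1"
    using lap_scale[OF r, of "1/q" a a] lap_scale[OF r, of "1/q" a "a-1"] r by (simp_all add: powr_diff)
  have p: "complex_of_real (r powr - a) * of_real (r powr a) = 1"
    using r by (simp add: powr_minus field_simps flip: of_real_mult)
  show "psi a q r = exp (- q * of_real r) * (lap (1 / (q * of_real r)) a a 1 / of_real (lap_norm a))"
    unfolding psi_def s using p by (simp add: field_simps)
  have "psi' a q r + q * psi a q r = of_real (r powr - a) * exp (- q * of_real r) *
      (of_real a * lap (1 / q) a (a - 1) r - of_real a / of_real r * lap (1 / q) a a r) / of_real (lap_norm a)"
    unfolding psi'_def psi_def by (simp add: algebra_simps diff_divide_distrib add_divide_distrib)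
  also have "\<dots> = (of_real (r powr - a) * of_real (r powr a)) * (exp (- q * of_real r) * (of_real (a / r) *
       (lap (1 / (q * of_real r)) a (a - 1) 1 - lap (1 / (q * of_real r)) a a 1) / of_real (lap_norm a)))"
    unfolding s using r by (simp add: field_simps)
  finally show "psi' a q r + q * psi a q r = exp (- q * of_real r) * (of_real (a / r) *
       (lap (1 / (q * of_real r)) a (a - 1) 1 - lap (1 / (q * of_real r)) a a 1) / of_real (lap_norm a))"
    by (simp only: p mult_1)
qed

lemma Re_one_over_qr: "r > 0 \<Longrightarrow> Re (1 / (q * of_real r)) \<ge> 0"
  using q by (intro Re_one_over) simp

lemma psi_bounds:
  obtains C where "C \<ge> 0" "\<And>r. r \<ge> 1 \<Longrightarrow> cmod (psi a q r) \<le> C * exp (- Re q * r)"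
    "\<And>r. r \<ge> 1 \<Longrightarrow> cmod (psi' a q r + q * psi a q r) \<le> C * exp (- Re q * r) / r"
proof -
  obtain C1 where C1: "C1 \<ge> 0" "\<And>\<beta>. Re \<beta> \<ge> 0 \<Longrightarrow> cmod \<beta> \<le> 1 / cmod q \<Longrightarrow> cmod (lap \<beta> a a 1) \<le> C1"
    using lap_bound[of a "1 / cmod q" a] a by auto
  obtain C2 where C2: "C2 \<ge> 0" "\<And>\<beta>. Re \<beta> \<ge> 0 \<Longrightarrow> cmod \<beta> \<le> 1 / cmod q \<Longrightarrow> cmod (lap \<beta> a (a - 1) 1) \<le> C2"
    using lap_bound[of a "1 / cmod q" "a - 1"] a by auto
  have g: "lap_norm a > 0" using a by (intro lap_norm_pos) auto
  have nb: "Re (1 / (q * of_real r)) \<ge> 0" "cmod (1 / (q * of_real r)) \<le> 1 / cmod q" if "r \<ge> 1" for r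
    using Re_one_over_qr[of r] that q by (auto simp: norm_divide norm_mult divide_simps)
  show ?thesis
  proof (rule that[of "(1 + \<bar>a\<bar>) * (C1 + C2) / lap_norm a"])
    show "0 \<le> (1 + \<bar>a\<bar>) * (C1 + C2) / lap_norm a"
      using C1 C2 g by simp
    fix r :: real assume r: "r \<ge> 1"
    have l1: "cmod (lap (1 / (q * of_real r)) a a 1) \<le> C1" by (rule C1(2)[OF nb[OF r]])
    have l2: "cmod (lap (1 / (q * of_real r)) a (a - 1) 1) \<le> C2" by (rule C2(2)[OF nb[OF r]])
    have r0: "r > 0" using r by simp
    have e: "cmod (exp (- q * of_real r)) = exp (- Re q * r)" by simp
    have "C1 \<le> (1 + \<bar>a\<bar>) * (C1 + C2)"
      using C1 C2 by (simp add: algebra_simps add_nonneg_nonneg)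
    then have "cmod (lap (1 / (q * of_real r)) a a 1) / lap_norm a \<le> (1 + \<bar>a\<bar>) * (C1 + C2) / lap_norm a"
      using l1 g by (intro divide_right_mono) auto
    then show "cmod (psi a q r) \<le> (1 + \<bar>a\<bar>) * (C1 + C2) / lap_norm a * exp (- Re q * r)"
      unfolding psi_scaled(1)[OF r0] norm_mult e norm_divide norm_of_real using g
      by (subst mult.commute) (intro mult_right_mono, auto)
    have "cmod (lap (1 / (q * of_real r)) a (a - 1) 1 - lap (1 / (q * of_real r)) a a 1) \<le> C1 + C2"
      using norm_triangle_ineq4[of "lap (1 / (q * of_real r)) a (a - 1) 1" "lap (1 / (q * of_real r)) a a 1"] l1 l2 by simp
    then have "\<bar>a\<bar> * cmod (lap (1 / (q * of_real r)) a (a - 1) 1 - lap (1 / (q * of_real r)) a a 1) \<le> (1 + \<bar>a\<bar>) * (C1 + C2)"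
      using C1 C2 by (intro mult_mono) auto
    then have "exp (- Re q * r) / (r * lap_norm a) * (\<bar>a\<bar> * cmod (lap (1 / (q * of_real r)) a (a - 1) 1 - lap (1 / (q * of_real r)) a a 1))
       \<le> exp (- Re q * r) / (r * lap_norm a) * ((1 + \<bar>a\<bar>) * (C1 + C2))"
      using r0 g by (intro mult_left_mono) auto
    then show "cmod (psi' a q r + q * psi a q r) \<le> (1 + \<bar>a\<bar>) * (C1 + C2) / lap_norm a * exp (- Re q * r) / r"
      unfolding psi_scaled(2)[OF r0] norm_mult e norm_divide norm_of_real using g r0
      by (simp add: field_simps)
  qed
qed

text \<open>After scaling, the limit at infinity is the value of \<open>lap\<close> at parameter 0,
  which is \<open>lap_norm a\<close> for every exponent \<open>p\<close>; the second limit vanishes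
  through the factor 1/r.\<close>

lemma psi_limits:
  "((\<lambda>r. psi a q r * exp (q * of_real r)) \<longlongrightarrow> 1) at_top"
  "((\<lambda>r. (psi' a q r + q * psi a q r) * exp (q * of_real r)) \<longlongrightarrow> 0) at_top"
proof -
  have g: "lap_norm a > 0" using a by (intro lap_norm_pos) auto
  have seq: "(\<lambda>n. lap (1 / (q * of_real (X n))) a p 1) \<longlonglongrightarrow> of_real (lap_norm a)"
    if X: "filterlim X at_top sequentially" for X p
  proof -
    obtain N where N: "\<And>n. n \<ge> N \<Longrightarrow> X n \<ge> 1"
      using X unfolding filterlim_at_top eventually_sequentially by blast
    have X': "filterlim (\<lambda>n. X (n + N)) at_top sequentially"
      using X by (rule filterlim_compose) (rule filterlim_add_const_nat_at_top)
    have "(\<lambda>n. lap (1 / (q * of_real (X (n + N)))) a p 1) \<longlonglongrightarrow> lap 0 a p 1"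
    proof (rule lap_tendsto[of 1 "\<lambda>_. 1" 1 _ "1 / cmod q" a "\<lambda>_. a" a "\<lambda>_. p" "\<bar>p\<bar>"])
      have X1: "X (n + N) \<ge> 1" for n using N by simp
      show "Re (1 / (q * of_real (X (n + N)))) \<ge> 0" for n
        using Re_one_over_qr[of "X (n + N)"] X1[of n] by simp
      show "cmod (1 / (q * of_real (X (n + N)))) \<le> 1 / cmod q" for n
        using q X1[of n] by (auto simp: norm_divide norm_mult divide_simps)
      have "(\<lambda>n. 1 / q * of_real (inverse (X (n + N)))) \<longlonglongrightarrow> 1 / q * of_real 0"
        by (intro tendsto_mult tendsto_const tendsto_of_real filterlim_compose[OF tendsto_inverse_0_at_top X'] filterlim_ident)
      then show "(\<lambda>n. 1 / (q * of_real (X (n + N)))) \<longlonglongrightarrow> 0"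
        by (simp add: divide_inverse)
    qed (use a in auto)
    then show ?thesis
      using LIMSEQ_offset by (fastforce simp: lap_0)
  qed
  have lim: "((\<lambda>r. lap (1 / (q * of_real r)) a p 1) \<longlongrightarrow> of_real (lap_norm a)) at_top" for p
    by (rule tendsto_at_topI_sequentially) (rule seq)
  have "((\<lambda>r. lap (1 / (q * of_real r)) a a 1 / of_real (lap_norm a)) \<longlongrightarrow> of_real (lap_norm a) / of_real (lap_norm a)) at_top"
    using g by (intro tendsto_divide lim tendsto_const) auto
  moreover have "\<forall>\<^sub>F r in at_top. lap (1 / (q * of_real r)) a a 1 / of_real (lap_norm a) = psi a q r * exp (q * of_real r)"
  proof (rule eventually_at_top_linorderI[of 1])
    fix r :: real assume "r \<ge> 1"
    then show "lap (1 / (q * of_real r)) a a 1 / of_real (lap_norm a) = psi a q r * exp (q * of_real r)"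
      by (simp add: psi_scaled(1) exp_minus field_simps)
  qed
  ultimately show "((\<lambda>r. psi a q r * exp (q * of_real r)) \<longlongrightarrow> 1) at_top"
    using g Lim_transform_eventually by fastforce
  have "((\<lambda>r. of_real (a * inverse r) * (lap (1 / (q * of_real r)) a (a - 1) 1 - lap (1 / (q * of_real r)) a a 1) / of_real (lap_norm a))
      \<longlongrightarrow> of_real (a * 0) * (of_real (lap_norm a) - of_real (lap_norm a)) / of_real (lap_norm a)) at_top"
    using g by (intro tendsto_divide tendsto_mult tendsto_of_real tendsto_diff lim tendsto_const tendsto_inverse_0_at_top filterlim_ident) auto
  moreover have "\<forall>\<^sub>F r in at_top. of_real (a * inverse r) * (lap (1 / (q * of_real r)) a (a - 1) 1 - lap (1 / (q * of_real r)) a a 1) / of_real (lap_norm a)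
     = (psi' a q r + q * psi a q r) * exp (q * of_real r)"
  proof (rule eventually_at_top_linorderI[of 1])
    fix r :: real assume "r \<ge> 1"
    then show "of_real (a * inverse r) * (lap (1 / (q * of_real r)) a (a - 1) 1 - lap (1 / (q * of_real r)) a a 1) / of_real (lap_norm a)
     = (psi' a q r + q * psi a q r) * exp (q * of_real r)"
      by (simp add: psi_scaled(2) exp_minus divide_inverse mult_ac)
  qed
  ultimately show "((\<lambda>r. (psi' a q r + q * psi a q r) * exp (q * of_real r)) \<longlongrightarrow> 0) at_top"
    using Lim_transform_eventually by fastforce
qed

end

lemma lap_cnj:
  assumes "r > 0" "Re \<beta> \<ge> 0"
  shows "lap (cnj \<beta>) b p r = cnj (lap \<beta> b p r)"
proof -
  have "lap_fun (cnj \<beta>) b p r s = cnj (lap_fun \<beta> b p r s)" if "s > 0" for s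
  proof -
    have "cnj ((of_real r + \<beta> * of_real s) powr of_real p) = cnj (of_real r + \<beta> * of_real s) powr cnj (of_real p)"
      using assms that by (intro cnj_powr) auto
    then show ?thesis by (simp add: lap_fun_def)
  qed
  then have "lap (cnj \<beta>) b p r = (\<integral>s. cnj (lap_fun \<beta> b p r s) \<partial>half_line)"
    unfolding lap_def by (intro Bochner_Integration.integral_cong) auto
  then show ?thesis by (simp add: lap_def)
qed

lemma psi_cnj:
  assumes "r > 0" "Re q \<ge> 0"
  shows "psi a (cnj q) r = cnj (psi a q r)" "psi' a (cnj q) r = cnj (psi' a q r)"
  using lap_cnj[OF assms(1) Re_one_over[OF assms(2)]]
  by (simp_all add: psi_def psi'_def exp_cnj)

section \<open>The regular solution and the Wronskian\<close>

text \<open>Taylor coefficients of the hypergeometric function 0F1(; nu + 1; y/4) with nu = a + 1/2,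
  the entire factor of I_nu. Evaluated at y = (q r)^2 it depends on q^2 only, so q and -q give the
  same regular solution.\<close>

definition bcoef :: "real \<Rightarrow> nat \<Rightarrow> real" where
  "bcoef a n = 1 / (4 ^ n * fact n * pochhammer (a + 3/2) n)"

lemma pochhammer_ge_1: "x \<ge> 1 \<Longrightarrow> pochhammer (x::real) n \<ge> 1"
proof (induction n)
  case (Suc n)
  have "1 * 1 \<le> pochhammer x n * (x + of_nat n)"
    using Suc by (intro mult_mono) auto
  then show ?case by (simp add: pochhammer_Suc)
qed simp

lemma bcoef_bounds:
  assumes "a > -1/2"
  shows "0 \<le> bcoef a n" "bcoef a n \<le> 1 / fact n"
    "4 * (real n + 1) * (real n + a + 3/2) * bcoef a (Suc n) = bcoef a n"
proof -
  have p: "pochhammer (a + 3/2) n \<ge> 1"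
    using assms by (intro pochhammer_ge_1) auto
  then show "0 \<le> bcoef a n" by (simp add: bcoef_def)
  have "1 * fact n * 1 \<le> 4 ^ n * fact n * pochhammer (a + 3/2) n"
    using p by (intro mult_mono) auto
  then show "bcoef a n \<le> 1 / fact n"
    unfolding bcoef_def by (intro frac_le) auto
  have "real n + a + 3/2 \<noteq> 0" using assms by simp
  then show "4 * (real n + 1) * (real n + a + 3/2) * bcoef a (Suc n) = bcoef a n"
    using p unfolding bcoef_def pochhammer_Suc by (simp add: divide_simps) (simp add: algebra_simps)
qed

lemma power_series_exp_bound:
  fixes c :: "nat \<Rightarrow> complex"
  assumes "\<And>n. cmod (c n) \<le> 1 / fact n"
  shows "summable (\<lambda>n. c n * y ^ n)" "cmod (\<Sum>n. c n * y ^ n) \<le> exp (cmod y)"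
proof -
  have s: "(\<lambda>n. cmod y ^ n / fact n) sums exp (cmod y)"
    using exp_converges[of "cmod y"] by (simp add: scaleR_conv_of_real divide_inverse mult.commute)
  have b: "cmod (c n * y ^ n) \<le> cmod y ^ n / fact n" for n
    using mult_right_mono[OF assms[of n], of "cmod y ^ n"] by (simp add: norm_mult norm_power)
  show "summable (\<lambda>n. c n * y ^ n)"
    by (rule summable_comparison_test'[OF sums_summable[OF s] b])
  have "cmod (\<Sum>n. c n * y ^ n) \<le> (\<Sum>n. cmod y ^ n / fact n)"
    by (rule norm_suminf_le[OF b sums_summable[OF s]])
  then show "cmod (\<Sum>n. c n * y ^ n) \<le> exp (cmod y)"
    using sums_unique[OF s] by simp
qed

definition cbcoef :: "real \<Rightarrow> nat \<Rightarrow> complex" where "cbcoef a n = of_real (bcoef a n)"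
definition bser :: "real \<Rightarrow> complex \<Rightarrow> complex" where "bser a y = (\<Sum>n. cbcoef a n * y ^ n)"
definition bser1 :: "real \<Rightarrow> complex \<Rightarrow> complex" where "bser1 a y = (\<Sum>n. diffs (cbcoef a) n * y ^ n)"
definition bser2 :: "real \<Rightarrow> complex \<Rightarrow> complex" where "bser2 a y = (\<Sum>n. diffs (diffs (cbcoef a)) n * y ^ n)"

context
  fixes a :: real
  assumes a: "a > -1/2"
begin

lemma cbcoef_bound: "cmod (cbcoef a n) \<le> 1 / fact n"
  using bcoef_bounds[OF a, of n] by (simp add: cbcoef_def)

lemma diffs_cbcoef_bound: "cmod (diffs (cbcoef a) n) \<le> 1 / fact n"
proof -
  have "cmod (diffs (cbcoef a) n) = real (Suc n) * cmod (cbcoef a (Suc n))"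
    unfolding diffs_def norm_mult norm_of_nat by simp
  also have "\<dots> \<le> real (Suc n) * (1 / fact (Suc n))"
    by (intro mult_left_mono cbcoef_bound) auto
  also have "\<dots> = 1 / fact n" by (simp add: divide_simps)
  finally show ?thesis .
qed

lemma bser_deriv: "(bser a has_field_derivative bser1 a y) (at y)"
  unfolding bser_def[abs_def] bser1_def
  by (rule termdiffs_strong_converges_everywhere) (rule power_series_exp_bound(1)[OF cbcoef_bound])

lemma bser1_deriv: "(bser1 a has_field_derivative bser2 a y) (at y)"
  unfolding bser1_def[abs_def] bser2_def
  by (rule termdiffs_strong_converges_everywhere) (rule power_series_exp_bound(1)[OF diffs_cbcoef_bound])

lemma bser_bound: "cmod (bser a y) \<le> exp (cmod y)" "cmod (bser1 a y) \<le> exp (cmod y)"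
  unfolding bser_def bser1_def
  by (rule power_series_exp_bound(2)[OF cbcoef_bound], rule power_series_exp_bound(2)[OF diffs_cbcoef_bound])

lemma bser_0: "bser a 0 = 1"
  unfolding bser_def powser_zero by (simp add: cbcoef_def bcoef_def)

lemma bser_ode: "4 * y * bser2 a y + (4 * of_real a + 6) * bser1 a y = bser a y"
proof -
  define d where "d = diffs (cbcoef a)"
  have s1: "(\<lambda>n. d n * y ^ n) sums bser1 a y"
    unfolding d_def bser1_def by (intro summable_sums power_series_exp_bound(1) diffs_cbcoef_bound)
  have "summable (\<lambda>n. diffs d n * y ^ n)"
    unfolding d_def by (intro termdiff_converges_all power_series_exp_bound(1) diffs_cbcoef_bound)
  then have "(\<lambda>n. diffs d n * y ^ n) sums bser2 a y"
    unfolding bser2_def d_def by (rule summable_sums)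
  then have "(\<lambda>n. y * (diffs d n * y ^ n)) sums (y * bser2 a y)"
    by (rule sums_mult)
  then have "(\<lambda>n. of_nat (Suc n) * d (Suc n) * y ^ Suc n) sums (y * bser2 a y)"
    by (simp add: diffs_def mult_ac)
  \<comment> \<open>The term of index 0 carries the factor 0, so undoing the shift does not change
    the sum.\<close>
  then have s2: "(\<lambda>n. of_nat n * d n * y ^ n) sums (y * bser2 a y)"
    using sums_Suc_iff[of "\<lambda>n. of_nat n * d n * y ^ n" "y * bser2 a y"] by simp
  have "(\<lambda>n. 4 * (of_nat n * d n * y ^ n) + (4 * of_real a + 6) * (d n * y ^ n)) sums
      (4 * (y * bser2 a y) + (4 * of_real a + 6) * bser1 a y)"
    by (intro sums_add sums_mult s1 s2)
  moreover have "4 * (of_nat n * d n * y ^ n) + (4 * of_real a + 6) * (d n * y ^ n) = cbcoef a n * y ^ n" for n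
  proof -
    have "cbcoef a n = of_real (4 * (real n + 1) * (real n + a + 3/2) * bcoef a (Suc n))"
      using bcoef_bounds(3)[OF a, of n] by (simp only: cbcoef_def)
    also have "\<dots> = (4 * of_nat n + 4 * of_real a + 6) * d n"
      by (simp add: d_def diffs_def cbcoef_def algebra_simps)
    finally show ?thesis by (simp add: algebra_simps)
  qed
  ultimately have "(\<lambda>n. cbcoef a n * y ^ n) sums (4 * (y * bser2 a y) + (4 * of_real a + 6) * bser1 a y)"
    by simp
  then show ?thesis
    unfolding bser_def using sums_unique by (metis mult.assoc)
qed

end

text \<open>\<open>phi a q r = \<Gamma>(\<nu> + 1) (2 / q)\<^sup>\<nu> r\<^sup>1\<^sup>/\<^sup>2 I\<^sub>\<nu>(q r)\<close> with \<open>\<nu> = a + 1/2\<close>.\<close>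

definition phi :: "real \<Rightarrow> complex \<Rightarrow> real \<Rightarrow> complex" where
  "phi a q r = of_real (r powr (a + 1)) * bser a (q\<^sup>2 * of_real r ^ 2)"

definition phi' :: "real \<Rightarrow> complex \<Rightarrow> real \<Rightarrow> complex" where
  "phi' a q r = of_real (r powr a) * ((of_real a + 1) * bser a (q\<^sup>2 * of_real r ^ 2)
      + 2 * q\<^sup>2 * of_real r ^ 2 * bser1 a (q\<^sup>2 * of_real r ^ 2))"

context
  fixes a :: real
  assumes a: "a > -1/2"
begin

lemma bser_comp_deriv:
  "((\<lambda>r. bser a (q\<^sup>2 * of_real r ^ 2)) has_vector_derivative 2 * q\<^sup>2 * of_real r * bser1 a (q\<^sup>2 * of_real r ^ 2)) (at r)"
  "((\<lambda>r. bser1 a (q\<^sup>2 * of_real r ^ 2)) has_vector_derivative 2 * q\<^sup>2 * of_real r * bser2 a (q\<^sup>2 * of_real r ^ 2)) (at r)"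
proof -
  have d: "((\<lambda>z. q\<^sup>2 * z ^ 2) has_field_derivative 2 * q\<^sup>2 * of_real r) (at (of_real r))"
    by (auto intro!: derivative_eq_intros)
  have "((\<lambda>z. bser a (q\<^sup>2 * z ^ 2)) has_field_derivative bser1 a (q\<^sup>2 * of_real r ^ 2) * (2 * q\<^sup>2 * of_real r)) (at (of_real r))"
    by (rule DERIV_chain2[OF bser_deriv[OF a] d])
  then show "((\<lambda>r. bser a (q\<^sup>2 * of_real r ^ 2)) has_vector_derivative 2 * q\<^sup>2 * of_real r * bser1 a (q\<^sup>2 * of_real r ^ 2)) (at r)"
    using has_vector_derivative_real_field[of "\<lambda>z. bser a (q\<^sup>2 * z ^ 2)"] by (simp add: mult_ac)
  have "((\<lambda>z. bser1 a (q\<^sup>2 * z ^ 2)) has_field_derivative bser2 a (q\<^sup>2 * of_real r ^ 2) * (2 * q\<^sup>2 * of_real r)) (at (of_real r))"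
    by (rule DERIV_chain2[OF bser1_deriv[OF a] d])
  then show "((\<lambda>r. bser1 a (q\<^sup>2 * of_real r ^ 2)) has_vector_derivative 2 * q\<^sup>2 * of_real r * bser2 a (q\<^sup>2 * of_real r ^ 2)) (at r)"
    using has_vector_derivative_real_field[of "\<lambda>z. bser1 a (q\<^sup>2 * z ^ 2)"] by (simp add: mult_ac)
qed

lemma phi_deriv:
  assumes r: "r > 0"
  shows "(phi a q has_vector_derivative phi' a q r) (at r)"
  unfolding phi_def[abs_def]
  using has_vector_derivative_mult[OF powr_has_vector_derivative[OF r, of "a + 1"] bser_comp_deriv(1)[of q r]]
  by (rule has_vector_derivative_eq_rhs)
    (use r in \<open>simp add: phi'_def powr_add field_simps power2_eq_square\<close>)

lemma phi'_deriv:
  assumes r: "r > 0"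
  shows "(phi' a q has_vector_derivative (q\<^sup>2 + of_real (a * (a + 1)) / of_real r ^ 2) * phi a q r) (at r)"
proof -
  define R where "R = complex_of_real r"
  define A where "A = complex_of_real a"
  define S where "S = bser a (q\<^sup>2 * R ^ 2)"
  define S1 where "S1 = bser1 a (q\<^sup>2 * R ^ 2)"
  define S2 where "S2 = bser2 a (q\<^sup>2 * R ^ 2)"
  define P where "P = complex_of_real (r powr a)"
  have R: "R \<noteq> 0" using r by (simp add: R_def)
  have ode: "4 * (q\<^sup>2 * R\<^sup>2) * S2 + (4 * A + 6) * S1 = S"
    unfolding S_def S1_def S2_def A_def by (rule bser_ode[OF a])
  have dR: "((\<lambda>r. 2 * q\<^sup>2 * of_real r ^ 2) has_vector_derivative 4 * q\<^sup>2 * R) (at r)"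
    unfolding R_def by (rule has_vector_derivative_real_field) (auto intro!: derivative_eq_intros)
  have "((\<lambda>r. (of_real a + 1) * bser a (q\<^sup>2 * of_real r ^ 2) + 2 * q\<^sup>2 * of_real r ^ 2 * bser1 a (q\<^sup>2 * of_real r ^ 2))
      has_vector_derivative (A + 1) * (2 * q\<^sup>2 * R * S1) + ((2 * q\<^sup>2 * R ^ 2) * (2 * q\<^sup>2 * R * S2) + 4 * q\<^sup>2 * R * S1)) (at r)"
    using has_vector_derivative_add[OF has_vector_derivative_mult_right[OF bser_comp_deriv(1)[of q r], of "of_real a + 1"]
      has_vector_derivative_mult[OF dR bser_comp_deriv(2)[of q r]]]
    by (simp add: R_def A_def S1_def S2_def)
  from has_vector_derivative_mult[OF powr_has_vector_derivative[OF r, of a] this]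
  have "(phi' a q has_vector_derivative
     P * ((A + 1) * (2 * q\<^sup>2 * R * S1) + ((2 * q\<^sup>2 * R ^ 2) * (2 * q\<^sup>2 * R * S2) + 4 * q\<^sup>2 * R * S1))
     + A * P / R * ((A + 1) * S + 2 * q\<^sup>2 * R ^ 2 * S1)) (at r)"
    by (simp add: phi'_def[abs_def] P_def A_def R_def S_def S1_def)
  moreover have "P * ((A + 1) * (2 * q\<^sup>2 * R * S1) + ((2 * q\<^sup>2 * R ^ 2) * (2 * q\<^sup>2 * R * S2) + 4 * q\<^sup>2 * R * S1))
     + A * P / R * ((A + 1) * S + 2 * q\<^sup>2 * R ^ 2 * S1) = (q\<^sup>2 + A * (A + 1) / R ^ 2) * (P * R * S)"
  proof -
    have "(R * R) * (P * ((A + 1) * (2 * q\<^sup>2 * R * S1) + ((2 * q\<^sup>2 * R ^ 2) * (2 * q\<^sup>2 * R * S2) + 4 * q\<^sup>2 * R * S1)))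
     + R * (A * P * ((A + 1) * S + 2 * q\<^sup>2 * R ^ 2 * S1)) = (R * R * q\<^sup>2 + A * (A + 1)) * (P * R * S)"
    proof -
      have "(2 * q\<^sup>2 * R ^ 2) * (2 * q\<^sup>2 * R * S2) = q\<^sup>2 * R * (4 * (q\<^sup>2 * R\<^sup>2) * S2)"
        by (simp add: power2_eq_square)
      also have "4 * (q\<^sup>2 * R\<^sup>2) * S2 = S - (4 * A + 6) * S1"
        using ode by (simp add: algebra_simps)
      finally have t: "(2 * q\<^sup>2 * R ^ 2) * (2 * q\<^sup>2 * R * S2) = q\<^sup>2 * R * (S - (4 * A + 6) * S1)" .
      show ?thesis unfolding t by (simp add: algebra_simps power2_eq_square)
    qed
    then show ?thesis
      using R by (simp add: field_simps power2_eq_square)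
  qed
  moreover have "phi a q r = P * R * S"
    using r by (simp add: phi_def P_def R_def S_def powr_add)
  ultimately show ?thesis
    by (simp add: A_def R_def)
qed

lemma phi_bounds:
  obtains C where "C \<ge> 0" "\<And>r. 0 < r \<Longrightarrow> r \<le> 1 \<Longrightarrow> cmod (phi a q r) \<le> C * r powr (a + 1)"
    "\<And>r. 0 < r \<Longrightarrow> r \<le> 1 \<Longrightarrow> cmod (phi' a q r) \<le> C * r powr a"
proof -
  define E where "E = exp ((cmod q)\<^sup>2)"
  have E: "cmod (bser a (q\<^sup>2 * of_real r ^ 2)) \<le> E" "cmod (bser1 a (q\<^sup>2 * of_real r ^ 2)) \<le> E" if "0 < r" "r \<le> 1" for r
  proof -
    have "cmod (q\<^sup>2 * of_real r ^ 2) \<le> (cmod q)\<^sup>2"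
      using that by (simp add: norm_mult norm_power mult_left_le power_le_one)
    then have "exp (cmod (q\<^sup>2 * of_real r ^ 2)) \<le> E" by (simp add: E_def)
    then show "cmod (bser a (q\<^sup>2 * of_real r ^ 2)) \<le> E" "cmod (bser1 a (q\<^sup>2 * of_real r ^ 2)) \<le> E"
      using bser_bound[OF a, of "q\<^sup>2 * of_real r ^ 2"] by linarith+
  qed
  have E0: "E > 0" by (simp add: E_def)
  show ?thesis
  proof (rule that[of "(1 + \<bar>a + 1\<bar> + 2 * (cmod q)\<^sup>2) * E"])
    show "0 \<le> (1 + \<bar>a + 1\<bar> + 2 * (cmod q)\<^sup>2) * E" using E0 by simp
    fix r :: real assume r: "0 < r" "r \<le> 1"
    have "1 * E \<le> (1 + \<bar>a + 1\<bar> + 2 * (cmod q)\<^sup>2) * E"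
      using E0 by (intro mult_right_mono) auto
    then have "cmod (bser a (q\<^sup>2 * of_real r ^ 2)) \<le> (1 + \<bar>a + 1\<bar> + 2 * (cmod q)\<^sup>2) * E"
      using E(1)[OF r] by linarith
    then show "cmod (phi a q r) \<le> (1 + \<bar>a + 1\<bar> + 2 * (cmod q)\<^sup>2) * E * r powr (a + 1)"
      by (simp add: phi_def norm_mult mult.commute[of "r powr (a + 1)"] mult_right_mono)
    have c1: "cmod (of_real a + 1) = \<bar>a + 1\<bar>"
      by (metis norm_of_real of_real_1 of_real_add real_norm_def)
    have c2: "cmod (2 * q\<^sup>2 * of_real r ^ 2) \<le> 2 * (cmod q)\<^sup>2"
      using r by (simp add: norm_mult norm_power mult_left_le power_le_one)
    have "cmod ((of_real a + 1) * bser a (q\<^sup>2 * of_real r ^ 2) + 2 * q\<^sup>2 * of_real r ^ 2 * bser1 a (q\<^sup>2 * of_real r ^ 2))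
       \<le> \<bar>a + 1\<bar> * E + 2 * (cmod q)\<^sup>2 * E"
    proof (rule norm_triangle_le, rule add_mono)
      show "cmod ((of_real a + 1) * bser a (q\<^sup>2 * of_real r ^ 2)) \<le> \<bar>a + 1\<bar> * E"
        using E(1)[OF r] by (simp only: norm_mult c1) (rule mult_left_mono, auto)
      show "cmod (2 * q\<^sup>2 * of_real r ^ 2 * bser1 a (q\<^sup>2 * of_real r ^ 2)) \<le> 2 * (cmod q)\<^sup>2 * E"
        unfolding norm_mult[of "2 * q\<^sup>2 * of_real r ^ 2"] by (rule mult_mono[OF c2 E(2)[OF r]]) auto
    qed
    also have "\<dots> \<le> (1 + \<bar>a + 1\<bar> + 2 * (cmod q)\<^sup>2) * E"
      using E0 by (simp add: algebra_simps)
    finally show "cmod (phi' a q r) \<le> (1 + \<bar>a + 1\<bar> + 2 * (cmod q)\<^sup>2) * E * r powr a"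
      by (simp add: phi'_def norm_mult mult.commute[of "r powr a"] mult_right_mono)
  qed
qed

end

section \<open>Wronskians\<close>

lemma wronskian_const:
  fixes f g f' g' :: "real \<Rightarrow> complex"
  assumes "\<And>r. r > 0 \<Longrightarrow> (f has_vector_derivative f' r) (at r)" "\<And>r. r > 0 \<Longrightarrow> (f' has_vector_derivative V r * f r) (at r)"
    "\<And>r. r > 0 \<Longrightarrow> (g has_vector_derivative g' r) (at r)" "\<And>r. r > 0 \<Longrightarrow> (g' has_vector_derivative V r * g r) (at r)"
  shows "\<exists>c. \<forall>r\<in>{0<..}. f' r * g r - f r * g' r = c"
proof -
  show "\<exists>c. \<forall>r\<in>{0<..}. f' r * g r - f r * g' r = c"
  proof (rule has_derivative_zero_constant)
    fix r :: real assume "r \<in> {0<..}"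
    then have r: "r > 0" by simp
    have "((\<lambda>r. f' r * g r - f r * g' r) has_vector_derivative
        (f' r * g' r + V r * f r * g r) - (f r * (V r * g r) + f' r * g' r)) (at r)"
      by (intro has_vector_derivative_diff has_vector_derivative_mult assms r)
    then have "((\<lambda>r. f' r * g r - f r * g' r) has_vector_derivative 0) (at r)"
      by (simp add: algebra_simps)
    then show "((\<lambda>r. f' r * g r - f r * g' r) has_derivative (\<lambda>h. 0)) (at r within {0<..})"
      by (simp add: has_vector_derivative_def has_derivative_at_withinI)
  qed auto
qed

text \<open>The Wronskian is constant, hence equal to its limit at 0, where \<open>phi\<close>
  behaves like r^(a+1) and \<open>psi\<close> like a constant times r^(-a).\<close>

lemma wronskian_phi_psi:
  assumes a: "a > -1/2" and q: "Re q \<ge> 0" "q \<noteq> 0" and r: "r > 0"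
  shows "phi' a q r * psi a q r - phi a q r * psi' a q r
      = of_real ((2 * a + 1) * lap_norm (2 * a) / lap_norm a) * (1 / q) powr of_real a"
proof -
  obtain c where c: "\<And>r. r > 0 \<Longrightarrow> phi' a q r * psi a q r - phi a q r * psi' a q r = c"
    using wronskian_const[OF phi_deriv[OF a] phi'_deriv[OF a] psi_deriv[OF a q] psi'_deriv[OF a q]] by auto
  define L where "L = (1 / q) powr of_real a * of_real (lap_norm (2 * a))"
  define g where "g = complex_of_real (lap_norm a)"
  have g: "g \<noteq> 0" using lap_norm_pos[of a] a by (simp add: g_def)
  have b: "Re (1 / q) \<ge> 0" "1 / q \<noteq> 0" using q by (auto intro: Re_one_over)
  have id: "((\<lambda>r. complex_of_real r) \<longlongrightarrow> of_real 0) (at_right 0)"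
    by (intro tendsto_of_real tendsto_ident_at)
  have arg: "((\<lambda>r. q\<^sup>2 * complex_of_real r ^ 2) \<longlongrightarrow> q\<^sup>2 * of_real 0 ^ 2) (at_right 0)"
    by (intro tendsto_mult tendsto_power id tendsto_const)
  have S: "((\<lambda>r. bser a (q\<^sup>2 * of_real r ^ 2)) \<longlongrightarrow> 1) (at_right 0)"
    using isCont_tendsto_compose[OF DERIV_isCont[OF bser_deriv[OF a]] arg] bser_0[OF a] by simp
  have S1: "((\<lambda>r. bser1 a (q\<^sup>2 * of_real r ^ 2)) \<longlongrightarrow> bser1 a 0) (at_right 0)"
    using isCont_tendsto_compose[OF DERIV_isCont[OF bser1_deriv[OF a]] arg] by simp
  have e: "((\<lambda>r. exp (- q * complex_of_real r)) \<longlongrightarrow> exp (- q * of_real 0)) (at_right 0)"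
    by (intro tendsto_exp tendsto_mult tendsto_const id)
  define n where "n r = lap (1/q) a a r" for r
  define n1 where "n1 r = lap (1/q) a (a - 1) r" for r
  have n: "(n \<longlongrightarrow> L) (at_right 0)" "((\<lambda>r. of_real r * n1 r) \<longlongrightarrow> 0) (at_right 0)"
    unfolding n_def[abs_def] n1_def[abs_def] L_def using lap_limit_0[OF a b] by auto
  \<comment> \<open>The Wronskian with r^a and r^(-a) already cancelled against each other, so that
    every remaining factor has a limit at 0.\<close>
  define F where "F r = ((of_real a + 1) * bser a (q\<^sup>2 * of_real r ^ 2) + 2 * q\<^sup>2 * of_real r ^ 2 * bser1 a (q\<^sup>2 * of_real r ^ 2))
      * exp (- q * of_real r) * n r / g
      - bser a (q\<^sup>2 * of_real r ^ 2) * exp (- q * of_real r) * (of_real a * (of_real r * n1 r) - (of_real a + q * of_real r) * n r) / g" for r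
  have "(F \<longlongrightarrow> ((of_real a + 1) * 1 + 2 * q\<^sup>2 * of_real 0 ^ 2 * bser1 a 0) * exp (- q * of_real 0) * L / g
      - 1 * exp (- q * of_real 0) * (of_real a * 0 - (of_real a + q * of_real 0) * L) / g) (at_right 0)"
    unfolding F_def using g
    by (intro tendsto_diff tendsto_divide tendsto_mult tendsto_add tendsto_power tendsto_const S S1 e id n) auto
  then have lim: "(F \<longlongrightarrow> (2 * of_real a + 1) * L / g) (at_right 0)"
    by (simp add: algebra_simps add_divide_distrib)
  have FE: "F r = phi' a q r * psi a q r - phi a q r * psi' a q r" if r: "r > 0" for r
  proof -
    have p: "complex_of_real (r powr a) = P \<Longrightarrow> complex_of_real (r powr (a + 1)) = P * of_real r"
      "complex_of_real (r powr a) = P \<Longrightarrow> complex_of_real (r powr (- a)) = 1 / P" for P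
      using r by (auto simp: powr_add powr_minus field_simps)
    define P where "P = complex_of_real (r powr a)"
    have P: "P \<noteq> 0" "complex_of_real r \<noteq> 0" using r by (auto simp: P_def)
    show ?thesis
      unfolding F_def phi_def phi'_def psi_def psi'_def p(1)[OF P_def[symmetric]] p(2)[OF P_def[symmetric]]
        P_def[symmetric] n_def[symmetric] n1_def[symmetric] g_def[symmetric]
      using P g by (simp add: field_simps)
  qed
  have "\<forall>\<^sub>F r in at_right 0. F r = c"
    using eventually_at_right_less[of "0::real"] by (rule eventually_mono) (simp add: FE c)
  then have "(F \<longlongrightarrow> c) (at_right 0)"
    by (rule tendsto_eventually)
  then have "c = (2 * of_real a + 1) * L / g"
    by (rule tendsto_unique[OF trivial_limit_at_right_real _ lim])
  then show ?thesis
    using c[OF r] by (simp add: L_def g_def)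
qed

text \<open>The factor that normalises the Wronskian up to the power of 1/q. By the duplication
  formula it equals sqrt(pi/2) / (2^nu Gamma(nu + 1)), nu = a + 1/2, and it turns \<open>phi\<close>
  at energy one into \<open>besJ\<close>.\<close>

definition rho :: "real \<Rightarrow> real" where
  "rho a = lap_norm a / ((2 * a + 1) * lap_norm (2 * a))"

lemma rho_pos: "a > -1/2 \<Longrightarrow> rho a > 0"
  unfolding rho_def using lap_norm_pos[of a] lap_norm_pos[of "2 * a"] by (intro divide_pos_pos mult_pos_pos) auto

lemma wronskian_rho:
  assumes a: "a > -1/2" and q: "Re q \<ge> 0" "q \<noteq> 0" and r: "r > 0"
  shows "of_real (rho a) * (phi' a q r * psi a q r - phi a q r * psi' a q r) = (1 / q) powr of_real a"
proof -
  have "lap_norm a > 0" "lap_norm (2 * a) > 0" "2 * a + 1 > 0"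
    using a by (auto intro!: lap_norm_pos)
  then have "rho a * ((2 * a + 1) * lap_norm (2 * a) / lap_norm a) = 1"
    by (simp add: rho_def)
  then show ?thesis
    by (simp only: wronskian_phi_psi[OF assms] mult.assoc[symmetric] of_real_mult[symmetric] of_real_1 mult_1)
qed

section \<open>The oscillating solution at energy one\<close>

text \<open>\<open>besJ a r = (\<pi> r / 2)\<^sup>1\<^sup>/\<^sup>2 J\<^sub>\<nu>(r)\<close> with \<open>\<nu> = a + 1/2\<close>.\<close>

definition besJ :: "real \<Rightarrow> real \<Rightarrow> real" where
  "besJ a r = Im (cis (- pi * a / 2) * psi a (- \<i>) r)"

definition besJ' :: "real \<Rightarrow> real \<Rightarrow> real" where
  "besJ' a r = Im (cis (- pi * a / 2) * psi' a (- \<i>) r)"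

lemma ii_powr: "\<i> powr of_real a = cis (pi * a / 2)"
  by (simp add: powr_def cis_conv_exp mult_ac)

lemma phi_real:
  assumes a: "a > -1/2" and q: "q\<^sup>2 = -1"
  shows "Im (phi a q r) = 0" "Im (phi' a q r) = 0"
proof -
  have y: "q\<^sup>2 * of_real r ^ 2 = of_real (- (r\<^sup>2))" using q by simp
  have cn: "cnj (\<Sum>n. c n * of_real y ^ n) = (\<Sum>n. c n * of_real y ^ n)"
    if "\<And>n. cmod (c n) \<le> 1 / fact n" "\<And>n. cnj (c n) = c n" for c and y :: real
  proof -
    have "(\<lambda>n. c n * of_real y ^ n) sums (\<Sum>n. c n * of_real y ^ n)"
      by (intro summable_sums power_series_exp_bound(1) that)
    then have "(\<lambda>n. cnj (c n * of_real y ^ n)) sums cnj (\<Sum>n. c n * of_real y ^ n)"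
      by (simp only: sums_cnj)
    then show ?thesis by (simp add: that(2) sums_iff)
  qed
  have "cnj (bser a (of_real y)) = bser a (of_real y)" for y
    unfolding bser_def by (rule cn) (auto simp: cbcoef_bound[OF a], simp add: cbcoef_def)
  then have 1: "Im (bser a (of_real y)) = 0" for y by (metis Reals_cnj_iff complex_is_Real_iff)
  have "cnj (bser1 a (of_real y)) = bser1 a (of_real y)" for y
    unfolding bser1_def by (rule cn) (auto simp: diffs_cbcoef_bound[OF a], simp add: diffs_def cbcoef_def)
  then have 2: "Im (bser1 a (of_real y)) = 0" for y by (metis Reals_cnj_iff complex_is_Real_iff)
  show "Im (phi a q r) = 0" unfolding phi_def y by (simp only: times_complex.sel Im_complex_of_real 1)
  have "2 * q\<^sup>2 * of_real r ^ 2 = 2 * (q\<^sup>2 * of_real r ^ 2)" by simp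
  also have "\<dots> = of_real (- 2 * r\<^sup>2)" unfolding y by simp
  finally have y2: "2 * q\<^sup>2 * of_real r ^ 2 = complex_of_real (- 2 * r\<^sup>2)" .
  have a1: "complex_of_real a + 1 = of_real (a + 1)" by simp
  show "Im (phi' a q r) = 0" unfolding phi'_def y y2 a1
    using 1 2 by (simp only: times_complex.sel plus_complex.sel Im_complex_of_real) simp
qed

context
  fixes a :: real
  assumes a: "a > -1/2"
begin

text \<open>Here the constant is read off at infinity instead, from psi(q) ~ exp(-q r) and psi' + q
  psi -> 0 for q = \<i> and q = -\<i>.\<close>

lemma psi_ii_wronskian:
  assumes r: "r > 0"
  shows "psi' a \<i> r * psi a (-\<i>) r - psi a \<i> r * psi' a (-\<i>) r = - 2 * \<i>"
proof -
  have m: "Re (-\<i>) \<ge> 0" "-\<i> \<noteq> 0" "Re \<i> \<ge> 0" "\<i> \<noteq> 0" by auto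
  have ode: "(psi' a \<i> has_vector_derivative ((- 1) + of_real (a * (a + 1)) / of_real r ^ 2) * psi a \<i> r) (at r)"
    "(psi' a (-\<i>) has_vector_derivative ((- 1) + of_real (a * (a + 1)) / of_real r ^ 2) * psi a (-\<i>) r) (at r)" if "r > 0" for r
    using psi'_deriv[OF a m(3,4) that] psi'_deriv[OF a m(1,2) that] by (simp_all add: power2_eq_square)
  obtain c where c: "\<And>r. r > 0 \<Longrightarrow> psi' a \<i> r * psi a (-\<i>) r - psi a \<i> r * psi' a (-\<i>) r = c"
    using wronskian_const[OF psi_deriv[OF a m(3,4)] ode(1) psi_deriv[OF a m(1,2)] ode(2)] by auto
  note l = psi_limits[OF a m(1,2)] psi_limits[OF a m(3,4)]
  define e where "e r = exp (\<i> * complex_of_real r)" for r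
  define ec where "ec r = exp (- \<i> * complex_of_real r)" for r
  have ee: "e r * ec r = 1" for r by (simp add: e_def ec_def flip: exp_add)
  have lim: "((\<lambda>r. ((psi' a \<i> r + \<i> * psi a \<i> r) * e r - \<i> * (psi a \<i> r * e r)) * (psi a (-\<i>) r * ec r)
     - (psi a \<i> r * e r) * ((psi' a (-\<i>) r + (- \<i>) * psi a (-\<i>) r) * ec r + \<i> * (psi a (-\<i>) r * ec r)))
     \<longlongrightarrow> (0 - \<i> * 1) * 1 - 1 * (0 + \<i> * 1)) at_top"
    unfolding e_def ec_def by (intro tendsto_diff tendsto_mult tendsto_add tendsto_const l)
  have eq: "((psi' a \<i> r + \<i> * psi a \<i> r) * e r - \<i> * (psi a \<i> r * e r)) * (psi a (-\<i>) r * ec r)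
     - (psi a \<i> r * e r) * ((psi' a (-\<i>) r + (- \<i>) * psi a (-\<i>) r) * ec r + \<i> * (psi a (-\<i>) r * ec r)) =
     (psi' a \<i> r * psi a (-\<i>) r - psi a \<i> r * psi' a (-\<i>) r) * (e r * ec r)" for r
    by (simp add: algebra_simps)
  have ev: "\<forall>\<^sub>F r in at_top. (psi' a \<i> r * psi a (-\<i>) r - psi a \<i> r * psi' a (-\<i>) r) * (e r * ec r) = c"
    by (rule eventually_at_top_linorderI[of 1]) (simp add: c ee)
  have "c = (0 - \<i> * 1) * 1 - 1 * (0 + \<i> * 1)"
    by (rule tendsto_unique[OF _ tendsto_eventually[OF ev] lim[unfolded eq]]) simp
  then show ?thesis using c[OF r] by simp
qed

text \<open>The connection formula between 0 and infinity. \<open>psi\<close> at \<i> and at -\<i>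
  are conjugate to each other, and their Wronskians with the real solution
  \<open>rho a * phi\<close> are known; solving for that solution exhibits it as the imaginary part
  of the rotated \<open>psi\<close> at -\<i>. Thus \<open>besJ\<close> has both the size of
  \<open>phi\<close> at 0 and oscillating asymptotics.\<close>

lemma besJ_phi:
  assumes r: "r > 0" and q: "q = \<i> \<or> q = - \<i>"
  shows "of_real (besJ a r) = of_real (rho a) * phi a q r" "of_real (besJ' a r) = of_real (rho a) * phi' a q r"
proof -
  have m: "Re (-\<i>) \<ge> 0" "-\<i> \<noteq> 0" "Re \<i> \<ge> 0" "\<i> \<noteq> 0" by auto
  have q2: "phi a q r = phi a \<i> r" "phi a (-\<i>) r = phi a \<i> r" "phi' a q r = phi' a \<i> r" "phi' a (-\<i>) r = phi' a \<i> r"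
    using q by (auto simp: phi_def phi'_def)
  define p where "p = psi a (-\<i>) r"
  define p' where "p' = psi' a (-\<i>) r"
  define f where "f = of_real (rho a) * phi a \<i> r"
  define f' where "f' = of_real (rho a) * phi' a \<i> r"
  have pc: "psi a \<i> r = cnj p" "psi' a \<i> r = cnj p'"
    using psi_cnj[OF r m(1)] by (simp_all add: p_def p'_def)
  define w where "w = cis (pi * a / 2)"
  have w: "cnj w = cis (- pi * a / 2)" "w * cnj w = 1"
    by (simp_all add: w_def cis_cnj cis_mult)
  have fr: "cnj f = f" "cnj f' = f'"
    using phi_real[OF a, of \<i> r] by (auto simp: f_def f'_def complex_eq_iff)
  have W1: "f' * p - f * p' = w"
    using wronskian_rho[OF a m(1,2) r] q2 ii_powr[of a]
    by (simp add: f_def f'_def p_def p'_def w_def algebra_simps)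
  then have W1c: "f' * cnj p - f * cnj p' = cnj w"
    using fr by (metis complex_cnj_diff complex_cnj_mult)
  have W2: "cnj p' * p - cnj p * p' = - 2 * \<i>"
    using psi_ii_wronskian[OF r] pc by (simp add: p_def p'_def)
  \<comment> \<open>The linear relation among three solutions of one equation, with Wronskians as
    coefficients; the next one is its derivative.\<close>
  have "- 2 * \<i> * f = cnj p * (f' * p - f * p') - p * (f' * cnj p - f * cnj p')"
    unfolding W2[symmetric] by (simp add: algebra_simps)
  then have 1: "- 2 * \<i> * f = cnj p * w - p * cnj w"
    by (simp only: W1 W1c)
  have "- 2 * \<i> * f' = cnj p' * (f' * p - f * p') - p' * (f' * cnj p - f * cnj p')"
    unfolding W2[symmetric] by (simp add: algebra_simps)
  then have 2: "- 2 * \<i> * f' = cnj p' * w - p' * cnj w"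
    by (simp only: W1 W1c)
  have I: "z = of_real (Im (u * cnj w))" if "- 2 * \<i> * z = cnj u * w - u * cnj w" for z u
  proof -
    have "u * cnj w - cnj (u * cnj w) = - (cnj u * w - u * cnj w)" by simp
    also have "\<dots> = 2 * \<i> * z" by (simp only: that[symmetric]) simp
    finally have "2 * \<i> * z = u * cnj w - cnj (u * cnj w)" by simp
    also have "\<dots> = 2 * \<i> * of_real (Im (u * cnj w))"
      by (simp add: complex_eq_iff)
    finally have "2 * \<i> * z = 2 * \<i> * of_real (Im (u * cnj w))" .
    then show ?thesis unfolding mult_cancel_left by auto
  qed
  show "of_real (besJ a r) = of_real (rho a) * phi a q r" "of_real (besJ' a r) = of_real (rho a) * phi' a q r"
    using I[OF 1] I[OF 2] unfolding besJ_def besJ'_def w(1)[symmetric] q2 p_def[symmetric] p'_def[symmetric]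
      f_def[symmetric] f'_def[symmetric] by (simp_all only: mult.commute)
qed

lemma besJ_deriv:
  assumes r: "r > 0"
  shows "(besJ a has_real_derivative besJ' a r) (at r)"
    "(besJ' a has_real_derivative (a * (a + 1) / r\<^sup>2 - 1) * besJ a r) (at r)"
proof -
  have m: "Re (-\<i>) \<ge> 0" "-\<i> \<noteq> 0" by auto
  let ?w = "cis (- pi * a / 2)"
  have "((\<lambda>r. Im (?w * psi a (-\<i>) r)) has_vector_derivative Im (?w * psi' a (-\<i>) r)) (at r)"
    by (intro bounded_linear.has_vector_derivative[OF bounded_linear_Im] has_vector_derivative_mult_right psi_deriv[OF a m r])
  then show "(besJ a has_real_derivative besJ' a r) (at r)"
    by (simp add: besJ_def[abs_def] besJ'_def has_real_derivative_iff_has_vector_derivative)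
  have "((\<lambda>r. Im (?w * psi' a (-\<i>) r)) has_vector_derivative Im (?w * (((-\<i>)\<^sup>2 + of_real (a * (a + 1)) / of_real r ^ 2) * psi a (-\<i>) r))) (at r)"
    by (intro bounded_linear.has_vector_derivative[OF bounded_linear_Im] has_vector_derivative_mult_right psi'_deriv[OF a m r])
  moreover have "Im (?w * (((-\<i>)\<^sup>2 + of_real (a * (a + 1)) / of_real r ^ 2) * psi a (-\<i>) r)) = (a * (a + 1) / r\<^sup>2 - 1) * besJ a r"
  proof -
    have "((-\<i>)\<^sup>2 + of_real (a * (a + 1)) / of_real r ^ 2) = complex_of_real (a * (a + 1) / r\<^sup>2 - 1)"
      by simp
    then have "?w * (((-\<i>)\<^sup>2 + of_real (a * (a + 1)) / of_real r ^ 2) * psi a (-\<i>) r) = of_real (a * (a + 1) / r\<^sup>2 - 1) * (?w * psi a (-\<i>) r)"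
      by (simp only: mult_ac)
    then show ?thesis by (simp only: besJ_def) simp
  qed
  ultimately show "(besJ' a has_real_derivative (a * (a + 1) / r\<^sup>2 - 1) * besJ a r) (at r)"
    by (simp add: besJ'_def[abs_def] has_real_derivative_iff_has_vector_derivative)
qed

lemma besJ_bound_infinity: obtains C where "C \<ge> 0" "\<And>r. r \<ge> 1 \<Longrightarrow> \<bar>besJ a r\<bar> \<le> C"
proof -
  have m: "Re (-\<i>) \<ge> 0" "-\<i> \<noteq> 0" by auto
  obtain C where C: "C \<ge> 0" "\<And>r. r \<ge> 1 \<Longrightarrow> cmod (psi a (-\<i>) r) \<le> C * exp (- Re (-\<i>) * r)"
    by (rule psi_bounds[OF a m]) blast
  show ?thesis
  proof (rule that[OF C(1)])
    fix r :: real assume "r \<ge> 1"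
    then have "cmod (psi a (-\<i>) r) \<le> C" using C(2)[of r] by simp
    then show "\<bar>besJ a r\<bar> \<le> C"
      using abs_Im_le_cmod[of "cis (- pi * a / 2) * psi a (-\<i>) r"] by (simp add: besJ_def norm_mult)
  qed
qed

lemma besJ_bound_0:
  obtains C where "C \<ge> 0" "\<And>r. 0 < r \<Longrightarrow> r \<le> 1 \<Longrightarrow> \<bar>besJ a r\<bar> \<le> C * r powr (a + 1)"
    "\<And>r. 0 < r \<Longrightarrow> r \<le> 1 \<Longrightarrow> \<bar>besJ' a r\<bar> \<le> C * r powr a"
proof -
  obtain C where C: "C \<ge> 0" "\<And>r. 0 < r \<Longrightarrow> r \<le> 1 \<Longrightarrow> cmod (phi a \<i> r) \<le> C * r powr (a + 1)"
    "\<And>r. 0 < r \<Longrightarrow> r \<le> 1 \<Longrightarrow> cmod (phi' a \<i> r) \<le> C * r powr a"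
    by (rule phi_bounds[OF a, of \<i>]) blast
  have n: "\<bar>besJ a r\<bar> = rho a * cmod (phi a \<i> r)" "\<bar>besJ' a r\<bar> = rho a * cmod (phi' a \<i> r)" if "r > 0" for r
    using besJ_phi[OF that, of \<i>] rho_pos[OF a] by (metis norm_mult norm_of_real abs_of_pos)+
  show ?thesis
  proof (rule that[of "rho a * C"])
    show "0 \<le> rho a * C" using C rho_pos[OF a] by simp
    fix r :: real assume r: "0 < r" "r \<le> 1"
    show "\<bar>besJ a r\<bar> \<le> rho a * C * r powr (a + 1)" "\<bar>besJ' a r\<bar> \<le> rho a * C * r powr a"
      using mult_left_mono[OF C(2)[OF r], of "rho a"] mult_left_mono[OF C(3)[OF r], of "rho a"] rho_pos[OF a] n[OF r(1)]
      by (simp_all add: mult.assoc)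
  qed
qed

text \<open>The rotation in \<open>besJ\<close> turns exp(\<i> r) into exp(\<i> (r - pi a/2)). The
  derivative is compared with \<i> exp(\<i> r) by way of psi' - \<i> psi, which tends to 0.\<close>

lemma besJ_asymp:
  "((\<lambda>r. besJ a r - sin (r - pi * a / 2)) \<longlongrightarrow> 0) at_top"
  "((\<lambda>r. besJ' a r - cos (r - pi * a / 2)) \<longlongrightarrow> 0) at_top"
proof -
  have m: "Re (-\<i>) \<ge> 0" "-\<i> \<noteq> 0" by auto
  note l = psi_limits[OF a m]
  let ?w = "cis (- pi * a / 2)"
  define e where "e r = exp (\<i> * complex_of_real r)" for r
  have ne: "cmod (e r) = 1" "exp (- \<i> * complex_of_real r) * e r = 1" for r
    by (simp_all add: e_def flip: exp_add)
  have l1: "((\<lambda>r. cmod (psi a (-\<i>) r - e r)) \<longlongrightarrow> 0) at_top"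
  proof -
    have "((\<lambda>r. cmod (psi a (-\<i>) r * exp (-\<i> * of_real r) - 1)) \<longlongrightarrow> cmod (1 - 1)) at_top"
      by (intro tendsto_norm tendsto_diff l tendsto_const)
    moreover have "cmod (psi a (-\<i>) r * exp (-\<i> * of_real r) - 1) = cmod (psi a (-\<i>) r - e r)" for r
    proof -
      have "cmod (psi a (-\<i>) r * exp (-\<i> * of_real r) - 1) = cmod ((psi a (-\<i>) r * exp (-\<i> * of_real r) - 1) * e r)"
        by (simp add: norm_mult ne(1))
      also have "(psi a (-\<i>) r * exp (-\<i> * of_real r) - 1) * e r = psi a (-\<i>) r * (exp (-\<i> * of_real r) * e r) - e r"
        by (simp add: algebra_simps)
      finally show ?thesis by (simp only: ne(2) mult_1_right)
    qed
    ultimately show ?thesis by simp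
  qed
  have l2: "((\<lambda>r. cmod (psi' a (-\<i>) r + (-\<i>) * psi a (-\<i>) r)) \<longlongrightarrow> 0) at_top"
    using tendsto_norm[OF l(2)] by (simp add: norm_mult)
  have l4: "((\<lambda>r. cmod (psi' a (-\<i>) r + (-\<i>) * psi a (-\<i>) r) + cmod (psi a (-\<i>) r - e r)) \<longlongrightarrow> 0) at_top"
    using tendsto_add[OF l2 l1] by simp
  have l3: "((\<lambda>r. cmod (psi' a (-\<i>) r - \<i> * e r)) \<longlongrightarrow> 0) at_top"
  proof (rule Lim_null_comparison[OF _ l4])
    show "\<forall>\<^sub>F r in at_top. norm (cmod (psi' a (-\<i>) r - \<i> * e r)) \<le> cmod (psi' a (-\<i>) r + (-\<i>) * psi a (-\<i>) r) + cmod (psi a (-\<i>) r - e r)"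
    proof (rule always_eventually, rule allI)
      fix r
      have "psi' a (-\<i>) r - \<i> * e r = (psi' a (-\<i>) r - \<i> * psi a (-\<i>) r) + \<i> * (psi a (-\<i>) r - e r)"
        by (simp add: algebra_simps)
      then show "norm (cmod (psi' a (-\<i>) r - \<i> * e r)) \<le> cmod (psi' a (-\<i>) r + (-\<i>) * psi a (-\<i>) r) + cmod (psi a (-\<i>) r - e r)"
        using norm_triangle_ineq[of "psi' a (-\<i>) r - \<i> * psi a (-\<i>) r" "\<i> * (psi a (-\<i>) r - e r)"]
        by (simp only: real_norm_def abs_norm_cancel norm_mult norm_ii mult_1 mult_minus_left diff_conv_add_uminus)
    qed
  qed
  have we: "?w * e r = cis (r - pi * a / 2)" for r
    by (simp add: e_def cis_conv_exp flip: exp_add) (simp add: algebra_simps)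
  show "((\<lambda>r. besJ a r - sin (r - pi * a / 2)) \<longlongrightarrow> 0) at_top"
  proof (rule Lim_null_comparison[OF always_eventually l1], rule allI)
    fix r
    have "besJ a r - sin (r - pi * a / 2) = Im (?w * (psi a (-\<i>) r - e r))"
      by (simp only: right_diff_distrib we minus_complex.sel cis.sel besJ_def)
    then show "norm (besJ a r - sin (r - pi * a / 2)) \<le> cmod (psi a (-\<i>) r - e r)"
      using abs_Im_le_cmod[of "?w * (psi a (-\<i>) r - e r)"] by (simp only: real_norm_def norm_mult norm_cis mult_1)
  qed
  show "((\<lambda>r. besJ' a r - cos (r - pi * a / 2)) \<longlongrightarrow> 0) at_top"
  proof (rule Lim_null_comparison[OF always_eventually l3], rule allI)
    fix r
    have "besJ' a r - cos (r - pi * a / 2) = Im (?w * psi' a (-\<i>) r) - Im (\<i> * (?w * e r))"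
      unfolding we by (simp add: besJ'_def)
    also have "\<dots> = Im (?w * (psi' a (-\<i>) r - \<i> * e r))"
      by (simp only: minus_complex.sel(2)[symmetric]) (simp only: right_diff_distrib mult.left_commute)
    finally show "norm (besJ' a r - cos (r - pi * a / 2)) \<le> cmod (psi' a (-\<i>) r - \<i> * e r)"
      using abs_Im_le_cmod[of "?w * (psi' a (-\<i>) r - \<i> * e r)"] by (simp only: real_norm_def norm_mult norm_cis mult_1)
  qed
qed

end

section \<open>Operators given by kernels\<close>

text \<open>An inner product with the class of a section of the kernel instead of an integral of
  representatives: the value at each single \<open>r\<close> is then defined for a class
  \<open>F\<close>, and it is linear and norm continuous in \<open>F\<close>.\<close>

definition kfun :: "(real \<Rightarrow> real \<Rightarrow> complex) \<Rightarrow> L2 \<Rightarrow> real \<Rightarrow> complex" where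
  "kfun K F r = cinner_L2 F (abs_L2 (\<lambda>R. cnj (K r R)))"

definition kop :: "(real \<Rightarrow> real \<Rightarrow> complex) \<Rightarrow> L2 \<Rightarrow> L2" where
  "kop K F = abs_L2 (kfun K F)"

lemma square_integrable_cnj: "square_integrable f \<Longrightarrow> square_integrable (\<lambda>r. cnj (f r))"
  unfolding square_integrable_def
  by (auto intro: measurable_compose[OF _ borel_measurable_continuous_onI] continuous_intros)

lemma test_function_support:
  assumes "test_function f"
  obtains a b where "0 < a" "\<And>r. r \<notin> {a..b} \<Longrightarrow> f r = 0"
  using assms unfolding test_function_def by blast

lemma test_function_common_support:
  assumes "test_function f" "test_function g"
  obtains a b where "0 < a" "\<And>r. r \<notin> {a..b} \<Longrightarrow> f r = 0" "\<And>r. r \<notin> {a..b} \<Longrightarrow> g r = 0"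
proof -
  obtain a b where 1: "0 < a" "\<And>r. r \<notin> {a..b} \<Longrightarrow> f r = 0"
    using test_function_support[OF assms(1)] by metis
  obtain c d where 2: "0 < c" "\<And>r. r \<notin> {c..d} \<Longrightarrow> g r = 0"
    using test_function_support[OF assms(2)] by metis
  show ?thesis
  proof (rule that[of "min a c" "max b d"])
    show "f r = 0" "g r = 0" if "r \<notin> {min a c..max b d}" for r
    proof -
      have "r \<notin> {a..b}" "r \<notin> {c..d}" using that by auto
      then show "f r = 0" "g r = 0" using 1(2) 2(2) by blast+
    qed
  qed (use 1 2 in auto)
qed

text \<open>The common bound reduces weak convergence to a dense set. The approximant
  \<open>g\<close> is chosen after \<open>f\<close>, because the error of replacing \<open>G\<close>
  is weighted by the norm of \<open>f\<close>.\<close>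

lemma weak_limit_dense:
  fixes T :: "nat \<Rightarrow> L2 \<Rightarrow> L2" and T' :: "L2 \<Rightarrow> L2"
  assumes lin: "\<And>n. bounded_clinear (T n)" "bounded_clinear T'"
    and bound: "\<And>n F. norm (T n F) \<le> C * norm F" "\<And>F. norm (T' F) \<le> C * norm F"
    and dense: "closure D = UNIV"
    and lim: "\<And>f g. f \<in> D \<Longrightarrow> g \<in> D \<Longrightarrow> (\<lambda>n. cinner_L2 (T n f) g) \<longlonglongrightarrow> cinner_L2 (T' f) g"
  shows "(\<lambda>n. cinner_L2 (T n F) G) \<longlonglongrightarrow> cinner_L2 (T' F) G"
proof (rule LIMSEQ_I)
  fix e :: real assume e: "e > 0"
  have approx: "\<exists>f\<in>D. norm (X - f) < d" if "d > 0" for X d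
    using dense that closure_approachable[of X D] by (auto simp: dist_norm norm_minus_commute)
  have C0: "0 \<le> \<bar>C\<bar>" by simp
  obtain f where f: "f \<in> D" "norm (F - f) < e / (6 * (\<bar>C\<bar> + 1) * (norm G + 1))"
    using approx[of "e / (6 * (\<bar>C\<bar> + 1) * (norm G + 1))" F] e by (auto simp: add_nonneg_pos)
  obtain g where g: "g \<in> D" "norm (G - g) < e / (6 * (\<bar>C\<bar> + 1) * (norm f + 1))"
    using approx[of "e / (6 * (\<bar>C\<bar> + 1) * (norm f + 1))" G] e by (auto simp: add_nonneg_pos)
  obtain N where N: "\<And>n. n \<ge> N \<Longrightarrow> cmod (cinner_L2 (T n f) g - cinner_L2 (T' f) g) < e / 3"
    using LIMSEQ_D[OF lim[OF f(1) g(1)], of "e / 3"] e by auto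
  have small: "cmod (cinner_L2 (S F) G - cinner_L2 (S f) g) < e / 3"
    if S: "bounded_clinear S" "\<And>X. norm (S X) \<le> C * norm X" for S
  proof -
    have b: "norm (S X) \<le> (\<bar>C\<bar> + 1) * norm X" for X
    proof (rule order_trans[OF S(2)], rule mult_right_mono)
      show "C \<le> \<bar>C\<bar> + 1" using abs_ge_self[of C] by linarith
    qed simp
    have d: "S F - S f = S (F - f)"
      using S(1) by (simp add: bounded_clinear_def bounded_linear.linear linear_diff)
    have "cinner_L2 (S F) G - cinner_L2 (S f) g = cinner_L2 (S (F - f)) G + cinner_L2 (S f) (G - g)"
      by (simp add: cinner_L2_simps flip: d)
    then have "cmod (cinner_L2 (S F) G - cinner_L2 (S f) g) \<le> cmod (cinner_L2 (S (F - f)) G) + cmod (cinner_L2 (S f) (G - g))"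
      by (simp add: norm_triangle_ineq)
    also have "\<dots> \<le> norm (S (F - f)) * norm G + norm (S f) * norm (G - g)"
      by (intro add_mono cinner_L2_bound)
    also have "\<dots> \<le> ((\<bar>C\<bar> + 1) * norm (F - f)) * (norm G + 1) + ((\<bar>C\<bar> + 1) * (norm f + 1)) * norm (G - g)"
    proof (rule add_mono)
      show "norm (S (F - f)) * norm G \<le> ((\<bar>C\<bar> + 1) * norm (F - f)) * (norm G + 1)"
        by (intro mult_mono b) auto
      have "norm (S f) \<le> (\<bar>C\<bar> + 1) * (norm f + 1)"
        by (intro order_trans[OF b] mult_left_mono) auto
      then show "norm (S f) * norm (G - g) \<le> ((\<bar>C\<bar> + 1) * (norm f + 1)) * norm (G - g)"
        by (rule mult_right_mono) auto
    qed
    also have "\<dots> < e / 6 + e / 6"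
    proof (rule add_strict_mono)
      have sc: "(\<bar>C\<bar> + 1) * x * y < e / 6" if "x < e / (6 * (\<bar>C\<bar> + 1) * y)" "y > 0" for x y
      proof -
        have "0 < 6 * (\<bar>C\<bar> + 1) * y" using that(2) by (intro mult_pos_pos) auto
        then have "x * (6 * (\<bar>C\<bar> + 1) * y) < e" using that(1) by (simp only: pos_less_divide_eq)
        moreover have "x * (6 * (\<bar>C\<bar> + 1) * y) = 6 * ((\<bar>C\<bar> + 1) * x * y)" by (simp only: mult_ac)
        ultimately show ?thesis by linarith
      qed
      show "(\<bar>C\<bar> + 1) * norm (F - f) * (norm G + 1) < e / 6"
        by (rule sc[OF f(2)]) (simp add: add_nonneg_pos)
      show "(\<bar>C\<bar> + 1) * (norm f + 1) * norm (G - g) < e / 6"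
        using sc[OF g(2)] by (simp add: add_nonneg_pos mult.assoc mult.commute[of "norm f + 1"])
    qed
    finally show ?thesis by simp
  qed
  show "\<exists>N. \<forall>n\<ge>N. norm (cinner_L2 (T n F) G - cinner_L2 (T' F) G) < e"
  proof (intro exI allI impI)
    fix n assume n: "n \<ge> N"
    have "cinner_L2 (T n F) G - cinner_L2 (T' F) G = (cinner_L2 (T n F) G - cinner_L2 (T n f) g)
        + (cinner_L2 (T n f) g - cinner_L2 (T' f) g) - (cinner_L2 (T' F) G - cinner_L2 (T' f) g)"
      by simp
    also have "cmod \<dots> \<le> cmod (cinner_L2 (T n F) G - cinner_L2 (T n f) g)
        + cmod (cinner_L2 (T n f) g - cinner_L2 (T' f) g) + cmod (cinner_L2 (T' F) G - cinner_L2 (T' f) g)"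
      by (meson norm_triangle_ineq4 norm_triangle_ineq order_trans add_right_mono)
    also have "\<dots> < e / 3 + e / 3 + e / 3"
      by (intro add_strict_mono small[OF lin(1) bound(1)] small[OF lin(2) bound(2)] N n)
    finally show "norm (cinner_L2 (T n F) G - cinner_L2 (T' F) G) < e" by simp
  qed
qed

section \<open>Kernel operators on test functions, and their extension to L^2\<close>

lemma kfun_abs:
  assumes "square_integrable f" "square_integrable (K r)"
  shows "kfun K (abs_L2 f) r = (\<integral>R. K r R * f R \<partial>half_line)"
  unfolding kfun_def using cinner_abs_L2[OF assms(1) square_integrable_cnj[OF assms(2)]] by (simp add: mult.commute)

lemma kernel_section_continuous:
  assumes "continuous_on ({0<..} \<times> {0<..}) (\<lambda>(r, R). K r R)" "r > 0"
  shows "continuous_on {0<..} (K r)"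
proof -
  have "continuous_on {0<..} (\<lambda>R. (\<lambda>(r, R). K r R) (r, R))"
    by (rule continuous_on_compose2[OF assms(1)]) (use assms(2) in \<open>auto intro!: continuous_on_Pair continuous_on_const continuous_on_id\<close>)
  then show ?thesis by simp
qed

lemma kfun_test:
  assumes "continuous_on ({0<..} \<times> {0<..}) (\<lambda>(r, R). K r R)" "r > 0" "square_integrable (K r)"
    "test_function \<theta>" "0 < a" "\<And>r. r \<notin> {a..b} \<Longrightarrow> \<theta> r = 0"
  shows "kfun K (abs_L2 \<theta>) r = integral {a..b} (\<lambda>R. K r R * \<theta> R)"
proof -
  have "continuous_on {a..b} (\<lambda>R. K r R * \<theta> R)"
    using assms(5) by (intro continuous_on_mult continuous_on_subset[OF kernel_section_continuous[OF assms(1,2)]]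
        test_function_continuous[OF assms(4)]) auto
  then have "(\<integral>R. K r R * \<theta> R \<partial>half_line) = integral {a..b} (\<lambda>R. K r R * \<theta> R)"
    using assms(5,6) by (intro half_line_integral_compact(2)) auto
  then show ?thesis
    using kfun_abs[of \<theta> K r] assms(3) test_function_square_integrable[OF assms(4)] by simp
qed

lemma kfun_test_continuous:
  assumes "continuous_on ({0<..} \<times> {0<..}) (\<lambda>(r, R). K r R)" "\<And>r. r > 0 \<Longrightarrow> square_integrable (K r)" "test_function \<theta>"
  shows "continuous_on {0<..} (kfun K (abs_L2 \<theta>))"
proof -
  obtain a b where ab: "0 < a" "\<And>r. r \<notin> {a..b} \<Longrightarrow> \<theta> r = 0"
    using test_function_support[OF assms(3)] by metis
  have "continuous_on {0<..} (\<lambda>r. integral (cbox a b) (\<lambda>R. K r R * \<theta> R))"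
  proof (rule integral_continuous_on_param)
    have "continuous_on ({0<..} \<times> cbox a b) (\<lambda>x. (\<lambda>(r, R). K r R) x * \<theta> (snd x))"
      using ab(1) by (intro continuous_on_mult continuous_on_subset[OF assms(1)]
          continuous_on_compose2[OF test_function_continuous[OF assms(3), of UNIV]] continuous_on_snd continuous_on_id) auto
    then show "continuous_on ({0<..} \<times> cbox a b) (\<lambda>(r, R). K r R * \<theta> R)"
      by (simp add: case_prod_unfold)
  qed
  then show ?thesis
    by (rule continuous_on_eq) (use kfun_test[OF assms(1) _ assms(2,3) ab] in auto)
qed

text \<open>The operator bound is required on test functions only, where the energy estimate is
  available; square integrable sections give the pointwise convergence that extends it to every
  class.\<close>

locale bounded_kernel =
  fixes K :: "real \<Rightarrow> real \<Rightarrow> complex" and C :: real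
  assumes Kcont: "continuous_on ({0<..} \<times> {0<..}) (\<lambda>(r, R). K r R)"
    and Ksq: "r > 0 \<Longrightarrow> square_integrable (K r)"
    and C0: "C \<ge> 0"
    and Kbound: "test_function \<theta> \<Longrightarrow> square_integrable (kfun K (abs_L2 \<theta>)) \<and> norm (kop K (abs_L2 \<theta>)) \<le> C * norm (abs_L2 \<theta>)"
begin

text \<open>For approximating test functions the values \<open>kfun\<close> converge at every point,
  since each section is a fixed vector of L^2; Fatou's lemma then transfers measurability and the
  bound.\<close>

lemma kop_bound: "square_integrable (kfun K F) \<and> norm (kop K F) \<le> C * norm F"
proof -
  have "F \<in> closure L2_test" using closure_L2_test by simp
  then obtain d where d: "\<And>n. d n \<in> L2_test" "d \<longlonglongrightarrow> F"
    unfolding closure_sequential by blast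
  then have "\<exists>t. \<forall>n. d n = abs_L2 (t n) \<and> test_function (t n)"
    by (intro choice) (auto simp: L2_test_def)
  then obtain t where t: "\<And>n. d n = abs_L2 (t n)" "\<And>n. test_function (t n)" by blast
  have lim: "(\<lambda>n. kfun K (d n) r) \<longlonglongrightarrow> kfun K F r" for r
    unfolding kfun_def by (rule continuous_cinner_left[OF d(2)])
  have si: "square_integrable (kfun K (d n))" for n
    using Kbound[OF t(2), of n] by (simp add: t(1))
  have m: "(\<lambda>r. indicator {0<..} r *\<^sub>R kfun K F r) \<in> borel_measurable lborel"
  proof (rule borel_measurable_LIMSEQ_metric)
    show "(\<lambda>r. indicator {0<..} r *\<^sub>R kfun K (d n) r) \<in> borel_measurable lborel" for n
      using si[of n] by (simp add: square_integrable_def borel_measurable_restrict_space_iff)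
    show "(\<lambda>n. indicator {0<..} r *\<^sub>R kfun K (d n) r) \<longlonglongrightarrow> indicator {0<..} r *\<^sub>R kfun K F r" for r
      by (intro tendsto_scaleR tendsto_const lim)
  qed
  have m': "kfun K F \<in> borel_measurable half_line"
    using m by (simp add: borel_measurable_restrict_space_iff)
  have "square_integrable (kfun K F) \<and> norm (abs_L2 (kfun K F)) \<le> C * norm F"
  proof (rule L2_Fatou[OF m' si])
    show "AE r in half_line. (\<lambda>n. kfun K (d n) r) \<longlonglongrightarrow> kfun K F r"
      using lim by simp
    show "norm (abs_L2 (kfun K (d n))) \<le> C * norm (d n)" for n
      using Kbound[OF t(2), of n] by (simp add: t(1) kop_def)
    show "(\<lambda>n. C * norm (d n)) \<longlonglongrightarrow> C * norm F"
      by (intro tendsto_mult tendsto_const tendsto_norm d(2))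
  qed
  then show ?thesis by (simp add: kop_def)
qed

lemma kfun_square_integrable [simp]: "square_integrable (kfun K F)"
  using kop_bound by blast

lemma norm_kop: "norm (kop K F) \<le> C * norm F"
  using kop_bound by blast

lemma bounded_clinear_kop: "bounded_clinear (kop K)"
proof (rule bounded_clinearI[OF _ _ norm_kop])
  fix F G
  have "kfun K (F + G) = (\<lambda>r. kfun K F r + kfun K G r)"
    by (simp add: kfun_def cinner_L2_simps fun_eq_iff)
  then show "kop K (F + G) = kop K F + kop K G"
    by (simp add: kop_def plus_abs_L2)
next
  fix c F
  have "kfun K (scaleC_L2 c F) = (\<lambda>r. c * kfun K F r)"
    by (simp add: kfun_def cinner_L2_simps fun_eq_iff)
  then show "kop K (scaleC_L2 c F) = scaleC_L2 c (kop K F)"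
    by (simp add: kop_def scaleC_abs_L2)
qed

end

text \<open>For test functions the integrals may be exchanged over a compact square on which
  everything is continuous; density in one argument and then in the other gives the general
  case.\<close>

lemma kop_adjoint:
  assumes "bounded_kernel K C" "bounded_kernel K' C'" "\<And>r R. r > 0 \<Longrightarrow> R > 0 \<Longrightarrow> K' r R = cnj (K R r)"
  shows "cinner_L2 (kop K F) G = cinner_L2 F (kop K' G)"
proof -
  interpret K: bounded_kernel K C by fact
  interpret K': bounded_kernel K' C' by fact
  have test: "cinner_L2 (kop K (abs_L2 \<theta>)) (abs_L2 \<eta>) = cinner_L2 (abs_L2 \<theta>) (kop K' (abs_L2 \<eta>))"
    if t: "test_function \<theta>" "test_function \<eta>" for \<theta> \<eta>
  proof -
    obtain a b where ab: "0 < a" "\<And>r. r \<notin> {a..b} \<Longrightarrow> \<theta> r = 0" "\<And>r. r \<notin> {a..b} \<Longrightarrow> \<eta> r = 0"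
      using test_function_common_support[OF t] by metis
    note si = test_function_square_integrable[OF t(1)] test_function_square_integrable[OF t(2)]
    have k1: "kfun K (abs_L2 \<theta>) r = integral {a..b} (\<lambda>R. K r R * \<theta> R)" if "r > 0" for r
      using kfun_test[OF K.Kcont that K.Ksq[OF that] t(1) ab(1,2)] .
    have k2: "kfun K' (abs_L2 \<eta>) r = integral {a..b} (\<lambda>R. K' r R * \<eta> R)" if "r > 0" for r
      using kfun_test[OF K'.Kcont that K'.Ksq[OF that] t(2) ab(1,3)] .
    have c1: "continuous_on {a..b} (kfun K (abs_L2 \<theta>))"
      by (rule continuous_on_subset[OF kfun_test_continuous[OF K.Kcont K.Ksq t(1)]]) (use ab in auto)
    have c2: "continuous_on {a..b} (kfun K' (abs_L2 \<eta>))"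
      by (rule continuous_on_subset[OF kfun_test_continuous[OF K'.Kcont K'.Ksq t(2)]]) (use ab in auto)
    have cnjc: "continuous_on {a..b} (\<lambda>r. cnj (\<eta> r))" "continuous_on {a..b} (\<lambda>r. cnj (kfun K' (abs_L2 \<eta>) r))"
      by (intro continuous_on_cnj test_function_continuous[OF t(2)] c2)+
    have "cinner_L2 (kop K (abs_L2 \<theta>)) (abs_L2 \<eta>) = (\<integral>r. kfun K (abs_L2 \<theta>) r * cnj (\<eta> r) \<partial>half_line)"
      unfolding kop_def by (rule cinner_abs_L2) (simp_all add: si)
    also have "\<dots> = integral {a..b} (\<lambda>r. kfun K (abs_L2 \<theta>) r * cnj (\<eta> r))"
      using ab by (intro half_line_integral_compact(2) continuous_on_mult c1 cnjc) auto
    also have "\<dots> = integral {a..b} (\<lambda>r. integral {a..b} (\<lambda>R. K r R * \<theta> R * cnj (\<eta> r)))"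
      using ab(1) by (intro Henstock_Kurzweil_Integration.integral_cong) (simp add: k1)
    also have "\<dots> = integral {a..b} (\<lambda>R. integral {a..b} (\<lambda>r. K r R * \<theta> R * cnj (\<eta> r)))"
    proof -
      have "continuous_on (cbox (a, a) (b, b)) (\<lambda>x. (\<lambda>(r, R). K r R) x * \<theta> (snd x) * cnj (\<eta> (fst x)))"
        using ab(1)
        by (intro continuous_on_mult continuous_on_cnj continuous_on_subset[OF K.Kcont]
          continuous_on_compose2[OF test_function_continuous[OF t(1), of UNIV]]
          continuous_on_compose2[OF test_function_continuous[OF t(2), of UNIV]]
          continuous_on_fst continuous_on_snd continuous_on_id) (auto simp: cbox_Pair_eq)
      then have "continuous_on (cbox (a, a) (b, b)) (\<lambda>(r, R). K r R * \<theta> R * cnj (\<eta> r))"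
        by (simp add: case_prod_unfold)
      from integral_swap_continuous[OF this] show ?thesis by simp
    qed
    also have "\<dots> = integral {a..b} (\<lambda>R. \<theta> R * cnj (kfun K' (abs_L2 \<eta>) R))"
    proof (rule Henstock_Kurzweil_Integration.integral_cong)
      fix R assume R: "R \<in> {a..b}"
      then have R0: "R > 0" using ab(1) by simp
      have "cnj (kfun K' (abs_L2 \<eta>) R) = integral {a..b} (\<lambda>r. cnj (K' R r * \<eta> r))"
        unfolding k2[OF R0] by (rule integral_cnj)
      also have "\<dots> = integral {a..b} (\<lambda>r. K r R * cnj (\<eta> r))"
        by (rule Henstock_Kurzweil_Integration.integral_cong) (use R0 ab(1) in \<open>simp add: assms(3)\<close>)
      finally show "integral {a..b} (\<lambda>r. K r R * \<theta> R * cnj (\<eta> r)) = \<theta> R * cnj (kfun K' (abs_L2 \<eta>) R)"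
        by (simp add: mult_ac flip: integral_mult_right)
    qed
    also have "\<dots> = (\<integral>R. \<theta> R * cnj (kfun K' (abs_L2 \<eta>) R) \<partial>half_line)"
      using ab by (intro half_line_integral_compact(2)[symmetric] continuous_on_mult cnjc test_function_continuous[OF t(1)]) auto
    also have "\<dots> = cinner_L2 (abs_L2 \<theta>) (kop K' (abs_L2 \<eta>))"
      unfolding kop_def by (rule cinner_abs_L2[symmetric]) (simp_all add: si)
    finally show ?thesis .
  qed
  have ex: "\<exists>d. (\<forall>n. d n \<in> L2_test) \<and> d \<longlonglongrightarrow> X" for X
    using closure_L2_test closure_sequential[of X L2_test] by blast
  have 1: "cinner_L2 (kop K F) g = cinner_L2 F (kop K' g)" if g: "g \<in> L2_test" for g
  proof -
    obtain d where d: "\<And>n. d n \<in> L2_test" "d \<longlonglongrightarrow> F" using ex by blast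
    have "(\<lambda>n. kop K (d n)) \<longlonglongrightarrow> kop K F"
      using K.bounded_clinear_kop d(2) unfolding bounded_clinear_def by (auto intro: bounded_linear.tendsto)
    then have "(\<lambda>n. cinner_L2 (kop K (d n)) g) \<longlonglongrightarrow> cinner_L2 (kop K F) g"
      by (rule continuous_cinner_left)
    moreover have "cinner_L2 (kop K (d n)) g = cinner_L2 (d n) (kop K' g)" for n
      using d(1)[of n] g test by (auto simp: L2_test_def)
    ultimately have "(\<lambda>n. cinner_L2 (d n) (kop K' g)) \<longlonglongrightarrow> cinner_L2 (kop K F) g" by simp
    then show ?thesis
      using continuous_cinner_left[OF d(2)] by (rule LIMSEQ_unique)
  qed
  obtain d where d: "\<And>n. d n \<in> L2_test" "d \<longlonglongrightarrow> G" using ex by blast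
  have "(\<lambda>n. kop K' (d n)) \<longlonglongrightarrow> kop K' G"
    using K'.bounded_clinear_kop d(2) unfolding bounded_clinear_def by (auto intro: bounded_linear.tendsto)
  then have "(\<lambda>n. cinner_L2 F (kop K' (d n))) \<longlonglongrightarrow> cinner_L2 F (kop K' G)"
    by (rule continuous_cinner_right)
  then have "(\<lambda>n. cinner_L2 (kop K F) (d n)) \<longlonglongrightarrow> cinner_L2 F (kop K' G)"
    by (simp add: 1[OF d(1)])
  then show ?thesis
    using continuous_cinner_right[OF d(2)] LIMSEQ_unique by blast
qed

text \<open>The mechanism of limiting absorption. Locally bounded pointwise convergence suffices
  against compactly supported data, while the common operator bound replaces any control of the
  kernels near 0 and infinity and survives by Fatou's lemma.\<close>

lemma bounded_kernel_limit:
  assumes bk: "\<And>n. bounded_kernel (K n) C"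
    and cont: "continuous_on ({0<..} \<times> {0<..}) (\<lambda>(r, R). K' r R)" and sq: "\<And>r. r > 0 \<Longrightarrow> square_integrable (K' r)"
    and lim: "\<And>r R. r > 0 \<Longrightarrow> R > 0 \<Longrightarrow> (\<lambda>n. K n r R) \<longlonglongrightarrow> K' r R"
    and lb: "\<And>a b. 0 < a \<Longrightarrow> \<exists>M. \<forall>n. \<forall>r\<in>{a..b}. \<forall>R\<in>{a..b}. cmod (K n r R) \<le> M"
  shows "bounded_kernel K' C" "(\<lambda>n. cinner_L2 (kop (K n) F) G) \<longlonglongrightarrow> cinner_L2 (kop K' F) G"
proof -
  interpret K: bounded_kernel "K n" C for n by (rule bk)
  have pw: "(\<lambda>n. kfun (K n) (abs_L2 \<theta>) r) \<longlonglongrightarrow> kfun K' (abs_L2 \<theta>) r" if t: "test_function \<theta>" and r: "r > 0" for \<theta> r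
  proof -
    obtain a b where ab: "0 < a" "\<And>r. r \<notin> {a..b} \<Longrightarrow> \<theta> r = 0"
      using test_function_support[OF t] by metis
    obtain M where M: "\<And>n r' R. r' \<in> {min a r..max b r} \<Longrightarrow> R \<in> {min a r..max b r} \<Longrightarrow> cmod (K n r' R) \<le> M"
    proof -
      obtain M where "\<forall>n. \<forall>r'\<in>{min a r..max b r}. \<forall>R\<in>{min a r..max b r}. cmod (K n r' R) \<le> M"
        using lb[of "min a r" "max b r"] ab(1) r by auto
      then show ?thesis by (intro that[of M]) blast
    qed
    have m: "\<And>n. K n r \<in> borel_measurable half_line" "K' r \<in> borel_measurable half_line" "\<theta> \<in> borel_measurable half_line"
      using K.Ksq[OF r] sq[OF r] test_function_square_integrable[OF t] by (auto simp: square_integrable_def)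
    have "(\<lambda>n. \<integral>R. K n r R * \<theta> R \<partial>half_line) \<longlonglongrightarrow> (\<integral>R. K' r R * \<theta> R \<partial>half_line)"
    proof (rule integral_dominated_convergence)
      show "integrable half_line (\<lambda>R. M * cmod (\<theta> R))"
        using ab by (intro half_line_integral_compact(1)[of a b] continuous_on_mult continuous_on_const continuous_on_norm
            test_function_continuous[OF t]) auto
      show "AE R in half_line. cmod (K n r R * \<theta> R) \<le> M * cmod (\<theta> R)" for n
      proof (rule AE_half_lineI)
        fix R :: real
        show "cmod (K n r R * \<theta> R) \<le> M * cmod (\<theta> R)"
        proof (cases "R \<in> {a..b}")
          case True
          then have "cmod (K n r R) \<le> M" by (intro M) auto
          then show ?thesis by (simp add: norm_mult mult_right_mono)
        qed (simp add: ab(2))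
      qed
      show "AE R in half_line. (\<lambda>n. K n r R * \<theta> R) \<longlonglongrightarrow> K' r R * \<theta> R"
        by (rule AE_half_lineI) (intro tendsto_mult tendsto_const lim r)
    qed (intro borel_measurable_times m)+
    then show ?thesis
      using kfun_abs[OF test_function_square_integrable[OF t]] K.Ksq[OF r] sq[OF r] by simp
  qed
  show bk': "bounded_kernel K' C"
  proof
    show "0 \<le> C" by (rule K.C0)
    fix \<theta> assume t: "test_function \<theta>"
    have "square_integrable (kfun K' (abs_L2 \<theta>)) \<and> norm (abs_L2 (kfun K' (abs_L2 \<theta>))) \<le> C * norm (abs_L2 \<theta>)"
    proof (rule L2_Fatou[of _ "\<lambda>n. kfun (K n) (abs_L2 \<theta>)" "\<lambda>n. C * norm (abs_L2 \<theta>)"])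
      show "kfun K' (abs_L2 \<theta>) \<in> borel_measurable half_line"
        by (intro half_line_measurable_continuous kfun_test_continuous cont sq t)
      show "AE r in half_line. (\<lambda>n. kfun (K n) (abs_L2 \<theta>) r) \<longlonglongrightarrow> kfun K' (abs_L2 \<theta>) r"
        by (rule AE_half_lineI) (rule pw[OF t])
      show "norm (abs_L2 (kfun (K n) (abs_L2 \<theta>))) \<le> C * norm (abs_L2 \<theta>)" for n
        using K.norm_kop[of n "abs_L2 \<theta>"] by (simp add: kop_def)
    qed auto
    then show "square_integrable (kfun K' (abs_L2 \<theta>)) \<and> norm (kop K' (abs_L2 \<theta>)) \<le> C * norm (abs_L2 \<theta>)"
      by (simp add: kop_def)
  qed (use cont sq in auto)
  then interpret K': bounded_kernel K' C .
  show "(\<lambda>n. cinner_L2 (kop (K n) F) G) \<longlonglongrightarrow> cinner_L2 (kop K' F) G"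
  proof (rule weak_limit_dense[OF K.bounded_clinear_kop K'.bounded_clinear_kop K.norm_kop K'.norm_kop closure_L2_test])
    fix f g assume "f \<in> L2_test" "g \<in> L2_test"
    then obtain \<theta> \<eta> where t: "f = abs_L2 \<theta>" "g = abs_L2 \<eta>" "test_function \<theta>" "test_function \<eta>"
      by (auto simp: L2_test_def)
    obtain a b where ab: "0 < a" "\<And>r. r \<notin> {a..b} \<Longrightarrow> \<theta> r = 0" "\<And>r. r \<notin> {a..b} \<Longrightarrow> \<eta> r = 0"
      using test_function_common_support[OF t(3,4)] by metis
    obtain M where M: "\<And>n r R. r \<in> {a..b} \<Longrightarrow> R \<in> {a..b} \<Longrightarrow> cmod (K n r R) \<le> M"
    proof -
      obtain M where "\<forall>n. \<forall>r\<in>{a..b}. \<forall>R\<in>{a..b}. cmod (K n r R) \<le> M"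
        using lb[of a b] ab(1) by auto
      then show ?thesis by (intro that[of M]) blast
    qed
    define I where "I = integral {a..b} (\<lambda>R. M * cmod (\<theta> R))"
    have kb: "cmod (kfun (K n) f r) \<le> I" if "r \<in> {a..b}" for n r
    proof -
      have r: "r > 0" using that ab(1) by simp
      have "continuous_on {a..b} (\<lambda>R. K n r R * \<theta> R)"
        using ab(1) by (intro continuous_on_mult continuous_on_subset[OF kernel_section_continuous[OF K.Kcont r]]
            test_function_continuous[OF t(3)]) auto
      then have "(\<lambda>R. K n r R * \<theta> R) integrable_on {a..b}" by (rule integrable_continuous_interval)
      moreover have "(\<lambda>R. M * cmod (\<theta> R)) integrable_on {a..b}"
        by (intro integrable_continuous_interval continuous_on_mult continuous_on_const continuous_on_norm test_function_continuous[OF t(3)])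
      ultimately have "cmod (integral {a..b} (\<lambda>R. K n r R * \<theta> R)) \<le> I"
        unfolding I_def
        by (rule Henstock_Kurzweil_Integration.integral_norm_bound_integral)
          (use M[OF that] in \<open>auto simp: norm_mult intro!: mult_right_mono\<close>)
      moreover have "kfun (K n) (abs_L2 \<theta>) r = integral {a..b} (\<lambda>R. K n r R * \<theta> R)"
        by (rule kfun_test[OF K.Kcont r K.Ksq[OF r] t(3) ab(1,2)])
      ultimately show ?thesis by (simp add: t(1))
    qed
    have "(\<lambda>n. \<integral>r. kfun (K n) f r * cnj (\<eta> r) \<partial>half_line) \<longlonglongrightarrow> (\<integral>r. kfun K' f r * cnj (\<eta> r) \<partial>half_line)"
    proof (rule integral_dominated_convergence)
      show "integrable half_line (\<lambda>R. I * cmod (\<eta> R))"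
        using ab by (intro half_line_integral_compact(1)[of a b] continuous_on_mult continuous_on_const continuous_on_norm
            test_function_continuous[OF t(4)]) auto
      show "AE r in half_line. cmod (kfun (K n) f r * cnj (\<eta> r)) \<le> I * cmod (\<eta> r)" for n
      proof (rule AE_half_lineI)
        fix r :: real
        show "cmod (kfun (K n) f r * cnj (\<eta> r)) \<le> I * cmod (\<eta> r)"
          by (cases "r \<in> {a..b}") (auto simp: norm_mult ab(3) kb intro!: mult_right_mono)
      qed
      show "AE r in half_line. (\<lambda>n. kfun (K n) f r * cnj (\<eta> r)) \<longlonglongrightarrow> kfun K' f r * cnj (\<eta> r)"
        unfolding t(1) by (rule AE_half_lineI) (intro tendsto_mult tendsto_const pw t)
      have m: "(\<lambda>r. cnj (\<eta> r)) \<in> borel_measurable half_line"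
        using square_integrable_cnj[OF test_function_square_integrable[OF t(4)]] by (simp add: square_integrable_def)
      show "(\<lambda>r. kfun K' f r * cnj (\<eta> r)) \<in> borel_measurable half_line"
        using K'.kfun_square_integrable[of f] m by (auto simp: square_integrable_def)
      show "(\<lambda>r. kfun (K n) f r * cnj (\<eta> r)) \<in> borel_measurable half_line" for n
        using K.kfun_square_integrable[of n f] m by (auto simp: square_integrable_def)
    qed
    then show "(\<lambda>n. cinner_L2 (kop (K n) f) g) \<longlonglongrightarrow> cinner_L2 (kop K' f) g"
      by (simp add: kop_def t(2) cinner_abs_L2 test_function_square_integrable[OF t(4)])
  qed
qed

section \<open>Green kernels and the a priori bound\<close>

lemma integrable_inverse_square: "integrable half_line (\<lambda>r. 1 / (1 + r)\<^sup>2)"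
proof -
  have "(\<integral>\<^sup>+r. ennreal (1 / (1 + r)\<^sup>2) * indicator {0..} r \<partial>lborel) = 0 - (- 1 / (1 + 0::real))"
  proof (rule nn_integral_FTC_atLeast)
    show "((\<lambda>r::real. - 1 / (1 + r)) \<longlongrightarrow> 0) at_top"
      by real_asymp
    show "((\<lambda>r. - 1 / (1 + r)) has_real_derivative 1 / (1 + x)\<^sup>2) (at x)" if "0 \<le> x" for x :: real
      using that by (auto intro!: derivative_eq_intros simp: power2_eq_square)
  qed auto
  moreover have "(\<integral>\<^sup>+r. ennreal (norm (indicator {0<..} (r::real) *\<^sub>R (1 / (1 + r)\<^sup>2))) \<partial>lborel)
      \<le> (\<integral>\<^sup>+r. ennreal (1 / (1 + r)\<^sup>2) * indicator {0..} r \<partial>lborel)"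
    by (intro nn_integral_mono) (auto simp: indicator_def)
  ultimately have "(\<integral>\<^sup>+r. ennreal (norm (indicator {0<..} (r::real) *\<^sub>R (1 / (1 + r)\<^sup>2))) \<partial>lborel) < \<infinity>"
    by (auto intro: le_less_trans)
  then have "integrable lborel (\<lambda>r::real. indicator {0<..} r *\<^sub>R (1 / (1 + r)\<^sup>2))"
    by (rule integrableI_bounded[rotated]) measurable
  then show ?thesis by (simp add: integrable_restrict_space)
qed

lemma le_abs_mult: "x \<le> C * y \<Longrightarrow> 0 \<le> y \<Longrightarrow> x \<le> \<bar>C\<bar> * (y::real)"
  by (rule order_trans[OF _ mult_right_mono[OF abs_ge_self]])

text \<open>The rates are those of a regular solution divided by r near 0 and of a bounded one
  divided by r at infinity. The criterion therefore also covers imaginary q, where solutions are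
  merely bounded.\<close>

lemma square_integrable_decay:
  assumes cont: "continuous_on {0<..} F" and \<nu>: "\<nu> > 0" and \<delta>: "\<delta> > 0"
    and b0: "\<And>r. 0 < r \<Longrightarrow> r \<le> \<delta> \<Longrightarrow> cmod (F r) \<le> C * r powr (\<nu> - 1/2)"
    and b1: "\<And>r. r \<ge> D \<Longrightarrow> cmod (F r) \<le> C * (1 / r)"
  shows "square_integrable F"
proof -
  define d where "d = min \<delta> 1"
  define e where "e = max D 1"
  have d: "0 < d" "d \<le> 1" and e: "e \<ge> 1" using \<delta> by (auto simp: d_def e_def)
  have "compact {d..e}" by simp
  then have "compact (F ` {d..e})"
    using d by (intro compact_continuous_image continuous_on_subset[OF cont]) auto
  then obtain M where M: "\<And>r. r \<in> {d..e} \<Longrightarrow> cmod (F r) \<le> M"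
    using compact_imp_bounded bounded_iff by (metis imageI)
  \<comment> \<open>In \<open>A\<close>, exp(1/2) compensates the factor exp(-r/2) for r up to 1. In
    \<open>B\<close>, the first term dominates the compact middle range and the second the tail, as
    1/r is at most 2/(1 + r) there.\<close>
  define A where "A = \<bar>C\<bar> * exp (1/2)"
  define B where "B = \<bar>M\<bar> * (1 + e) + 2 * \<bar>C\<bar>"
  have 1: "square_integrable (\<lambda>r. of_real (r powr (\<nu> - 1/2) * exp (- r / 2)))"
    unfolding square_integrable_def
  proof
    show "(\<lambda>r. complex_of_real (r powr (\<nu> - 1/2) * exp (- r / 2))) \<in> borel_measurable half_line"
      by (intro half_line_measurable_continuous continuous_on_of_real continuous_on_mult continuous_on_powr
          continuous_on_exp continuous_intros) auto
    have "(cmod (of_real (r powr (\<nu> - 1/2) * exp (- r / 2))))\<^sup>2 = 1 * (r powr (2 * \<nu> - 1) * exp (- r))" for r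
    proof -
      have "r powr (\<nu> - 1/2) * r powr (\<nu> - 1/2) = r powr (2 * \<nu> - 1)" by (simp flip: powr_add)
      moreover have "exp (- r / 2) * exp (- r / 2) = exp (- r)" by (simp flip: exp_add)
      moreover have "(cmod (of_real (r powr (\<nu> - 1/2) * exp (- r / 2))))\<^sup>2 =
          (r powr (\<nu> - 1/2) * r powr (\<nu> - 1/2)) * (exp (- r / 2) * exp (- r / 2))"
      proof -
        have "(cmod (of_real t))\<^sup>2 = t * t" for t by (simp add: power2_eq_square)
        then show ?thesis by (simp only: mult_ac)
      qed
      ultimately show ?thesis by (simp only: mult_1)
    qed
    then show "integrable half_line (\<lambda>r. (cmod (of_real (r powr (\<nu> - 1/2) * exp (- r / 2))))\<^sup>2)"
      using integrable_powr_exp[of "2 * \<nu> - 1" 1] \<nu> by simp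
  qed
  have 2: "square_integrable (\<lambda>r. of_real (1 / (1 + r)))"
    unfolding square_integrable_def
  proof
    show "(\<lambda>r. complex_of_real (1 / (1 + r))) \<in> borel_measurable half_line"
      by (intro half_line_measurable_continuous continuous_on_of_real continuous_on_divide continuous_intros) auto
    show "integrable half_line (\<lambda>r. (cmod (of_real (1 / (1 + r))))\<^sup>2)"
      using integrable_inverse_square by (simp only: norm_of_real power2_abs power_divide power_one)
  qed
  show ?thesis
  proof (rule square_integrableI_bounded)
    show "F \<in> borel_measurable half_line" by (rule half_line_measurable_continuous[OF cont])
    show "square_integrable (\<lambda>r. of_real A * of_real (r powr (\<nu> - 1/2) * exp (- r / 2)) + of_real B * of_real (1 / (1 + r)))"
      by (intro square_integrable_add square_integrable_mult 1 2)
    show "AE r in half_line. cmod (F r) \<le> cmod (of_real A * of_real (r powr (\<nu> - 1/2) * exp (- r / 2)) + of_real B * of_real (1 / (1 + r)))"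
    proof (rule AE_half_lineI)
      fix r :: real assume r: "r > 0"
      have AB: "A \<ge> 0" "B \<ge> 0" using e by (auto simp: A_def B_def)
      have t1: "0 \<le> A * (r powr (\<nu> - 1/2) * exp (- r / 2))" using AB by simp
      have t2: "0 \<le> B * (1 / (1 + r))" using AB r by simp
      have "cmod (F r) \<le> A * (r powr (\<nu> - 1/2) * exp (- r / 2)) + B * (1 / (1 + r))"
      proof -
        consider "r \<le> d" | "r \<in> {d..e}" | "r \<ge> e" by fastforce
        then show ?thesis
        proof cases
          case 1
          have "cmod (F r) \<le> \<bar>C\<bar> * r powr (\<nu> - 1/2)"
            using b0[of r] r 1 by (intro le_abs_mult) (auto simp: d_def)
          also have "\<dots> \<le> \<bar>C\<bar> * r powr (\<nu> - 1/2) * (exp (1/2) * exp (- r / 2))"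
          proof -
            have "1 \<le> exp (1/2) * exp (- r / 2)" using 1 d by (simp flip: exp_add)
            then have "\<bar>C\<bar> * r powr (\<nu> - 1/2) * 1 \<le> \<bar>C\<bar> * r powr (\<nu> - 1/2) * (exp (1/2) * exp (- r / 2))"
              by (rule mult_left_mono) simp
            then show ?thesis by simp
          qed
          finally show ?thesis using t2 by (simp add: A_def mult_ac)
        next
          case 2
          have "cmod (F r) \<le> \<bar>M\<bar>" using M[OF 2] by linarith
          also have "\<bar>M\<bar> = \<bar>M\<bar> * (1 + r) * (1 / (1 + r))" using r by simp
          also have "\<dots> \<le> B * (1 / (1 + r))"
          proof (rule mult_right_mono)
            have "\<bar>M\<bar> * (1 + r) \<le> \<bar>M\<bar> * (1 + e)" using 2 by (intro mult_left_mono) auto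
            then show "\<bar>M\<bar> * (1 + r) \<le> B" unfolding B_def using abs_ge_zero[of C] by linarith
          qed (use r in simp)
          finally show ?thesis using t1 by simp
        next
          case 3
          have "cmod (F r) \<le> \<bar>C\<bar> * (1 / r)"
            using b1[of r] r 3 by (intro le_abs_mult) (auto simp: e_def)
          also have "\<dots> \<le> \<bar>C\<bar> * (2 * (1 / (1 + r)))"
            using 3 e r by (intro mult_left_mono) (auto simp: divide_simps)
          also have "\<dots> \<le> B * (1 / (1 + r))"
            using r e by (simp add: B_def divide_right_mono)
          finally show ?thesis using t1 by simp
        qed
      qed
      also have "\<dots> \<le> cmod (of_real (A * (r powr (\<nu> - 1/2) * exp (- r / 2)) + B * (1 / (1 + r))))"
        unfolding norm_of_real by simp
      finally show "cmod (F r) \<le> cmod (of_real A * of_real (r powr (\<nu> - 1/2) * exp (- r / 2)) + of_real B * of_real (1 / (1 + r)))"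
        by (simp only: of_real_add of_real_mult)
    qed
  qed
qed

definition green_kernel :: "(real \<Rightarrow> complex) \<Rightarrow> (real \<Rightarrow> complex) \<Rightarrow> real \<Rightarrow> real \<Rightarrow> complex" where
  "green_kernel f g r R = f (min r R) * g (max r R) / of_real (r * R)"

lemma green_kernel_continuous:
  assumes "continuous_on {0<..} f" "continuous_on {0<..} g"
  shows "continuous_on ({0<..} \<times> {0<..}) (\<lambda>(r, R). green_kernel f g r R)"
proof -
  have "continuous_on ({0<..} \<times> {0<..}) (\<lambda>x. f (min (fst x) (snd x)) * g (max (fst x) (snd x)) / of_real (fst x * snd x))"
    by (intro continuous_on_divide continuous_on_mult continuous_on_compose2[OF assms(1)] continuous_on_compose2[OF assms(2)]
        continuous_on_of_real continuous_on_min continuous_on_max continuous_on_fst continuous_on_snd continuous_on_id) auto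
  then show ?thesis by (simp add: green_kernel_def case_prod_unfold)
qed

lemma norm_square_deriv:
  assumes "(u has_vector_derivative u') (at r)"
  shows "((\<lambda>r. (cmod (u r))\<^sup>2) has_real_derivative 2 * Re (u' * cnj (u r))) (at r)"
proof -
  have "((\<lambda>r. Re (u r)) has_real_derivative Re u') (at r)" "((\<lambda>r. Im (u r)) has_real_derivative Im u') (at r)"
    using bounded_linear.has_vector_derivative[OF bounded_linear_Re assms] bounded_linear.has_vector_derivative[OF bounded_linear_Im assms]
    by (auto simp: has_real_derivative_iff_has_vector_derivative)
  note d = this
  have "((\<lambda>r. (Re (u r))\<^sup>2 + (Im (u r))\<^sup>2) has_real_derivative
      of_nat 2 * (Re u' * Re (u r) ^ (2 - Suc 0)) + of_nat 2 * (Im u' * Im (u r) ^ (2 - Suc 0))) (at r)"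
    by (intro DERIV_add DERIV_power d)
  then have "((\<lambda>r. (Re (u r))\<^sup>2 + (Im (u r))\<^sup>2) has_real_derivative 2 * Re (u' * cnj (u r))) (at r)"
    by (simp add: algebra_simps)
  then show ?thesis by (simp add: cmod_power2)
qed

text \<open>Allows primitives to start at 0 although \<open>f\<close> is controlled for positive
  arguments only and may be singular at the origin.\<close>

lemma continuous_on_cut:
  assumes "continuous_on {0<..} f" "test_function \<theta>"
  shows "continuous_on UNIV (\<lambda>R. f R * \<theta> R)"
proof -
  obtain a b where ab: "0 < a" "\<And>r. r \<notin> {a..b} \<Longrightarrow> \<theta> r = 0"
    using test_function_support[OF assms(2)] by metis
  have "continuous_on ({0<..} \<union> {..<a}) (\<lambda>R. f R * \<theta> R)"
  proof (rule continuous_on_open_Un)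
    show "continuous_on {0<..} (\<lambda>R. f R * \<theta> R)"
      by (intro continuous_on_mult assms(1) test_function_continuous[OF assms(2)])
    have "continuous_on {..<a} (\<lambda>R. 0 :: complex)" by simp
    then show "continuous_on {..<a} (\<lambda>R. f R * \<theta> R)"
      by (rule continuous_on_eq) (use ab(2) in auto)
  qed auto
  moreover have "{0<..} \<union> {..<a} = (UNIV :: real set)" using ab(1) by auto
  ultimately show ?thesis by simp
qed

lemma integral_zero_deriv:
  assumes "continuous_on UNIV h" "r > 0"
  shows "((\<lambda>r. integral {0..r} h) has_vector_derivative (h r :: complex)) (at r)"
proof -
  have "((\<lambda>r. integral {0..r} h) has_vector_derivative h r) (at r within {0..r + 1})"
    by (rule integral_has_vector_derivative) (use assms in \<open>auto intro: continuous_on_subset\<close>)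
  moreover have "at r within {0..r + 1} = at r"
    using assms(2) by (intro at_within_interior) auto
  ultimately show ?thesis by simp
qed

text \<open>Abstracts from \<open>phi\<close> and \<open>psi\<close>, so that q and its conjugate
  share one development. Admitting Re q = 0 makes the boundary kernels instances too;
  \<open>g_inf\<close> then says that \<open>g\<close> is bounded and satisfies the radiation
  condition.\<close>

locale green_pair =
  fixes \<nu> :: real and q :: complex and f f' g g' :: "real \<Rightarrow> complex"
  assumes \<nu>: "\<nu> > 0" and Re_q: "Re q \<ge> 0"
    and f_deriv: "r > 0 \<Longrightarrow> (f has_vector_derivative f' r) (at r)"
    and f'_deriv: "r > 0 \<Longrightarrow> (f' has_vector_derivative (q\<^sup>2 + of_real (\<nu>\<^sup>2 - 1/4) / of_real r ^ 2) * f r) (at r)"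
    and g_deriv: "r > 0 \<Longrightarrow> (g has_vector_derivative g' r) (at r)"
    and g'_deriv: "r > 0 \<Longrightarrow> (g' has_vector_derivative (q\<^sup>2 + of_real (\<nu>\<^sup>2 - 1/4) / of_real r ^ 2) * g r) (at r)"
    and wr: "r > 0 \<Longrightarrow> f' r * g r - f r * g' r = 1"
    and f_zero: "\<exists>C. \<forall>r. 0 < r \<longrightarrow> r \<le> 1 \<longrightarrow> cmod (f r) \<le> C * r powr (\<nu> + 1/2) \<and> cmod (f' r) \<le> C * r powr (\<nu> - 1/2)"
    and g_inf: "\<exists>C. \<forall>r\<ge>1. cmod (g r) \<le> C * exp (- Re q * r) \<and> cmod (g' r + q * g r) \<le> C * exp (- Re q * r) / r"
begin

lemma f_cont: "continuous_on {0<..} f" and g_cont: "continuous_on {0<..} g"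
  by (intro continuous_at_imp_continuous_on ballI has_vector_derivative_continuous[OF f_deriv], simp)
    (intro continuous_at_imp_continuous_on ballI has_vector_derivative_continuous[OF g_deriv], simp)

lemma kernel_square_integrable:
  assumes r: "r > 0"
  shows "square_integrable (green_kernel f g r)"
proof -
  obtain C where C: "\<And>r. 0 < r \<Longrightarrow> r \<le> 1 \<Longrightarrow> cmod (f r) \<le> C * r powr (\<nu> + 1/2)"
    using f_zero by blast
  obtain D where D: "\<And>r. 1 \<le> r \<Longrightarrow> cmod (g r) \<le> D * exp (- Re q * r)"
    using g_inf by blast
  define M where "M = max (cmod (g r) / r * \<bar>C\<bar>) (cmod (f r) / r * \<bar>D\<bar>)"
  show ?thesis
  proof (rule square_integrable_decay[OF kernel_section_continuous[OF green_kernel_continuous[OF f_cont g_cont] r] \<nu>, of "min r 1" M "max r 1"])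
    fix R :: real assume R: "0 < R" "R \<le> min r 1"
    have p: "R powr (\<nu> + 1/2) = R powr (\<nu> - 1/2) * R"
    proof -
      have "R powr (\<nu> + 1/2) = R powr ((\<nu> - 1/2) + 1)" by (rule arg_cong) simp
      then show ?thesis using R by (simp only: powr_add) simp
    qed
    have "cmod (f R) \<le> \<bar>C\<bar> * (R powr (\<nu> - 1/2) * R)"
      using C[of R] R p by (intro le_abs_mult) auto
    then have "cmod (f R) / R \<le> \<bar>C\<bar> * R powr (\<nu> - 1/2)"
      using R by (simp add: pos_divide_le_eq mult.assoc)
    then have "cmod (g r) / r * (cmod (f R) / R) \<le> cmod (g r) / r * (\<bar>C\<bar> * R powr (\<nu> - 1/2))"
      using r by (intro mult_left_mono) auto
    also have "\<dots> \<le> M * R powr (\<nu> - 1/2)"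
      unfolding mult.assoc[symmetric] M_def by (intro mult_right_mono) auto
    finally show "cmod (green_kernel f g r R) \<le> M * R powr (\<nu> - 1/2)"
      using R r by (simp add: green_kernel_def norm_mult norm_divide min_absorb2 max_absorb1 mult.commute)
  next
    fix R :: real assume R: "max r 1 \<le> R"
    have "exp (- Re q * R) \<le> 1" using Re_q R by simp
    then have "\<bar>D\<bar> * exp (- Re q * R) \<le> \<bar>D\<bar> * 1" by (intro mult_left_mono) auto
    then have "cmod (g R) \<le> \<bar>D\<bar>"
      using le_abs_mult[OF D[of R]] R by simp
    then have "cmod (f r) / r * (cmod (g R) / R) \<le> cmod (f r) / r * (\<bar>D\<bar> / R)"
      using r R by (intro mult_left_mono divide_right_mono) auto
    also have "\<dots> = cmod (f r) / r * \<bar>D\<bar> * (1 / R)" by simp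
    also have "\<dots> \<le> M * (1 / R)"
      unfolding M_def using R r by (intro mult_right_mono) auto
    finally show "cmod (green_kernel f g r R) \<le> M * (1 / R)"
      using R r by (simp add: green_kernel_def norm_mult norm_divide min_absorb1 max_absorb2)
  qed (use r in auto)
qed

text \<open>Variation of parameters. To the left of the support of \<theta> the solution is a
  multiple of \<open>f\<close>, to the right a multiple of \<open>g\<close>; these two facts are the
  source of all boundary conditions used below.\<close>

lemma solution:
  assumes t: "test_function \<theta>"
  obtains u u' A B a b where
    "\<And>r. r > 0 \<Longrightarrow> kfun (green_kernel f g) (abs_L2 \<theta>) r = u r / of_real r"
    "\<And>r. r > 0 \<Longrightarrow> (u has_vector_derivative u' r) (at r)"
    "\<And>r. r > 0 \<Longrightarrow> (u' has_vector_derivative (q\<^sup>2 + of_real (\<nu>\<^sup>2 - 1/4) / of_real r ^ 2) * u r - \<theta> r / of_real r) (at r)"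
    "0 < a" "\<And>r. 0 < r \<Longrightarrow> r \<le> a \<Longrightarrow> u r = A * f r \<and> u' r = A * f' r"
    "\<And>r. b \<le> r \<Longrightarrow> u r = B * g r \<and> u' r = B * g' r"
proof -
  obtain a b0 where ab0: "0 < a" "\<And>r. r \<notin> {a..b0} \<Longrightarrow> \<theta> r = 0"
    using test_function_support[OF t] by metis
  \<comment> \<open>Guards against an empty support interval: afterwards \<open>a\<close> is at most
    \<open>b\<close> in every case.\<close>
  define b where "b = max a b0"
  have ab: "0 < a" "a \<le> b" "\<And>r. r \<notin> {a..b} \<Longrightarrow> \<theta> r = 0"
  proof -
    show "\<theta> r = 0" if "r \<notin> {a..b}" for r
    proof -
      have "r \<notin> {a..b0}" using that by (auto simp: b_def)
      then show ?thesis by (rule ab0(2))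
    qed
  qed (use ab0 in \<open>auto simp: b_def\<close>)
  define F where "F r = \<theta> r / of_real r" for r
  have F: "test_function F" unfolding F_def by (rule test_function_divide_r[OF t])
  have F0: "F r = 0" if "r \<notin> {a..b}" for r using ab(3)[OF that] by (simp add: F_def)
  define P where "P r = integral {0..r} (\<lambda>R. f R * F R)" for r
  define Q where "Q r = integral {0..r} (\<lambda>R. g R * F R)" for r
  have cf: "continuous_on S (\<lambda>R. f R * F R)" and cg: "continuous_on S (\<lambda>R. g R * F R)" for S
    using continuous_on_cut[OF f_cont F] continuous_on_cut[OF g_cont F] by (auto intro: continuous_on_subset)
  have P: "(P has_vector_derivative f r * F r) (at r)" and Q: "(Q has_vector_derivative g r * F r) (at r)" if "r > 0" for r
    unfolding P_def[abs_def] Q_def[abs_def]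
    by (rule integral_zero_deriv[OF cf that], rule integral_zero_deriv[OF cg that])
  have z: "integral {s..t} (\<lambda>R. h R * F R) = 0" if "t \<le> a \<or> b \<le> s" for s t and h :: "real \<Rightarrow> complex"
  proof -
    have "integral {s..t} (\<lambda>R. h R * F R) = integral {s..t} (\<lambda>R. 0)"
    proof (rule integral_spike[where S = "{a, b}"])
      show "0 = h x * F x" if "x \<in> {s..t} - {a, b}" for x
        using F0[of x] that \<open>t \<le> a \<or> b \<le> s\<close> by fastforce
    qed auto
    then show ?thesis by simp
  qed
  have P0: "P r = 0" "Q r = 0" if "r \<le> a" for r
    unfolding P_def Q_def using that by (auto intro: z)
  have comb: "integral {s..r} (\<lambda>R. h R * F R) + integral {r..t} (\<lambda>R. h R * F R) = integral {s..t} (\<lambda>R. h R * F R)"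
    if "s \<le> r" "r \<le> t" "continuous_on {s..t} (\<lambda>R. h R * F R)" for s r t and h :: "real \<Rightarrow> complex"
    using that by (intro Henstock_Kurzweil_Integration.integral_combine integrable_continuous_interval)
  have P1: "P r = P b" "Q r = Q b" if "b \<le> r" for r
    using comb[of 0 b r f] comb[of 0 b r g] that ab z[of r b f] z[of r b g] cf cg unfolding P_def Q_def by auto
  define u where "u r = g r * P r + f r * (Q b - Q r)" for r
  define u' where "u' r = g' r * P r + f' r * (Q b - Q r)" for r
  show ?thesis
  proof (rule that[of u u' a "Q b" b "P b"])
    fix r :: real assume r: "r > 0"
    have "((\<lambda>r. g r * P r + f r * (Q b - Q r)) has_vector_derivative
        (g r * (f r * F r) + g' r * P r) + (f r * (0 - g r * F r) + f' r * (Q b - Q r))) (at r)"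
      by (intro has_vector_derivative_add has_vector_derivative_mult has_vector_derivative_diff has_vector_derivative_const
          P Q f_deriv g_deriv r)
    then show "(u has_vector_derivative u' r) (at r)"
      unfolding u_def[abs_def] by (rule has_vector_derivative_eq_rhs) (simp add: u'_def algebra_simps)
    let ?V = "q\<^sup>2 + of_real (\<nu>\<^sup>2 - 1/4) / of_real r ^ 2"
    have "((\<lambda>r. g' r * P r + f' r * (Q b - Q r)) has_vector_derivative
        (g' r * (f r * F r) + ?V * g r * P r) + (f' r * (0 - g r * F r) + ?V * f r * (Q b - Q r))) (at r)"
      by (intro has_vector_derivative_add has_vector_derivative_mult has_vector_derivative_diff has_vector_derivative_const
          P Q f'_deriv g'_deriv r)
    moreover have "(g' r * (f r * F r) + V * g r * P r) + (f' r * (0 - g r * F r) + V * f r * (Q b - Q r))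
       = V * u r - (f' r * g r - f r * g' r) * F r" for V
      by (simp add: u_def ring_distribs mult_ac)
    ultimately show "(u' has_vector_derivative ?V * u r - \<theta> r / of_real r) (at r)"
      unfolding u'_def[abs_def] by (simp add: wr[OF r] F_def)
    define s where "s = min a r"
    define t where "t = max b r"
    have st: "0 < s" "s \<le> r" "r \<le> t" "s \<le> a" "b \<le> t" using r ab by (auto simp: s_def t_def)
    have k0: "\<theta> R = 0" if "R \<notin> {s..t}" for R using that st ab(3)[of R] by fastforce
    have kc: "continuous_on {s..t} (\<lambda>R. green_kernel f g r R * \<theta> R)"
      using st(1) by (intro continuous_on_mult test_function_continuous[OF t]
         continuous_on_subset[OF kernel_section_continuous[OF green_kernel_continuous[OF f_cont g_cont] r]]) auto
    have "kfun (green_kernel f g) (abs_L2 \<theta>) r = integral {s..t} (\<lambda>R. green_kernel f g r R * \<theta> R)"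
      by (rule kfun_test[OF green_kernel_continuous[OF f_cont g_cont] r kernel_square_integrable[OF r] t st(1) k0])
    also have "\<dots> = integral {s..r} (\<lambda>R. green_kernel f g r R * \<theta> R) + integral {r..t} (\<lambda>R. green_kernel f g r R * \<theta> R)"
      using st kc by (intro Henstock_Kurzweil_Integration.integral_combine[symmetric] integrable_continuous_interval)
    also have "integral {s..r} (\<lambda>R. green_kernel f g r R * \<theta> R) = integral {s..r} (\<lambda>R. (g r / of_real r) * (f R * F R))"
      by (rule Henstock_Kurzweil_Integration.integral_cong) (use st in \<open>auto simp: green_kernel_def F_def\<close>)
    also have "\<dots> = g r / of_real r * P r"
      using comb[of 0 s r f] st z[of s 0 f] cf by (simp add: P_def)
    also have "integral {r..t} (\<lambda>R. green_kernel f g r R * \<theta> R) = integral {r..t} (\<lambda>R. (f r / of_real r) * (g R * F R))"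
      by (rule Henstock_Kurzweil_Integration.integral_cong) (use st in \<open>auto simp: green_kernel_def F_def\<close>)
    also have "\<dots> = f r / of_real r * (Q b - Q r)"
    proof -
      have "integral {r..t} (\<lambda>R. g R * F R) = Q b - Q r"
        using comb[of 0 r t g] r st P1(2)[of t] cg by (simp add: Q_def algebra_simps)
      then show ?thesis by simp
    qed
    finally show "kfun (green_kernel f g) (abs_L2 \<theta>) r = u r / of_real r"
      by (simp add: u_def add_divide_distrib)
  next
    fix r assume "0 < r" "r \<le> a"
    then show "u r = Q b * f r \<and> u' r = Q b * f' r" using P0 by (simp add: u_def u'_def)
  next
    fix r assume br: "b \<le> r"
    show "u r = P b * g r \<and> u' r = P b * g' r" unfolding u_def u'_def P1[OF br] by simp
  qed (use ab in auto)
qed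

end

text \<open>The reciprocal square root of the maximum of \<tau> (\<nu>^2 - \<tau>/4) over 0 < \<tau>
  <= 1. The maximiser 2 \<nu>^2 is admissible up to \<nu>^2 = 1/2 and has the value \<nu>^4; beyond
  that the endpoint \<tau> = 1 is best.\<close>

definition bound_const :: "real \<Rightarrow> real" where
  "bound_const \<nu> = (if \<nu>\<^sup>2 \<le> 1/2 then 1 / \<nu>\<^sup>2 else 1 / sqrt (\<nu>\<^sup>2 - 1/4))"

text \<open>
  Multiplying the equation by \<open>r\<close> times the conjugate of \<open>w = u' + q u\<close>, which is small exactly on
  outgoing solutions, gives the first identity; the second is Hardy's inequality for \<open>w\<close>.
\<close>

lemma multiplier_inequality:
  fixes r \<tau> \<kappa> \<nu> W Y S T \<Theta> :: real
  assumes "r > 0" "0 < \<tau>" "\<tau> \<le> 1" "\<tau> \<le> 4 * \<nu>\<^sup>2" "\<kappa> \<ge> 0" "W \<ge> 0" "Y \<ge> 0"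
    and young: "2 * T \<le> \<tau> * W + \<Theta> / \<tau>" and hardy: "0 \<le> W - S / r + Y / (4 * r\<^sup>2)"
  shows "(\<nu>\<^sup>2 - \<tau>/4) * (Y / r\<^sup>2) - \<Theta> / \<tau> \<le>
     (1 + 2 * \<kappa> * r) * W + 2 * (\<nu>\<^sup>2 - 1/4) * \<kappa> * Y / r + (\<nu>\<^sup>2 - 1/4) * Y / r\<^sup>2 - 2 * T
      - (1 - \<tau>) * ((2 * S - 2 * \<kappa> * Y) * (1 / (2 * r) + \<kappa>) - Y / (2 * r\<^sup>2))"
proof -
  define i where "i = 1 / r"
  define c where "c = \<nu>\<^sup>2 - 1/4"
  define D where "D = \<Theta> / \<tau>"
  define X where "X = W - S * i + Y * i\<^sup>2 / 4"
  have ri: "r * i = 1" using assms(1) by (simp add: i_def)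
  have X: "(1 + 2 * \<kappa> * r) * X = (1 + 2 * \<kappa> * r) * W - S * i - 2 * \<kappa> * S + Y * i\<^sup>2 / 4 + \<kappa> * Y * i / 2"
    unfolding X_def using ri by algebra
  have A: "(1 + 2 * \<kappa> * r) * W + 2 * c * \<kappa> * Y * i + c * Y * i\<^sup>2 - 2 * T
      - (1 - \<tau>) * ((2 * S - 2 * \<kappa> * Y) * (i / 2 + \<kappa>) - Y * i\<^sup>2 / 2) - ((c + 1/4 - \<tau>/4) * (Y * i\<^sup>2) - D)
    = (1 - \<tau>) * ((1 + 2 * \<kappa> * r) * X) + \<tau> * (2 * \<kappa> * r) * W
      + (\<tau> * W + D - 2 * T) + (1 - \<tau>) * (2 * \<kappa>\<^sup>2 * Y) + (c + 1/4 - \<tau>/4) * (2 * \<kappa> * Y * i)"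
    unfolding X by (simp add: field_simps power2_eq_square)
  have "0 \<le> X" using hardy by (simp add: X_def i_def power2_eq_square)
  then have B: "0 \<le> (1 - \<tau>) * ((1 + 2 * \<kappa> * r) * X)" "0 \<le> \<tau> * (2 * \<kappa> * r) * W"
     "0 \<le> (1 - \<tau>) * (2 * \<kappa>\<^sup>2 * Y)" "0 \<le> (c + 1/4 - \<tau>/4) * (2 * \<kappa> * Y * i)"
    using assms by (auto intro!: mult_nonneg_nonneg simp: i_def c_def)
  have "y \<le> x" if "x - y = p1 + p2 + p3 + p4 + p5" "0 \<le> p1" "0 \<le> p2" "0 \<le> p4" "0 \<le> p5" "0 \<le> p3"
    for x y p1 p2 p3 p4 p5 :: real using that by linarith
  from this[OF A B] have "(c + 1/4 - \<tau>/4) * (Y * i\<^sup>2) - D \<le> (1 + 2 * \<kappa> * r) * W + 2 * c * \<kappa> * Y * i + c * Y * i\<^sup>2 - 2 * T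
      - (1 - \<tau>) * ((2 * S - 2 * \<kappa> * Y) * (i / 2 + \<kappa>) - Y * i\<^sup>2 / 2)"
    using young by (simp add: D_def)
  then show ?thesis
    by (simp add: i_def c_def D_def power_divide mult.commute[of 2 r] mult.commute[of 2 "r\<^sup>2"])
qed

section \<open>The energy estimate for the inhomogeneous equation\<close>

context green_pair
begin

lemma solution_bounds:
  assumes t: "test_function \<theta>" and \<kappa>: "Re q > 0"
  obtains u u' C \<delta> D where
    "\<And>r. r > 0 \<Longrightarrow> kfun (green_kernel f g) (abs_L2 \<theta>) r = u r / of_real r"
    "\<And>r. r > 0 \<Longrightarrow> (u has_vector_derivative u' r) (at r)"
    "\<And>r. r > 0 \<Longrightarrow> (u' has_vector_derivative (q\<^sup>2 + of_real (\<nu>\<^sup>2 - 1/4) / of_real r ^ 2) * u r - \<theta> r / of_real r) (at r)"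
    "0 < \<delta>" "\<delta> \<le> 1" "1 \<le> D" "0 \<le> C"
    "\<And>r. 0 < r \<Longrightarrow> r \<le> \<delta> \<Longrightarrow> cmod (u r) \<le> C * r powr (\<nu> + 1/2)"
    "\<And>r. 0 < r \<Longrightarrow> r \<le> \<delta> \<Longrightarrow> cmod (u' r) \<le> C * r powr (\<nu> - 1/2)"
    "\<And>r. D \<le> r \<Longrightarrow> cmod (u r) \<le> C * exp (- Re q * r)"
    "\<And>r. D \<le> r \<Longrightarrow> cmod (u' r + q * u r) \<le> C * exp (- Re q * r) / r"
proof (rule solution[OF t])
  fix u u' A B a b
  assume u: "\<And>r. r > 0 \<Longrightarrow> kfun (green_kernel f g) (abs_L2 \<theta>) r = u r / of_real r"
    "\<And>r. r > 0 \<Longrightarrow> (u has_vector_derivative u' r) (at r)"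
    "\<And>r. r > 0 \<Longrightarrow> (u' has_vector_derivative (q\<^sup>2 + of_real (\<nu>\<^sup>2 - 1/4) / of_real r ^ 2) * u r - \<theta> r / of_real r) (at r)"
    and a: "0 < a" and ua: "\<And>r. 0 < r \<Longrightarrow> r \<le> a \<Longrightarrow> u r = A * f r \<and> u' r = A * f' r"
    and ub: "\<And>r. b \<le> r \<Longrightarrow> u r = B * g r \<and> u' r = B * g' r"
  obtain C1 where C1: "\<And>r. 0 < r \<Longrightarrow> r \<le> 1 \<Longrightarrow> cmod (f r) \<le> C1 * r powr (\<nu> + 1/2)"
    "\<And>r. 0 < r \<Longrightarrow> r \<le> 1 \<Longrightarrow> cmod (f' r) \<le> C1 * r powr (\<nu> - 1/2)"
    using f_zero by blast
  obtain C2 where C2: "\<And>r. 1 \<le> r \<Longrightarrow> cmod (g r) \<le> C2 * exp (- Re q * r)"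
    "\<And>r. 1 \<le> r \<Longrightarrow> cmod (g' r + q * g r) \<le> C2 * exp (- Re q * r) / r"
    using g_inf by blast
  define C where "C = cmod A * \<bar>C1\<bar> + cmod B * \<bar>C2\<bar>"
  have le: "cmod (k * x) \<le> C * y" if "cmod x \<le> M * y" "0 \<le> y" "k = A \<and> M = C1 \<or> k = B \<and> M = C2" for k x M y
  proof -
    have "cmod (k * x) \<le> cmod k * (\<bar>M\<bar> * y)"
      unfolding norm_mult by (intro mult_left_mono le_abs_mult that) auto
    also have "\<dots> = cmod k * \<bar>M\<bar> * y" by simp
    also have "\<dots> \<le> C * y"
      using that by (intro mult_right_mono) (auto simp: C_def)
    finally show ?thesis .
  qed
  show thesis
  proof (rule that[OF u, of "min a 1" "max b 1" C])
    show "0 \<le> C" by (simp add: C_def)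
  next
    fix r assume r: "0 < r" "r \<le> min a 1"
    then have e: "u r = A * f r" "u' r = A * f' r" using ua[of r] by auto
    show "cmod (u r) \<le> C * r powr (\<nu> + 1/2)" "cmod (u' r) \<le> C * r powr (\<nu> - 1/2)"
      unfolding e using C1[of r] r by (auto intro!: le)
  next
    fix r assume r: "max b 1 \<le> r"
    then have e: "u r = B * g r" "u' r + q * u r = B * (g' r + q * g r)" using ub[of r] by (auto simp: algebra_simps)
    show "cmod (u r) \<le> C * exp (- Re q * r)"
      unfolding e using C2[of r] r by (auto intro!: le)
    have "cmod (u' r + q * u r) \<le> C * (exp (- Re q * r) / r)"
      unfolding e(2) by (rule le) (use C2(2)[of r] r in auto)
    then show "cmod (u' r + q * u r) \<le> C * exp (- Re q * r) / r" by simp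
  qed (use a in auto)
qed

text \<open>The first two terms of the energy come from the multiplier. The third is the total
  derivative that Hardy's inequality contributes, with weight 1 - \<tau> because the share \<tau> of
  |w|^2 is spent on the right-hand side.\<close>

lemma energy_inequality:
  fixes u u' \<theta> :: "real \<Rightarrow> complex"
  assumes r: "r > 0" and u: "(u has_vector_derivative u' r) (at r)"
    "(u' has_vector_derivative (q\<^sup>2 + of_real (\<nu>\<^sup>2 - 1/4) / of_real r ^ 2) * u r - \<theta> r / of_real r) (at r)"
    and \<tau>: "0 < \<tau>" "\<tau> \<le> 1" "\<tau> \<le> 4 * \<nu>\<^sup>2"
  shows "\<exists>d. ((\<lambda>r. r * (cmod (u' r + q * u r))\<^sup>2 - (\<nu>\<^sup>2 - 1/4) * (cmod (u r))\<^sup>2 / r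
        - (1 - \<tau>) * ((cmod (u r))\<^sup>2 * (1 / (2 * r) + Re q))) has_real_derivative d) (at r) \<and>
    (\<nu>\<^sup>2 - \<tau>/4) * ((cmod (u r))\<^sup>2 / r\<^sup>2) - (cmod (\<theta> r))\<^sup>2 / \<tau> \<le> d"
proof -
  define c where "c = \<nu>\<^sup>2 - 1/4"
  define w where "w r = u' r + q * u r" for r
  define W where "W = (cmod (w r))\<^sup>2"
  define Y where "Y = (cmod (u r))\<^sup>2"
  define S where "S = Re (w r * cnj (u r))"
  define T where "T = Re (\<theta> r * cnj (w r))"
  define \<kappa> where "\<kappa> = Re q"
  \<comment> \<open>The factorisation of u'' - q^2 u as (d/dr - q) applied to u' + q u: the second
    order equation becomes a first order one for \<open>w\<close>.\<close>
  have wd: "(w has_vector_derivative q * w r + of_real (c / r\<^sup>2) * u r - \<theta> r / of_real r) (at r)"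
    unfolding w_def[abs_def] using has_vector_derivative_add[OF u(2) has_vector_derivative_mult_right[OF u(1), of q]]
    by (rule has_vector_derivative_eq_rhs) (simp add: c_def algebra_simps power2_eq_square)
  have Re1: "Re ((q * w r + of_real (c / r\<^sup>2) * u r - \<theta> r / of_real r) * cnj (w r)) = \<kappa> * W + c / r\<^sup>2 * S - T / r"
  proof -
    have "q * w r * cnj (w r) = q * of_real W"
      unfolding W_def by (simp only: mult.assoc complex_norm_square)
    then have "Re (q * w r * cnj (w r)) = Re (q * of_real W)" by (rule arg_cong)
    then have "Re (q * w r * cnj (w r)) = \<kappa> * W" by (simp only: \<kappa>_def times_complex.sel Re_complex_of_real Im_complex_of_real mult_zero_right diff_zero)
    moreover have "Re (of_real (c / r\<^sup>2) * u r * cnj (w r)) = c / r\<^sup>2 * S"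
      unfolding S_def by (simp add: mult.assoc)
    moreover have "Re (\<theta> r / of_real r * cnj (w r)) = T / r"
      unfolding T_def by (simp add: add_divide_distrib)
    ultimately show ?thesis
      by (simp only: left_diff_distrib distrib_right minus_complex.sel plus_complex.sel)
  qed
  have Wd: "((\<lambda>r. (cmod (w r))\<^sup>2) has_real_derivative 2 * (\<kappa> * W + c / r\<^sup>2 * S - T / r)) (at r)"
    using norm_square_deriv[OF wd] by (simp only: Re1)
  have "Re (u' r * cnj (u r)) = S - \<kappa> * Y"
  proof -
    have "u' r * cnj (u r) = w r * cnj (u r) - q * (u r * cnj (u r))" by (simp add: w_def algebra_simps)
    also have "u r * cnj (u r) = of_real Y" unfolding Y_def by (simp only: complex_norm_square)
    finally show ?thesis by (simp add: S_def \<kappa>_def)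
  qed
  then have Yd: "((\<lambda>r. (cmod (u r))\<^sup>2) has_real_derivative 2 * S - 2 * \<kappa> * Y) (at r)"
    using norm_square_deriv[OF u(1)] by (simp only: right_diff_distrib mult.assoc)
  define d where "d = (1 + 2 * \<kappa> * r) * W + 2 * c * \<kappa> * Y / r + c * Y / r\<^sup>2 - 2 * T
      - (1 - \<tau>) * ((2 * S - 2 * \<kappa> * Y) * (1 / (2 * r) + \<kappa>) - Y / (2 * r\<^sup>2))"
  have i: "((\<lambda>r. 1 / r) has_real_derivative - 1 / r\<^sup>2) (at r)" "((\<lambda>r. 1 / (2 * r) + \<kappa>) has_real_derivative - 1 / (2 * r\<^sup>2)) (at r)"
    using r by (auto intro!: derivative_eq_intros simp: power2_eq_square)
  have "((\<lambda>r. r * (cmod (w r))\<^sup>2 - c * ((cmod (u r))\<^sup>2 * (1 / r))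
        - (1 - \<tau>) * ((cmod (u r))\<^sup>2 * (1 / (2 * r) + \<kappa>))) has_real_derivative
      (1 * W + 2 * (\<kappa> * W + c / r\<^sup>2 * S - T / r) * r) - c * ((2 * S - 2 * \<kappa> * Y) * (1 / r) + (- 1 / r\<^sup>2) * Y)
        - (1 - \<tau>) * ((2 * S - 2 * \<kappa> * Y) * (1 / (2 * r) + \<kappa>) + (- 1 / (2 * r\<^sup>2)) * Y)) (at r)"
    unfolding W_def Y_def
    by (intro DERIV_diff DERIV_cmult DERIV_mult DERIV_ident Wd[unfolded W_def] Yd[unfolded Y_def] i)
  moreover have "(1 * W + 2 * (\<kappa> * W + c / r\<^sup>2 * S - T / r) * r) - c * ((2 * S - 2 * \<kappa> * Y) * (1 / r) + (- 1 / r\<^sup>2) * Y)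
        - (1 - \<tau>) * ((2 * S - 2 * \<kappa> * Y) * (1 / (2 * r) + \<kappa>) + (- 1 / (2 * r\<^sup>2)) * Y) = d"
  proof -
    have "(1 * W + 2 * (\<kappa> * W + c / r\<^sup>2 * S - T / r) * r) - c * ((2 * S - 2 * \<kappa> * Y) * (1 / r) + (- 1 / r\<^sup>2) * Y)
       = (1 + 2 * \<kappa> * r) * W + 2 * c * \<kappa> * Y / r + c * Y / r\<^sup>2 - 2 * T"
      using r by (simp add: field_simps power2_eq_square)
    then show ?thesis unfolding d_def by simp
  qed
  ultimately have D: "((\<lambda>r. r * (cmod (w r))\<^sup>2 - c * (cmod (u r))\<^sup>2 / r
        - (1 - \<tau>) * ((cmod (u r))\<^sup>2 * (1 / (2 * r) + \<kappa>))) has_real_derivative d) (at r)"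
    by simp
  have young: "2 * T \<le> \<tau> * W + (cmod (\<theta> r))\<^sup>2 / \<tau>"
  proof -
    have "T \<le> cmod (\<theta> r) * cmod (w r)"
      unfolding T_def using complex_Re_le_cmod[of "\<theta> r * cnj (w r)"] by (simp add: norm_mult)
    moreover have "0 \<le> (\<tau> * cmod (w r) - cmod (\<theta> r))\<^sup>2 / \<tau>" using \<tau> by simp
    then have "2 * (cmod (\<theta> r) * cmod (w r)) \<le> \<tau> * W + (cmod (\<theta> r))\<^sup>2 / \<tau>"
      using \<tau> by (simp add: W_def field_simps power2_eq_square)
    ultimately show ?thesis by linarith
  qed
  have hardy: "0 \<le> W - S / r + Y / (4 * r\<^sup>2)"
  proof -
    have "S \<le> cmod (w r) * cmod (u r)"
      unfolding S_def using complex_Re_le_cmod[of "w r * cnj (u r)"] by (simp add: norm_mult)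
    then have "S / r \<le> cmod (w r) * cmod (u r) / r" using r by (simp add: divide_right_mono)
    moreover have "0 \<le> (cmod (w r) - cmod (u r) / (2 * r))\<^sup>2" by simp
    ultimately show ?thesis by (simp add: W_def Y_def power2_diff power_divide power_mult_distrib)
  qed
  have "(\<nu>\<^sup>2 - \<tau>/4) * (Y / r\<^sup>2) - (cmod (\<theta> r))\<^sup>2 / \<tau> \<le> d"
    unfolding d_def c_def
    by (rule multiplier_inequality[OF r \<tau> _ _ _ young hardy]) (use Re_q in \<open>auto simp: \<kappa>_def W_def Y_def\<close>)
  then show ?thesis
    using D by (intro exI[of _ d]) (simp add: w_def c_def Y_def \<kappa>_def)
qed

text \<open>The pointwise energy inequality is integrated over growing compact intervals. The energy
  \<open>E\<close> is of order r^(2 \<nu>) at 0 and exponentially small at infinity as Re q > 0, so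
  only the norms of \<theta> and of the truncated u/r are left in the limit. The final constant does
  not involve q.\<close>

lemma apriori_bound:
  assumes t: "test_function \<theta>" and \<kappa>: "Re q > 0" and \<tau>: "0 < \<tau>" "\<tau> \<le> 1" "\<tau> < 4 * \<nu>\<^sup>2"
  shows "square_integrable (kfun (green_kernel f g) (abs_L2 \<theta>)) \<and>
    norm (kop (green_kernel f g) (abs_L2 \<theta>)) \<le> sqrt ((norm (abs_L2 \<theta>))\<^sup>2 / (\<tau> * (\<nu>\<^sup>2 - \<tau>/4)))"
proof (rule solution_bounds[OF t \<kappa>])
  fix u u' C \<delta> D
  assume u: "\<And>r. r > 0 \<Longrightarrow> kfun (green_kernel f g) (abs_L2 \<theta>) r = u r / of_real r"
    "\<And>r. r > 0 \<Longrightarrow> (u has_vector_derivative u' r) (at r)"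
    "\<And>r. r > 0 \<Longrightarrow> (u' has_vector_derivative (q\<^sup>2 + of_real (\<nu>\<^sup>2 - 1/4) / of_real r ^ 2) * u r - \<theta> r / of_real r) (at r)"
    and c: "0 < \<delta>" "\<delta> \<le> 1" "1 \<le> D" "0 \<le> C"
    and b: "\<And>r. 0 < r \<Longrightarrow> r \<le> \<delta> \<Longrightarrow> cmod (u r) \<le> C * r powr (\<nu> + 1/2)"
    "\<And>r. 0 < r \<Longrightarrow> r \<le> \<delta> \<Longrightarrow> cmod (u' r) \<le> C * r powr (\<nu> - 1/2)"
    "\<And>r. D \<le> r \<Longrightarrow> cmod (u r) \<le> C * exp (- Re q * r)"
    "\<And>r. D \<le> r \<Longrightarrow> cmod (u' r + q * u r) \<le> C * exp (- Re q * r) / r"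
  define E where "E r = r * (cmod (u' r + q * u r))\<^sup>2 - (\<nu>\<^sup>2 - 1/4) * (cmod (u r))\<^sup>2 / r
        - (1 - \<tau>) * ((cmod (u r))\<^sup>2 * (1 / (2 * r) + Re q))" for r
  define m where "m = \<nu>\<^sup>2 - \<tau>/4"
  have m: "m > 0" using \<tau> by (simp add: m_def)
  have "\<exists>d. (E has_real_derivative d) (at r) \<and> m * ((cmod (u r))\<^sup>2 / r\<^sup>2) - (cmod (\<theta> r))\<^sup>2 / \<tau> \<le> d" if r: "r > 0" for r
    using energy_inequality[where u = u and u' = u' and \<theta> = \<theta>, OF r u(2)[OF r] u(3)[OF r] \<tau>(1,2) less_imp_le[OF \<tau>(3)]]
    unfolding E_def[abs_def] m_def .
  then obtain E' where E': "\<And>r. r > 0 \<Longrightarrow> (E has_real_derivative E' r) (at r)"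
    "\<And>r. r > 0 \<Longrightarrow> m * ((cmod (u r))\<^sup>2 / r\<^sup>2) - (cmod (\<theta> r))\<^sup>2 / \<tau> \<le> E' r"
    by metis
  have Eabs: "\<bar>E r\<bar> \<le> r * (cmod (u' r + q * u r))\<^sup>2 + (\<bar>\<nu>\<^sup>2 - 1/4\<bar> + 1) * ((cmod (u r))\<^sup>2 / r) + Re q * (cmod (u r))\<^sup>2"
    if r: "r > 0" for r
  proof -
    have p: "0 \<le> r * (cmod (u' r + q * u r))\<^sup>2" "0 \<le> (cmod (u r))\<^sup>2 / r" "0 \<le> (cmod (u r))\<^sup>2 * Re q" using r Re_q by auto
    have A: "\<bar>(\<nu>\<^sup>2 - 1/4) * (cmod (u r))\<^sup>2 / r\<bar> = \<bar>\<nu>\<^sup>2 - 1/4\<bar> * ((cmod (u r))\<^sup>2 / r)"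
      using r by (simp add: abs_mult)
    have B: "\<bar>(1 - \<tau>) * ((cmod (u r))\<^sup>2 * (1 / (2 * r) + Re q))\<bar> \<le> 1 * ((cmod (u r))\<^sup>2 / r + (cmod (u r))\<^sup>2 * Re q)"
      unfolding abs_mult[of "1 - \<tau>"]
    proof (rule mult_mono)
      have h: "(cmod (u r))\<^sup>2 * (1 / (2 * r)) \<le> (cmod (u r))\<^sup>2 * (1 / r)"
        using r by (intro mult_left_mono) (auto simp: divide_simps)
      have nn: "0 \<le> (cmod (u r))\<^sup>2 * (1 / (2 * r) + Re q)" using r Re_q by simp
      have "(cmod (u r))\<^sup>2 * (1 / r) = (cmod (u r))\<^sup>2 / r" by simp
      then show "\<bar>(cmod (u r))\<^sup>2 * (1 / (2 * r) + Re q)\<bar> \<le> (cmod (u r))\<^sup>2 / r + (cmod (u r))\<^sup>2 * Re q"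
        unfolding distrib_left abs_of_nonneg[OF nn[unfolded distrib_left]] using h by linarith
    qed (use \<tau> p in auto)
    have "\<bar>x - y - z\<bar> \<le> x + (k + s) + t" if "\<bar>y\<bar> = k" "\<bar>z\<bar> \<le> 1 * (s + t)" "0 \<le> x" for x y z k s t :: real
      using that by (auto simp: abs_if split: if_splits)
    from this[OF A B p(1)] show ?thesis
      unfolding E_def by (simp only: distrib_right mult_1 mult.commute[of "Re q"])
  qed
  have p2: "(r powr (\<nu> + 1/2))\<^sup>2 / r = r powr (2 * \<nu>)" "r * (r powr (\<nu> - 1/2))\<^sup>2 = r powr (2 * \<nu>)" if r: "r > 0" for r
  proof -
    have "(r powr (\<nu> + 1/2))\<^sup>2 = r powr (2 * \<nu> + 1)" "(r powr (\<nu> - 1/2))\<^sup>2 = r powr (2 * \<nu> - 1)"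
      using r by (simp_all add: power2_eq_square flip: powr_add)
    then show "(r powr (\<nu> + 1/2))\<^sup>2 / r = r powr (2 * \<nu>)" "r * (r powr (\<nu> - 1/2))\<^sup>2 = r powr (2 * \<nu>)"
      using r by (simp_all add: powr_add powr_diff)
  qed
  have E0: "\<bar>E r\<bar> \<le> ((1 + cmod q)\<^sup>2 + \<bar>\<nu>\<^sup>2 - 1/4\<bar> + 1 + Re q) * C\<^sup>2 * r powr (2 * \<nu>)" if r: "0 < r" "r \<le> \<delta>" for r
  proof -
    have le: "r powr (\<nu> + 1/2) \<le> r powr (\<nu> - 1/2)" using r c by (intro powr_mono') auto
    have "cmod (u' r + q * u r) \<le> C * r powr (\<nu> - 1/2) + cmod q * (C * r powr (\<nu> - 1/2))"
    proof (rule norm_triangle_le, rule add_mono)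
      have "cmod (u r) \<le> C * r powr (\<nu> - 1/2)"
        using b(1)[OF r] mult_left_mono[OF le c(4)] by linarith
      then show "cmod (q * u r) \<le> cmod q * (C * r powr (\<nu> - 1/2))"
        unfolding norm_mult by (rule mult_left_mono) simp
    qed (rule b(2)[OF r])
    also have "\<dots> = (1 + cmod q) * C * r powr (\<nu> - 1/2)" by (simp add: algebra_simps)
    finally have "(cmod (u' r + q * u r))\<^sup>2 \<le> ((1 + cmod q) * C * r powr (\<nu> - 1/2))\<^sup>2" by (rule power_mono) simp
    then have "r * (cmod (u' r + q * u r))\<^sup>2 \<le> r * ((1 + cmod q) * C * r powr (\<nu> - 1/2))\<^sup>2"
      using r by (intro mult_left_mono) auto
    also have "\<dots> = (1 + cmod q)\<^sup>2 * C\<^sup>2 * (r * (r powr (\<nu> - 1/2))\<^sup>2)" by (simp add: power_mult_distrib)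
    finally have 1: "r * (cmod (u' r + q * u r))\<^sup>2 \<le> (1 + cmod q)\<^sup>2 * C\<^sup>2 * r powr (2 * \<nu>)" by (simp only: p2(2)[OF r(1)])
    have uu: "(cmod (u r))\<^sup>2 \<le> (C * r powr (\<nu> + 1/2))\<^sup>2" by (rule power_mono[OF b(1)[OF r]]) simp
    then have "(cmod (u r))\<^sup>2 / r \<le> (C * r powr (\<nu> + 1/2))\<^sup>2 / r" using r by (intro divide_right_mono) auto
    also have "\<dots> = C\<^sup>2 * ((r powr (\<nu> + 1/2))\<^sup>2 / r)" by (simp add: power_mult_distrib)
    finally have 2: "(cmod (u r))\<^sup>2 / r \<le> C\<^sup>2 * r powr (2 * \<nu>)" by (simp only: p2(1)[OF r(1)])
    have "(cmod (u r))\<^sup>2 = (cmod (u r))\<^sup>2 / r * r" using r by simp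
    also have "\<dots> \<le> (cmod (u r))\<^sup>2 / r * 1" using r c by (intro mult_left_mono) auto
    finally have 3: "(cmod (u r))\<^sup>2 \<le> C\<^sup>2 * r powr (2 * \<nu>)" using 2 by simp
    have "\<bar>E r\<bar> \<le> (1 + cmod q)\<^sup>2 * C\<^sup>2 * r powr (2 * \<nu>) + (\<bar>\<nu>\<^sup>2 - 1/4\<bar> + 1) * (C\<^sup>2 * r powr (2 * \<nu>)) + Re q * (C\<^sup>2 * r powr (2 * \<nu>))"
      by (rule order_trans[OF Eabs[OF r(1)]]) (intro add_mono 1 mult_left_mono 2 3, use Re_q in auto)
    then show ?thesis by (simp add: algebra_simps)
  qed
  have E1: "\<bar>E r\<bar> \<le> (1 + \<bar>\<nu>\<^sup>2 - 1/4\<bar> + 1 + Re q) * C\<^sup>2 * exp (- Re q * r)" if r: "D \<le> r" for r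
  proof -
    have r1: "r \<ge> 1" using r c by simp
    define X where "X = exp (- Re q * r)"
    have X: "0 < X" "X \<le> 1" using Re_q r1 by (auto simp: X_def)
    have XX: "X * X \<le> X" using X by (simp add: mult_left_le)
    have uu: "(cmod (u r))\<^sup>2 \<le> C\<^sup>2 * X"
    proof -
      have "(cmod (u r))\<^sup>2 \<le> (C * X)\<^sup>2" unfolding X_def by (rule power_mono[OF b(3)[OF r]]) simp
      also have "\<dots> = C\<^sup>2 * (X * X)" by (simp add: power2_eq_square)
      also have "\<dots> \<le> C\<^sup>2 * X" using XX by (intro mult_left_mono) auto
      finally show ?thesis .
    qed
    have 2: "(cmod (u r))\<^sup>2 / r \<le> C\<^sup>2 * X"
    proof -
      have "(cmod (u r))\<^sup>2 / r \<le> (cmod (u r))\<^sup>2 / 1" using r1 by (intro divide_left_mono) auto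
      then show ?thesis using uu by simp
    qed
    have 1: "r * (cmod (u' r + q * u r))\<^sup>2 \<le> C\<^sup>2 * X"
    proof -
      have "r * (cmod (u' r + q * u r))\<^sup>2 \<le> r * (C * X / r)\<^sup>2"
        unfolding X_def using r1 by (intro mult_left_mono power_mono b(4)[OF r]) auto
      also have "\<dots> = C\<^sup>2 * (X * X) / r" using r1 by (simp add: power2_eq_square)
      also have "\<dots> \<le> C\<^sup>2 * (X * X) / 1" using r1 X by (intro divide_left_mono) auto
      also have "\<dots> \<le> C\<^sup>2 * X" using XX by (simp add: mult_left_mono)
      finally show ?thesis .
    qed
    have "\<bar>E r\<bar> \<le> C\<^sup>2 * X + (\<bar>\<nu>\<^sup>2 - 1/4\<bar> + 1) * (C\<^sup>2 * X) + Re q * (C\<^sup>2 * X)"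
      by (rule order_trans[OF Eabs]) (use r1 in simp, intro add_mono 1 mult_left_mono 2 uu, use Re_q in auto)
    then show ?thesis by (simp add: X_def algebra_simps)
  qed
  define M where "M = ((1 + cmod q)\<^sup>2 + \<bar>\<nu>\<^sup>2 - 1/4\<bar> + 1 + Re q) * C\<^sup>2"
  define M' where "M' = (1 + \<bar>\<nu>\<^sup>2 - 1/4\<bar> + 1 + Re q) * C\<^sup>2"
  define rn where "rn n = 1 / real (Suc n)" for n
  define Rn where "Rn n = real (Suc n)" for n
  have rn0: "rn n > 0" "rn n \<le> Rn n" "Rn n > 0" for n
  proof -
    have "1 / real (Suc n) \<le> 1" "1 \<le> real (Suc n)" by auto
    then show "rn n \<le> Rn n" unfolding rn_def Rn_def by linarith
  qed (auto simp: rn_def Rn_def)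
  have limE: "(\<lambda>n. E (rn n)) \<longlonglongrightarrow> 0" "(\<lambda>n. E (Rn n)) \<longlonglongrightarrow> 0"
  proof -
    have "((\<lambda>r::real. r powr (2 * \<nu>)) \<longlongrightarrow> 0 powr (2 * \<nu>)) (at_right 0)"
      by (rule tendsto_powr2) (use \<nu> in \<open>auto simp: eventually_at_filter\<close>)
    then have "((\<lambda>r::real. M * r powr (2 * \<nu>)) \<longlongrightarrow> M * 0) (at_right 0)"
      using \<nu> by (intro tendsto_mult tendsto_const) simp
    then have "((\<lambda>r::real. M * r powr (2 * \<nu>)) \<longlongrightarrow> 0) (at_right 0)" by simp
    moreover have "\<forall>\<^sub>F r in at_right 0. norm (E r) \<le> M * r powr (2 * \<nu>)"
      unfolding eventually_at_right_field
      by (rule exI[of _ \<delta>]) (use c E0 in \<open>auto simp: M_def\<close>)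
    ultimately have "(E \<longlongrightarrow> 0) (at_right 0)" by (rule Lim_null_comparison[rotated])
    then show "(\<lambda>n. E (rn n)) \<longlonglongrightarrow> 0"
      unfolding rn_def by (rule filterlim_compose[OF _ filterlim_inverse_Suc])
    have "((\<lambda>r. exp (- Re q * r)) \<longlongrightarrow> 0) at_top"
      using \<kappa> by real_asymp
    then have "((\<lambda>r. M' * exp (- Re q * r)) \<longlongrightarrow> M' * 0) at_top" by (intro tendsto_mult tendsto_const)
    then have "((\<lambda>r. M' * exp (- Re q * r)) \<longlongrightarrow> 0) at_top" by simp
    moreover have "\<forall>\<^sub>F r in at_top. norm (E r) \<le> M' * exp (- Re q * r)"
      by (rule eventually_at_top_linorderI[of D]) (use E1 in \<open>auto simp: M'_def\<close>)
    ultimately have "(E \<longlongrightarrow> 0) at_top" by (rule Lim_null_comparison[rotated])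
    then show "(\<lambda>n. E (Rn n)) \<longlonglongrightarrow> 0"
      unfolding Rn_def by (rule filterlim_compose[OF _ filterlim_Suc_real])
  qed
  have ucont: "continuous_on {0<..} u"
    by (intro continuous_at_imp_continuous_on ballI has_vector_derivative_continuous[OF u(2)]) simp
  have sub: "{rn n..Rn n} \<subseteq> {0<..}" for n using less_le_trans[OF rn0(1)[of n]] by auto
  define N where "N = (norm (abs_L2 \<theta>))\<^sup>2"
  define fn where "fn n r = indicator {rn n..Rn n} r *\<^sub>R (u r / of_real r)" for n r
  have cu: "continuous_on {rn n..Rn n} (\<lambda>r. u r / of_real r)" for n
    using sub[of n] by (intro continuous_on_divide continuous_on_subset[OF ucont] continuous_on_of_real continuous_on_id) auto
  have cf: "continuous_on {rn n..Rn n} (fn n)" for n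
    by (rule continuous_on_eq[OF cu[of n]]) (simp add: fn_def)
  have fnsq: "square_integrable (fn n)" "(norm (abs_L2 (fn n)))\<^sup>2 = integral {rn n..Rn n} (\<lambda>r. (cmod (u r))\<^sup>2 / r\<^sup>2)" for n
  proof -
    have z: "fn n r = 0" if "r \<notin> {rn n..Rn n}" for r using that by (simp add: fn_def)
    have cn: "continuous_on {rn n..Rn n} (\<lambda>r. (cmod (fn n r))\<^sup>2)"
      by (intro continuous_on_power continuous_on_norm cf)
    have i: "integrable half_line (\<lambda>r. (cmod (fn n r))\<^sup>2)" "integral\<^sup>L half_line (\<lambda>r. (cmod (fn n r))\<^sup>2) = integral {rn n..Rn n} (\<lambda>r. (cmod (fn n r))\<^sup>2)"
      using half_line_integral_compact[OF cn rn0(1)] z by auto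
    have m: "fn n \<in> borel_measurable half_line"
      by (rule borel_measurable_integrable[OF half_line_integral_compact(1)[OF cf rn0(1)]]) (use z in auto)
    show "square_integrable (fn n)" using i m by (simp add: square_integrable_def)
    then have "(norm (abs_L2 (fn n)))\<^sup>2 = integral {rn n..Rn n} (\<lambda>r. (cmod (fn n r))\<^sup>2)"
      using i by (simp add: norm_abs_L2)
    also have "\<dots> = integral {rn n..Rn n} (\<lambda>r. (cmod (u r))\<^sup>2 / r\<^sup>2)"
      by (rule Henstock_Kurzweil_Integration.integral_cong) (simp add: fn_def norm_divide power_divide)
    finally show "(norm (abs_L2 (fn n)))\<^sup>2 = integral {rn n..Rn n} (\<lambda>r. (cmod (u r))\<^sup>2 / r\<^sup>2)" .
  qed
  have thN: "integral {rn n..Rn n} (\<lambda>r. (cmod (\<theta> r))\<^sup>2) \<le> N" for n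
  proof -
    have i: "integrable half_line (\<lambda>r. (cmod (\<theta> r))\<^sup>2)"
      using test_function_square_integrable[OF t] by (simp add: square_integrable_def)
    have c\<theta>: "continuous_on S (\<lambda>r. (cmod (\<theta> r))\<^sup>2)" for S
      by (intro continuous_on_power continuous_on_norm test_function_continuous[OF t])
    have "integral {rn n..Rn n} (\<lambda>r. (cmod (\<theta> r))\<^sup>2) = (LINT r:{rn n..Rn n}|lborel. (cmod (\<theta> r))\<^sup>2)"
      by (rule set_borel_integral_eq_integral(2)[symmetric, OF borel_integrable_atLeastAtMost'[OF c\<theta>]])
    also have "\<dots> \<le> (LINT r:{0<..}|lborel. (cmod (\<theta> r))\<^sup>2)"
      unfolding set_lebesgue_integral_def
    proof (rule integral_mono)
      show "integrable lborel (\<lambda>r. indicator {0<..} r *\<^sub>R (cmod (\<theta> r))\<^sup>2)"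
        using i by (simp add: integrable_restrict_space)
      show "integrable lborel (\<lambda>r. indicator {rn n..Rn n} r *\<^sub>R (cmod (\<theta> r))\<^sup>2)"
        using borel_integrable_atLeastAtMost'[OF c\<theta>] by (simp add: set_integrable_def)
      show "indicator {rn n..Rn n} r *\<^sub>R (cmod (\<theta> r))\<^sup>2 \<le> indicator {0<..} r *\<^sub>R (cmod (\<theta> r))\<^sup>2" for r
        using sub[of n] by (auto simp: indicator_def)
    qed
    also have "\<dots> = N"
      by (simp add: N_def norm_abs_L2[OF test_function_square_integrable[OF t]] integral_restrict_space set_lebesgue_integral_def)
    finally show ?thesis .
  qed
  \<comment> \<open>On a compact interval the two boundary values of \<open>E\<close> remain as an
    error; it tends to 0 with \<open>n\<close>, after which Fatou's lemma removes the
    truncation.\<close>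
  have key: "m * (norm (abs_L2 (fn n)))\<^sup>2 \<le> N / \<tau> + (E (Rn n) - E (rn n))" for n
  proof -
    have pos: "x > 0" if "x \<in> {rn n..Rn n}" for x using that sub[of n] by auto
    have c1: "continuous_on {rn n..Rn n} (\<lambda>r. (cmod (u r))\<^sup>2 / r\<^sup>2)"
      by (intro continuous_on_divide continuous_on_power continuous_on_norm continuous_on_subset[OF ucont sub] continuous_on_id)
        (use pos in fastforce)
    have c2: "continuous_on {rn n..Rn n} (\<lambda>r. (cmod (\<theta> r))\<^sup>2)"
      by (intro continuous_on_power continuous_on_norm test_function_continuous[OF t])
    have "((\<lambda>r. m * ((cmod (u r))\<^sup>2 / r\<^sup>2) - (cmod (\<theta> r))\<^sup>2 / \<tau>) has_integral
        m * integral {rn n..Rn n} (\<lambda>r. (cmod (u r))\<^sup>2 / r\<^sup>2) - integral {rn n..Rn n} (\<lambda>r. (cmod (\<theta> r))\<^sup>2) / \<tau>) {rn n..Rn n}"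
      by (rule has_integral_diff[OF has_integral_mult_right[OF integrable_integral[OF integrable_continuous_interval[OF c1]]]
          has_integral_divide[OF integrable_integral[OF integrable_continuous_interval[OF c2]]]])
    moreover have "(E' has_integral E (Rn n) - E (rn n)) {rn n..Rn n}"
    proof (rule fundamental_theorem_of_calculus[OF rn0(2)])
      fix x assume x: "x \<in> {rn n..Rn n}"
      show "(E has_vector_derivative E' x) (at x within {rn n..Rn n})"
        using E'(1)[OF pos[OF x]] unfolding has_real_derivative_iff_has_vector_derivative
        by (rule has_vector_derivative_at_within)
    qed
    ultimately have "m * integral {rn n..Rn n} (\<lambda>r. (cmod (u r))\<^sup>2 / r\<^sup>2) - integral {rn n..Rn n} (\<lambda>r. (cmod (\<theta> r))\<^sup>2) / \<tau> \<le> E (Rn n) - E (rn n)"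
      by (rule has_integral_le) (use E'(2) pos in auto)
    moreover have "integral {rn n..Rn n} (\<lambda>r. (cmod (\<theta> r))\<^sup>2) / \<tau> \<le> N / \<tau>"
      using thN \<tau> by (intro divide_right_mono) auto
    ultimately show ?thesis unfolding fnsq(2) by linarith
  qed
  have "norm (abs_L2 (fn n)) \<le> sqrt ((N / \<tau> + (E (Rn n) - E (rn n))) / m)" for n
    using key[of n] m by (intro real_le_rsqrt) (simp add: pos_le_divide_eq mult.commute)
  moreover have "(\<lambda>n. sqrt ((N / \<tau> + (E (Rn n) - E (rn n))) / m)) \<longlonglongrightarrow> sqrt ((N / \<tau> + (0 - 0)) / m)"
    using m by (intro tendsto_real_sqrt tendsto_divide tendsto_add tendsto_diff tendsto_const limE) auto
  moreover have "AE r in half_line. (\<lambda>n. fn n r) \<longlonglongrightarrow> kfun (green_kernel f g) (abs_L2 \<theta>) r"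
  proof (rule AE_half_lineI)
    fix r :: real assume r: "r > 0"
    obtain k where k: "real k > max r (1 / r)"
      using reals_Archimedean2 by blast
    have "r \<in> {rn n..Rn n}" if "n \<ge> k" for n
    proof -
      have "real (Suc n) > r" "real (Suc n) > 1 / r"
        using k that by auto
      then show ?thesis
        using r by (simp add: rn_def Rn_def field_simps)
    qed
    then show "(\<lambda>n. fn n r) \<longlonglongrightarrow> kfun (green_kernel f g) (abs_L2 \<theta>) r"
      using u(1)[OF r] by (intro tendsto_eventually eventually_sequentiallyI[of k]) (auto simp: fn_def)
  qed
  moreover have "kfun (green_kernel f g) (abs_L2 \<theta>) \<in> borel_measurable half_line"
    by (intro half_line_measurable_continuous kfun_test_continuous green_kernel_continuous f_cont g_cont kernel_square_integrable t)
  ultimately have "square_integrable (kfun (green_kernel f g) (abs_L2 \<theta>)) \<and>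
      norm (abs_L2 (kfun (green_kernel f g) (abs_L2 \<theta>))) \<le> sqrt ((N / \<tau> + (0 - 0)) / m)"
    by (intro L2_Fatou[where fn = fn]) (use fnsq(1) in auto)
  then show ?thesis
    by (simp add: kop_def N_def m_def)
qed

lemma bounded_kernel_green:
  assumes \<kappa>: "Re q > 0"
  shows "bounded_kernel (green_kernel f g) (bound_const \<nu>)"
proof
  show "continuous_on ({0<..} \<times> {0<..}) (\<lambda>(r, R). green_kernel f g r R)"
    by (intro green_kernel_continuous f_cont g_cont)
  show "square_integrable (green_kernel f g r)" if "r > 0" for r
    by (rule kernel_square_integrable[OF that])
  have half: "\<nu>\<^sup>2 > 1/4" if "\<not> \<nu>\<^sup>2 \<le> 1/2" using that by simp
  show "0 \<le> bound_const \<nu>"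
    using half by (auto simp: bound_const_def)
  fix \<theta> assume t: "test_function \<theta>"
  show "square_integrable (kfun (green_kernel f g) (abs_L2 \<theta>)) \<and>
      norm (kop (green_kernel f g) (abs_L2 \<theta>)) \<le> bound_const \<nu> * norm (abs_L2 \<theta>)"
  proof (cases "\<nu>\<^sup>2 \<le> 1/2")
    case True
    have \<tau>: "0 < 2 * \<nu>\<^sup>2" "2 * \<nu>\<^sup>2 \<le> 1" "2 * \<nu>\<^sup>2 < 4 * \<nu>\<^sup>2" using True \<nu> by auto
    have "sqrt ((norm (abs_L2 \<theta>))\<^sup>2 / (2 * \<nu>\<^sup>2 * (\<nu>\<^sup>2 - 2 * \<nu>\<^sup>2/4))) = sqrt ((norm (abs_L2 \<theta>) / \<nu>\<^sup>2)\<^sup>2)"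
    proof -
      have "2 * \<nu>\<^sup>2 * (\<nu>\<^sup>2 - 2 * \<nu>\<^sup>2/4) = (\<nu>\<^sup>2)\<^sup>2" by (simp add: power2_eq_square)
      then show ?thesis by (simp only: power_divide)
    qed
    also have "\<dots> = norm (abs_L2 \<theta>) / \<nu>\<^sup>2" using \<nu> by (subst real_sqrt_abs) simp
    finally show ?thesis
      using apriori_bound[OF t \<kappa> \<tau>] True by (simp add: bound_const_def)
  next
    case False
    have \<tau>: "0 < (1::real)" "(1::real) \<le> 1" "1 < 4 * \<nu>\<^sup>2" using half[OF False] by auto
    have "sqrt ((norm (abs_L2 \<theta>))\<^sup>2 / (1 * (\<nu>\<^sup>2 - 1/4))) = norm (abs_L2 \<theta>) / sqrt (\<nu>\<^sup>2 - 1/4)"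
      by (simp add: real_sqrt_divide)
    then show ?thesis
      using apriori_bound[OF t \<kappa> \<tau>] False by (simp add: bound_const_def)
  qed
qed

end

section \<open>The Friedrichs extension\<close>

text \<open>Cauchy-Schwarz for the form, from its non-negativity at sqrt(t) k x - x'/sqrt(t) with a
  unit \<open>k\<close> that makes the mixed term real. The free \<open>t\<close> lets one form
  value be traded against the other without square roots.\<close>

lemma form_abs_bound:
  fixes S :: L2_graph
  assumes diff: "\<And>x y x' y'. (x, y) \<in> S \<Longrightarrow> (x', y') \<in> S \<Longrightarrow> (x - x', y - y') \<in> S"
    and scale: "\<And>x y k. (x, y) \<in> S \<Longrightarrow> (scaleC_L2 k x, scaleC_L2 k y) \<in> S"
    and sym: "\<And>x y x' y'. (x, y) \<in> S \<Longrightarrow> (x', y') \<in> S \<Longrightarrow> cinner_L2 y x' = cinner_L2 x y'"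
    and pos: "\<And>x y. (x, y) \<in> S \<Longrightarrow> 0 \<le> Re (cinner_L2 y x)"
    and S: "(x, y) \<in> S" "(x', y') \<in> S" and t: "t > 0"
  shows "cmod (cinner_L2 y x') \<le> (t * Re (cinner_L2 y x) + Re (cinner_L2 y' x') / t) / 2"
proof (cases "cinner_L2 y x' = 0")
  case True
  then show ?thesis using pos[OF S(1)] pos[OF S(2)] t by simp
next
  case False
  define B where "B = cinner_L2 y x'"
  define k where "k = cnj B / of_real (cmod B)"
  have kB: "k * B = of_real (cmod B)" and kk: "k * cnj k = 1"
    using False by (simp_all add: k_def B_def complex_norm_square[symmetric] power2_eq_square mult.commute)
  define u where "u = scaleC_L2 (of_real (sqrt t) * k) x - scaleC_L2 (of_real (1 / sqrt t)) x'"
  define v where "v = scaleC_L2 (of_real (sqrt t) * k) y - scaleC_L2 (of_real (1 / sqrt t)) y'"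
  have "(u, v) \<in> S" unfolding u_def v_def by (intro diff scale S)
  then have 0: "0 \<le> Re (cinner_L2 v u)" by (rule pos)
  have B': "cinner_L2 y' x = cnj B"
    unfolding B_def sym[OF S] by (rule cinner_L2_commute)
  have st: "of_real (sqrt t) * of_real (1 / sqrt t) = (1::complex)" "of_real (sqrt t) * of_real (sqrt t) = (of_real t :: complex)"
    "of_real (1 / sqrt t) * of_real (1 / sqrt t) = (of_real (1 / t) :: complex)"
    using t by (simp_all flip: of_real_mult)
  have "cinner_L2 v u = (of_real (sqrt t) * of_real (sqrt t)) * (k * cnj k) * cinner_L2 y x
      - (of_real (sqrt t) * of_real (1 / sqrt t)) * (k * B) - (of_real (sqrt t) * of_real (1 / sqrt t)) * cnj (k * B)
      + (of_real (1 / sqrt t) * of_real (1 / sqrt t)) * cinner_L2 y' x'"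
    unfolding u_def v_def cinner_L2_simps B' B_def[symmetric] by (simp add: algebra_simps)
  also have "\<dots> = of_real t * cinner_L2 y x - of_real (cmod B) - of_real (cmod B) + of_real (1 / t) * cinner_L2 y' x'"
    unfolding st kB kk by simp
  finally have "Re (cinner_L2 v u) = t * Re (cinner_L2 y x) - 2 * cmod B + Re (cinner_L2 y' x') / t" by simp
  then show ?thesis using 0 by (simp add: B_def)
qed

text \<open>An exchange of limits for the numbers <y_n, x'_m>. For fixed \<open>m\<close> the
  adjoint relation of \<open>u\<close> gives the limit <w, x'_m>, for fixed \<open>n\<close> that of
  \<open>u'\<close> gives <x_n, w'>, and these tend to the two sides of the claim. Form convergence
  makes each limit uniform in the other index.\<close>

lemma friedrichs_symmetric:
  fixes S :: L2_graph
  assumes diff: "\<And>x y x' y'. (x, y) \<in> S \<Longrightarrow> (x', y') \<in> S \<Longrightarrow> (x - x', y - y') \<in> S"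
    and scale: "\<And>x y k. (x, y) \<in> S \<Longrightarrow> (scaleC_L2 k x, scaleC_L2 k y) \<in> S"
    and sym: "\<And>x y x' y'. (x, y) \<in> S \<Longrightarrow> (x', y') \<in> S \<Longrightarrow> cinner_L2 y x' = cinner_L2 x y'"
    and pos: "\<And>x y. (x, y) \<in> S \<Longrightarrow> 0 \<le> Re (cinner_L2 y x)"
    and F: "(u, w) \<in> friedrichs S" "(u', w') \<in> friedrichs S"
  shows "cinner_L2 w u' = cinner_L2 u w'"
proof -
  have bd: "cmod (cinner_L2 b a') \<le> (t * Re (cinner_L2 b a) + Re (cinner_L2 b' a') / t) / 2"
    if "(a, b) \<in> S" "(a', b') \<in> S" "t > 0" for a b a' b' t
    by (rule form_abs_bound[of S]) (fact diff, fact scale, fact sym, fact pos, (fact that)+)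
  have adj: "cinner_L2 y u = cinner_L2 x w" "cinner_L2 y u' = cinner_L2 x w'" if "(x, y) \<in> S" for x y
    using F that by (auto simp: friedrichs_def adjoint_graph_def)
  have adj': "cinner_L2 w x = cinner_L2 u y" if "(x, y) \<in> S" for x y
    using adj(1)[OF that] by (metis cinner_L2_commute)
  have "u \<in> form_domain S" "u' \<in> form_domain S"
    using F by (auto simp: friedrichs_def)
  then obtain x y x' y' where
    x: "\<And>n. (x n, y n) \<in> S" "x \<longlonglongrightarrow> u" "\<And>e. e > 0 \<Longrightarrow> \<exists>N::nat. \<forall>m\<ge>N. \<forall>n\<ge>N. cmod (cinner_L2 (y m - y n) (x m - x n)) < e" and
    x': "\<And>n. (x' n, y' n) \<in> S" "x' \<longlonglongrightarrow> u'" "\<And>e. e > 0 \<Longrightarrow> \<exists>N::nat. \<forall>m\<ge>N. \<forall>n\<ge>N. cmod (cinner_L2 (y' m - y' n) (x' m - x' n)) < e"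
    unfolding form_domain_def by blast
  \<comment> \<open>Half of the parallelogram law, bounding the form at one vector by its values at
    another and at the difference. It shows that form-Cauchy sequences are bounded in the
    form.\<close>
  have par: "Re (cinner_L2 b a) \<le> 2 * Re (cinner_L2 b' a') + 2 * Re (cinner_L2 (b - b') (a - a'))"
    if "(a, b) \<in> S" "(a', b') \<in> S" for a b a' b'
  proof -
    have d: "(a - a', b - b') \<in> S" by (rule diff[OF that])
    have "cmod (cinner_L2 b' (a - a')) \<le> (1 * Re (cinner_L2 b' a') + Re (cinner_L2 (b - b') (a - a')) / 1) / 2"
      by (rule bd[OF that(2) d]) simp
    then have r: "2 * Re (cinner_L2 b' (a - a')) \<le> Re (cinner_L2 b' a') + Re (cinner_L2 (b - b') (a - a'))"
      using complex_Re_le_cmod[of "cinner_L2 b' (a - a')"] by simp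
    have s: "cinner_L2 (b - b') a' = cnj (cinner_L2 b' (a - a'))"
      using sym[OF d that(2)] cinner_L2_commute[of "a - a'" b'] by simp
    have "cinner_L2 b a = cinner_L2 ((b - b') + b') ((a - a') + a')" by simp
    also have "\<dots> = cinner_L2 (b - b') (a - a') + cinner_L2 (b - b') a' + (cinner_L2 b' (a - a') + cinner_L2 b' a')"
      unfolding cinner_L2_add_left cinner_L2_add_right by simp
    finally have "Re (cinner_L2 b a) = Re (cinner_L2 (b - b') (a - a')) + 2 * Re (cinner_L2 b' (a - a')) + Re (cinner_L2 b' a')"
      unfolding s by simp
    then show ?thesis using r by linarith
  qed
  have bounded: "\<exists>M>0. \<exists>N. \<forall>n\<ge>N. Re (cinner_L2 (b n) (a n)) \<le> M"
    if ab: "\<And>n. (a n, b n) \<in> S" "\<And>e. e > 0 \<Longrightarrow> \<exists>N::nat. \<forall>m\<ge>N. \<forall>n\<ge>N. cmod (cinner_L2 (b m - b n) (a m - a n)) < e"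
    for a b :: "nat \<Rightarrow> L2"
  proof -
    obtain N where N: "\<And>m n. m \<ge> N \<Longrightarrow> n \<ge> N \<Longrightarrow> cmod (cinner_L2 (b m - b n) (a m - a n)) < 1"
      using ab(2)[of 1] by auto
    have "Re (cinner_L2 (b n) (a n)) \<le> 2 * Re (cinner_L2 (b N) (a N)) + 2" if "n \<ge> N" for n
      using par[OF ab(1)[of n] ab(1)[of N]] N[OF that, of N] complex_Re_le_cmod[of "cinner_L2 (b n - b N) (a n - a N)"] by simp
    moreover have "2 * Re (cinner_L2 (b N) (a N)) + 2 > 0" using pos[OF ab(1)[of N]] by simp
    ultimately show ?thesis by blast
  qed
  have unif: "\<exists>N. \<forall>n\<ge>N. \<forall>n'\<ge>N. \<forall>m\<ge>N. cmod (cinner_L2 (b n') (a' m) - cinner_L2 (b n) (a' m)) \<le> e"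
    if ab: "\<And>n. (a n, b n) \<in> S" "\<And>e. e > 0 \<Longrightarrow> \<exists>N::nat. \<forall>m\<ge>N. \<forall>n\<ge>N. cmod (cinner_L2 (b m - b n) (a m - a n)) < e"
      and ab': "\<And>n. (a' n, b' n) \<in> S" "\<And>e. e > 0 \<Longrightarrow> \<exists>N::nat. \<forall>m\<ge>N. \<forall>n\<ge>N. cmod (cinner_L2 (b' m - b' n) (a' m - a' n)) < e"
      and e: "e > 0"
    for a b a' b' :: "nat \<Rightarrow> L2" and e :: real
  proof -
    obtain M N1 where M: "M > 0" "\<And>n. n \<ge> N1 \<Longrightarrow> Re (cinner_L2 (b' n) (a' n)) \<le> M"
      using bounded[OF ab'] by blast
    \<comment> \<open>Balances \<open>form_abs_bound\<close>: both t (e/t) and M/t are equal to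
      \<open>e\<close>.\<close>
    define t where "t = M / e"
    have t: "t > 0" using M e by (simp add: t_def)
    obtain N2 where N2: "\<And>m n. m \<ge> N2 \<Longrightarrow> n \<ge> N2 \<Longrightarrow> cmod (cinner_L2 (b m - b n) (a m - a n)) < e / t"
      using ab(2)[of "e / t"] e t by auto
    have "cmod (cinner_L2 (b n') (a' m) - cinner_L2 (b n) (a' m)) \<le> e"
      if n: "n \<ge> max N1 N2" "n' \<ge> max N1 N2" "m \<ge> max N1 N2" for n n' m
    proof -
      have "cmod (cinner_L2 (b n' - b n) (a' m)) \<le> (t * Re (cinner_L2 (b n' - b n) (a n' - a n)) + Re (cinner_L2 (b' m) (a' m)) / t) / 2"
        by (rule bd[OF diff[OF ab(1) ab(1)] ab'(1) t])
      also have "\<dots> \<le> (t * (e / t) + M / t) / 2"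
      proof (intro divide_right_mono add_mono mult_left_mono)
        show "Re (cinner_L2 (b n' - b n) (a n' - a n)) \<le> e / t"
          using N2[of n' n] n complex_Re_le_cmod[of "cinner_L2 (b n' - b n) (a n' - a n)"] by simp
      qed (use M(2)[of m] n t in auto)
      also have "\<dots> = e" using t e M by (simp add: t_def)
      finally show ?thesis by (simp add: cinner_L2_simps)
    qed
    then show ?thesis by (intro exI[of _ "max N1 N2"]) blast
  qed
  have b_sym: "cinner_L2 (y n) (x' m) = cnj (cinner_L2 (y' m) (x n))" for n m
    using sym[OF x(1) x'(1)] cinner_L2_commute by metis
  have "cmod (cinner_L2 w u' - cinner_L2 u w') \<le> 4 * e" if e: "e > 0" for e
  proof -
    obtain N1 where N1: "\<And>n n' m. n \<ge> N1 \<Longrightarrow> n' \<ge> N1 \<Longrightarrow> m \<ge> N1 \<Longrightarrow> cmod (cinner_L2 (y n') (x' m) - cinner_L2 (y n) (x' m)) \<le> e"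
      using unif[OF x(1,3) x'(1,3) e] by blast
    obtain N2 where N2: "\<And>n n' m. n \<ge> N2 \<Longrightarrow> n' \<ge> N2 \<Longrightarrow> m \<ge> N2 \<Longrightarrow> cmod (cinner_L2 (y' n') (x m) - cinner_L2 (y' n) (x m)) \<le> e"
      using unif[OF x'(1,3) x(1,3) e] by blast
    have "(\<lambda>m. cinner_L2 w (x' m)) \<longlonglongrightarrow> cinner_L2 w u'" by (rule continuous_cinner_right[OF x'(2)])
    then obtain N3 where N3: "\<And>m. m \<ge> N3 \<Longrightarrow> cmod (cinner_L2 w (x' m) - cinner_L2 w u') < e"
      using LIMSEQ_D[OF _ e] by blast
    have "(\<lambda>n. cinner_L2 (x n) w') \<longlonglongrightarrow> cinner_L2 u w'" by (rule continuous_cinner_left[OF x(2)])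
    then obtain N4 where N4: "\<And>n. n \<ge> N4 \<Longrightarrow> cmod (cinner_L2 (x n) w' - cinner_L2 u w') < e"
      using LIMSEQ_D[OF _ e] by blast
    define K where "K = max (max N1 N2) (max N3 N4)"
    have K: "K \<ge> N1" "K \<ge> N2" "K \<ge> N3" "K \<ge> N4" by (auto simp: K_def)
    have 1: "cmod (cinner_L2 w (x' K) - cinner_L2 (y K) (x' K)) \<le> e"
    proof (rule LIMSEQ_le_const2)
      have "(\<lambda>n. cinner_L2 (x n) (y' K)) \<longlonglongrightarrow> cinner_L2 u (y' K)" by (rule continuous_cinner_left[OF x(2)])
      then have "(\<lambda>n. cinner_L2 (y n) (x' K)) \<longlonglongrightarrow> cinner_L2 w (x' K)"
        unfolding adj'[OF x'(1)] sym[OF x(1) x'(1)] .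
      then show "(\<lambda>n. cmod (cinner_L2 (y n) (x' K) - cinner_L2 (y K) (x' K))) \<longlonglongrightarrow> cmod (cinner_L2 w (x' K) - cinner_L2 (y K) (x' K))"
        by (intro tendsto_norm tendsto_diff tendsto_const)
      show "\<exists>N. \<forall>n\<ge>N. cmod (cinner_L2 (y n) (x' K) - cinner_L2 (y K) (x' K)) \<le> e"
        using N1[OF K(1) _ K(1)] by blast
    qed
    have 2: "cmod (cinner_L2 (x K) w' - cinner_L2 (y K) (x' K)) \<le> e"
    proof (rule LIMSEQ_le_const2)
      have "(\<lambda>m. cinner_L2 (y K) (x' m)) \<longlonglongrightarrow> cinner_L2 (y K) u'" by (rule continuous_cinner_right[OF x'(2)])
      then have "(\<lambda>m. cinner_L2 (y K) (x' m)) \<longlonglongrightarrow> cinner_L2 (x K) w'"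
        unfolding adj(2)[OF x(1)] .
      then show "(\<lambda>m. cmod (cinner_L2 (y K) (x' m) - cinner_L2 (y K) (x' K))) \<longlonglongrightarrow> cmod (cinner_L2 (x K) w' - cinner_L2 (y K) (x' K))"
        by (intro tendsto_norm tendsto_diff tendsto_const)
      have "cmod (cinner_L2 (y K) (x' m) - cinner_L2 (y K) (x' K)) \<le> e" if "m \<ge> K" for m
      proof -
        have "cmod (cinner_L2 (y K) (x' m) - cinner_L2 (y K) (x' K)) = cmod (cnj (cinner_L2 (y' m) (x K) - cinner_L2 (y' K) (x K)))"
          unfolding b_sym by simp
        also have "\<dots> \<le> e" unfolding complex_mod_cnj using that K by (intro N2) auto
        finally show ?thesis .
      qed
      then show "\<exists>N. \<forall>m\<ge>N. cmod (cinner_L2 (y K) (x' m) - cinner_L2 (y K) (x' K)) \<le> e" by blast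
    qed
    have tri: "cmod (p - s) \<le> cmod (a - p) + cmod (a - k) + cmod (c - k) + cmod (c - s)" for p s a c k
    proof -
      have "p - s = - (a - p) + (a - k) - (c - k) + (c - s)" by simp
      also have "cmod \<dots> \<le> cmod (- (a - p) + (a - k) - (c - k)) + cmod (c - s)" by (rule norm_triangle_ineq)
      also have "cmod (- (a - p) + (a - k) - (c - k)) \<le> cmod (- (a - p) + (a - k)) + cmod (c - k)" by (rule norm_triangle_ineq4)
      also have "cmod (- (a - p) + (a - k)) \<le> cmod (- (a - p)) + cmod (a - k)" by (rule norm_triangle_ineq)
      finally show ?thesis by (simp add: norm_minus_commute)
    qed
    show ?thesis
      using tri[of "cinner_L2 w u'" "cinner_L2 u w'" "cinner_L2 w (x' K)" "cinner_L2 (y K) (x' K)" "cinner_L2 (x K) w'"]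
        N3[OF K(3)] N4[OF K(4)] 1 2 by linarith
  qed
  then have "cmod (cinner_L2 w u' - cinner_L2 u w') \<le> 0 + e" if "e > 0" for e
    using that by (metis add_0 mult.commute nonzero_mult_div_cancel_right times_divide_eq_right zero_less_divide_iff zero_less_numeral zero_neq_numeral)
  then have "cmod (cinner_L2 w u' - cinner_L2 u w') \<le> 0" by (rule field_le_epsilon)
  then show ?thesis by simp
qed

section \<open>The Bessel operator on test functions\<close>

definition bessel_expr :: "real \<Rightarrow> (real \<Rightarrow> complex) \<Rightarrow> real \<Rightarrow> complex" where
  "bessel_expr \<nu> \<phi> r = - vderiv (vderiv \<phi>) r + of_real ((\<nu>\<^sup>2 - 1/4) / r\<^sup>2) * \<phi> r"

lemma bessel_minimal_eq: "bessel_minimal \<nu> = {(abs_L2 \<phi>, abs_L2 (bessel_expr \<nu> \<phi>)) | \<phi>. test_function \<phi>}"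
  by (simp add: bessel_minimal_def bessel_expr_def[abs_def])

lemma test_function_potential: "test_function \<phi> \<Longrightarrow> test_function (\<lambda>r. of_real (k / r\<^sup>2) * \<phi> r)"
  using test_function_mult[of \<phi> "\<lambda>r. of_real k / of_real r ^ 2"] csmooth_on_inverse_power[of "of_real k" 2] by simp

lemma test_function_const: "test_function \<phi> \<Longrightarrow> test_function (\<lambda>r. k * \<phi> r)"
  by (rule test_function_mult) (auto simp: csmooth_on_def csm_const)

lemma test_function_bessel_expr: "test_function \<phi> \<Longrightarrow> test_function (bessel_expr \<nu> \<phi>)"
  using test_function_diff[OF test_function_potential[of \<phi> "\<nu>\<^sup>2 - 1/4"] test_function_vderiv[OF test_function_vderiv]]
  by (simp add: bessel_expr_def[abs_def])

lemma vderiv_test_diff: "test_function \<phi> \<Longrightarrow> test_function \<psi> \<Longrightarrow> vderiv (\<lambda>r. \<phi> r - \<psi> r) = (\<lambda>r. vderiv \<phi> r - vderiv \<psi> r)"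
  by (rule ext, rule vderiv_eqI) (intro has_vector_derivative_diff test_function_deriv)

lemma vderiv_test_mult: "test_function \<phi> \<Longrightarrow> vderiv (\<lambda>r. k * \<phi> r) = (\<lambda>r. k * vderiv \<phi> r)"
  by (rule ext, rule vderiv_eqI) (intro has_vector_derivative_mult_right test_function_deriv)

lemma bessel_expr_diff: "test_function \<phi> \<Longrightarrow> test_function \<psi> \<Longrightarrow>
    bessel_expr \<nu> (\<lambda>r. \<phi> r - \<psi> r) = (\<lambda>r. bessel_expr \<nu> \<phi> r - bessel_expr \<nu> \<psi> r)"
  by (simp add: bessel_expr_def[abs_def] vderiv_test_diff test_function_vderiv fun_eq_iff right_diff_distrib diff_divide_distrib)

lemma bessel_expr_mult: "test_function \<phi> \<Longrightarrow> bessel_expr \<nu> (\<lambda>r. k * \<phi> r) = (\<lambda>r. k * bessel_expr \<nu> \<phi> r)"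
  by (simp add: bessel_expr_def[abs_def] vderiv_test_mult test_function_vderiv fun_eq_iff algebra_simps)

lemma bessel_minimal_diff:
  assumes "(x, y) \<in> bessel_minimal \<nu>" "(x', y') \<in> bessel_minimal \<nu>"
  shows "(x - x', y - y') \<in> bessel_minimal \<nu>"
proof -
  obtain \<phi> \<psi> where t: "test_function \<phi>" "test_function \<psi>" "x = abs_L2 \<phi>" "y = abs_L2 (bessel_expr \<nu> \<phi>)"
    "x' = abs_L2 \<psi>" "y' = abs_L2 (bessel_expr \<nu> \<psi>)"
    using assms by (auto simp: bessel_minimal_eq)
  have "x - x' = abs_L2 (\<lambda>r. \<phi> r - \<psi> r)" "y - y' = abs_L2 (bessel_expr \<nu> (\<lambda>r. \<phi> r - \<psi> r))"
    using t by (simp_all add: minus_abs_L2 test_function_square_integrable test_function_bessel_expr bessel_expr_diff)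
  then show ?thesis
    using test_function_diff[OF t(1,2)] by (auto simp: bessel_minimal_eq)
qed

lemma bessel_minimal_scale:
  assumes "(x, y) \<in> bessel_minimal \<nu>"
  shows "(scaleC_L2 k x, scaleC_L2 k y) \<in> bessel_minimal \<nu>"
proof -
  obtain \<phi> where t: "test_function \<phi>" "x = abs_L2 \<phi>" "y = abs_L2 (bessel_expr \<nu> \<phi>)"
    using assms by (auto simp: bessel_minimal_eq)
  have "scaleC_L2 k x = abs_L2 (\<lambda>r. k * \<phi> r)" "scaleC_L2 k y = abs_L2 (bessel_expr \<nu> (\<lambda>r. k * \<phi> r))"
    using t by (simp_all add: scaleC_abs_L2 test_function_square_integrable test_function_bessel_expr bessel_expr_mult)
  then show ?thesis
    using test_function_const[OF t(1)] by (auto simp: bessel_minimal_eq)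
qed

section \<open>Integration by parts and Hardy's inequality\<close>

lemma integral_deriv_compact:
  fixes F G :: "real \<Rightarrow> complex"
  assumes "0 < a" "\<And>r. r \<notin> {a..b} \<Longrightarrow> F r = 0" "\<And>r. r \<notin> {a..b} \<Longrightarrow> G r = 0"
    "\<And>r. r > 0 \<Longrightarrow> (F has_vector_derivative G r) (at r)" "continuous_on {0<..} G"
  shows "integral\<^sup>L half_line G = 0" "integrable half_line G"
proof -
  define a' where "a' = a / 2"
  define b' where "b' = max b a' + 1"
  have ab: "0 < a'" "a' < a" "b < b'" "a' \<le> b'" using assms(1) by (auto simp: a'_def b'_def)
  have c: "continuous_on {a'..b'} G"
    using ab by (intro continuous_on_subset[OF assms(5)]) auto
  have z: "G r = 0" if "r \<notin> {a'..b'}" for r using that ab by (intro assms(3)) auto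
  have "integral\<^sup>L half_line G = integral {a'..b'} G"
    using half_line_integral_compact(2)[OF c ab(1)] z by blast
  also have "(G has_integral F b' - F a') {a'..b'}"
  proof (rule fundamental_theorem_of_calculus[OF ab(4)])
    fix x assume "x \<in> {a'..b'}"
    then have "x > 0" using ab by auto
    from assms(4)[OF this] show "(F has_vector_derivative G x) (at x within {a'..b'})"
      by (rule has_vector_derivative_at_within)
  qed
  then have "integral {a'..b'} G = F b' - F a'" by (rule integral_unique)
  also have "\<dots> = 0" using assms(2)[of b'] assms(2)[of a'] ab by simp
  finally show "integral\<^sup>L half_line G = 0" .
  show "integrable half_line G"
    using half_line_integral_compact(1)[OF c ab(1)] z by blast
qed

lemma integrable_test_mult:
  assumes "test_function \<phi>" "continuous_on {0<..} v"
  shows "integrable half_line (\<lambda>r. \<phi> r * v r)"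
proof -
  obtain a b where ab: "0 < a" "\<And>r. r \<notin> {a..b} \<Longrightarrow> \<phi> r = 0"
    using test_function_support[OF assms(1)] by metis
  show ?thesis
    using ab by (intro half_line_integral_compact(1)[of a b] continuous_on_mult test_function_continuous[OF assms(1)]
        continuous_on_subset[OF assms(2)]) auto
qed

lemma half_line_continuous: "(\<And>r. r > 0 \<Longrightarrow> (v has_vector_derivative v' r) (at r)) \<Longrightarrow> continuous_on {0<..} v"
  by (intro continuous_at_imp_continuous_on ballI has_vector_derivative_continuous) auto

text \<open>All boundary terms vanish through the support of \<phi>, so \<open>v\<close> needs no
  decay. Taking \<open>v\<close> to be \<phi> itself yields the quadratic form; taking a solution
  yields membership in the adjoint graph.\<close>

lemma bessel_by_parts:
  assumes t: "test_function \<phi>"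
    and v: "\<And>r. r > 0 \<Longrightarrow> (v has_vector_derivative v' r) (at r)" "\<And>r. r > 0 \<Longrightarrow> (v' has_vector_derivative v'' r) (at r)"
    "continuous_on {0<..} v''"
  shows "(\<integral>r. bessel_expr \<nu> \<phi> r * cnj (v r) \<partial>half_line) = (\<integral>r. vderiv \<phi> r * cnj (v' r) \<partial>half_line)
      + of_real (\<nu>\<^sup>2 - 1/4) * (\<integral>r. \<phi> r * cnj (v r) / of_real (r\<^sup>2) \<partial>half_line)"
    "(\<integral>r. bessel_expr \<nu> \<phi> r * cnj (v r) \<partial>half_line) = (\<integral>r. \<phi> r * cnj (- v'' r + of_real ((\<nu>\<^sup>2 - 1/4) / r\<^sup>2) * v r) \<partial>half_line)"
proof -
  note t1 = test_function_vderiv[OF t]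
  note t2 = test_function_vderiv[OF t1]
  obtain a b where ab: "0 < a" "\<And>r. r \<notin> {a..b} \<Longrightarrow> \<phi> r = 0"
    using test_function_support[OF t] by metis
  have z: "vderiv \<phi> r = 0" if "r \<notin> {a..b}" for r by (rule vderiv_support(2)[OF _ that]) (rule ab(2))
  have z2: "vderiv (vderiv \<phi>) r = 0" if "r \<notin> {a..b}" for r by (rule vderiv_support(2)[OF _ that]) (rule z)
  have cv: "continuous_on {0<..} v" "continuous_on {0<..} v'" using half_line_continuous v by blast+
  have cd: "((\<lambda>r. cnj (v r)) has_vector_derivative cnj (v' r)) (at r)" "((\<lambda>r. cnj (v' r)) has_vector_derivative cnj (v'' r)) (at r)" if "r > 0" for r
    using bounded_linear.has_vector_derivative[OF bounded_linear_cnj] v that by blast+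
  have cc: "continuous_on {0<..} (\<lambda>r. cnj (v r))" "continuous_on {0<..} (\<lambda>r. cnj (v' r))" "continuous_on {0<..} (\<lambda>r. cnj (v'' r))"
    by (intro continuous_on_cnj cv v(3))+
  have cp: "continuous_on {0<..} (\<lambda>r. of_real ((\<nu>\<^sup>2 - 1/4) / r\<^sup>2) * cnj (v r))"
    by (intro continuous_on_mult continuous_on_of_real continuous_on_divide continuous_on_power continuous_on_const continuous_on_id cc) auto
  note int = integrable_test_mult[OF t2 cc(1)] integrable_test_mult[OF t1 cc(2)] integrable_test_mult[OF t cc(3)] integrable_test_mult[OF t cp]
  have 1: "(\<integral>r. vderiv \<phi> r * cnj (v' r) + vderiv (vderiv \<phi>) r * cnj (v r) \<partial>half_line) = 0"
    by (rule integral_deriv_compact(1)[OF ab(1), where F = "\<lambda>r. vderiv \<phi> r * cnj (v r)"])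
      (use z z2 in \<open>auto intro!: has_vector_derivative_mult cd test_function_deriv t1 continuous_on_add continuous_on_mult
        test_function_continuous[OF t1] test_function_continuous[OF t2] cc\<close>)
  have 2: "(\<integral>r. \<phi> r * cnj (v'' r) + vderiv \<phi> r * cnj (v' r) \<partial>half_line) = 0"
    by (rule integral_deriv_compact(1)[OF ab(1), where F = "\<lambda>r. \<phi> r * cnj (v' r)"])
      (use z ab in \<open>auto intro!: has_vector_derivative_mult cd test_function_deriv t continuous_on_add continuous_on_mult
        test_function_continuous[OF t1] test_function_continuous[OF t] cc\<close>)
  have A: "(\<integral>r. vderiv (vderiv \<phi>) r * cnj (v r) \<partial>half_line) = - (\<integral>r. vderiv \<phi> r * cnj (v' r) \<partial>half_line)"
    using 1 int by (simp add: eq_neg_iff_add_eq_0 add.commute)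
  have B: "(\<integral>r. vderiv \<phi> r * cnj (v' r) \<partial>half_line) = - (\<integral>r. \<phi> r * cnj (v'' r) \<partial>half_line)"
    using 2 int by (simp add: eq_neg_iff_add_eq_0 add.commute)
  have P: "(\<integral>r. bessel_expr \<nu> \<phi> r * cnj (v r) \<partial>half_line) = (\<integral>r. \<phi> r * (of_real ((\<nu>\<^sup>2 - 1/4) / r\<^sup>2) * cnj (v r)) - vderiv (vderiv \<phi>) r * cnj (v r) \<partial>half_line)"
    by (rule Bochner_Integration.integral_cong) (simp_all add: bessel_expr_def algebra_simps)
  also have "\<dots> = (\<integral>r. \<phi> r * (of_real ((\<nu>\<^sup>2 - 1/4) / r\<^sup>2) * cnj (v r)) \<partial>half_line) + (\<integral>r. vderiv \<phi> r * cnj (v' r) \<partial>half_line)"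
    using int A by simp
  finally have Q: "(\<integral>r. bessel_expr \<nu> \<phi> r * cnj (v r) \<partial>half_line) = (\<integral>r. \<phi> r * (of_real ((\<nu>\<^sup>2 - 1/4) / r\<^sup>2) * cnj (v r)) \<partial>half_line) + (\<integral>r. vderiv \<phi> r * cnj (v' r) \<partial>half_line)" .
  have "(\<integral>r. \<phi> r * (of_real ((\<nu>\<^sup>2 - 1/4) / r\<^sup>2) * cnj (v r)) \<partial>half_line) = (\<integral>r. of_real (\<nu>\<^sup>2 - 1/4) * (\<phi> r * cnj (v r) / of_real (r\<^sup>2)) \<partial>half_line)"
    by (rule Bochner_Integration.integral_cong) (simp_all add: of_real_divide)
  then show "(\<integral>r. bessel_expr \<nu> \<phi> r * cnj (v r) \<partial>half_line) = (\<integral>r. vderiv \<phi> r * cnj (v' r) \<partial>half_line)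
      + of_real (\<nu>\<^sup>2 - 1/4) * (\<integral>r. \<phi> r * cnj (v r) / of_real (r\<^sup>2) \<partial>half_line)"
    unfolding Q by (simp only: integral_mult_right_zero add.commute)
  have "(\<integral>r. \<phi> r * cnj (- v'' r + of_real ((\<nu>\<^sup>2 - 1/4) / r\<^sup>2) * v r) \<partial>half_line)
     = (\<integral>r. \<phi> r * (of_real ((\<nu>\<^sup>2 - 1/4) / r\<^sup>2) * cnj (v r)) - \<phi> r * cnj (v'' r) \<partial>half_line)"
    by (rule Bochner_Integration.integral_cong) (simp_all add: algebra_simps)
  also have "\<dots> = (\<integral>r. \<phi> r * (of_real ((\<nu>\<^sup>2 - 1/4) / r\<^sup>2) * cnj (v r)) \<partial>half_line) - (\<integral>r. \<phi> r * cnj (v'' r) \<partial>half_line)"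
    using int by simp
  finally show "(\<integral>r. bessel_expr \<nu> \<phi> r * cnj (v r) \<partial>half_line) = (\<integral>r. \<phi> r * cnj (- v'' r + of_real ((\<nu>\<^sup>2 - 1/4) / r\<^sup>2) * v r) \<partial>half_line)"
    unfolding Q B by simp
qed

lemma bessel_minimal_symmetric:
  assumes "(x, y) \<in> bessel_minimal \<nu>" "(x', y') \<in> bessel_minimal \<nu>"
  shows "cinner_L2 y x' = cinner_L2 x y'"
proof -
  obtain \<phi> \<psi> where t: "test_function \<phi>" "test_function \<psi>" "x = abs_L2 \<phi>" "y = abs_L2 (bessel_expr \<nu> \<phi>)"
    "x' = abs_L2 \<psi>" "y' = abs_L2 (bessel_expr \<nu> \<psi>)"
    using assms by (auto simp: bessel_minimal_eq)
  note v = test_function_deriv[OF t(2)] test_function_deriv[OF test_function_vderiv[OF t(2)]]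
    test_function_continuous[OF test_function_vderiv[OF test_function_vderiv[OF t(2)]]]
  have e: "- vderiv (vderiv \<psi>) r + of_real ((\<nu>\<^sup>2 - 1/4) / r\<^sup>2) * \<psi> r = bessel_expr \<nu> \<psi> r" for r
    by (simp only: bessel_expr_def)
  note si = test_function_square_integrable[OF t(1)] test_function_square_integrable[OF t(2)]
    test_function_square_integrable[OF test_function_bessel_expr[OF t(1)]] test_function_square_integrable[OF test_function_bessel_expr[OF t(2)]]
  show ?thesis
    unfolding t(3-6) cinner_abs_L2[OF si(3,2)] cinner_abs_L2[OF si(1,4)] by (rule bessel_by_parts(2)[OF t(1) v, of \<nu>, unfolded e])
qed

lemma bessel_form:
  assumes t: "test_function \<phi>"
  shows "cinner_L2 (abs_L2 (bessel_expr \<nu> \<phi>)) (abs_L2 \<phi>) = of_real ((norm (abs_L2 (vderiv \<phi>)))\<^sup>2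
     + (\<nu>\<^sup>2 - 1/4) * (norm (abs_L2 (\<lambda>r. \<phi> r / of_real r)))\<^sup>2)"
proof -
  note v = test_function_deriv[OF t] test_function_deriv[OF test_function_vderiv[OF t]]
    test_function_continuous[OF test_function_vderiv[OF test_function_vderiv[OF t]]]
  note si = test_function_square_integrable[OF test_function_vderiv[OF t]] test_function_square_integrable[OF test_function_divide_r[OF t]]
  have "of_real ((norm (abs_L2 (vderiv \<phi>)))\<^sup>2) = (\<integral>r. vderiv \<phi> r * cnj (vderiv \<phi> r) \<partial>half_line)"
    by (simp only: cinner_L2_self[symmetric] cinner_abs_L2[OF si(1) si(1)])
  moreover have "complex_of_real ((norm (abs_L2 (\<lambda>r. \<phi> r / of_real r)))\<^sup>2) = (\<integral>r. (\<phi> r / of_real r) * cnj (\<phi> r / of_real r) \<partial>half_line)"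
    by (simp only: cinner_L2_self[symmetric] cinner_abs_L2[OF si(2) si(2)])
  moreover have "(\<integral>r. (\<phi> r / of_real r) * cnj (\<phi> r / of_real r) \<partial>half_line) = (\<integral>r. \<phi> r * cnj (\<phi> r) / of_real (r\<^sup>2) \<partial>half_line)"
    by (rule Bochner_Integration.integral_cong) (simp_all add: power2_eq_square)
  ultimately show ?thesis
    using bessel_by_parts(1)[OF t v, of \<nu>] test_function_square_integrable[OF t] test_function_square_integrable[OF test_function_bessel_expr[OF t]]
    by (simp add: cinner_abs_L2)
qed

lemma hardy_test:
  assumes t: "test_function \<phi>"
  shows "(norm (abs_L2 (\<lambda>r. \<phi> r / of_real r)))\<^sup>2 / 4 \<le> (norm (abs_L2 (vderiv \<phi>)))\<^sup>2"
proof -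
  note t1 = test_function_vderiv[OF t]
  obtain a b where ab: "0 < a" "\<And>r. r \<notin> {a..b} \<Longrightarrow> \<phi> r = 0"
    using test_function_support[OF t] by metis
  have z: "vderiv \<phi> r = 0" if "r \<notin> {a..b}" for r by (rule vderiv_support(2)[OF _ that]) (rule ab(2))
  \<comment> \<open>The derivative of |\<phi>|^2/(2r), whose integral is 0. Subtracting it from
    |\<phi>'|^2 - |\<phi>/r|^2/4 leaves at least the square of |\<phi>'| - |\<phi>|/(2r).\<close>
  define G :: "real \<Rightarrow> complex" where "G r = of_real (2 * Re (vderiv \<phi> r * cnj (\<phi> r)) * (1 / (2 * r)) + (- 1 / (2 * r\<^sup>2)) * (cmod (\<phi> r))\<^sup>2)" for r
  have G: "integral\<^sup>L half_line G = (0::complex)" "integrable half_line G"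
  proof -
    have 1: "((\<lambda>r. complex_of_real ((cmod (\<phi> r))\<^sup>2 * (1 / (2 * r)))) has_vector_derivative G r) (at r)" if r: "r > 0" for r
      unfolding G_def
    proof (rule has_vector_derivative_of_real, rule DERIV_mult)
      show "((\<lambda>r. (cmod (\<phi> r))\<^sup>2) has_real_derivative 2 * Re (vderiv \<phi> r * cnj (\<phi> r))) (at r)"
        by (rule norm_square_deriv[OF test_function_deriv[OF t]])
      show "((\<lambda>r. 1 / (2 * r)) has_real_derivative - 1 / (2 * r\<^sup>2)) (at r)"
        using r by (auto intro!: derivative_eq_intros simp: power2_eq_square)
    qed
    have 2: "continuous_on {0<..} G"
      unfolding G_def
      by (intro continuous_on_of_real continuous_on_add continuous_on_mult continuous_on_divide continuous_on_const continuous_on_Re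
          continuous_on_cnj continuous_on_power continuous_on_norm continuous_on_id test_function_continuous[OF t] test_function_continuous[OF t1]) auto
    show "integral\<^sup>L half_line G = 0" "integrable half_line G"
    proof -
      have 3: "complex_of_real ((cmod (\<phi> r))\<^sup>2 * (1 / (2 * r))) = 0" if "r \<notin> {a..b}" for r
        by (simp add: ab(2)[OF that])
      have 4: "G r = 0" if "r \<notin> {a..b}" for r
        by (simp add: G_def ab(2)[OF that] z[OF that])
      show "integral\<^sup>L half_line G = 0" "integrable half_line G"
        by (rule integral_deriv_compact[OF ab(1) 3 4 1 2], assumption+)+
    qed
  qed
  have si: "square_integrable (vderiv \<phi>)" "square_integrable (\<lambda>r. \<phi> r / of_real r)"
    using test_function_square_integrable[OF t1] test_function_square_integrable[OF test_function_divide_r[OF t]] by auto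
  have i: "integrable half_line (\<lambda>r. (cmod (vderiv \<phi> r))\<^sup>2)" "integrable half_line (\<lambda>r. (cmod (\<phi> r / of_real r))\<^sup>2)"
    using si by (auto simp: square_integrable_def)
  have ReG: "integrable half_line (\<lambda>r. Re (G r))" "(\<integral>r. Re (G r) \<partial>half_line) = 0"
    using G by auto
  have "0 \<le> (\<integral>r. (cmod (vderiv \<phi> r))\<^sup>2 - (cmod (\<phi> r / of_real r))\<^sup>2 / 4 - Re (G r) \<partial>half_line)"
  proof (rule Bochner_Integration.integral_nonneg_AE, rule AE_half_lineI)
    fix r :: real assume r: "r > 0"
    define S where "S = Re (vderiv \<phi> r * cnj (\<phi> r))"
    have "S \<le> cmod (vderiv \<phi> r) * cmod (\<phi> r)"
      unfolding S_def using complex_Re_le_cmod[of "vderiv \<phi> r * cnj (\<phi> r)"] by (simp add: norm_mult)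
    then have "S / r \<le> cmod (vderiv \<phi> r) * cmod (\<phi> r) / r" using r by (simp add: divide_right_mono)
    moreover have "0 \<le> (cmod (vderiv \<phi> r) - cmod (\<phi> r) / (2 * r))\<^sup>2" by simp
    ultimately have "0 \<le> (cmod (vderiv \<phi> r))\<^sup>2 - S / r + (cmod (\<phi> r))\<^sup>2 / (4 * r\<^sup>2)"
      by (simp add: power2_diff power_divide power_mult_distrib)
    also have "\<dots> = (cmod (vderiv \<phi> r))\<^sup>2 - (cmod (\<phi> r / of_real r))\<^sup>2 / 4 - Re (G r)"
      using r by (simp add: G_def S_def norm_divide power_divide field_simps)
    finally show "0 \<le> (cmod (vderiv \<phi> r))\<^sup>2 - (cmod (\<phi> r / of_real r))\<^sup>2 / 4 - Re (G r)" .
  qed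
  then show ?thesis
    using i ReG by (simp add: norm_abs_L2[OF si(1)] norm_abs_L2[OF si(2)])
qed

text \<open>The potential is never below -1/4 times r^(-2), and 1/4 is exactly the constant in
  Hardy's inequality.\<close>

lemma bessel_minimal_nonneg:
  assumes "(x, y) \<in> bessel_minimal \<nu>"
  shows "0 \<le> Re (cinner_L2 y x)"
proof -
  obtain \<phi> where t: "test_function \<phi>" "x = abs_L2 \<phi>" "y = abs_L2 (bessel_expr \<nu> \<phi>)"
    using assms by (auto simp: bessel_minimal_eq)
  have "0 \<le> \<nu>\<^sup>2 * (norm (abs_L2 (\<lambda>r. \<phi> r / of_real r)))\<^sup>2" by simp
  then show ?thesis
    unfolding t bessel_form[OF t(1)] Re_complex_of_real using hardy_test[OF t(1)] by (simp only: left_diff_distrib)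
qed

lemma bessel_operator_symmetric:
  assumes "(u, w) \<in> bessel_operator \<nu>" "(u', w') \<in> bessel_operator \<nu>"
  shows "cinner_L2 w u' = cinner_L2 u w'"
proof (rule friedrichs_symmetric)
  show "(u, w) \<in> friedrichs (bessel_minimal \<nu>)" "(u', w') \<in> friedrichs (bessel_minimal \<nu>)"
    using assms by (simp_all add: bessel_operator_def)
qed (fact bessel_minimal_diff bessel_minimal_scale bessel_minimal_symmetric bessel_minimal_nonneg)+

section \<open>The resolvent of the Bessel operator\<close>

text \<open>Cutoffs in the variable ln r. Their derivatives are bounded by M/r uniformly in
  \<open>n\<close>, so in (\<omega> u)' = \<omega> u' + \<omega>' u the last term is dominated by a
  multiple of u/r and tends to 0 in L^2.\<close>

lemma cutoff_functions:
  obtains \<omega> :: "nat \<Rightarrow> real \<Rightarrow> complex" and M where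
    "\<And>n. csmooth_on {0<..} (\<omega> n)" "\<And>n. \<exists>a b. 0 < a \<and> (\<forall>r. r \<notin> {a..b} \<longrightarrow> \<omega> n r = 0)" "M \<ge> 0"
    "\<And>n r. cmod (\<omega> n r) \<le> M" "\<And>n r. r > 0 \<Longrightarrow> cmod (vderiv (\<omega> n) r) \<le> M / r"
    "\<And>r. r > 0 \<Longrightarrow> (\<lambda>n. \<omega> n r) \<longlonglongrightarrow> 1" "\<And>r. r > 0 \<Longrightarrow> (\<lambda>n. vderiv (\<omega> n) r) \<longlonglongrightarrow> 0"
proof -
  \<comment> \<open>The factor exp 2 makes \<eta> equal to 1 at 0, where both copies of
    \<open>cutoff_exp\<close> have the value exp(-1).\<close>
  define \<eta> where "\<eta> t = of_real (exp 2) * (of_real (cutoff_exp (1 * t + 1)) * complex_of_real (cutoff_exp (- 1 * t + 1)))" for t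
  have \<eta>s: "csm n UNIV \<eta>" for n
    unfolding \<eta>_def[abs_def] by (intro csm_mult csm_const csm_cutoff_affine) auto
  have \<eta>0: "\<eta> t = 0" if "t \<notin> {-1..1}" for t using that by (auto simp: \<eta>_def cutoff_exp_def)
  have \<eta>1: "\<eta> 0 = 1"
    by (simp add: \<eta>_def cutoff_exp_def flip: exp_add exp_of_real)
  have d: "\<eta> differentiable (at t)" for t using \<eta>s[of 1] by simp
  have d1: "vderiv \<eta> differentiable (at t)" for t using \<eta>s[of "Suc 1"] by simp
  have c: "continuous_on S \<eta>" "continuous_on S (vderiv \<eta>)" for S
    by (auto intro!: continuous_at_imp_continuous_on differentiable_imp_continuous_within d d1)
  have \<eta>'0: "vderiv \<eta> t = 0" if "t \<notin> {-1..1}" for t by (rule vderiv_support(2)[OF _ that]) (rule \<eta>0)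
  have "bounded (\<eta> ` {-1..1})" "bounded (vderiv \<eta> ` {-1..1})"
    by (intro compact_imp_bounded compact_continuous_image c compact_Icc)+
  then obtain M1 M2 where M12: "\<And>t. t \<in> {-1..1} \<Longrightarrow> cmod (\<eta> t) \<le> M1" "\<And>t. t \<in> {-1..1} \<Longrightarrow> cmod (vderiv \<eta> t) \<le> M2"
    unfolding bounded_iff by blast
  define M where "M = \<bar>M1\<bar> + \<bar>M2\<bar>"
  have M: "cmod (\<eta> t) \<le> M" "cmod (vderiv \<eta> t) \<le> M" for t
    using M12[of t] \<eta>0[of t] \<eta>'0[of t] unfolding M_def by (cases "t \<in> {-1..1}"; force)+
  have M0: "M \<ge> 0" by (simp add: M_def)
  define \<omega> where "\<omega> n r = (if r > 0 then \<eta> (ln r / real (Suc n)) else 0)" for n r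
  have hd: "((\<lambda>r. ln r / real (Suc n)) has_real_derivative 1 / (r * real (Suc n))) (at r)" if "r > 0" for n r
    using DERIV_cdivide[OF DERIV_ln_divide[OF that], of "real (Suc n)"] by (simp del: of_nat_Suc)
  have csm1: "csm m {0<..} (\<lambda>r. of_real (1 / (r * real (Suc n))))" for m n
    using csmooth_on_inverse_power[of "1 / of_nat (Suc n)" 1] unfolding csmooth_on_def by (simp add: field_simps)
  have comp: "csm m {0<..} (\<lambda>r. \<eta> (ln r / real (Suc n)))" for m n
    by (rule csm_compose[where h' = "\<lambda>r. 1 / (r * real (Suc n))" and T = UNIV and f = \<eta>, OF _ _ _ csm1 \<eta>s]) (use hd in auto)
  have \<omega>s: "csm m {0<..} (\<omega> n)" for m n
    by (rule csm_cong[OF _ _ comp]) (auto simp: \<omega>_def)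
  have \<omega>': "vderiv (\<omega> n) r = of_real (1 / (r * real (Suc n))) * vderiv \<eta> (ln r / real (Suc n))" if r: "r > 0" for n r
  proof (rule vderiv_eqI, rule has_vector_derivative_cong_open[of "{0<..}"])
    have "(\<eta> \<circ> (\<lambda>r. ln r / real (Suc n)) has_vector_derivative (1 / (r * real (Suc n))) *\<^sub>R vderiv \<eta> (ln r / real (Suc n))) (at r)"
      by (rule vector_diff_chain_at) (use hd[OF r] has_vderiv[OF d] in \<open>auto simp: has_real_derivative_iff_has_vector_derivative\<close>)
    then show "((\<lambda>r. \<eta> (ln r / real (Suc n))) has_vector_derivative of_real (1 / (r * real (Suc n))) * vderiv \<eta> (ln r / real (Suc n))) (at r)"
      by (simp only: o_def scaleR_conv_of_real)
  qed (use r in \<open>auto simp: \<omega>_def\<close>)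
  have arg: "(\<lambda>n. ln r / real (Suc n)) \<longlonglongrightarrow> 0" for r
    using tendsto_mult[OF tendsto_const[of "ln r"] LIMSEQ_inverse_real_of_nat] by (simp add: divide_inverse)
  show ?thesis
  proof (rule that[of \<omega> M])
    show "csmooth_on {0<..} (\<omega> n)" for n using \<omega>s by (simp add: csmooth_on_def)
    show "\<exists>a b. 0 < a \<and> (\<forall>r. r \<notin> {a..b} \<longrightarrow> \<omega> n r = 0)" for n
    proof (intro exI conjI allI impI)
      show "0 < exp (- real (Suc n))" by simp
      fix r assume r: "r \<notin> {exp (- real (Suc n))..exp (real (Suc n))}"
      show "\<omega> n r = 0"
      proof (cases "r > 0")
        case True
        have "ln r / real (Suc n) \<notin> {-1..1}"
        proof
          assume "ln r / real (Suc n) \<in> {-1..1}"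
          then have "- real (Suc n) \<le> ln r" "ln r \<le> real (Suc n)" by (auto simp: divide_simps)
          then have "exp (- real (Suc n)) \<le> r" "r \<le> exp (real (Suc n))"
            using True by (metis exp_le_cancel_iff exp_ln)+
          then show False using r by simp
        qed
        then show ?thesis using \<eta>0 by (simp add: \<omega>_def)
      qed (simp add: \<omega>_def)
    qed
    show "cmod (\<omega> n r) \<le> M" for n r using M M0 by (simp add: \<omega>_def)
    show "cmod (vderiv (\<omega> n) r) \<le> M / r" if r: "r > 0" for n r
    proof -
      have "cmod (vderiv (\<omega> n) r) = 1 / (r * real (Suc n)) * cmod (vderiv \<eta> (ln r / real (Suc n)))"
        unfolding \<omega>'[OF r] norm_mult norm_of_real using r by simp
      also have "\<dots> \<le> 1 / r * M"
        using r M by (intro mult_mono) (auto simp: divide_simps)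
      finally show ?thesis by simp
    qed
    show "(\<lambda>n. \<omega> n r) \<longlonglongrightarrow> 1" if r: "r > 0" for r
    proof -
      have "isCont \<eta> 0" by (rule differentiable_imp_continuous_within[OF d])
      then have "(\<lambda>n. \<eta> (ln r / real (Suc n))) \<longlonglongrightarrow> \<eta> 0"
        by (rule isCont_tendsto_compose[OF _ arg])
      then show ?thesis using r by (simp add: \<omega>_def \<eta>1)
    qed
    show "(\<lambda>n. vderiv (\<omega> n) r) \<longlonglongrightarrow> 0" if r: "r > 0" for r
    proof -
      have "isCont (vderiv \<eta>) 0" by (rule differentiable_imp_continuous_within[OF d1])
      then have 1: "(\<lambda>n. vderiv \<eta> (ln r / real (Suc n))) \<longlonglongrightarrow> vderiv \<eta> 0"
        by (rule isCont_tendsto_compose[OF _ arg])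
      have 2: "(\<lambda>n. complex_of_real (1 / r * inverse (real (Suc n)))) \<longlonglongrightarrow> of_real (1 / r * 0)"
        by (intro tendsto_of_real tendsto_mult tendsto_const LIMSEQ_inverse_real_of_nat)
      have "(\<lambda>n. complex_of_real (1 / r * inverse (real (Suc n))) * vderiv \<eta> (ln r / real (Suc n))) \<longlonglongrightarrow> of_real (1 / r * 0) * vderiv \<eta> 0"
        by (rule tendsto_mult[OF 2 1])
      then show ?thesis unfolding \<omega>'[OF r] by (simp add: divide_inverse)
    qed
  qed (rule M0)
qed

lemma square_integrable_norm: "square_integrable f \<Longrightarrow> square_integrable (\<lambda>r. of_real (cmod (f r)))"
  unfolding square_integrable_def by (auto simp: norm_mult)

text \<open>The form is the squared norm of u' plus a multiple of that of u/r, and logarithmic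
  cutoffs converge in both norms. This settles the boundary condition at 0: for 0 < \<nu> < 1 the
  other local solution r^(1/2 - \<nu>) is also square integrable there, but it is not after division
  by r.\<close>

lemma form_domain_bessel:
  assumes u: "\<And>r. r > 0 \<Longrightarrow> (u has_vector_derivative u' r) (at r)" "continuous_on {0<..} u'"
    and smooth: "csmooth_on {0<..} u"
    and si: "square_integrable u" "square_integrable u'" "square_integrable (\<lambda>r. u r / of_real r)"
  shows "abs_L2 u \<in> form_domain (bessel_minimal \<nu>)"
proof (rule cutoff_functions)
  fix \<omega> :: "nat \<Rightarrow> real \<Rightarrow> complex" and M
  assume \<omega>: "\<And>n. csmooth_on {0<..} (\<omega> n)" "\<And>n. \<exists>a b. 0 < a \<and> (\<forall>r. r \<notin> {a..b} \<longrightarrow> \<omega> n r = 0)" and M: "M \<ge> 0"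
    "\<And>n r. cmod (\<omega> n r) \<le> M" "\<And>n r. r > 0 \<Longrightarrow> cmod (vderiv (\<omega> n) r) \<le> M / r"
    and lim: "\<And>r. r > 0 \<Longrightarrow> (\<lambda>n. \<omega> n r) \<longlonglongrightarrow> 1" "\<And>r. r > 0 \<Longrightarrow> (\<lambda>n. vderiv (\<omega> n) r) \<longlonglongrightarrow> 0"
  define x where "x n r = \<omega> n r * u r" for n r
  have t: "test_function (x n)" for n
  proof -
    obtain a b where ab: "0 < a" "\<And>r. r \<notin> {a..b} \<Longrightarrow> \<omega> n r = 0" using \<omega>(2)[of n] by blast
    have "csmooth_on {0<..} (x n)"
      using csm_mult[of "{0<..}"] \<omega>(1)[of n] smooth unfolding x_def[abs_def] csmooth_on_def by auto
    then show ?thesis using ab by (intro test_functionI[of _ a b]) (auto simp: x_def)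
  qed
  have xd: "vderiv (x n) r = \<omega> n r * u' r + vderiv (\<omega> n) r * u r" if r: "r > 0" for n r
  proof -
    have "\<omega> n differentiable (at r)" using \<omega>(1)[of n] r unfolding csmooth_on_def by (auto dest: spec[of _ "Suc 0"])
    from has_vderiv[OF this] show ?thesis
      unfolding x_def[abs_def] by (intro vderiv_eqI has_vector_derivative_mult u(1)[OF r])
  qed
  note t1 = test_function_vderiv[OF t] and tr = test_function_divide_r[OF t]
  note si' = test_function_square_integrable[OF t] test_function_square_integrable[OF t1] test_function_square_integrable[OF tr]
  have m: "\<And>n. x n \<in> borel_measurable half_line" "\<And>n. vderiv (x n) \<in> borel_measurable half_line"
    "\<And>n. (\<lambda>r. x n r / of_real r) \<in> borel_measurable half_line" "u \<in> borel_measurable half_line" "u' \<in> borel_measurable half_line"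
    "(\<lambda>r. u r / of_real r) \<in> borel_measurable half_line"
    using si si' by (auto simp: square_integrable_def)
  have L1: "(\<lambda>n. abs_L2 (x n)) \<longlonglongrightarrow> abs_L2 u"
  proof (rule L2_dominated(3)[OF m(4) square_integrable_mult[OF si(1), of "of_real M"] m(1)])
    show "AE r in half_line. (\<lambda>n. x n r) \<longlonglongrightarrow> u r"
      by (rule AE_half_lineI) (use tendsto_mult[OF lim(1) tendsto_const] in \<open>fastforce simp: x_def\<close>)
    show "AE r in half_line. cmod (x n r) \<le> cmod (of_real M * u r)" for n
      by (rule AE_half_lineI) (use M in \<open>auto simp: x_def norm_mult intro!: mult_right_mono\<close>)
  qed
  have L2: "(\<lambda>n. abs_L2 (\<lambda>r. x n r / of_real r)) \<longlonglongrightarrow> abs_L2 (\<lambda>r. u r / of_real r)"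
  proof (rule L2_dominated(3)[OF m(6) square_integrable_mult[OF si(3), of "of_real M"] m(3)])
    show "AE r in half_line. (\<lambda>n. x n r / of_real r) \<longlonglongrightarrow> u r / of_real r"
    proof (rule AE_half_lineI)
      fix r :: real assume "r > 0"
      from tendsto_mult[OF lim(1)[OF this] tendsto_const[of "u r / of_real r"]]
      show "(\<lambda>n. x n r / of_real r) \<longlonglongrightarrow> u r / of_real r" by (simp add: x_def)
    qed
    show "AE r in half_line. cmod (x n r / of_real r) \<le> cmod (of_real M * (u r / of_real r))" for n
      by (rule AE_half_lineI) (use M in \<open>auto simp: x_def norm_mult norm_divide intro!: mult_right_mono divide_right_mono\<close>)
  qed
  have L3: "(\<lambda>n. abs_L2 (vderiv (x n))) \<longlonglongrightarrow> abs_L2 u'"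
  proof (rule L2_dominated(3)[OF m(5) _ m(2)])
    show "square_integrable (\<lambda>r. of_real M * of_real (cmod (u' r)) + of_real M * of_real (cmod (u r / of_real r)))"
      by (intro square_integrable_add square_integrable_mult square_integrable_norm si)
    show "AE r in half_line. (\<lambda>n. vderiv (x n) r) \<longlonglongrightarrow> u' r"
    proof (rule AE_half_lineI)
      fix r :: real assume r: "r > 0"
      have "(\<lambda>n. \<omega> n r * u' r + vderiv (\<omega> n) r * u r) \<longlonglongrightarrow> 1 * u' r + 0 * u r"
        by (intro tendsto_add tendsto_mult tendsto_const lim r)
      then show "(\<lambda>n. vderiv (x n) r) \<longlonglongrightarrow> u' r" by (simp add: xd[OF r])
    qed
    show "AE r in half_line. cmod (vderiv (x n) r) \<le> cmod (of_real M * of_real (cmod (u' r)) + of_real M * of_real (cmod (u r / of_real r)))" for n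
    proof (rule AE_half_lineI)
      fix r :: real assume r: "r > 0"
      have "cmod (vderiv (x n) r) \<le> M * cmod (u' r) + M / r * cmod (u r)"
        unfolding xd[OF r] by (rule norm_triangle_le, unfold norm_mult, intro add_mono mult_right_mono M r) auto
      also have "\<dots> = M * cmod (u' r) + M * cmod (u r / of_real r)" using r by (simp add: norm_divide)
      also have "\<dots> \<le> cmod (of_real (M * cmod (u' r) + M * cmod (u r / of_real r)))"
        unfolding norm_of_real by simp
      finally show "cmod (vderiv (x n) r) \<le> cmod (of_real M * of_real (cmod (u' r)) + of_real M * of_real (cmod (u r / of_real r)))"
        by (simp only: of_real_add of_real_mult)
    qed
  qed
  define c where "c = \<nu>\<^sup>2 - 1/4"
  have form: "cinner_L2 (abs_L2 (bessel_expr \<nu> (x m)) - abs_L2 (bessel_expr \<nu> (x n))) (abs_L2 (x m) - abs_L2 (x n))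
    = of_real ((norm (abs_L2 (vderiv (x m)) - abs_L2 (vderiv (x n))))\<^sup>2 + c * (norm (abs_L2 (\<lambda>r. x m r / of_real r) - abs_L2 (\<lambda>r. x n r / of_real r)))\<^sup>2)" for m n
  proof -
    note b = bessel_form[OF test_function_diff[OF t t], of \<nu> m n]
    show ?thesis
      using b by (simp add: minus_abs_L2 si' test_function_square_integrable test_function_bessel_expr t bessel_expr_diff vderiv_test_diff
          diff_divide_distrib c_def)
  qed
  have cauchy: "\<exists>N. \<forall>m\<ge>N. \<forall>n\<ge>N. norm (X m - X n) < e" if "X \<longlonglongrightarrow> l" "e > 0" for X :: "nat \<Rightarrow> L2" and l e
    using LIMSEQ_imp_Cauchy[OF that(1)] that(2) unfolding Cauchy_def dist_norm by blast
  show ?thesis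
    unfolding form_domain_def
  proof (rule CollectI, rule exI[of _ "\<lambda>n. abs_L2 (x n)"], rule exI[of _ "\<lambda>n. abs_L2 (bessel_expr \<nu> (x n))"], intro conjI allI impI)
    show "(abs_L2 (x n), abs_L2 (bessel_expr \<nu> (x n))) \<in> bessel_minimal \<nu>" for n
      using t by (auto simp: bessel_minimal_eq)
    show "(\<lambda>n. abs_L2 (x n)) \<longlonglongrightarrow> abs_L2 u" by (rule L1)
    fix e :: real assume e: "e > 0"
    \<comment> \<open>The bound by 1 turns \<open>y < d\<close> into y^2 <= d; the second argument
      leaves room for the factor 1 + |c|.\<close>
    define d where "d = min 1 (e / (2 * (1 + \<bar>c\<bar>)))"
    have d: "d > 0" "d \<le> 1" "d * (1 + \<bar>c\<bar>) < e"
    proof -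
      show "d > 0" using e by (simp add: d_def add_pos_nonneg)
      have "d * (1 + \<bar>c\<bar>) \<le> e / (2 * (1 + \<bar>c\<bar>)) * (1 + \<bar>c\<bar>)"
        by (intro mult_right_mono) (auto simp: d_def)
      also have "\<dots> = e / 2" by (simp add: field_simps)
      finally show "d * (1 + \<bar>c\<bar>) < e" using e by simp
    qed (simp add: d_def)
    obtain N1 where N1: "\<And>m n. m \<ge> N1 \<Longrightarrow> n \<ge> N1 \<Longrightarrow> norm (abs_L2 (vderiv (x m)) - abs_L2 (vderiv (x n))) < d"
      using cauchy[OF L3 d(1)] by blast
    obtain N2 where N2: "\<And>m n. m \<ge> N2 \<Longrightarrow> n \<ge> N2 \<Longrightarrow> norm (abs_L2 (\<lambda>r. x m r / of_real r) - abs_L2 (\<lambda>r. x n r / of_real r)) < d"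
      using cauchy[OF L2 d(1)] by blast
    have "cmod (cinner_L2 (abs_L2 (bessel_expr \<nu> (x m)) - abs_L2 (bessel_expr \<nu> (x n))) (abs_L2 (x m) - abs_L2 (x n))) < e"
      if mn: "m \<ge> max N1 N2" "n \<ge> max N1 N2" for m n
    proof -
      have sq: "y\<^sup>2 \<le> d" if "0 \<le> y" "y < d" for y
      proof -
        have "y * y \<le> 1 * d" using that d by (intro mult_mono) auto
        then show ?thesis by (simp add: power2_eq_square)
      qed
      have 1: "(norm (abs_L2 (vderiv (x m)) - abs_L2 (vderiv (x n))))\<^sup>2 \<le> d" by (rule sq) (use N1 mn in auto)
      have 2: "(norm (abs_L2 (\<lambda>r. x m r / of_real r) - abs_L2 (\<lambda>r. x n r / of_real r)))\<^sup>2 \<le> d" by (rule sq) (use N2 mn in auto)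
      have "\<bar>A + c * B\<bar> \<le> d * (1 + \<bar>c\<bar>)" if "0 \<le> A" "A \<le> d" "0 \<le> B" "B \<le> d" for A B
      proof -
        have "\<bar>A + c * B\<bar> \<le> A + \<bar>c\<bar> * B" using that abs_triangle_ineq[of A "c * B"] by (simp add: abs_mult)
        also have "\<dots> \<le> d + \<bar>c\<bar> * d" using that by (intro add_mono mult_left_mono) auto
        finally show ?thesis by (simp add: algebra_simps)
      qed
      from this[OF _ 1 _ 2] show ?thesis unfolding form norm_of_real using d(3) by simp
    qed
    then show "\<exists>N. \<forall>m\<ge>N. \<forall>n\<ge>N. cmod (cinner_L2 (abs_L2 (bessel_expr \<nu> (x m)) - abs_L2 (bessel_expr \<nu> (x n))) (abs_L2 (x m) - abs_L2 (x n))) < e"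
      by blast
  qed
qed

text \<open>Bootstrapping through the equation, for \<open>u\<close> and \<open>u'\<close> together.
  Smoothness of \<open>u\<close> is what makes its cutoffs test functions.\<close>

lemma ode_smooth:
  assumes u: "\<And>r. r > 0 \<Longrightarrow> (u has_vector_derivative u' r) (at r)"
    "\<And>r. r > 0 \<Longrightarrow> (u' has_vector_derivative (k + c / of_real r ^ 2) * u r - F r) (at r)" and F: "csmooth_on {0<..} F"
  shows "csmooth_on {0<..} u"
proof -
  have "csm n {0<..} u \<and> csm n {0<..} u'" for n
  proof (induction n)
    case (Suc n)
    then have IH: "csm n {0<..} u" "csm n {0<..} u'" by auto
    have V: "csm n {0<..} (\<lambda>r. k + c / of_real r ^ 2)"
      using csmooth_on_inverse_power[of c 2] by (intro csm_add csm_const) (auto simp: csmooth_on_def)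
    have "csm n {0<..} (\<lambda>r. (k + c / of_real r ^ 2) * u r + (-1) * F r)"
      using F by (intro csm_add csm_mult csm_const V IH) (auto simp: csmooth_on_def)
    then have "csm n {0<..} (vderiv u')"
      by (rule csm_cong[rotated 2]) (use u(2) in \<open>auto intro!: vderiv_eqI[symmetric]\<close>)
    moreover have "csm n {0<..} (vderiv u)"
      by (rule csm_cong[OF _ _ IH(2)]) (use u(1) in \<open>auto intro!: vderiv_eqI[symmetric]\<close>)
    ultimately show ?case
      using u by (auto intro: differentiableI_vector)
  qed auto
  then show ?thesis by (simp add: csmooth_on_def)
qed

context green_pair
begin

text \<open>For test data \<theta> the product \<theta>/r is again a test function, and the solution
  meets both halves of the Friedrichs condition: its size at 0 and infinity gives the form domain,
  integration by parts gives the adjoint graph.\<close>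

lemma resolvent_test:
  assumes t: "test_function \<theta>" and \<kappa>: "Re q > 0"
  shows "\<exists>u. square_integrable u \<and> (\<forall>r>0. kfun (green_kernel f g) (abs_L2 \<theta>) r = u r / of_real r) \<and>
    (abs_L2 u, abs_L2 (\<lambda>r. - q\<^sup>2 * u r + \<theta> r / of_real r)) \<in> bessel_operator \<nu>"
proof (rule solution_bounds[OF t \<kappa>])
  fix u u' C \<delta> D
  assume u: "\<And>r. r > 0 \<Longrightarrow> kfun (green_kernel f g) (abs_L2 \<theta>) r = u r / of_real r"
    "\<And>r. r > 0 \<Longrightarrow> (u has_vector_derivative u' r) (at r)"
    "\<And>r. r > 0 \<Longrightarrow> (u' has_vector_derivative (q\<^sup>2 + of_real (\<nu>\<^sup>2 - 1/4) / of_real r ^ 2) * u r - \<theta> r / of_real r) (at r)"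
    and c: "0 < \<delta>" "\<delta> \<le> 1" "1 \<le> D" "0 \<le> C"
    and b: "\<And>r. 0 < r \<Longrightarrow> r \<le> \<delta> \<Longrightarrow> cmod (u r) \<le> C * r powr (\<nu> + 1/2)"
    "\<And>r. 0 < r \<Longrightarrow> r \<le> \<delta> \<Longrightarrow> cmod (u' r) \<le> C * r powr (\<nu> - 1/2)"
    "\<And>r. D \<le> r \<Longrightarrow> cmod (u r) \<le> C * exp (- Re q * r)"
    "\<And>r. D \<le> r \<Longrightarrow> cmod (u' r + q * u r) \<le> C * exp (- Re q * r) / r"
  have tF: "test_function (\<lambda>r. \<theta> r / of_real r)" by (rule test_function_divide_r[OF t])
  have cu: "continuous_on {0<..} u" and cu': "continuous_on {0<..} u'"
    using half_line_continuous[OF u(2)] half_line_continuous[OF u(3)] by auto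
  have expb: "exp (- Re q * r) \<le> 1 / Re q * (1 / r)" "exp (- Re q * r) \<le> 1" if "r \<ge> D" for r
  proof -
    have r: "r > 0" using that c by simp
    have "Re q * r \<le> exp (Re q * r)" using exp_ge_add_one_self[of "Re q * r"] by linarith
    then show "exp (- Re q * r) \<le> 1 / Re q * (1 / r)" using r \<kappa> by (simp add: exp_minus field_simps)
    show "exp (- Re q * r) \<le> 1" using r \<kappa> by simp
  qed
  define C1 where "C1 = C * (1 + (1 + cmod q) * (1 / Re q) + 1)"
  have C1: "C \<le> C1" "C * (1 / Re q) \<le> C1" "C + cmod q * (C * (1 / Re q)) \<le> C1"
    using c \<kappa> by (auto simp: C1_def field_simps add_nonneg_nonneg)
  have pw: "r powr (\<nu> + 1/2) \<le> r powr (\<nu> - 1/2)" if "0 < r" "r \<le> \<delta>" for r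
    using that c by (intro powr_mono') auto
  have le0: "y \<le> C1 * z" if "y \<le> C * z" "0 \<le> z" for y z
    using that mult_right_mono[OF C1(1), of z] by linarith
  have si1: "square_integrable u"
  proof (rule square_integrable_decay[OF cu \<nu> c(1)])
    fix r assume r: "0 < r" "r \<le> \<delta>"
    show "cmod (u r) \<le> C1 * r powr (\<nu> - 1/2)"
      using b(1)[OF r] mult_left_mono[OF pw[OF r] c(4)] by (intro le0) auto
  next
    fix r assume r: "D \<le> r"
    have "cmod (u r) \<le> C * (1 / Re q * (1 / r))"
      using b(3)[OF r] mult_left_mono[OF expb(1)[OF r] c(4)] by linarith
    also have "\<dots> = C * (1 / Re q) * (1 / r)" by simp
    also have "\<dots> \<le> C1 * (1 / r)" using r c by (intro mult_right_mono C1) auto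
    finally show "cmod (u r) \<le> C1 * (1 / r)" .
  qed
  have si2: "square_integrable u'"
  proof (rule square_integrable_decay[OF cu' \<nu> c(1)])
    fix r assume r: "0 < r" "r \<le> \<delta>"
    show "cmod (u' r) \<le> C1 * r powr (\<nu> - 1/2)"
      using b(2)[OF r] by (intro le0) auto
  next
    fix r assume r: "D \<le> r"
    have r0: "r > 0" using r c by simp
    have 1: "cmod (u' r + q * u r) \<le> C * (1 / r)"
    proof -
      have "C * exp (- Re q * r) / r \<le> C * 1 / r"
        using r0 c expb(2)[OF r] by (intro divide_right_mono mult_left_mono) auto
      then show ?thesis using b(4)[OF r] by simp
    qed
    have 2: "cmod (q * u r) \<le> cmod q * (C * (1 / Re q * (1 / r)))"
      unfolding norm_mult using b(3)[OF r] mult_left_mono[OF expb(1)[OF r] c(4)] by (intro mult_left_mono) auto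
    have "cmod (u' r) = cmod ((u' r + q * u r) - q * u r)" by simp
    also have "\<dots> \<le> C * (1 / r) + cmod q * (C * (1 / Re q * (1 / r)))"
      using norm_triangle_ineq4[of "u' r + q * u r" "q * u r"] 1 2 by linarith
    also have "\<dots> = (C + cmod q * (C * (1 / Re q))) * (1 / r)" by (simp add: algebra_simps add_divide_distrib)
    also have "\<dots> \<le> C1 * (1 / r)" using r0 by (intro mult_right_mono C1) auto
    finally show "cmod (u' r) \<le> C1 * (1 / r)" .
  qed
  have si3: "square_integrable (\<lambda>r. u r / of_real r)"
  proof (rule square_integrable_decay[OF _ \<nu> c(1)])
    show "continuous_on {0<..} (\<lambda>r. u r / complex_of_real r)"
      by (intro continuous_on_divide cu continuous_on_of_real continuous_on_id) auto
  next
    fix r assume r: "0 < r" "r \<le> \<delta>"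
    have "r powr (\<nu> + 1/2) = r powr ((\<nu> - 1/2) + 1)" by (rule arg_cong) simp
    then have p: "r powr (\<nu> + 1/2) = r powr (\<nu> - 1/2) * r" using r by (simp only: powr_add) simp
    have "cmod (u r / of_real r) \<le> C * r powr (\<nu> - 1/2)"
      using b(1)[OF r] r unfolding p by (simp add: norm_divide pos_divide_le_eq mult.assoc)
    then show "cmod (u r / of_real r) \<le> C1 * r powr (\<nu> - 1/2)" by (rule le0) simp
  next
    fix r assume r: "D \<le> r"
    have r0: "r > 0" using r c by simp
    have "cmod (u r) \<le> C * 1" using b(3)[OF r] mult_left_mono[OF expb(2)[OF r] c(4)] by linarith
    then have "cmod (u r / of_real r) \<le> C * (1 / r)" using r0 by (simp add: norm_divide divide_right_mono)
    then show "cmod (u r / of_real r) \<le> C1 * (1 / r)" by (rule le0) (use r0 in simp)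
  qed
  have siw: "square_integrable (\<lambda>r. - q\<^sup>2 * u r + \<theta> r / of_real r)"
    by (intro square_integrable_add square_integrable_mult si1 test_function_square_integrable tF)
  have "abs_L2 u \<in> form_domain (bessel_minimal \<nu>)"
    by (rule form_domain_bessel[OF u(2) cu' ode_smooth[OF u(2,3) test_function_smooth[OF tF]] si1 si2 si3])
  moreover have "(abs_L2 u, abs_L2 (\<lambda>r. - q\<^sup>2 * u r + \<theta> r / of_real r)) \<in> adjoint_graph (bessel_minimal \<nu>)"
    unfolding adjoint_graph_def bessel_minimal_eq
  proof (clarsimp)
    fix \<phi> assume p: "test_function \<phi>"
    let ?u'' = "\<lambda>r. (q\<^sup>2 + of_real (\<nu>\<^sup>2 - 1/4) / of_real r ^ 2) * u r - \<theta> r / of_real r"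
    have cu'': "continuous_on {0<..} ?u''"
      by (intro continuous_on_diff continuous_on_mult continuous_on_add continuous_on_divide continuous_on_power continuous_on_const
          continuous_on_of_real continuous_on_id cu test_function_continuous[OF tF] test_function_continuous[OF t]) auto
    have w: "- ?u'' r + of_real ((\<nu>\<^sup>2 - 1/4) / r\<^sup>2) * u r = - q\<^sup>2 * u r + \<theta> r / of_real r" for r
      by (simp add: algebra_simps)
    note pb = bessel_by_parts(2)[OF p u(2,3) cu'', of \<nu>, unfolded w]
    show "cinner_L2 (abs_L2 (bessel_expr \<nu> \<phi>)) (abs_L2 u) = cinner_L2 (abs_L2 \<phi>) (abs_L2 (\<lambda>r. \<theta> r / of_real r - q\<^sup>2 * u r))"
      using pb siw by (simp add: cinner_abs_L2 si1 test_function_square_integrable[OF p] test_function_square_integrable[OF test_function_bessel_expr[OF p]])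
  qed
  ultimately have "(abs_L2 u, abs_L2 (\<lambda>r. - q\<^sup>2 * u r + \<theta> r / of_real r)) \<in> bessel_operator \<nu>"
    by (simp add: bessel_operator_def friedrichs_def)
  with si1 u(1) show ?thesis by blast
qed

end

section \<open>Identification of the weighted resolvent with the Green kernel operator\<close>

lemma L2_times_r:
  assumes "(f, g) \<in> mult_inverse_r" and that: "test_function \<theta>"
  shows "cinner_L2 f (abs_L2 \<theta>) = cinner_L2 g (abs_L2 (\<lambda>r. of_real r * \<theta> r))"
proof -
  note si = test_function_square_integrable[OF that] test_function_square_integrable[OF test_function_times_r[OF that]]
  have "AE r in half_line. rep_L2 g r = rep_L2 f r / of_real r" using assms by (simp add: mult_inverse_r_def)
  moreover have "AE r in half_line. r > 0" by (rule AE_half_lineI)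
  ultimately have ae: "AE r in half_line. rep_L2 f r * cnj (\<theta> r) = rep_L2 g r * cnj (of_real r * \<theta> r)"
    by eventually_elim simp
  have "cinner_L2 f (abs_L2 \<theta>) = (\<integral>r. rep_L2 f r * cnj (\<theta> r) \<partial>half_line)"
    using cinner_abs_L2[of "rep_L2 f" \<theta>] si by simp
  also have "\<dots> = (\<integral>r. rep_L2 g r * cnj (of_real r * \<theta> r) \<partial>half_line)"
    using square_integrable_product[OF rep_L2_square_integrable si(1)] square_integrable_product[OF rep_L2_square_integrable si(2)]
    by (intro integral_cong_AE ae borel_measurable_integrable)
  also have "\<dots> = cinner_L2 g (abs_L2 (\<lambda>r. of_real r * \<theta> r))"
    using cinner_abs_L2[of "rep_L2 g" "\<lambda>r. of_real r * \<theta> r"] si by simp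
  finally show ?thesis .
qed

lemma mult_inverse_r_abs:
  assumes "square_integrable f" "square_integrable g" "\<And>r. r > 0 \<Longrightarrow> g r = f r / of_real r"
  shows "(abs_L2 f, abs_L2 g) \<in> mult_inverse_r"
proof -
  have "AE r in half_line. g r = f r / of_real r" by (rule AE_half_lineI) (rule assms(3))
  with rep_abs_L2[OF assms(1)] rep_abs_L2[OF assms(2)]
  have "AE r in half_line. rep_L2 (abs_L2 g) r = rep_L2 (abs_L2 f) r / of_real r"
    by eventually_elim simp
  then show ?thesis by (simp add: mult_inverse_r_def)
qed

text \<open>Test data lie in the domain of the composition by the explicit solution, which gives
  uniqueness by density. That an arbitrary pair of the graph agrees with the kernel operator follows
  by duality, from solvability for the conjugate of q.\<close>

theorem weighted_resolvent_kernel: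
  assumes "green_pair \<nu> q f f' g g'" "green_pair \<nu> (cnj q) h h' k k'" "Re q > 0"
    and conj: "\<And>r. r > 0 \<Longrightarrow> h r = cnj (f r)" "\<And>r. r > 0 \<Longrightarrow> k r = cnj (g r)"
  shows "weighted_resolvent \<nu> (- q\<^sup>2) = kop (green_kernel f g)"
proof -
  interpret A: green_pair \<nu> q f f' g g' by fact
  interpret B: green_pair \<nu> "cnj q" h h' k k' by fact
  have q': "Re (cnj q) > 0" using assms(3) by simp
  interpret KA: bounded_kernel "green_kernel f g" "bound_const \<nu>" by (rule A.bounded_kernel_green[OF assms(3)])
  interpret KB: bounded_kernel "green_kernel h k" "bound_const \<nu>" by (rule B.bounded_kernel_green[OF q'])
  have adj: "cinner_L2 (kop (green_kernel f g) F) G = cinner_L2 F (kop (green_kernel h k) G)" for F G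
    by (rule kop_adjoint[OF KA.bounded_kernel_axioms KB.bounded_kernel_axioms])
      (simp add: green_kernel_def conj min.commute max.commute mult.commute)
  let ?graph = "mult_inverse_r O resolvent_graph (bessel_operator \<nu>) (- q\<^sup>2) O mult_inverse_r"
  have on_test: "(F, kop (green_kernel f g) F) \<in> ?graph" if "F \<in> L2_test" for F
  proof -
    obtain \<theta> where t: "test_function \<theta>" "F = abs_L2 \<theta>" using \<open>F \<in> L2_test\<close> by (auto simp: L2_test_def)
    obtain u where u: "square_integrable u" "\<And>r. r > 0 \<Longrightarrow> kfun (green_kernel f g) (abs_L2 \<theta>) r = u r / of_real r"
      "(abs_L2 u, abs_L2 (\<lambda>r. - q\<^sup>2 * u r + \<theta> r / of_real r)) \<in> bessel_operator \<nu>"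
      using A.resolvent_test[OF t(1) assms(3)] by blast
    note tF = test_function_divide_r[OF t(1)]
    note si = test_function_square_integrable[OF t(1)] test_function_square_integrable[OF tF]
    have "(F, abs_L2 (\<lambda>r. \<theta> r / of_real r)) \<in> mult_inverse_r"
      unfolding t(2) by (rule mult_inverse_r_abs[OF si]) simp
    moreover have "(abs_L2 (\<lambda>r. \<theta> r / of_real r), abs_L2 u) \<in> resolvent_graph (bessel_operator \<nu>) (- q\<^sup>2)"
    proof -
      have "abs_L2 (\<lambda>r. - q\<^sup>2 * u r + \<theta> r / of_real r) - scaleC_L2 (- q\<^sup>2) (abs_L2 u) = abs_L2 (\<lambda>r. \<theta> r / of_real r)"
        unfolding scaleC_abs_L2[OF u(1)] minus_abs_L2[OF square_integrable_add[OF square_integrable_mult[OF u(1)] si(2)] square_integrable_mult[OF u(1)]]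
        by simp
      then show ?thesis unfolding resolvent_graph_def using u(3) by force
    qed
    moreover have "(abs_L2 u, kop (green_kernel f g) F) \<in> mult_inverse_r"
      unfolding kop_def t(2) by (rule mult_inverse_r_abs[OF u(1) KA.kfun_square_integrable u(2)])
    ultimately show ?thesis by blast
  qed
  \<comment> \<open>With \<open>v\<close> the solution for the conjugate of q and data \<theta>, the
    chain is <G, \<theta>> = <u, \<theta>/r> = <F1, v> = <F, v/r> = <kernel operator F, \<theta>>;
    the second equality is the symmetry of the Bessel operator and the last the adjointness of the
    two kernels.\<close>
  have all: "G = kop (green_kernel f g) F" if "(F, G) \<in> ?graph" for F G
  proof -
    obtain F1 u where FG: "(F, F1) \<in> mult_inverse_r" "(F1, u) \<in> resolvent_graph (bessel_operator \<nu>) (- q\<^sup>2)" "(u, G) \<in> mult_inverse_r"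
      using \<open>(F, G) \<in> ?graph\<close> by blast
    then obtain w where w: "(u, w) \<in> bessel_operator \<nu>" "F1 = w - scaleC_L2 (- q\<^sup>2) u"
      by (auto simp: resolvent_graph_def)
    have "cinner_L2 (G - kop (green_kernel f g) F) g' = 0" if "g' \<in> L2_test" for g'
    proof -
      obtain \<theta> where t: "test_function \<theta>" "g' = abs_L2 \<theta>" using \<open>g' \<in> L2_test\<close> by (auto simp: L2_test_def)
      obtain v where v: "square_integrable v" "\<And>r. r > 0 \<Longrightarrow> kfun (green_kernel h k) (abs_L2 \<theta>) r = v r / of_real r"
        "(abs_L2 v, abs_L2 (\<lambda>r. - (cnj q)\<^sup>2 * v r + \<theta> r / of_real r)) \<in> bessel_operator \<nu>"
        using B.resolvent_test[OF t(1) q'] by blast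
      note tF = test_function_divide_r[OF t(1)]
      note si = test_function_square_integrable[OF t(1)] test_function_square_integrable[OF tF]
      have W: "abs_L2 (\<lambda>r. - (cnj q)\<^sup>2 * v r + \<theta> r / of_real r) = scaleC_L2 (- (cnj q)\<^sup>2) (abs_L2 v) + abs_L2 (\<lambda>r. \<theta> r / of_real r)"
        unfolding scaleC_abs_L2[OF v(1)] plus_abs_L2[OF square_integrable_mult[OF v(1)] si(2)] ..
      have "cinner_L2 w (abs_L2 v) = cinner_L2 u (abs_L2 (\<lambda>r. - (cnj q)\<^sup>2 * v r + \<theta> r / of_real r))"
        by (rule bessel_operator_symmetric[OF w(1) v(3)])
      then have "cinner_L2 F1 (abs_L2 v) = cinner_L2 u (abs_L2 (\<lambda>r. \<theta> r / of_real r))"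
        unfolding w(2) W cinner_L2_simps by simp
      also have "\<dots> = cinner_L2 G (abs_L2 (\<lambda>r. of_real r * (\<theta> r / of_real r)))"
        by (rule L2_times_r[OF FG(3) tF])
      also have "abs_L2 (\<lambda>r. of_real r * (\<theta> r / of_real r)) = abs_L2 \<theta>"
      proof (subst abs_L2_eq_iff)
        show "square_integrable (\<lambda>r. of_real r * (\<theta> r / of_real r))"
          by (rule test_function_square_integrable[OF test_function_times_r[OF tF]])
        show "AE r in half_line. of_real r * (\<theta> r / of_real r) = \<theta> r"
          by (rule AE_half_lineI) simp
      qed (rule si)
      finally have 1: "cinner_L2 F1 (abs_L2 v) = cinner_L2 G (abs_L2 \<theta>)" .
      have "cinner_L2 F1 (abs_L2 v) = cinner_L2 F (kop (green_kernel h k) (abs_L2 \<theta>))"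
      proof -
        have "AE r in half_line. rep_L2 F1 r = rep_L2 F r / of_real r" using FG(1) by (simp add: mult_inverse_r_def)
        moreover have "AE r in half_line. r > 0" by (rule AE_half_lineI)
        ultimately have ae: "AE r in half_line. rep_L2 F1 r * cnj (v r) = rep_L2 F r * cnj (kfun (green_kernel h k) (abs_L2 \<theta>) r)"
          by eventually_elim (simp add: v(2))
        have "cinner_L2 F1 (abs_L2 v) = (\<integral>r. rep_L2 F1 r * cnj (v r) \<partial>half_line)"
          using cinner_abs_L2[of "rep_L2 F1" v] v(1) by simp
        also have "\<dots> = (\<integral>r. rep_L2 F r * cnj (kfun (green_kernel h k) (abs_L2 \<theta>) r) \<partial>half_line)"
          using square_integrable_product[OF rep_L2_square_integrable v(1)]
            square_integrable_product[OF rep_L2_square_integrable KB.kfun_square_integrable]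
          by (intro integral_cong_AE ae borel_measurable_integrable)
        also have "\<dots> = cinner_L2 F (kop (green_kernel h k) (abs_L2 \<theta>))"
          unfolding kop_def using cinner_abs_L2[of "rep_L2 F" "kfun (green_kernel h k) (abs_L2 \<theta>)"] by simp
        finally show ?thesis .
      qed
      then have "cinner_L2 G (abs_L2 \<theta>) = cinner_L2 (kop (green_kernel f g) F) (abs_L2 \<theta>)"
        using 1 adj by simp
      then show ?thesis by (simp add: t(2) cinner_L2_simps)
    qed
    then have "G - kop (green_kernel f g) F = 0"
      by (rule L2_orthogonal_dense[OF closure_L2_test])
    then show ?thesis by simp
  qed
  show ?thesis
    unfolding weighted_resolvent_def
  proof (rule the_equality)
    show "bounded_clinear (kop (green_kernel f g)) \<and> (\<forall>(F, G)\<in>?graph. kop (green_kernel f g) F = G)"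
      using KA.bounded_clinear_kop all by fast
    fix T assume T: "bounded_clinear T \<and> (\<forall>(F, G)\<in>?graph. T F = G)"
    show "T = kop (green_kernel f g)"
    proof (rule bounded_clinear_eqI[OF conjunct1[OF T] KA.bounded_clinear_kop closure_L2_test])
      fix F assume "F \<in> L2_test"
      from bspec[OF conjunct2[OF T] on_test[OF this]] show "T F = kop (green_kernel f g) F" by simp
    qed
  qed
qed

section \<open>The limiting absorption principle\<close>

lemma bser_cnj:
  assumes "a > -1/2"
  shows "bser a (cnj y) = cnj (bser a y)"
proof -
  have "(\<lambda>n. cbcoef a n * y ^ n) sums bser a y"
    unfolding bser_def by (rule summable_sums[OF power_series_exp_bound(1)[OF cbcoef_bound[OF assms]]])
  then have "(\<lambda>n. cnj (cbcoef a n * y ^ n)) sums cnj (bser a y)" by (simp only: sums_cnj)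
  then have "(\<lambda>n. cbcoef a n * cnj y ^ n) sums cnj (bser a y)" by (simp add: cbcoef_def)
  then show ?thesis unfolding bser_def using sums_unique by force
qed

lemma phi_cnj:
  assumes "a > -1/2"
  shows "phi a (cnj q) r = cnj (phi a q r)"
proof -
  have "bser a (cnj (q\<^sup>2 * of_real r ^ 2)) = cnj (bser a (q\<^sup>2 * of_real r ^ 2))" by (rule bser_cnj[OF assms])
  then show ?thesis by (simp add: phi_def)
qed

text \<open>\<open>phi\<close> scaled to unit Wronskian against \<open>psi\<close>, in accordance
  with \<open>wronskian_rho\<close>.\<close>

definition zeta :: "real \<Rightarrow> complex \<Rightarrow> real \<Rightarrow> complex" where
  "zeta a q r = of_real (rho a) / (1 / q) powr of_real a * phi a q r"

definition zeta' :: "real \<Rightarrow> complex \<Rightarrow> real \<Rightarrow> complex" where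
  "zeta' a q r = of_real (rho a) / (1 / q) powr of_real a * phi' a q r"

lemma zeta_cnj:
  assumes "a > -1/2" "Re q \<ge> 0"
  shows "zeta a (cnj q) r = cnj (zeta a q r)"
proof -
  have "cnj ((1 / q) powr of_real a) = cnj (1 / q) powr cnj (of_real a)"
    by (rule cnj_powr) (rule Re_one_over[OF assms(2)])
  then show ?thesis by (simp add: zeta_def phi_cnj[OF assms(1)])
qed

lemma green_pair_bessel:
  assumes \<nu>: "\<nu> > 0" and q: "Re q \<ge> 0" "q \<noteq> 0"
  shows "green_pair \<nu> q (zeta (\<nu> - 1/2) q) (zeta' (\<nu> - 1/2) q) (psi (\<nu> - 1/2) q) (psi' (\<nu> - 1/2) q)"
proof -
  define a where "a = \<nu> - 1/2"
  have a: "a > -1/2" using \<nu> by (simp add: a_def)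
  have c: "a * (a + 1) = \<nu>\<^sup>2 - 1/4" by (simp add: a_def power2_eq_square field_simps)
  define k where "k = of_real (rho a) / (1 / q) powr of_real a"
  have k: "zeta a q = (\<lambda>r. k * phi a q r)" "zeta' a q = (\<lambda>r. k * phi' a q r)"
    by (auto simp: zeta_def zeta'_def k_def)
  have nz: "(1 / q) powr of_real a \<noteq> 0" using q by simp
  have "green_pair \<nu> q (zeta a q) (zeta' a q) (psi a q) (psi' a q)"
  proof
    show "\<nu> > 0" "Re q \<ge> 0" by fact+
  next
    fix r :: real assume r: "r > 0"
    show "(zeta a q has_vector_derivative zeta' a q r) (at r)"
      unfolding k by (rule has_vector_derivative_mult_right[OF phi_deriv[OF a r]])
    have "((\<lambda>r. k * phi' a q r) has_vector_derivative k * ((q\<^sup>2 + of_real (a * (a + 1)) / of_real r ^ 2) * phi a q r)) (at r)"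
      by (rule has_vector_derivative_mult_right[OF phi'_deriv[OF a r]])
    then show "(zeta' a q has_vector_derivative (q\<^sup>2 + of_real (\<nu>\<^sup>2 - 1/4) / of_real r ^ 2) * zeta a q r) (at r)"
      unfolding k c by (simp only: mult.left_commute)
    show "(psi a q has_vector_derivative psi' a q r) (at r)" by (rule psi_deriv[OF a q r])
    show "(psi' a q has_vector_derivative (q\<^sup>2 + of_real (\<nu>\<^sup>2 - 1/4) / of_real r ^ 2) * psi a q r) (at r)"
      using psi'_deriv[OF a q r] unfolding c .
    have "zeta' a q r * psi a q r - zeta a q r * psi' a q r
      = of_real (rho a) * (phi' a q r * psi a q r - phi a q r * psi' a q r) / (1 / q) powr of_real a"
      by (simp add: k k_def diff_divide_distrib algebra_simps)
    then show "zeta' a q r * psi a q r - zeta a q r * psi' a q r = 1"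
      unfolding wronskian_rho[OF a q r] using nz by simp
  next
    show "\<exists>C. \<forall>r. 0 < r \<longrightarrow> r \<le> 1 \<longrightarrow> cmod (zeta a q r) \<le> C * r powr (\<nu> + 1/2) \<and> cmod (zeta' a q r) \<le> C * r powr (\<nu> - 1/2)"
    proof (rule phi_bounds[OF a, of q])
      fix C assume "C \<ge> 0" and C: "\<And>r. 0 < r \<Longrightarrow> r \<le> 1 \<Longrightarrow> cmod (phi a q r) \<le> C * r powr (a + 1)"
        "\<And>r. 0 < r \<Longrightarrow> r \<le> 1 \<Longrightarrow> cmod (phi' a q r) \<le> C * r powr a"
      have e: "\<nu> + 1/2 = a + 1" "\<nu> - 1/2 = a" by (simp_all add: a_def)
      show ?thesis
        unfolding e k
      proof (intro exI[of _ "cmod k * C"] allI impI conjI)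
        fix r :: real assume "0 < r" "r \<le> 1"
        from C[OF this] show "cmod (k * phi a q r) \<le> cmod k * C * r powr (a + 1)" "cmod (k * phi' a q r) \<le> cmod k * C * r powr a"
          by (simp_all add: norm_mult mult_left_mono mult.assoc)
      qed
    qed
    show "\<exists>C. \<forall>r\<ge>1. cmod (psi a q r) \<le> C * exp (- Re q * r) \<and> cmod (psi' a q r + q * psi a q r) \<le> C * exp (- Re q * r) / r"
      by (rule psi_bounds[OF a q]) blast
  qed
  then show ?thesis by (simp only: a_def)
qed

definition bessel_kernel :: "real \<Rightarrow> complex \<Rightarrow> real \<Rightarrow> real \<Rightarrow> complex" where
  "bessel_kernel \<nu> q = green_kernel (zeta (\<nu> - 1/2) q) (psi (\<nu> - 1/2) q)"

lemma bessel_kernel_cnj: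
  assumes "\<nu> > 0" "Re q \<ge> 0" "r > 0" "R > 0"
  shows "bessel_kernel \<nu> (cnj q) r R = cnj (bessel_kernel \<nu> q R r)"
  using assms zeta_cnj[of "\<nu> - 1/2" q "min r R"] psi_cnj(1)[of "max r R" q "\<nu> - 1/2"]
  by (simp add: bessel_kernel_def green_kernel_def min.commute max.commute mult.commute)

lemma weighted_resolvent_bessel:
  assumes "\<nu> > 0" "Re q > 0" "q\<^sup>2 = - z"
  shows "weighted_resolvent \<nu> z = kop (bessel_kernel \<nu> q)"
proof -
  have q: "Re q \<ge> 0" "q \<noteq> 0" "Re (cnj q) \<ge> 0" "cnj q \<noteq> 0" using assms by auto
  have a: "\<nu> - 1/2 > -1/2" using assms by simp
  have "weighted_resolvent \<nu> (- q\<^sup>2) = kop (green_kernel (zeta (\<nu> - 1/2) q) (psi (\<nu> - 1/2) q))"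
    by (rule weighted_resolvent_kernel[OF green_pair_bessel[OF assms(1) q(1,2)] green_pair_bessel[OF assms(1) q(3,4)] assms(2)])
      (simp_all add: zeta_cnj[OF a q(1)] psi_cnj(1)[OF _ q(1)])
  then show ?thesis using assms(3) by (simp add: bessel_kernel_def)
qed

section \<open>Continuity of solutions and kernels up to the boundary\<close>

lemma convergent_bound: "X \<longlonglongrightarrow> l \<Longrightarrow> \<exists>K>0. \<forall>n. norm (X n :: 'a::real_normed_vector) \<le> K"
  unfolding Bseq_def[symmetric] by (rule convergent_imp_Bseq[OF convergentI])

text \<open>The index is allowed to vary together with q and r, since the norms of Bessel functions
  are later found as limits in the index.\<close>

lemma psi_tendsto:
  assumes a: "\<And>n. a n \<ge> a0" "a0 > -1" "a \<longlonglongrightarrow> a'"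
    and q: "\<And>n. Re (q n) \<ge> 0" "\<And>n. q n \<noteq> 0" "q \<longlonglongrightarrow> q'" "q' \<noteq> 0"
    and r: "\<And>n. r n > 0" "r \<longlonglongrightarrow> r'" "r' > 0"
  shows "(\<lambda>n. psi (a n) (q n) (r n)) \<longlonglongrightarrow> psi a' q' r'"
proof -
  have a': "a' \<ge> a0" by (rule LIMSEQ_le_const[OF a(3)]) (use a(1) in auto)
  have one: "(\<lambda>n. 1 / q n) \<longlonglongrightarrow> 1 / q'" by (intro tendsto_divide tendsto_const q)
  have inv: "(\<lambda>n. inverse (r n)) \<longlonglongrightarrow> inverse r'" by (rule tendsto_inverse[OF r(2)]) (use r(3) in simp)
  obtain K1 where K1: "\<And>n. cmod (1 / q n) \<le> K1" using convergent_bound[OF one] by blast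
  obtain K2 where K2: "\<And>n. norm (r n) \<le> K2" using convergent_bound[OF r(2)] by blast
  obtain K3 where K3: "K3 > 0" "\<And>n. norm (inverse (r n)) \<le> K3" using convergent_bound[OF inv] by blast
  obtain K4 where K4: "\<And>n. norm (a n) \<le> K4" using convergent_bound[OF a(3)] by blast
  have rl: "1 / K3 \<le> r n" for n
  proof -
    have "inverse (r n) \<le> K3" using K3(2)[of n] r(1)[of n] by simp
    then show ?thesis using K3(1) r(1)[of n] by (simp add: field_simps)
  qed
  have a4: "a n \<le> K4" "\<bar>a n\<bar> \<le> K4" for n using K4[of n] by auto
  have lap: "(\<lambda>n. lap (1 / q n) (a n) (a n) (r n)) \<longlonglongrightarrow> lap (1 / q') a' a' r'"
    by (rule lap_tendsto[of "1 / K3" r K2 "\<lambda>n. 1 / q n" K1 a0 a K4 a K4])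
      (use K1 K2 K3 a4 a rl r one Re_one_over[OF q(1)] in \<open>auto simp: abs_le_iff\<close>)
  have ln: "(\<lambda>n. lap_norm (a n)) \<longlonglongrightarrow> lap_norm a'"
    by (rule lap_norm_tendsto[OF a(2) a(1) a4(1) a(3)])
  have "lap_norm a' > 0" using lap_norm_pos[of a'] a' a(2) by simp
  then show ?thesis
    unfolding psi_def
    by (intro tendsto_divide tendsto_mult tendsto_of_real tendsto_powr tendsto_minus tendsto_exp lap ln a q r) (use r in auto)
qed

lemma zeta_tendsto:
  assumes a: "a > -1/2"
    and q: "\<And>n. Re (q n) \<ge> 0" "q \<longlonglongrightarrow> q'" "q' \<noteq> 0"
    and r: "\<And>n. r n > 0" "r \<longlonglongrightarrow> r'" "r' > 0"
  shows "(\<lambda>n. zeta a (q n) (r n)) \<longlonglongrightarrow> zeta a q' r'"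
proof -
  have one: "(\<lambda>n. 1 / q n) \<longlonglongrightarrow> 1 / q'" by (intro tendsto_divide tendsto_const q)
  have "Re q' \<ge> 0" by (rule LIMSEQ_le_const[OF tendsto_Re[OF q(2)]]) (use q(1) in auto)
  then have "Re (1 / q') \<ge> 0" by (rule Re_one_over)
  moreover have "1 / q' = 0" if "Re (1 / q') = 0" "Im (1 / q') = 0" using that by (intro complex_eqI) auto
  \<comment> \<open>The closed right half plane without 0 does not meet the branch cut, so the
    principal power is continuous even at imaginary limits.\<close>
  ultimately have nr: "1 / q' \<notin> \<real>\<^sub>\<le>\<^sub>0" using q(3) unfolding complex_nonpos_Reals_iff by fastforce
  have pw: "(\<lambda>n. (1 / q n) powr of_real a) \<longlonglongrightarrow> (1 / q') powr of_real a"
    by (rule tendsto_powr_complex[OF nr one tendsto_const])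
  have "isCont (bser a) (q'\<^sup>2 * of_real r' ^ 2)"
    by (rule DERIV_isCont[OF bser_deriv[OF a]])
  moreover have "(\<lambda>n. (q n)\<^sup>2 * of_real (r n) ^ 2) \<longlonglongrightarrow> q'\<^sup>2 * of_real r' ^ 2"
    by (intro tendsto_mult tendsto_power tendsto_of_real q r)
  ultimately have b: "(\<lambda>n. bser a ((q n)\<^sup>2 * of_real (r n) ^ 2)) \<longlonglongrightarrow> bser a (q'\<^sup>2 * of_real r' ^ 2)"
    by (rule isCont_tendsto_compose)
  show ?thesis
    unfolding zeta_def phi_def
    by (intro tendsto_mult tendsto_divide tendsto_const tendsto_of_real tendsto_powr pw b r) (use r q in auto)
qed

text \<open>\<open>bound_const \<nu>\<close> does not depend on q; this uniformity is what allows q'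
  to lie on the imaginary axis.\<close>

lemma bessel_kernel_limit:
  assumes \<nu>: "\<nu> > 0" and q: "\<And>n. Re (q n) > 0" "q \<longlonglongrightarrow> q'" "q' \<noteq> 0"
  shows "bounded_kernel (bessel_kernel \<nu> q') (bound_const \<nu>)"
    "(\<lambda>n. cinner_L2 (kop (bessel_kernel \<nu> (q n)) F) G) \<longlonglongrightarrow> cinner_L2 (kop (bessel_kernel \<nu> q') F) G"
proof -
  define a where "a = \<nu> - 1/2"
  have a: "a > -1/2" using \<nu> by (simp add: a_def)
  have qn: "Re (q n) \<ge> 0" "q n \<noteq> 0" for n using q(1)[of n] by auto
  have q'0: "Re q' \<ge> 0" by (rule LIMSEQ_le_const[OF tendsto_Re[OF q(2)]]) (use qn(1) in auto)
  define S where "S = {q :: complex. Re q \<ge> 0 \<and> q \<noteq> 0}"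
  have pc: "continuous_on (S \<times> {0<..}) (\<lambda>(q, r). psi a q r)" and zc: "continuous_on (S \<times> {0<..}) (\<lambda>(q, r). zeta a q r)"
  proof -
    { fix X :: "nat \<Rightarrow> complex \<times> real" and x assume X: "\<And>n. X n \<in> S \<times> {0<..}" "X \<longlonglongrightarrow> x" and x: "x \<in> S \<times> {0<..}"
      note l = tendsto_fst[OF X(2)] tendsto_snd[OF X(2)]
      have m: "Re (fst (X n)) \<ge> 0" "fst (X n) \<noteq> 0" "snd (X n) > 0" for n
        using X(1)[of n] by (auto simp: S_def)
      have m': "fst x \<noteq> 0" "snd x > 0" using x by (auto simp: S_def)
      have "(\<lambda>n. psi a (fst (X n)) (snd (X n))) \<longlonglongrightarrow> psi a (fst x) (snd x)"
        by (rule psi_tendsto[where a = "\<lambda>n. a" and a' = a and ?a0.0 = a, OF order_refl _ tendsto_const m(1,2) l(1) m'(1) m(3) l(2) m'(2)])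
          (use a in simp)
      moreover have "(\<lambda>n. zeta a (fst (X n)) (snd (X n))) \<longlonglongrightarrow> zeta a (fst x) (snd x)"
        by (rule zeta_tendsto[OF a m(1) l(1) m'(1) m(3) l(2) m'(2)])
      ultimately have "((\<lambda>(q, r). psi a q r) \<circ> X) \<longlonglongrightarrow> (\<lambda>(q, r). psi a q r) x" "((\<lambda>(q, r). zeta a q r) \<circ> X) \<longlonglongrightarrow> (\<lambda>(q, r). zeta a q r) x"
        by (simp_all add: o_def case_prod_beta) }
    then show "continuous_on (S \<times> {0<..}) (\<lambda>(q, r). psi a q r)" "continuous_on (S \<times> {0<..}) (\<lambda>(q, r). zeta a q r)"
      unfolding continuous_on_sequentially by blast+
  qed
  interpret L: green_pair \<nu> q' "zeta (\<nu> - 1/2) q'" "zeta' (\<nu> - 1/2) q'" "psi (\<nu> - 1/2) q'" "psi' (\<nu> - 1/2) q'"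
    by (rule green_pair_bessel[OF \<nu> q'0 q(3)])
  have bk: "bounded_kernel (bessel_kernel \<nu> (q n)) (bound_const \<nu>)" for n
    unfolding bessel_kernel_def by (rule green_pair.bounded_kernel_green[OF green_pair_bessel[OF \<nu> qn] q(1)])
  have cont: "continuous_on ({0<..} \<times> {0<..}) (\<lambda>(r, R). bessel_kernel \<nu> q' r R)"
    unfolding bessel_kernel_def by (rule green_kernel_continuous[OF L.f_cont L.g_cont])
  have sq: "square_integrable (bessel_kernel \<nu> q' r)" if "r > 0" for r
    unfolding bessel_kernel_def by (rule L.kernel_square_integrable[OF that])
  have lim: "(\<lambda>n. bessel_kernel \<nu> (q n) r R) \<longlonglongrightarrow> bessel_kernel \<nu> q' r R" if r: "r > 0" "R > 0" for r R
  proof -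
    have m: "min r R > 0" "max r R > 0" using r by auto
    have "(\<lambda>n. psi a (q n) (max r R)) \<longlonglongrightarrow> psi a q' (max r R)"
      by (rule psi_tendsto[where a = "\<lambda>n. a" and a' = a and ?a0.0 = a, OF order_refl _ tendsto_const qn q(2,3) m(2) tendsto_const m(2)])
        (use a in simp)
    moreover have "(\<lambda>n. zeta a (q n) (min r R)) \<longlonglongrightarrow> zeta a q' (min r R)"
      by (rule zeta_tendsto[OF a qn(1) q(2,3) m(1) tendsto_const m(1)])
    ultimately show ?thesis
      unfolding bessel_kernel_def green_kernel_def a_def[symmetric]
      using r by (intro tendsto_divide tendsto_mult tendsto_const) auto
  qed
  have lb: "\<exists>M. \<forall>n. \<forall>r\<in>{b..d}. \<forall>R\<in>{b..d}. cmod (bessel_kernel \<nu> (q n) r R) \<le> M" if b: "0 < b" for b d :: real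
  proof -
    \<comment> \<open>A convergent sequence with its limit is compact, so joint continuity in q and
      r gives bounds uniform in \<open>n\<close> on compact sets of radii.\<close>
    define T where "T = insert q' (range q) \<times> {b..d}"
    have T: "compact T" unfolding T_def by (intro compact_Times compact_sequence_with_limit[OF q(2)] compact_Icc)
    have TS: "T \<subseteq> S \<times> {0<..}" using b qn q'0 q(3) by (auto simp: T_def S_def)
    have "bounded ((\<lambda>(q, r). psi a q r) ` T)" "bounded ((\<lambda>(q, r). zeta a q r) ` T)"
      by (intro compact_imp_bounded compact_continuous_image continuous_on_subset[OF pc TS] continuous_on_subset[OF zc TS] T)+
    then obtain M1 M2 where M: "\<And>x. x \<in> T \<Longrightarrow> cmod (case x of (q, r) \<Rightarrow> psi a q r) \<le> M1" "\<And>x. x \<in> T \<Longrightarrow> cmod (case x of (q, r) \<Rightarrow> zeta a q r) \<le> M2"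
      unfolding bounded_iff by blast
    have M': "cmod (psi a (q n) r) \<le> M1" "cmod (zeta a (q n) r) \<le> M2" if "r \<in> {b..d}" for n r
      using M[of "(q n, r)"] that by (auto simp: T_def)
    show ?thesis
    proof (intro exI allI ballI)
      fix n r R assume rR: "r \<in> {b..d}" "R \<in> {b..d}"
      then have mm: "min r R \<in> {b..d}" "max r R \<in> {b..d}" by (auto simp: min_def max_def)
      have M0: "0 \<le> M2" by (rule order_trans[OF norm_ge_zero M'(2)[OF mm(1), of n]])
      have "b * b \<le> r * R" using rR b by (intro mult_mono) auto
      moreover have "cmod (zeta a (q n) (min r R)) * cmod (psi a (q n) (max r R)) \<le> M2 * M1"
        by (intro mult_mono M' mm M0 norm_ge_zero)
      ultimately show "cmod (bessel_kernel \<nu> (q n) r R) \<le> M2 * M1 / (b * b)"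
        unfolding bessel_kernel_def green_kernel_def a_def[symmetric] norm_divide norm_mult norm_of_real
        using rR b by (intro frac_le) (auto intro: order_trans[OF _ \<open>_ \<le> M2 * M1\<close>] simp: abs_mult)
    qed
  qed
  show "bounded_kernel (bessel_kernel \<nu> q') (bound_const \<nu>)"
    by (rule bounded_kernel_limit(1)[OF bk cont sq lim lb])
  show "(\<lambda>n. cinner_L2 (kop (bessel_kernel \<nu> (q n)) F) G) \<longlonglongrightarrow> cinner_L2 (kop (bessel_kernel \<nu> q') F) G"
    by (rule bounded_kernel_limit(2)[OF bk cont sq lim lb])
qed

text \<open>The root of -z in the right half plane has real part \<sigma> times the imaginary part
  of \<open>csqrt\<close>, positive for either sign. Approaching the spectrum from above thus leads
  to q = -\<i>, from below to q = \<i>.\<close>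

lemma boundary_root:
  assumes \<sigma>: "\<sigma> = 1 \<or> \<sigma> = -1" and X: "\<And>n. X n > 0" "X \<longlonglongrightarrow> 0"
  obtains q where "\<And>n. Re (q n) > 0" "\<And>n. (q n)\<^sup>2 = - Complex 1 (\<sigma> * X n)" "q \<longlonglongrightarrow> - \<i> * of_real \<sigma>"
proof
  define q where "q n = - \<i> * of_real \<sigma> * csqrt (Complex 1 (\<sigma> * X n))" for n
  have \<sigma>2: "of_real \<sigma> * of_real \<sigma> = (1 :: complex)" using \<sigma> by auto
  show "(q n)\<^sup>2 = - Complex 1 (\<sigma> * X n)" for n
    using \<sigma> by (auto simp: q_def power_mult_distrib)
  show "Re (q n) > 0" for n
  proof -
    have "sqrt (1 + (\<sigma> * X n)\<^sup>2) > 1" using X(1)[of n] \<sigma> by auto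
    then have "sqrt ((cmod (Complex 1 (\<sigma> * X n)) - 1) / 2) > 0" by (simp add: cmod_def)
    moreover have "Re (q n) = \<sigma> * Im (csqrt (Complex 1 (\<sigma> * X n)))" by (simp add: q_def)
    ultimately show ?thesis using \<sigma> X(1)[of n] by auto
  qed
  have "isCont csqrt 1" by (rule continuous_at_csqrt) (simp add: complex_nonpos_Reals_iff)
  moreover have "(\<lambda>n. Complex 1 (\<sigma> * X n)) \<longlonglongrightarrow> 1"
  proof -
    have "(\<lambda>n. Complex 1 (\<sigma> * X n)) \<longlonglongrightarrow> Complex 1 (\<sigma> * 0)" by (intro tendsto_Complex tendsto_mult tendsto_const X)
    then show ?thesis by (simp add: one_complex.code)
  qed
  ultimately have "(\<lambda>n. csqrt (Complex 1 (\<sigma> * X n))) \<longlonglongrightarrow> csqrt 1" by (rule isCont_tendsto_compose)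
  then have "q \<longlonglongrightarrow> - \<i> * of_real \<sigma> * csqrt 1" unfolding q_def by (intro tendsto_mult tendsto_const)
  then show "q \<longlonglongrightarrow> - \<i> * of_real \<sigma>" by simp
qed

lemma boundary_resolvent_kernel:
  assumes \<nu>: "\<nu> > 0" and \<sigma>: "\<sigma> = 1 \<or> \<sigma> = -1"
  shows "bounded_kernel (bessel_kernel \<nu> (- \<i> * of_real \<sigma>)) (bound_const \<nu>)"
    "boundary_resolvent \<nu> \<sigma> = kop (bessel_kernel \<nu> (- \<i> * of_real \<sigma>))"
proof -
  have nz: "- \<i> * of_real \<sigma> \<noteq> 0" using \<sigma> by auto
  have seq: "bounded_kernel (bessel_kernel \<nu> (- \<i> * of_real \<sigma>)) (bound_const \<nu>) \<and>
    (\<lambda>n. cinner_L2 (weighted_resolvent \<nu> (Complex 1 (\<sigma> * X n)) F) G) \<longlonglongrightarrow> cinner_L2 (kop (bessel_kernel \<nu> (- \<i> * of_real \<sigma>)) F) G"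
    if X: "\<And>n. X n > 0" "X \<longlonglongrightarrow> 0" for X F G
  proof (rule boundary_root[OF \<sigma> X])
    fix q assume q: "\<And>n. Re (q n) > 0" "\<And>n. (q n)\<^sup>2 = - Complex 1 (\<sigma> * X n)" "q \<longlonglongrightarrow> - \<i> * of_real \<sigma>"
    have "weighted_resolvent \<nu> (Complex 1 (\<sigma> * X n)) = kop (bessel_kernel \<nu> (q n))" for n
      by (rule weighted_resolvent_bessel[OF \<nu> q(1,2)])
    with bessel_kernel_limit[OF \<nu> q(1,3) nz] show ?thesis by simp
  qed
  show bk: "bounded_kernel (bessel_kernel \<nu> (- \<i> * of_real \<sigma>)) (bound_const \<nu>)"
    using seq[of "\<lambda>n. inverse (real (Suc n))"] LIMSEQ_inverse_real_of_nat by simp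
  interpret bounded_kernel "bessel_kernel \<nu> (- \<i> * of_real \<sigma>)" "bound_const \<nu>" by (rule bk)
  have lim: "((\<lambda>\<epsilon>. cinner_L2 (weighted_resolvent \<nu> (Complex 1 (\<sigma> * \<epsilon>)) F) G)
     \<longlongrightarrow> cinner_L2 (kop (bessel_kernel \<nu> (- \<i> * of_real \<sigma>)) F) G) (at_right 0)" for F G
    unfolding tendsto_at_iff_sequentially o_def using seq by auto
  show "boundary_resolvent \<nu> \<sigma> = kop (bessel_kernel \<nu> (- \<i> * of_real \<sigma>))"
    unfolding boundary_resolvent_def
  proof (rule the_equality)
    fix T assume T: "bounded_clinear T \<and> (\<forall>f g. ((\<lambda>\<epsilon>. cinner_L2 (weighted_resolvent \<nu> (Complex 1 (\<sigma> * \<epsilon>)) f) g)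
               \<longlongrightarrow> cinner_L2 (T f) g) (at_right 0))"
    show "T = kop (bessel_kernel \<nu> (- \<i> * of_real \<sigma>))"
    proof (rule ext, rule cinner_L2_eqI)
      fix F G show "cinner_L2 (T F) G = cinner_L2 (kop (bessel_kernel \<nu> (- \<i> * of_real \<sigma>)) F) G"
        by (rule tendsto_unique[OF _ _ lim]) (use T in auto)
    qed
  qed (use bounded_clinear_kop lim in blast)
qed

lemma onorm_boundary_resolvent:
  assumes "\<nu> > 0" "\<sigma> = 1 \<or> \<sigma> = -1"
  shows "bounded_clinear (boundary_resolvent \<nu> \<sigma>)" "onorm (boundary_resolvent \<nu> \<sigma>) \<le> bound_const \<nu>"
proof -
  interpret bounded_kernel "bessel_kernel \<nu> (- \<i> * of_real \<sigma>)" "bound_const \<nu>" by (rule boundary_resolvent_kernel(1)[OF assms])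
  show "bounded_clinear (boundary_resolvent \<nu> \<sigma>)" "onorm (boundary_resolvent \<nu> \<sigma>) \<le> bound_const \<nu>"
    unfolding boundary_resolvent_kernel(2)[OF assms]
    by (rule bounded_clinear_kop, rule onorm_bound[OF C0 norm_kop])
qed

text \<open>The multiplier bound is never worse than the claimed one: 1/\<nu>^2 <= 2/\<nu> beyond
  1/2, and 1/\<nu>^2 <= 1/sqrt(\<nu>^2 - 1/4) is (\<nu>^2 - 1/2)^2 >= 0 in disguise.\<close>

lemma bound_const_le_C_bound:
  assumes "\<nu> > 0"
  shows "bound_const \<nu> \<le> C_bound \<nu>"
proof -
  have half: "\<nu>\<^sup>2 \<le> 1/4" if "\<nu> \<le> 1/2"
    using power_mono[OF that, of 2] assms by (simp add: power2_eq_square)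
  have third: "\<nu>\<^sup>2 \<le> 1/3" if "\<nu> \<le> 1 / sqrt 3"
    using power_mono[OF that, of 2] assms by (simp add: power_divide)
  have third': "\<nu>\<^sup>2 > 1/3" if "\<nu> > 1 / sqrt 3"
    using power_strict_mono[OF that, of 2] by (simp add: power_divide)
  have mid: "1 / \<nu>\<^sup>2 \<le> 2 / \<nu>" if "\<nu> > 1/2"
    using that by (simp add: power2_eq_square divide_simps)
  have last: "1 / \<nu>\<^sup>2 \<le> 1 / sqrt (\<nu>\<^sup>2 - 1/4)" if "\<nu>\<^sup>2 > 1/3"
  proof -
    have "0 \<le> (\<nu>\<^sup>2 - 1/2)\<^sup>2" by simp
    then have "\<nu>\<^sup>2 - 1/4 \<le> (\<nu>\<^sup>2)\<^sup>2" by (simp add: power2_eq_square algebra_simps)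
    then have "sqrt (\<nu>\<^sup>2 - 1/4) \<le> \<nu>\<^sup>2" by (intro real_le_lsqrt) auto
    then show ?thesis using that assms by (intro divide_left_mono mult_pos_pos) auto
  qed
  show ?thesis
    using assms half third third' mid last unfolding bound_const_def C_bound_def by (auto simp: not_le)
qed

section \<open>Adjoint and imaginary part of the boundary operator\<close>

lemma cadjoint_eqI:
  assumes "bounded_clinear S" "\<And>f g. cinner_L2 (T f) g = cinner_L2 f (S g)"
  shows "cadjoint T = S"
  unfolding cadjoint_def
proof (rule the_equality)
  fix S' assume S': "bounded_clinear S' \<and> (\<forall>f g. cinner_L2 (T f) g = cinner_L2 f (S' g))"
  show "S' = S"
  proof (rule ext, rule cinner_L2_eqI)
    fix g h
    have "cinner_L2 h (S' g) = cinner_L2 h (S g)" using S' assms(2) by metis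
    then show "cinner_L2 (S' g) h = cinner_L2 (S g) h" by (metis cinner_L2_commute)
  qed
qed (use assms in blast)

text \<open>On the boundary the regular factor is real up to a unimodular constant. Moving this
  constant to \<open>psi\<close> leaves a kernel whose complex part sits entirely in the factor at
  the larger radius.\<close>

lemma zeta_besJ:
  assumes "a > -1/2" "r > 0" and \<sigma>: "\<sigma> = 1 \<or> \<sigma> = -1"
  shows "zeta a (- \<i> * of_real \<sigma>) r = of_real (besJ a r) * cis (- \<sigma> * pi * a / 2)"
proof -
  have q: "- \<i> * of_real \<sigma> = \<i> \<or> - \<i> * of_real \<sigma> = - \<i>" using \<sigma> by auto
  have pw: "(1 / (- \<i> * of_real \<sigma>)) powr of_real a = cis (\<sigma> * pi * a / 2)"
  proof -
    have "cnj (\<i> powr of_real a) = cnj \<i> powr cnj (of_real a)" by (rule cnj_powr) simp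
    then show ?thesis using \<sigma> ii_powr[of a] by (auto simp: cis_cnj)
  qed
  have "zeta a (- \<i> * of_real \<sigma>) r = of_real (rho a) * phi a (- \<i> * of_real \<sigma>) r / cis (\<sigma> * pi * a / 2)"
    by (simp only: zeta_def pw times_divide_eq_left)
  moreover have "of_real (rho a) * phi a (- \<i> * of_real \<sigma>) r = of_real (besJ a r)"
    by (rule besJ_phi(1)[OF assms(1,2) q, symmetric])
  moreover have "inverse (cis (\<sigma> * pi * a / 2)) = cis (- \<sigma> * pi * a / 2)"
    by (simp only: cis_inverse minus_mult_left minus_divide_left)
  ultimately show ?thesis by (simp only: divide_inverse)
qed

lemma psi_besJ:
  assumes "r > 0" and \<sigma>: "\<sigma> = 1 \<or> \<sigma> = -1"
  shows "cis (- \<sigma> * pi * a / 2) * psi a (- \<i> * of_real \<sigma>) r - cnj (cis (- \<sigma> * pi * a / 2) * psi a (- \<i> * of_real \<sigma>) r)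
    = 2 * \<i> * of_real (\<sigma> * besJ a r)"
proof -
  have "psi a (cnj (- \<i>)) r = cnj (psi a (- \<i>) r)" by (rule psi_cnj(1)[OF assms(1)]) simp
  then have c: "cis (- \<sigma> * pi * a / 2) * psi a (- \<i> * of_real \<sigma>) r =
    (if \<sigma> = 1 then cis (- pi * a / 2) * psi a (- \<i>) r else cnj (cis (- pi * a / 2) * psi a (- \<i>) r))"
    using \<sigma> by (auto simp: cis_cnj)
  show ?thesis unfolding c using \<sigma> by (auto simp: besJ_def complex_eq_iff)
qed

text \<open>The kernel is besJ(min) times a function \<open>P\<close> of max with imaginary part
  \<sigma> besJ(max). In the difference with the conjugate the roles of min and max disappear, and a
  rank one kernel remains.\<close>

lemma bessel_kernel_im:
  assumes \<nu>: "\<nu> > 0" and \<sigma>: "\<sigma> = 1 \<or> \<sigma> = -1" and r: "r > 0" "R > 0"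
  shows "bessel_kernel \<nu> (- \<i> * of_real \<sigma>) r R - bessel_kernel \<nu> (\<i> * of_real \<sigma>) r R
    = 2 * \<i> * of_real \<sigma> * of_real (besJ (\<nu> - 1/2) r / r) * of_real (besJ (\<nu> - 1/2) R / R)"
proof -
  define a where "a = \<nu> - 1/2"
  have a: "a > -1/2" using \<nu> by (simp add: a_def)
  have m: "min r R > 0" "max r R > 0" using r by auto
  define P where "P = cis (- \<sigma> * pi * a / 2) * psi a (- \<i> * of_real \<sigma>) (max r R)"
  have 1: "bessel_kernel \<nu> (- \<i> * of_real \<sigma>) r' R' = of_real (besJ a (min r R)) * P / of_real (r * R)"
    if "r' = r \<and> R' = R \<or> r' = R \<and> R' = r" for r' R'
    using that zeta_besJ[OF a m(1) \<sigma>]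
    by (auto simp: bessel_kernel_def green_kernel_def P_def a_def min.commute max.commute mult.commute mult.left_commute)
  have "bessel_kernel \<nu> (cnj (- \<i> * of_real \<sigma>)) r R = cnj (bessel_kernel \<nu> (- \<i> * of_real \<sigma>) R r)"
    by (rule bessel_kernel_cnj[OF \<nu> _ r]) simp
  then have "bessel_kernel \<nu> (\<i> * of_real \<sigma>) r R = of_real (besJ a (min r R)) * cnj P / of_real (r * R)"
    using 1[of R r] by simp
  then have "bessel_kernel \<nu> (- \<i> * of_real \<sigma>) r R - bessel_kernel \<nu> (\<i> * of_real \<sigma>) r R
    = of_real (besJ a (min r R)) * (P - cnj P) / of_real (r * R)"
    using 1[of r R] by (simp add: diff_divide_distrib right_diff_distrib)
  also have "P - cnj P = 2 * \<i> * of_real (\<sigma> * besJ a (max r R))"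
    unfolding P_def by (rule psi_besJ[OF m(2) \<sigma>])
  also have "of_real (besJ a (min r R)) * (2 * \<i> * of_real (\<sigma> * besJ a (max r R))) / of_real (r * R)
    = 2 * \<i> * of_real \<sigma> * of_real (besJ a r / r) * of_real (besJ a R / R)"
    by (cases "r \<le> R") (simp_all add: min_def max_def)
  finally show ?thesis by (simp only: a_def)
qed

lemma besJ_continuous:
  assumes "a > -1/2"
  shows "continuous_on {0<..} (besJ a)"
  by (rule continuous_at_imp_continuous_on) (use besJ_deriv(1)[OF assms] DERIV_isCont in blast)

lemma square_integrable_besJ:
  assumes "a > -1/2"
  shows "square_integrable (\<lambda>r. of_real (besJ a r / r))"
proof (rule besJ_bound_0[OF assms], rule besJ_bound_infinity[OF assms])
  fix C D assume C: "C \<ge> 0" "\<And>r. 0 < r \<Longrightarrow> r \<le> 1 \<Longrightarrow> \<bar>besJ a r\<bar> \<le> C * r powr (a + 1)"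
    and D: "D \<ge> 0" "\<And>r. r \<ge> 1 \<Longrightarrow> \<bar>besJ a r\<bar> \<le> D"
  show ?thesis
  proof (rule square_integrable_decay[where \<nu> = "a + 1/2" and \<delta> = 1 and C = "C + D" and D = 1])
    show "continuous_on {0<..} (\<lambda>r. complex_of_real (besJ a r / r))"
      by (intro continuous_on_of_real continuous_on_divide besJ_continuous assms continuous_on_id) auto
  next
    fix r :: real assume r: "0 < r" "r \<le> 1"
    have "r powr (a + 1) = r powr a * r" using r by (simp add: powr_add)
    then have "\<bar>besJ a r\<bar> / r \<le> C * r powr a" using C(2)[OF r] r by (simp add: pos_divide_le_eq mult.assoc)
    also have "\<dots> \<le> (C + D) * r powr a" using D(1) by (intro mult_right_mono) auto
    finally show "cmod (complex_of_real (besJ a r / r)) \<le> (C + D) * r powr (a + 1/2 - 1/2)" using r by (simp add: norm_divide)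
  next
    fix r :: real assume r: "1 \<le> r"
    have "\<bar>besJ a r\<bar> / r \<le> (C + D) / r" using D(2)[OF r] C(1) r by (intro divide_right_mono) auto
    then show "cmod (complex_of_real (besJ a r / r)) \<le> (C + D) * (1 / r)" using r by (simp add: norm_divide)
  qed (use assms in auto)
qed

lemma onorm_rank_one:
  assumes \<sigma>: "\<sigma> = 1 \<or> \<sigma> = -1"
  shows "onorm (\<lambda>F. scaleC_L2 (of_real \<sigma> * cinner_L2 F B) B) = (norm B)\<^sup>2"
proof (rule antisym)
  let ?T = "\<lambda>F. scaleC_L2 (of_real \<sigma> * cinner_L2 F B) B"
  have b: "norm (?T F) \<le> (norm B)\<^sup>2 * norm F" for F
  proof -
    have "norm (?T F) = cmod (cinner_L2 F B) * norm B"
      using \<sigma> by (auto simp: norm_scaleC_L2 norm_mult)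
    also have "\<dots> \<le> norm F * norm B * norm B" by (intro mult_right_mono cinner_L2_bound norm_ge_zero)
    finally show ?thesis by (simp add: power2_eq_square mult_ac)
  qed
  then show "onorm ?T \<le> (norm B)\<^sup>2" by (intro onorm_bound) auto
  have add: "scaleC_L2 (k + l) B = scaleC_L2 k B + scaleC_L2 l B" for k l
    by (rule cinner_L2_eqI) (simp add: cinner_L2_simps algebra_simps)
  have sc: "scaleC_L2 k (scaleC_L2 l B) = scaleC_L2 (k * l) B" for k l
    by (rule cinner_L2_eqI) (simp add: cinner_L2_simps)
  have "bounded_clinear ?T"
    by (rule bounded_clinearI[OF _ _ b]) (simp_all add: cinner_L2_simps distrib_left add sc mult_ac)
  then have bl: "bounded_linear ?T" by (simp add: bounded_clinear_def)
  have "norm (?T B) = (norm B)\<^sup>2 * norm B"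
    using \<sigma> by (auto simp: norm_scaleC_L2 cinner_L2_self norm_mult norm_power)
  then have "(norm B)\<^sup>2 * norm B \<le> onorm ?T * norm B" using onorm[OF bl, of B] by simp
  then show "(norm B)\<^sup>2 \<le> onorm ?T"
    using onorm_pos_le[OF bl] by (cases "norm B = 0") auto
qed

lemma onorm_Im_boundary_resolvent:
  assumes \<nu>: "\<nu> > 0" and \<sigma>: "\<sigma> = 1 \<or> \<sigma> = -1"
  shows "onorm (Im_op (boundary_resolvent \<nu> \<sigma>)) = (norm (abs_L2 (\<lambda>r. of_real (besJ (\<nu> - 1/2) r / r))))\<^sup>2"
proof -
  define b where "b = (\<lambda>r. complex_of_real (besJ (\<nu> - 1/2) r / r))"
  have b: "square_integrable b" unfolding b_def by (rule square_integrable_besJ) (use \<nu> in simp)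
  define K where "K \<sigma> = bessel_kernel \<nu> (- \<i> * of_real \<sigma>)" for \<sigma> :: real
  have \<sigma>': "- \<sigma> = 1 \<or> - \<sigma> = -1" using \<sigma> by auto
  interpret A: bounded_kernel "K \<sigma>" "bound_const \<nu>" unfolding K_def by (rule boundary_resolvent_kernel(1)[OF \<nu> \<sigma>])
  interpret B: bounded_kernel "K (- \<sigma>)" "bound_const \<nu>" unfolding K_def by (rule boundary_resolvent_kernel(1)[OF \<nu> \<sigma>'])
  \<comment> \<open>Conjugating q exchanges the two boundary values, so each is the adjoint of the
    other.\<close>
  have "cadjoint (kop (K \<sigma>)) = kop (K (- \<sigma>))"
  proof (rule cadjoint_eqI[OF B.bounded_clinear_kop], rule kop_adjoint[OF A.bounded_kernel_axioms B.bounded_kernel_axioms])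
    fix r R :: real assume r: "r > 0" "R > 0"
    have "bessel_kernel \<nu> (cnj (- \<i> * of_real \<sigma>)) r R = cnj (bessel_kernel \<nu> (- \<i> * of_real \<sigma>) R r)"
      by (rule bessel_kernel_cnj[OF \<nu> _ r]) simp
    then show "K (- \<sigma>) r R = cnj (K \<sigma> R r)" by (simp add: K_def)
  qed
  then have "Im_op (boundary_resolvent \<nu> \<sigma>) = (\<lambda>F. scaleC_L2 (1 / (2 * \<i>)) (kop (K \<sigma>) F - kop (K (- \<sigma>)) F))"
    unfolding Im_op_def boundary_resolvent_kernel(2)[OF \<nu> \<sigma>] K_def by simp
  also have "\<dots> = (\<lambda>F. scaleC_L2 (of_real \<sigma> * cinner_L2 F (abs_L2 b)) (abs_L2 b))"
  proof
    fix F
    have k: "1 / (2 * \<i>) * (kfun (K \<sigma>) F r - kfun (K (- \<sigma>)) F r) = of_real \<sigma> * cinner_L2 F (abs_L2 b) * b r" if r: "r > 0" for r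
    proof -
      note si = square_integrable_cnj[OF A.Ksq[OF r]] square_integrable_cnj[OF B.Ksq[OF r]]
      have "kfun (K \<sigma>) F r - kfun (K (- \<sigma>)) F r = cinner_L2 F (abs_L2 (\<lambda>R. cnj (K \<sigma> r R) - cnj (K (- \<sigma>) r R)))"
        unfolding kfun_def by (simp only: minus_abs_L2[OF si, symmetric] cinner_L2_simps)
      also have "abs_L2 (\<lambda>R. cnj (K \<sigma> r R) - cnj (K (- \<sigma>) r R)) = abs_L2 (\<lambda>R. cnj (2 * \<i> * of_real \<sigma> * b r) * b R)"
      proof (subst abs_L2_eq_iff)
        show "AE R in half_line. cnj (K \<sigma> r R) - cnj (K (- \<sigma>) r R) = cnj (2 * \<i> * of_real \<sigma> * b r) * b R"
        proof (rule AE_half_lineI)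
          fix R :: real assume "R > 0"
          have "K \<sigma> r R - K (- \<sigma>) r R = 2 * \<i> * of_real \<sigma> * b r * b R"
            using bessel_kernel_im[OF \<nu> \<sigma> r \<open>R > 0\<close>] by (simp add: K_def b_def)
          then have "cnj (K \<sigma> r R - K (- \<sigma>) r R) = cnj (2 * \<i> * of_real \<sigma> * b r * b R)" by (rule arg_cong)
          then show "cnj (K \<sigma> r R) - cnj (K (- \<sigma>) r R) = cnj (2 * \<i> * of_real \<sigma> * b r) * b R"
            by (simp add: b_def)
        qed
      qed (intro square_integrable_diff square_integrable_mult b si)+
      also have "\<dots> = scaleC_L2 (cnj (2 * \<i> * of_real \<sigma> * b r)) (abs_L2 b)" by (rule scaleC_abs_L2[OF b, symmetric])
      finally show ?thesis by (simp add: cinner_L2_simps)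
    qed
    have "scaleC_L2 (1 / (2 * \<i>)) (kop (K \<sigma>) F - kop (K (- \<sigma>)) F) = abs_L2 (\<lambda>r. 1 / (2 * \<i>) * (kfun (K \<sigma>) F r - kfun (K (- \<sigma>)) F r))"
      unfolding kop_def minus_abs_L2[OF A.kfun_square_integrable B.kfun_square_integrable]
      by (rule scaleC_abs_L2) (intro square_integrable_diff A.kfun_square_integrable B.kfun_square_integrable)
    also have "\<dots> = abs_L2 (\<lambda>r. of_real \<sigma> * cinner_L2 F (abs_L2 b) * b r)"
    proof (subst abs_L2_eq_iff)
      show "AE r in half_line. 1 / (2 * \<i>) * (kfun (K \<sigma>) F r - kfun (K (- \<sigma>)) F r) = of_real \<sigma> * cinner_L2 F (abs_L2 b) * b r"
        by (rule AE_half_lineI) (rule k)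
    qed (intro square_integrable_mult square_integrable_diff b A.kfun_square_integrable B.kfun_square_integrable)+
    finally show "scaleC_L2 (1 / (2 * \<i>)) (kop (K \<sigma>) F - kop (K (- \<sigma>)) F) = scaleC_L2 (of_real \<sigma> * cinner_L2 F (abs_L2 b)) (abs_L2 b)"
      by (simp only: scaleC_abs_L2[OF b])
  qed
  finally have "onorm (Im_op (boundary_resolvent \<nu> \<sigma>)) = (norm (abs_L2 b))\<^sup>2"
    by (simp only: onorm_rank_one[OF \<sigma>])
  then show ?thesis by (simp only: b_def)
qed

section \<open>Inner products of Bessel functions\<close>

lemma besJ_bound_zero:
  assumes "a > -1/2"
  shows "\<exists>C\<ge>0. \<forall>r. 0 < r \<longrightarrow> r \<le> 1 \<longrightarrow> \<bar>besJ a r\<bar> \<le> C * r powr (a + 1) \<and> \<bar>besJ' a r\<bar> \<le> C * r powr a"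
  by (rule besJ_bound_0[OF assms]) blast

lemma tendsto_null_at_right:
  fixes f :: "real \<Rightarrow> 'a::real_normed_vector"
  assumes "e > 0" "\<And>r. 0 < r \<Longrightarrow> r \<le> 1 \<Longrightarrow> norm (f r) \<le> C * r powr e"
  shows "(f \<longlongrightarrow> 0) (at_right 0)"
proof (rule Lim_null_comparison)
  show "eventually (\<lambda>r. norm (f r) \<le> C * r powr e) (at_right 0)"
    unfolding eventually_at_right_field using assms(2) by (intro exI[of _ 1]) auto
  have "((\<lambda>r::real. r powr e) \<longlongrightarrow> 0) (at_right 0)"
  proof (rule tendsto_zero_powrI[OF _ tendsto_const _ assms(1)])
    show "((\<lambda>r::real. r) \<longlongrightarrow> 0) (at_right 0)" by (rule tendsto_ident_at)
    show "eventually (\<lambda>r::real. 0 \<le> r) (at_right 0)"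
      unfolding eventually_at_right_field by (intro exI[of _ 1]) auto
  qed
  from tendsto_mult[OF tendsto_const[of C] this] show "((\<lambda>r. C * r powr e) \<longlongrightarrow> 0) (at_right 0)" by simp
qed

lemma tendsto_null_mult_bounded:
  fixes f g :: "'a \<Rightarrow> 'b::real_normed_algebra"
  assumes "(f \<longlongrightarrow> 0) F" "eventually (\<lambda>x. norm (g x) \<le> C) F"
  shows "((\<lambda>x. f x * g x) \<longlongrightarrow> 0) F"
proof (rule Lim_null_comparison)
  show "eventually (\<lambda>x. norm (f x * g x) \<le> norm (f x) * C) F"
    using assms(2)
  proof eventually_elim
    case (elim x)
    show ?case by (rule order_trans[OF norm_mult_ineq]) (intro mult_left_mono elim norm_ge_zero)
  qed
  from tendsto_mult[OF tendsto_norm_zero[OF assms(1)] tendsto_const[of C]]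
  show "((\<lambda>x. norm (f x) * C) \<longlongrightarrow> 0) F" by simp
qed

text \<open>At 0 each product is of order r^(a+b+1) with a positive exponent; at infinity the sine
  subtraction formula leaves the difference of the two phases.\<close>

lemma besJ_wronskian_limits:
  assumes a: "a > -1/2" and b: "b > -1/2"
  shows "((\<lambda>r. besJ' a r * besJ b r - besJ a r * besJ' b r) \<longlongrightarrow> 0) (at_right 0)"
    "((\<lambda>r. besJ' a r * besJ b r - besJ a r * besJ' b r) \<longlongrightarrow> sin (pi * (a - b) / 2)) at_top"
proof -
  obtain C where C: "C \<ge> 0" "\<And>r. 0 < r \<Longrightarrow> r \<le> 1 \<Longrightarrow> \<bar>besJ a r\<bar> \<le> C * r powr (a + 1)" "\<And>r. 0 < r \<Longrightarrow> r \<le> 1 \<Longrightarrow> \<bar>besJ' a r\<bar> \<le> C * r powr a"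
    using besJ_bound_zero[OF a] by auto
  obtain D where D: "D \<ge> 0" "\<And>r. 0 < r \<Longrightarrow> r \<le> 1 \<Longrightarrow> \<bar>besJ b r\<bar> \<le> D * r powr (b + 1)" "\<And>r. 0 < r \<Longrightarrow> r \<le> 1 \<Longrightarrow> \<bar>besJ' b r\<bar> \<le> D * r powr b"
    using besJ_bound_zero[OF b] by auto
  show "((\<lambda>r. besJ' a r * besJ b r - besJ a r * besJ' b r) \<longlongrightarrow> 0) (at_right 0)"
  proof (rule tendsto_null_at_right[of "a + b + 1" _ "2 * (C * D)"])
    show "a + b + 1 > 0" using a b by simp
    fix r :: real assume r: "0 < r" "r \<le> 1"
    have p: "r powr a * r powr (b + 1) = r powr (a + b + 1)" "r powr (a + 1) * r powr b = r powr (a + b + 1)"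
      by (simp_all add: add_ac flip: powr_add)
    have "\<bar>besJ' a r * besJ b r\<bar> \<le> (C * r powr a) * (D * r powr (b + 1))"
      unfolding abs_mult using C D r by (intro mult_mono) auto
    also have "\<dots> = C * D * r powr (a + b + 1)" unfolding p[symmetric] by (simp only: mult_ac)
    finally have 1: "\<bar>besJ' a r * besJ b r\<bar> \<le> C * D * r powr (a + b + 1)" .
    have "\<bar>besJ a r * besJ' b r\<bar> \<le> (C * r powr (a + 1)) * (D * r powr b)"
      unfolding abs_mult using C D r by (intro mult_mono) auto
    also have "\<dots> = C * D * r powr (a + b + 1)" unfolding p(2)[symmetric] by (simp only: mult_ac)
    finally show "norm (besJ' a r * besJ b r - besJ a r * besJ' b r) \<le> 2 * (C * D) * r powr (a + b + 1)"
      using 1 by simp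
  qed
  define Ea Ea' Eb Eb' where "Ea r = besJ a r - sin (r - pi * a / 2)" and "Ea' r = besJ' a r - cos (r - pi * a / 2)"
    and "Eb r = besJ b r - sin (r - pi * b / 2)" and "Eb' r = besJ' b r - cos (r - pi * b / 2)" for r
  note E = besJ_asymp[OF a, folded Ea_def Ea'_def] besJ_asymp[OF b, folded Eb_def Eb'_def]
  have n: "((\<lambda>r. f r * sin (r - c)) \<longlongrightarrow> 0) at_top" "((\<lambda>r. f r * cos (r - c)) \<longlongrightarrow> 0) at_top" if "(f \<longlongrightarrow> 0) at_top" for f :: "real \<Rightarrow> real" and c
    by (rule tendsto_null_mult_bounded[OF that, of _ 1], simp)+
  have "((\<lambda>r. sin (pi * (a - b) / 2) + (Ea' r * Eb r + Ea' r * sin (r - pi * b / 2) + Eb r * cos (r - pi * a / 2)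
      - (Ea r * Eb' r + Ea r * cos (r - pi * b / 2) + Eb' r * sin (r - pi * a / 2))))
    \<longlongrightarrow> sin (pi * (a - b) / 2) + (0 * 0 + 0 + 0 - (0 * 0 + 0 + 0))) at_top"
    by (intro tendsto_add tendsto_diff tendsto_const tendsto_mult E n)
  moreover have "sin (pi * (a - b) / 2) = cos (r - pi * a / 2) * sin (r - pi * b / 2) - sin (r - pi * a / 2) * cos (r - pi * b / 2)" for r
  proof -
    have "pi * (a - b) / 2 = (r - pi * b / 2) - (r - pi * a / 2)" by (simp add: field_simps)
    then show ?thesis by (simp only: sin_diff mult.commute)
  qed
  ultimately show "((\<lambda>r. besJ' a r * besJ b r - besJ a r * besJ' b r) \<longlongrightarrow> sin (pi * (a - b) / 2)) at_top"
    by (simp add: Ea_def Ea'_def Eb_def Eb'_def algebra_simps)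
qed

text \<open>Classically sqrt(pi/2) r^(-1/2) J_nu with nu = a + 1/2.\<close>

definition bes :: "real \<Rightarrow> L2" where
  "bes a = abs_L2 (\<lambda>r. of_real (besJ a r / r))"

lemma besJ_vderiv:
  assumes "a > -1/2" "r > 0"
  shows "((\<lambda>r. complex_of_real (besJ a r)) has_vector_derivative of_real (besJ' a r)) (at r)"
    "((\<lambda>r. complex_of_real (besJ' a r)) has_vector_derivative of_real ((a * (a + 1) / r\<^sup>2 - 1) * besJ a r)) (at r)"
  by (rule has_vector_derivative_of_real[OF besJ_deriv(1)[OF assms]],
    rule has_vector_derivative_of_real[OF besJ_deriv(2)[OF assms]])

text \<open>Lagrange's identity: the derivative of the Wronskian is the difference of the two
  potentials times the product of the solutions, which is the integrand. For equal indices both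
  sides are 0.\<close>

lemma cinner_bes:
  assumes a: "a > -1/2" and b: "b > -1/2"
  shows "of_real (a * (a + 1) - b * (b + 1)) * cinner_L2 (bes a) (bes b) = of_real (sin (pi * (a - b) / 2))"
proof -
  let ?c = "complex_of_real (a * (a + 1) - b * (b + 1))"
  let ?f = "\<lambda>r. ?c * (of_real (besJ a r / r) * cnj (of_real (besJ b r / r)))"
  note si = square_integrable_besJ[OF a] square_integrable_besJ[OF b]
  have "integral\<^sup>L half_line ?f = of_real (sin (pi * (a - b) / 2)) - of_real 0"
  proof (rule half_line_FTC)
    fix r :: real assume r: "r > 0"
    have "((\<lambda>r. besJ' a r * besJ b r - besJ a r * besJ' b r) has_real_derivative
      (besJ' a r * besJ' b r + (a * (a + 1) / r\<^sup>2 - 1) * besJ a r * besJ b r) -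
      (besJ a r * ((b * (b + 1) / r\<^sup>2 - 1) * besJ b r) + besJ' a r * besJ' b r)) (at r)"
      by (intro DERIV_diff DERIV_mult' besJ_deriv a b r)
    moreover have "(besJ' a r * besJ' b r + (a * (a + 1) / r\<^sup>2 - 1) * besJ a r * besJ b r) -
      (besJ a r * ((b * (b + 1) / r\<^sup>2 - 1) * besJ b r) + besJ' a r * besJ' b r)
      = (a * (a + 1) - b * (b + 1)) * (besJ a r / r * (besJ b r / r))"
      by (simp add: algebra_simps power2_eq_square diff_divide_distrib add_divide_distrib)
    ultimately have "((\<lambda>r. besJ' a r * besJ b r - besJ a r * besJ' b r) has_real_derivative
      (a * (a + 1) - b * (b + 1)) * (besJ a r / r * (besJ b r / r))) (at r)"
      by simp
    from has_vector_derivative_of_real[OF this]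
    show "((\<lambda>r. complex_of_real (besJ' a r * besJ b r - besJ a r * besJ' b r)) has_vector_derivative ?f r) (at r)"
      by (simp only: of_real_mult complex_cnj_complex_of_real)
  next
    show "continuous_on {0<..} ?f"
      unfolding complex_cnj_complex_of_real
      by (intro continuous_on_mult continuous_on_const continuous_on_of_real continuous_on_divide besJ_continuous a b continuous_on_id) auto
    show "integrable half_line ?f"
      by (rule Bochner_Integration.integrable_mult_right) (rule square_integrable_product[OF si])
  qed (intro tendsto_of_real besJ_wronskian_limits a b)+
  moreover have "integral\<^sup>L half_line ?f = ?c * cinner_L2 (bes a) (bes b)"
    unfolding bes_def cinner_abs_L2[OF si] by (rule integral_mult_right_zero)
  ultimately show ?thesis by simp
qed

text \<open>The explicit constant is what makes the bound at 0 uniform when the index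
  varies.\<close>

lemma besJ_abs_zero:
  assumes a: "a > -1/2" and r: "0 < r" "r \<le> 1"
  shows "\<bar>besJ a r\<bar> \<le> rho a * exp 1 * r powr (a + 1)"
proof -
  have "\<bar>besJ a r\<bar> = cmod (of_real (rho a) * phi a \<i> r)"
    unfolding besJ_phi(1)[OF a r(1), of \<i>, simplified, symmetric] by simp
  also have "\<dots> = rho a * (r powr (a + 1) * cmod (bser a (\<i>\<^sup>2 * of_real r ^ 2)))"
    using rho_pos[OF a] by (simp add: phi_def norm_mult)
  also have "\<dots> \<le> rho a * (r powr (a + 1) * exp 1)"
  proof (intro mult_left_mono)
    have "cmod (\<i>\<^sup>2 * of_real r ^ 2) \<le> 1" using r by (simp add: norm_mult norm_power power_le_one)
    then have "exp (cmod (\<i>\<^sup>2 * of_real r ^ 2)) \<le> exp 1" by simp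
    with bser_bound(1)[OF a] show "cmod (bser a (\<i>\<^sup>2 * of_real r ^ 2)) \<le> exp 1" by (rule order_trans)
  qed (use rho_pos[OF a] in auto)
  finally show ?thesis by (simp only: mult_ac)
qed

text \<open>The indices approach \<open>a\<close> from above, so that r^(b+1) <= r^(a+1) on the unit
  interval and one constant serves the whole sequence.\<close>

lemma besJ_tendsto:
  assumes a: "a > -1/2" and b: "\<And>n. a \<le> b n" "b \<longlonglongrightarrow> a"
  shows "r > 0 \<Longrightarrow> (\<lambda>n. besJ (b n) r) \<longlonglongrightarrow> besJ a r"
    and "\<exists>C\<ge>0. \<forall>n. (\<forall>r. 0 < r \<longrightarrow> r \<le> 1 \<longrightarrow> \<bar>besJ (b n) r\<bar> \<le> C * r powr (a + 1)) \<and> (\<forall>r\<ge>1. \<bar>besJ (b n) r\<bar> \<le> C)"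
proof -
  have bn: "b n > -1/2" "2 * a \<le> 2 * b n" for n using a b(1)[of n] by auto
  have i: "Re (- \<i>) \<ge> 0" "- \<i> \<noteq> 0" by auto
  obtain K where K: "\<And>n. norm (b n) \<le> K" using convergent_bound[OF b(2)] by blast
  have bK: "b n \<le> K" "2 * b n \<le> 2 * K" "\<bar>b n\<bar> \<le> K" for n using K[of n] by auto
  { assume r: "r > 0"
    have "(\<lambda>n. psi (b n) (- \<i>) r) \<longlonglongrightarrow> psi a (- \<i>) r"
      by (rule psi_tendsto[where q = "\<lambda>n. - \<i>", OF b(1) _ b(2) i tendsto_const i(2) r tendsto_const r]) (use a in simp)
    then show "(\<lambda>n. besJ (b n) r) \<longlonglongrightarrow> besJ a r"
      unfolding besJ_def cis_conv_exp
      by (intro tendsto_Im tendsto_mult tendsto_exp tendsto_const tendsto_of_real tendsto_divide b(2)) auto }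
  have l1: "(\<lambda>n. lap_norm (b n)) \<longlonglongrightarrow> lap_norm a"
    by (rule lap_norm_tendsto[OF _ b(1) bK(1) b(2)]) (use a in simp)
  have l2: "(\<lambda>n. lap_norm (2 * b n)) \<longlonglongrightarrow> lap_norm (2 * a)"
    by (rule lap_norm_tendsto[OF _ bn(2) bK(2)]) (use a in \<open>auto intro: tendsto_mult b(2)\<close>)
  have p: "lap_norm a > 0" "lap_norm (2 * a) > 0" using a by (auto intro!: lap_norm_pos)
  have "(\<lambda>n. rho (b n)) \<longlonglongrightarrow> rho a"
    unfolding rho_def by (intro tendsto_divide tendsto_mult tendsto_add tendsto_const l1 l2 b(2)) (use p a in auto)
  then obtain R where R: "R > 0" "\<And>n. norm (rho (b n)) \<le> R" using convergent_bound by blast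
  have "(\<lambda>n. inverse (lap_norm (b n))) \<longlonglongrightarrow> inverse (lap_norm a)"
    by (rule tendsto_inverse[OF l1]) (use p in auto)
  then obtain L where L: "L > 0" "\<And>n. norm (inverse (lap_norm (b n))) \<le> L" using convergent_bound by blast
  have a1: "a > -1" using a by simp
  obtain M where M: "M \<ge> 0" "\<And>\<beta> c. Re \<beta> \<ge> 0 \<Longrightarrow> cmod \<beta> \<le> 1 \<Longrightarrow> a \<le> c \<Longrightarrow> c \<le> K \<Longrightarrow> \<bar>c\<bar> \<le> K \<Longrightarrow> cmod (lap \<beta> c c 1) \<le> M"
    using lap_uniform_bound[OF zero_less_one a1, of 1 1 K K] by auto
  show "\<exists>C\<ge>0. \<forall>n. (\<forall>r. 0 < r \<longrightarrow> r \<le> 1 \<longrightarrow> \<bar>besJ (b n) r\<bar> \<le> C * r powr (a + 1)) \<and> (\<forall>r\<ge>1. \<bar>besJ (b n) r\<bar> \<le> C)"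
  proof (intro exI[of _ "R * exp 1 + M * L"] conjI allI impI)
    show "0 \<le> R * exp 1 + M * L" using R L M by auto
    fix n
    { fix r :: real assume r: "0 < r" "r \<le> 1"
      have "\<bar>besJ (b n) r\<bar> \<le> rho (b n) * exp 1 * r powr (b n + 1)" by (rule besJ_abs_zero[OF bn(1) r])
      also have "\<dots> \<le> (R * exp 1 + M * L) * r powr (a + 1)"
      proof (rule mult_mono)
        show "rho (b n) * exp 1 \<le> R * exp 1 + M * L"
        proof -
          have "rho (b n) * exp 1 \<le> R * exp 1" using R(2)[of n] by (intro mult_right_mono) auto
          moreover have "0 \<le> M * L" using M(1) L(1) by simp
          ultimately show ?thesis by linarith
        qed
        show "r powr (b n + 1) \<le> r powr (a + 1)" using r b(1)[of n] by (intro powr_mono') auto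
      qed (use R M L in auto)
      finally show "\<bar>besJ (b n) r\<bar> \<le> (R * exp 1 + M * L) * r powr (a + 1)" . }
    { fix r :: real assume r: "1 \<le> r"
      have "\<bar>besJ (b n) r\<bar> \<le> cmod (cis (- pi * b n / 2) * psi (b n) (- \<i>) r)"
        unfolding besJ_def by (rule abs_Im_le_cmod)
      also have "\<dots> = cmod (psi (b n) (- \<i>) r)" by (simp add: norm_mult)
      also have "\<dots> = cmod (lap (1 / (- \<i> * of_real r)) (b n) (b n) 1) * norm (inverse (lap_norm (b n)))"
        by (subst psi_scaled(1)[OF bn(1) i]) (use r in \<open>simp_all add: norm_mult norm_divide norm_inverse divide_inverse\<close>)
      also have "\<dots> \<le> M * L"
      proof (intro mult_mono L(2) M norm_ge_zero b(1) bK)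
        show "0 \<le> Re (1 / (- \<i> * of_real r))" by (simp add: Re_divide)
        show "cmod (1 / (- \<i> * of_real r)) \<le> 1" using r by (simp add: norm_divide norm_mult)
      qed
      finally show "\<bar>besJ (b n) r\<bar> \<le> R * exp 1 + M * L" using R(1) by (simp add: add_increasing) }
  qed
qed

text \<open>Since \<open>cinner_bes\<close> is empty for equal indices, the norm is obtained as the
  limit of inner products with neighbouring indices; the quotient of the sine by the index
  difference tends to a derivative of the sine.\<close>

lemma norm_bes:
  assumes a: "a > -1/2"
  shows "(norm (bes a))\<^sup>2 = pi / (2 * (2 * a + 1))"
proof -
  define b where "b n = a + inverse (real (Suc n))" for n
  have b: "a < b n" "a \<le> b n" "b n > -1/2" for n
  proof -
    have "inverse (real (Suc n)) > 0" by simp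
    then show "a < b n" "a \<le> b n" "b n > -1/2" unfolding b_def using a by linarith+
  qed
  have "(\<lambda>n. a + inverse (real (Suc n))) \<longlonglongrightarrow> a + 0" by (intro tendsto_add tendsto_const LIMSEQ_inverse_real_of_nat)
  then have lim: "b \<longlonglongrightarrow> a" by (simp add: b_def[abs_def])
  obtain C where C: "C \<ge> 0" "\<And>n r. 0 < r \<Longrightarrow> r \<le> 1 \<Longrightarrow> \<bar>besJ (b n) r\<bar> \<le> C * r powr (a + 1)" "\<And>n r. r \<ge> 1 \<Longrightarrow> \<bar>besJ (b n) r\<bar> \<le> C"
    using besJ_tendsto(2)[OF a b(2) lim] by blast
  \<comment> \<open>Comparable to r^a near 0 and to 1/r at infinity, the uniform sizes of
    \<open>besJ (b n) r / r\<close>, in one formula.\<close>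
  define w where "w r = r powr a / (1 + r powr (a + 1))" for r :: real
  have w0: "0 \<le> w r" for r by (simp add: w_def)
  have w1: "r powr a \<le> 2 * w r" if r: "0 < r" "r \<le> 1" for r
  proof -
    have "r powr (a + 1) \<le> 1 powr (a + 1)" using r a by (intro powr_mono2) auto
    then have "r powr a * (1 + r powr (a + 1)) \<le> r powr a * 2" by (intro mult_left_mono) auto
    then show ?thesis by (simp add: w_def pos_le_divide_eq add_pos_nonneg)
  qed
  have pa: "r powr (a + 1) = r powr a * r" if "r > 0" for r :: real using that by (simp add: powr_add)
  have w2: "1 / r \<le> 2 * w r" if r: "1 \<le> r" for r
  proof -
    have "1 \<le> r powr (a + 1)" using r a by (intro ge_one_powr_ge_zero) auto
    then have "1 * (1 + r powr (a + 1)) \<le> 2 * r powr a * r" using r by (simp add: pa mult.commute)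
    then show ?thesis using r by (simp add: w_def divide_simps add_pos_nonneg mult_ac)
  qed
  have siw: "square_integrable (\<lambda>r. of_real (w r))"
  proof (rule square_integrable_decay[where \<nu> = "a + 1/2" and \<delta> = 1 and D = 1 and C = 1])
    have "1 + r powr (a + 1) \<noteq> 0" for r :: real using powr_ge_zero[of r "a + 1"] by linarith
    then show "continuous_on {0<..} (\<lambda>r. complex_of_real (w r))"
      unfolding w_def
      by (intro continuous_on_of_real continuous_on_divide continuous_on_add continuous_on_const continuous_on_powr continuous_on_id) auto
  next
    fix r :: real assume r: "0 < r" "r \<le> 1"
    have "w r \<le> r powr a / 1" unfolding w_def by (intro divide_left_mono) (auto simp: add_pos_nonneg)
    then show "cmod (complex_of_real (w r)) \<le> 1 * r powr (a + 1/2 - 1/2)" using w0[of r] by simp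
  next
    fix r :: real assume r: "1 \<le> r"
    have "w r \<le> r powr a / r powr (a + 1)" unfolding w_def using r by (intro divide_left_mono mult_pos_pos) (auto simp: add_pos_nonneg)
    also have "\<dots> = 1 / r" using r by (simp add: pa)
    finally show "cmod (complex_of_real (w r)) \<le> 1 * (1 / r)" using w0[of r] by simp
  qed (use a in auto)
  have "(\<lambda>n. bes (b n)) \<longlonglongrightarrow> bes a"
    unfolding bes_def
  proof (rule L2_dominated(3)[OF square_integrable_measurable[OF square_integrable_besJ[OF a]] square_integrable_mult[OF siw, of "of_real (2 * C)"]
        square_integrable_measurable[OF square_integrable_besJ[OF b(3)]]])
    show "AE r in half_line. (\<lambda>n. complex_of_real (besJ (b n) r / r)) \<longlonglongrightarrow> of_real (besJ a r / r)"
      by (rule AE_half_lineI, intro tendsto_of_real tendsto_divide tendsto_const besJ_tendsto(1)[OF a b(2) lim]) auto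
    show "AE r in half_line. cmod (complex_of_real (besJ (b n) r / r)) \<le> cmod (of_real (2 * C) * of_real (w r))" for n
    proof (rule AE_half_lineI)
      fix r :: real assume r: "r > 0"
      have "\<bar>besJ (b n) r\<bar> / r \<le> C * (2 * w r)"
      proof (cases "r \<le> 1")
        case True
        have "\<bar>besJ (b n) r\<bar> / r \<le> C * r powr a" using C(2)[OF r True, of n] r by (simp add: pa pos_divide_le_eq mult.assoc)
        also have "\<dots> \<le> C * (2 * w r)" by (rule mult_left_mono[OF w1[OF r True] C(1)])
        finally show ?thesis .
      next
        case False
        then have "\<bar>besJ (b n) r\<bar> / r \<le> C * (1 / r)" using C(3)[of r n] r by (simp add: divide_right_mono)
        also have "\<dots> \<le> C * (2 * w r)" by (rule mult_left_mono[OF w2 C(1)]) (use False in simp)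
        finally show ?thesis .
      qed
      with w0[of r] show "cmod (complex_of_real (besJ (b n) r / r)) \<le> cmod (of_real (2 * C) * of_real (w r))"
        using r C(1) unfolding norm_mult norm_of_real abs_divide abs_mult by (simp add: mult_ac)
    qed
  qed
  then have L: "(\<lambda>n. cinner_L2 (bes (b n)) (bes a)) \<longlonglongrightarrow> of_real ((norm (bes a))\<^sup>2)"
    unfolding cinner_L2_self[symmetric] by (rule continuous_cinner_left)
  define t where "t n = pi / 2 * inverse (real (Suc n))" for n
  have t0: "t n \<noteq> 0" for n by (simp add: t_def)
  have t: "t \<longlonglongrightarrow> 0"
    using tendsto_mult[OF tendsto_const[of "pi / 2"] LIMSEQ_inverse_real_of_nat] by (simp add: t_def[abs_def])
  have v: "cinner_L2 (bes (b n)) (bes a) = of_real (pi / 2 * (sin (t n) / t n) / (a + b n + 1))" for n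
  proof -
    have d: "b n * (b n + 1) - a * (a + 1) = (b n - a) * (a + b n + 1)" by (simp add: algebra_simps)
    have nz: "b n - a \<noteq> 0" "a + b n + 1 \<noteq> 0" using b(1)[of n] b(3)[of n] a by auto
    have gen: "S / (h * s) = pi / 2 * (S / (pi * h / 2)) / s" if "h \<noteq> 0" for S h s :: real
      using that by (simp add: divide_simps)
    have nz': "complex_of_real ((b n - a) * (a + b n + 1)) \<noteq> 0"
      unfolding of_real_eq_0_iff mult_eq_0_iff using nz by blast
    have tn: "t n = pi * (b n - a) / 2" by (simp add: t_def b_def)
    have "of_real ((b n - a) * (a + b n + 1)) * cinner_L2 (bes (b n)) (bes a) = of_real (sin (t n))"
      using cinner_bes[OF b(3) a, of n] unfolding d tn .
    then have "cinner_L2 (bes (b n)) (bes a) = of_real (sin (t n)) / of_real ((b n - a) * (a + b n + 1))"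
      using nonzero_mult_div_cancel_left[OF nz', of "cinner_L2 (bes (b n)) (bes a)"] by (simp only:)
    also have "\<dots> = of_real (sin (t n) / ((b n - a) * (a + b n + 1)))" by (rule of_real_divide[symmetric])
    also have "sin (t n) / ((b n - a) * (a + b n + 1)) = pi / 2 * (sin (t n) / t n) / (a + b n + 1)"
      unfolding tn by (rule gen[OF nz(1)])
    finally show ?thesis .
  qed
  have "((\<lambda>h::real. sin h / h) \<longlongrightarrow> 1) (at 0)" using DERIV_sin[of "0::real"] by (simp add: has_field_derivative_iff)
  then have "(\<lambda>n. sin (t n) / t n) \<longlonglongrightarrow> 1"
    by (rule filterlim_compose) (use t t0 in \<open>simp add: filterlim_at\<close>)
  then have "(\<lambda>n. complex_of_real (pi / 2 * (sin (t n) / t n) / (a + b n + 1))) \<longlonglongrightarrow> of_real (pi / 2 * 1 / (a + a + 1))"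
    by (intro tendsto_of_real tendsto_divide tendsto_mult tendsto_add tendsto_const lim) (use a in auto)
  then have "complex_of_real ((norm (bes a))\<^sup>2) = of_real (pi / 2 * 1 / (a + a + 1))"
    using L unfolding v by (intro LIMSEQ_unique)
  then have "(norm (bes a))\<^sup>2 = pi / 2 * 1 / (a + a + 1)" by (simp only: of_real_eq_iff)
  then show ?thesis by simp
qed

section \<open>Lower bounds from outgoing trial functions\<close>

text \<open>Green's identity on either side of \<open>s\<close>: the boundary terms at 0 and
  infinity vanish, and the two contributions at \<open>s\<close> recombine to the Wronskian 1.
  Unlike \<open>solution\<close> this admits data without compact support, as the trial functions
  require.\<close>

lemma (in green_pair) kfun_green:
  assumes u: "\<And>r. r > 0 \<Longrightarrow> (u has_vector_derivative u' r) (at r)"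
    "\<And>r. r > 0 \<Longrightarrow> (u' has_vector_derivative (q\<^sup>2 + of_real (\<nu>\<^sup>2 - 1/4) / of_real r ^ 2) * u r - h r / of_real r) (at r)"
    and h: "continuous_on {0<..} h" "square_integrable h"
    and lim: "((\<lambda>r. f' r * u r - f r * u' r) \<longlongrightarrow> 0) (at_right 0)" "((\<lambda>r. g' r * u r - g r * u' r) \<longlongrightarrow> 0) at_top"
    and s: "s > 0"
  shows "kfun (green_kernel f g) (abs_L2 h) s = u s / of_real s"
proof -
  let ?K = "green_kernel f g s"
  have W: "((\<lambda>r. y' r * u r - y r * u' r) has_vector_derivative y r * (h r / of_real r)) (at r)"
    if r: "r > 0" and y: "(y has_vector_derivative y' r) (at r)" "(y' has_vector_derivative (q\<^sup>2 + of_real (\<nu>\<^sup>2 - 1/4) / of_real r ^ 2) * y r) (at r)"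
    for y y' :: "real \<Rightarrow> complex" and r
  proof -
    note d = has_vector_derivative_diff[OF has_vector_derivative_mult[OF y(2) u(1)[OF r]] has_vector_derivative_mult[OF y(1) u(2)[OF r]]]
    have "(y' r * u' r + P * y r * u r) - (y r * (P * u r - h r / of_real r) + y' r * u' r) = y r * (h r / of_real r)" for P
      by (simp add: algebra_simps)
    with d show ?thesis by (simp only:)
  qed
  have sq: "square_integrable ?K" by (rule kernel_square_integrable[OF s])
  have "kfun (green_kernel f g) (abs_L2 h) s = (\<integral>r. ?K r * h r \<partial>half_line)"
    by (rule kfun_abs[where K = "green_kernel f g" and r = s, OF h(2) sq])
  also have "\<dots> = (0 - f s / of_real s * (g' s * u s - g s * u' s)) + (g s / of_real s * (f' s * u s - f s * u' s) - 0)"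
  proof (rule half_line_FTC_split[where F = "\<lambda>r. g s / of_real s * (f' r * u r - f r * u' r)"
        and G = "\<lambda>r. f s / of_real s * (g' r * u r - g r * u' r)", OF s])
    fix r assume r: "0 < r" "r \<le> s"
    have "?K r * h r = g s / of_real s * (f r * (h r / of_real r))"
      using r by (simp add: green_kernel_def min_absorb2 max_absorb1)
    then show "((\<lambda>r. g s / of_real s * (f' r * u r - f r * u' r)) has_vector_derivative ?K r * h r) (at r)"
      using has_vector_derivative_mult_right[OF W[OF r(1) f_deriv[OF r(1)] f'_deriv[OF r(1)]], of "g s / of_real s"] by simp
  next
    fix r assume r: "s \<le> r"
    have r0: "r > 0" using r s by simp
    have "?K r * h r = f s / of_real s * (g r * (h r / of_real r))"
      using r by (simp add: green_kernel_def min_absorb1 max_absorb2)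
    then show "((\<lambda>r. f s / of_real s * (g' r * u r - g r * u' r)) has_vector_derivative ?K r * h r) (at r)"
      using has_vector_derivative_mult_right[OF W[OF r0 g_deriv[OF r0] g'_deriv[OF r0]], of "f s / of_real s"] by simp
  next
    show "continuous_on {0<..} (\<lambda>r. ?K r * h r)"
      by (intro continuous_on_mult h kernel_section_continuous[OF green_kernel_continuous[OF f_cont g_cont] s])
    show "integrable half_line (\<lambda>r. ?K r * h r)"
      using square_integrable_product[OF sq square_integrable_cnj[OF h(2)]] by simp
    show "((\<lambda>r. g s / of_real s * (f' r * u r - f r * u' r)) \<longlongrightarrow> 0) (at_right 0)"
      using tendsto_mult[OF tendsto_const lim(1), of "g s / of_real s"] by simp
    show "((\<lambda>r. f s / of_real s * (g' r * u r - g r * u' r)) \<longlongrightarrow> 0) at_top"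
      using tendsto_mult[OF tendsto_const lim(2), of "f s / of_real s"] by simp
  qed
  also have "\<dots> = (f' s * g s - f s * g' s) * (u s / of_real s)"
    by (simp add: algebra_simps diff_divide_distrib add_divide_distrib)
  finally show ?thesis unfolding wr[OF s] by simp
qed

text \<open>Raising the index by one turns sin x into -cos x, where x = r - pi b/2, so the
  combination is asymptotic to sin x - \<i> \<sigma> cos x = -\<i> \<sigma> exp(\<i> \<sigma> x), a
  wave of a single direction.\<close>

lemma besJ_outgoing:
  assumes b: "b > -1/2" and \<sigma>: "\<sigma> = 1 \<or> \<sigma> = -1"
  defines "u \<equiv> \<lambda>r. of_real (besJ b r) + \<i> * of_real \<sigma> * of_real (besJ (b + 1) r)"
    and "u' \<equiv> \<lambda>r. of_real (besJ' b r) + \<i> * of_real \<sigma> * of_real (besJ' (b + 1) r)"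
  shows "((\<lambda>r. u' r - \<i> * of_real \<sigma> * u r) \<longlongrightarrow> 0) at_top"
    and "\<exists>C. \<forall>r\<ge>1. cmod (u r) \<le> C"
    and "\<exists>C\<ge>0. \<forall>r. 0 < r \<longrightarrow> r \<le> 1 \<longrightarrow> cmod (u r) \<le> C * r powr (b + 1) \<and> cmod (u' r) \<le> C * r powr b"
proof -
  have b1: "b + 1 > -1/2" using b by simp
  have \<sigma>2: "of_real \<sigma> * of_real \<sigma> = (1 :: complex)" using \<sigma> by auto
  have sh: "sin (r - pi * (b + 1) / 2) = - cos (r - pi * b / 2)" "cos (r - pi * (b + 1) / 2) = sin (r - pi * b / 2)" for r
  proof -
    have "r - pi * (b + 1) / 2 = (r - pi * b / 2) - pi / 2" by (simp add: field_simps)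
    then show "sin (r - pi * (b + 1) / 2) = - cos (r - pi * b / 2)" "cos (r - pi * (b + 1) / 2) = sin (r - pi * b / 2)"
      by (simp_all only: sin_diff cos_diff) simp_all
  qed
  have "((\<lambda>r. (besJ' b r - cos (r - pi * b / 2)) + (besJ (b + 1) r - sin (r - pi * (b + 1) / 2))) \<longlongrightarrow> 0 + 0) at_top"
    by (intro tendsto_add besJ_asymp b b1)
  then have 1: "((\<lambda>r. besJ' b r + besJ (b + 1) r) \<longlongrightarrow> 0) at_top" by (simp add: sh)
  have "((\<lambda>r. (besJ' (b + 1) r - cos (r - pi * (b + 1) / 2)) - (besJ b r - sin (r - pi * b / 2))) \<longlongrightarrow> 0 - 0) at_top"
    by (intro tendsto_diff besJ_asymp b b1)
  then have 2: "((\<lambda>r. besJ' (b + 1) r - besJ b r) \<longlongrightarrow> 0) at_top" by (simp add: sh)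
  have "((\<lambda>r. of_real (besJ' b r + besJ (b + 1) r) + \<i> * of_real \<sigma> * of_real (besJ' (b + 1) r - besJ b r)) \<longlongrightarrow> of_real 0 + \<i> * of_real \<sigma> * of_real 0) at_top"
    by (intro tendsto_add tendsto_mult tendsto_const tendsto_of_real 1 2)
  moreover have "of_real (besJ' b r + besJ (b + 1) r) + \<i> * of_real \<sigma> * of_real (besJ' (b + 1) r - besJ b r) = u' r - \<i> * of_real \<sigma> * u r" for r
    using \<sigma> by (auto simp: u_def u'_def algebra_simps)
  ultimately show "((\<lambda>r. u' r - \<i> * of_real \<sigma> * u r) \<longlongrightarrow> 0) at_top" by simp
  have tri: "cmod (of_real x + \<i> * of_real \<sigma> * of_real y) \<le> \<bar>x\<bar> + \<bar>y\<bar>" for x y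
    using norm_triangle_ineq[of "of_real x" "\<i> * of_real \<sigma> * of_real y"] \<sigma> by (auto simp: norm_mult)
  show "\<exists>C. \<forall>r\<ge>1. cmod (u r) \<le> C"
  proof (rule besJ_bound_infinity[OF b], rule besJ_bound_infinity[OF b1])
    fix C D assume C: "\<And>r. r \<ge> 1 \<Longrightarrow> \<bar>besJ b r\<bar> \<le> C" and D: "\<And>r. r \<ge> 1 \<Longrightarrow> \<bar>besJ (b + 1) r\<bar> \<le> D"
    show ?thesis
    proof (intro exI[of _ "C + D"] allI impI)
      fix r :: real assume "r \<ge> 1"
      from C[OF this] D[OF this] tri[of "besJ b r" "besJ (b + 1) r"] show "cmod (u r) \<le> C + D" unfolding u_def by linarith
    qed
  qed
  obtain C where C: "C \<ge> 0" "\<And>r. 0 < r \<Longrightarrow> r \<le> 1 \<Longrightarrow> \<bar>besJ b r\<bar> \<le> C * r powr (b + 1)" "\<And>r. 0 < r \<Longrightarrow> r \<le> 1 \<Longrightarrow> \<bar>besJ' b r\<bar> \<le> C * r powr b"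
    using besJ_bound_zero[OF b] by auto
  obtain D where D: "D \<ge> 0" "\<And>r. 0 < r \<Longrightarrow> r \<le> 1 \<Longrightarrow> \<bar>besJ (b + 1) r\<bar> \<le> D * r powr (b + 1 + 1)" "\<And>r. 0 < r \<Longrightarrow> r \<le> 1 \<Longrightarrow> \<bar>besJ' (b + 1) r\<bar> \<le> D * r powr (b + 1)"
    using besJ_bound_zero[OF b1] by auto
  show "\<exists>C\<ge>0. \<forall>r. 0 < r \<longrightarrow> r \<le> 1 \<longrightarrow> cmod (u r) \<le> C * r powr (b + 1) \<and> cmod (u' r) \<le> C * r powr b"
  proof (intro exI[of _ "C + D"] conjI allI impI)
    show "0 \<le> C + D" using C D by simp
    fix r :: real assume r: "0 < r" "r \<le> 1"
    have p: "D * r powr (b + 1 + 1) \<le> D * r powr (b + 1)" "D * r powr (b + 1) \<le> D * r powr b"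
      using r D(1) by (intro mult_left_mono powr_mono', simp_all)+
    show "cmod (u r) \<le> (C + D) * r powr (b + 1)"
      using tri[of "besJ b r" "besJ (b + 1) r"] C(2)[OF r] D(2)[OF r] p(1) unfolding u_def distrib_right by linarith
    show "cmod (u' r) \<le> (C + D) * r powr b"
      using tri[of "besJ' b r" "besJ' (b + 1) r"] C(3)[OF r] D(3)[OF r] p(2) unfolding u'_def distrib_right by linarith
  qed
qed

text \<open>The two Bessel vectors are not orthogonal, but their inner product is real while the
  second coefficient is imaginary, so the cross terms cancel.\<close>

lemma norm_bes_combination:
  assumes b: "b > -1/2" and \<sigma>: "\<sigma> = 1 \<or> \<sigma> = -1"
  shows "(norm (scaleC_L2 (of_real x) (bes b) + scaleC_L2 (\<i> * of_real (\<sigma> * y)) (bes (b + 1))))\<^sup>2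
    = pi / 4 * (x\<^sup>2 / (b + 1/2) + y\<^sup>2 / (b + 3/2))"
proof -
  have b1: "b + 1 > -1/2" using b by simp
  let ?c = "b * (b + 1) - (b + 1) * (b + 1 + 1)"
  have c: "?c \<noteq> 0" using b by (simp add: algebra_simps)
  have "cinner_L2 (bes b) (bes (b + 1)) = of_real (sin (pi * (b - (b + 1)) / 2)) / of_real ?c"
    using cinner_bes[OF b b1] c by (metis nonzero_mult_div_cancel_left of_real_eq_0_iff)
  then obtain k where k: "cinner_L2 (bes b) (bes (b + 1)) = of_real k" by (metis of_real_divide)
  then have k': "cinner_L2 (bes (b + 1)) (bes b) = of_real k" by (subst cinner_L2_commute) simp
  have n: "(norm (bes b))\<^sup>2 = pi / 4 / (b + 1/2)" "(norm (bes (b + 1)))\<^sup>2 = pi / 4 / (b + 3/2)"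
    unfolding norm_bes[OF b] norm_bes[OF b1] using b by (simp_all add: field_simps)
  have "complex_of_real ((norm (scaleC_L2 (of_real x) (bes b) + scaleC_L2 (\<i> * of_real (\<sigma> * y)) (bes (b + 1))))\<^sup>2)
    = of_real (x\<^sup>2 * (norm (bes b))\<^sup>2 + y\<^sup>2 * (norm (bes (b + 1)))\<^sup>2)"
    unfolding cinner_L2_self[symmetric] cinner_L2_simps k k'
    using \<sigma> by (auto simp: cinner_L2_self power2_eq_square algebra_simps)
  then have "(norm (scaleC_L2 (of_real x) (bes b) + scaleC_L2 (\<i> * of_real (\<sigma> * y)) (bes (b + 1))))\<^sup>2
    = x\<^sup>2 * (norm (bes b))\<^sup>2 + y\<^sup>2 * (norm (bes (b + 1)))\<^sup>2" by (simp only: of_real_eq_iff)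
  then show ?thesis unfolding n by (simp add: algebra_simps)
qed

text \<open>The operators for indices \<nu> and \<mu> differ by (\<nu>^2 - \<mu>^2)/r^2. Applying
  the first, minus 1, to r^(1/2) J_\<mu> therefore reproduces this function with that factor, and
  one power of 1/r goes to the weight on each side.\<close>

lemma boundary_resolvent_trial:
  assumes \<nu>: "\<nu> > 0" and \<sigma>: "\<sigma> = 1 \<or> \<sigma> = -1" and \<mu>: "\<mu> > 0"
  defines "b \<equiv> \<mu> - 1/2"
  shows "boundary_resolvent \<nu> \<sigma> (scaleC_L2 (of_real (\<nu>\<^sup>2 - \<mu>\<^sup>2)) (bes b) + scaleC_L2 (\<i> * of_real (\<sigma> * (\<nu>\<^sup>2 - (\<mu> + 1)\<^sup>2))) (bes (b + 1)))
    = scaleC_L2 (of_real 1) (bes b) + scaleC_L2 (\<i> * of_real (\<sigma> * 1)) (bes (b + 1))"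
proof -
  have b: "b > -1/2" "b + 1 > -1/2" using \<mu> by (simp_all add: b_def)
  define q where "q = - \<i> * of_real \<sigma>"
  have q: "Re q \<ge> 0" "q \<noteq> 0" "Re q = 0" "q\<^sup>2 = -1" using \<sigma> by (auto simp: q_def)
  let ?f = "zeta (\<nu> - 1/2) q" and ?f' = "zeta' (\<nu> - 1/2) q" and ?g = "psi (\<nu> - 1/2) q" and ?g' = "psi' (\<nu> - 1/2) q"
  interpret G: green_pair \<nu> q ?f ?f' ?g ?g' by (rule green_pair_bessel[OF \<nu> q(1,2)])
  interpret K: bounded_kernel "green_kernel ?f ?g" "bound_const \<nu>"
    using boundary_resolvent_kernel(1)[OF \<nu> \<sigma>] by (simp only: q_def bessel_kernel_def)
  define u where "u r = of_real (besJ b r) + \<i> * of_real \<sigma> * of_real (besJ (b + 1) r)" for r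
  define u' where "u' r = of_real (besJ' b r) + \<i> * of_real \<sigma> * of_real (besJ' (b + 1) r)" for r
  define h where "h r = of_real (\<nu>\<^sup>2 - \<mu>\<^sup>2) * of_real (besJ b r / r)
      + \<i> * of_real (\<sigma> * (\<nu>\<^sup>2 - (\<mu> + 1)\<^sup>2)) * of_real (besJ (b + 1) r / r)" for r
  note out = besJ_outgoing[OF b(1) \<sigma>, folded u_def u'_def]
  note si = square_integrable_besJ[OF b(1)] square_integrable_besJ[OF b(2)]
  have bb: "b * (b + 1) = \<mu>\<^sup>2 - 1/4" "(b + 1) * (b + 1 + 1) = (\<mu> + 1)\<^sup>2 - 1/4"
    by (simp_all add: b_def power2_eq_square field_simps)
  have sih: "square_integrable h"
    unfolding h_def by (intro square_integrable_add square_integrable_mult si)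
  have "kfun (green_kernel ?f ?g) (abs_L2 h) s = u s / of_real s" if s: "s > 0" for s
  proof (rule G.kfun_green[OF _ _ _ sih _ _ s])
    fix r :: real assume r: "r > 0"
    show "(u has_vector_derivative u' r) (at r)"
      unfolding u_def u'_def by (rule has_vector_derivative_add[OF besJ_vderiv(1)[OF b(1) r] has_vector_derivative_mult_right[OF besJ_vderiv(1)[OF b(2) r]]])
    have d: "(u' has_vector_derivative of_real ((b * (b + 1) / r\<^sup>2 - 1) * besJ b r)
        + \<i> * of_real \<sigma> * of_real (((b + 1) * (b + 1 + 1) / r\<^sup>2 - 1) * besJ (b + 1) r)) (at r)"
      unfolding u'_def by (rule has_vector_derivative_add[OF besJ_vderiv(2)[OF b(1) r] has_vector_derivative_mult_right[OF besJ_vderiv(2)[OF b(2) r]]])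
    have "of_real ((b * (b + 1) / r\<^sup>2 - 1) * besJ b r) + \<i> * of_real \<sigma> * of_real (((b + 1) * (b + 1 + 1) / r\<^sup>2 - 1) * besJ (b + 1) r)
      = (q\<^sup>2 + of_real (\<nu>\<^sup>2 - 1/4) / of_real r ^ 2) * u r - h r / of_real r"
      unfolding q(4) bb using r by (simp add: u_def h_def field_simps power2_eq_square)
    with d show "(u' has_vector_derivative (q\<^sup>2 + of_real (\<nu>\<^sup>2 - 1/4) / of_real r ^ 2) * u r - h r / of_real r) (at r)" by simp
  next
    show "continuous_on {0<..} h"
      unfolding h_def by (intro continuous_on_add continuous_on_mult continuous_on_const continuous_on_of_real continuous_on_divide besJ_continuous b continuous_on_id) auto
    obtain C where C: "\<And>r. 0 < r \<Longrightarrow> r \<le> 1 \<Longrightarrow> cmod (?f r) \<le> C * r powr (\<nu> + 1/2)" "\<And>r. 0 < r \<Longrightarrow> r \<le> 1 \<Longrightarrow> cmod (?f' r) \<le> C * r powr (\<nu> - 1/2)"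
      using G.f_zero by blast
    have C0: "C \<ge> 0" using order_trans[OF norm_ge_zero C(1)[of 1]] by simp
    obtain D where D: "D \<ge> 0" "\<And>r. 0 < r \<Longrightarrow> r \<le> 1 \<Longrightarrow> cmod (u r) \<le> D * r powr (b + 1)" "\<And>r. 0 < r \<Longrightarrow> r \<le> 1 \<Longrightarrow> cmod (u' r) \<le> D * r powr b"
      using out(3) by blast
    show "((\<lambda>r. ?f' r * u r - ?f r * u' r) \<longlongrightarrow> 0) (at_right 0)"
    proof (rule tendsto_null_at_right[of "\<nu> + \<mu>" _ "2 * (C * D)"])
      show "\<nu> + \<mu> > 0" using \<nu> \<mu> by simp
      fix r :: real assume r: "0 < r" "r \<le> 1"
      have p: "r powr (\<nu> - 1/2) * r powr (b + 1) = r powr (\<nu> + \<mu>)" "r powr (\<nu> + 1/2) * r powr b = r powr (\<nu> + \<mu>)"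
        by (simp_all add: b_def add_ac flip: powr_add)
      have "cmod (?f' r * u r) \<le> (C * r powr (\<nu> - 1/2)) * (D * r powr (b + 1))"
        unfolding norm_mult using C D C0 r by (intro mult_mono) auto
      also have "\<dots> = C * D * r powr (\<nu> + \<mu>)" unfolding p(1)[symmetric] by (simp only: mult_ac)
      finally have 1: "cmod (?f' r * u r) \<le> C * D * r powr (\<nu> + \<mu>)" .
      have "cmod (?f r * u' r) \<le> (C * r powr (\<nu> + 1/2)) * (D * r powr b)"
        unfolding norm_mult using C D C0 r by (intro mult_mono) auto
      also have "\<dots> = C * D * r powr (\<nu> + \<mu>)" unfolding p(2)[symmetric] by (simp only: mult_ac)
      finally show "norm (?f' r * u r - ?f r * u' r) \<le> 2 * (C * D) * r powr (\<nu> + \<mu>)"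
        using 1 norm_triangle_ineq4[of "?f' r * u r" "?f r * u' r"] by linarith
    qed
    obtain E where E: "\<And>r. r \<ge> 1 \<Longrightarrow> cmod (?g r) \<le> E" "\<And>r. r \<ge> 1 \<Longrightarrow> cmod (?g' r + q * ?g r) \<le> E / r"
      using G.g_inf unfolding q(3) by auto
    obtain M where M: "\<And>r. r \<ge> 1 \<Longrightarrow> cmod (u r) \<le> M" using out(2) by blast
    have g0: "((\<lambda>r. ?g' r + q * ?g r) \<longlongrightarrow> 0) at_top"
    proof (rule Lim_null_comparison)
      show "eventually (\<lambda>r. norm (?g' r + q * ?g r) \<le> E / r) at_top"
        using eventually_ge_at_top[of "1::real"] by (rule eventually_mono) (rule E(2))
      show "((\<lambda>r. E / r) \<longlongrightarrow> 0) at_top"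
        by (rule tendsto_divide_0[OF tendsto_const]) (rule filterlim_at_top_imp_at_infinity[OF filterlim_ident])
    qed
    have ev: "eventually (\<lambda>r. norm (u r) \<le> M) at_top" "eventually (\<lambda>r. norm (?g r) \<le> E) at_top"
      using eventually_mono[OF eventually_ge_at_top[of "1::real"] M] eventually_mono[OF eventually_ge_at_top[of "1::real"] E(1)] by auto
    \<comment> \<open>Inserting q g u twice writes the Wronskian at infinity through the radiation
      terms of \<open>g\<close> and of \<open>u\<close>, each of which tends to 0 against a bounded
      factor.\<close>
    have "((\<lambda>r. (?g' r + q * ?g r) * u r - (u' r - \<i> * of_real \<sigma> * u r) * ?g r) \<longlongrightarrow> 0 - 0) at_top"
      by (intro tendsto_diff tendsto_null_mult_bounded[OF g0 ev(1)] tendsto_null_mult_bounded[OF out(1) ev(2)])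
    then show "((\<lambda>r. ?g' r * u r - ?g r * u' r) \<longlongrightarrow> 0) at_top"
      by (simp add: q_def algebra_simps)
  qed
  then have ae: "AE r in half_line. kfun (green_kernel ?f ?g) (abs_L2 h) r = of_real 1 * of_real (besJ b r / r) + \<i> * of_real (\<sigma> * 1) * of_real (besJ (b + 1) r / r)"
    by (intro AE_half_lineI) (simp add: u_def add_divide_distrib)
  have comb: "scaleC_L2 x (bes b) + scaleC_L2 y (bes (b + 1)) = abs_L2 (\<lambda>r. x * of_real (besJ b r / r) + y * of_real (besJ (b + 1) r / r))" for x y
    unfolding bes_def scaleC_abs_L2[OF si(1)] scaleC_abs_L2[OF si(2)]
    by (rule plus_abs_L2[OF square_integrable_mult[OF si(1)] square_integrable_mult[OF si(2)]])
  have "boundary_resolvent \<nu> \<sigma> (abs_L2 h) = abs_L2 (kfun (green_kernel ?f ?g) (abs_L2 h))"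
    unfolding boundary_resolvent_kernel(2)[OF \<nu> \<sigma>] q_def[symmetric] bessel_kernel_def kop_def ..
  also have "\<dots> = scaleC_L2 (of_real 1) (bes b) + scaleC_L2 (\<i> * of_real (\<sigma> * 1)) (bes (b + 1))"
    unfolding comb by (subst abs_L2_eq_iff[OF K.kfun_square_integrable square_integrable_add[OF square_integrable_mult[OF si(1)] square_integrable_mult[OF si(2)]]]) (rule ae)
  finally show ?thesis unfolding comb[of "of_real (\<nu>\<^sup>2 - \<mu>\<^sup>2)"] h_def[abs_def] .
qed

section \<open>Consequences for the operator norm\<close>

lemma onorm_boundary_resolvent_trial:
  assumes \<nu>: "\<nu> > 0" and \<sigma>: "\<sigma> = 1 \<or> \<sigma> = -1" and \<mu>: "\<mu> > 0"
  shows "1 / \<mu> + 1 / (\<mu> + 1) \<le> (onorm (boundary_resolvent \<nu> \<sigma>))\<^sup>2 * ((\<nu>\<^sup>2 - \<mu>\<^sup>2)\<^sup>2 / \<mu> + (\<nu>\<^sup>2 - (\<mu> + 1)\<^sup>2)\<^sup>2 / (\<mu> + 1))"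
proof -
  have b: "\<mu> - 1/2 > -1/2" using \<mu> by simp
  have e: "\<mu> - 1/2 + 1/2 = \<mu>" "\<mu> - 1/2 + 3/2 = \<mu> + 1" by simp_all
  let ?f = "scaleC_L2 (of_real (\<nu>\<^sup>2 - \<mu>\<^sup>2)) (bes (\<mu> - 1/2)) + scaleC_L2 (\<i> * of_real (\<sigma> * (\<nu>\<^sup>2 - (\<mu> + 1)\<^sup>2))) (bes (\<mu> - 1/2 + 1))"
  have "bounded_linear (boundary_resolvent \<nu> \<sigma>)" using onorm_boundary_resolvent(1)[OF \<nu> \<sigma>] by (simp add: bounded_clinear_def)
  from onorm[OF this, of ?f] have "(norm (boundary_resolvent \<nu> \<sigma> ?f))\<^sup>2 \<le> (onorm (boundary_resolvent \<nu> \<sigma>))\<^sup>2 * (norm ?f)\<^sup>2"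
    unfolding power_mult_distrib[symmetric] by (intro power_mono) auto
  then have "pi / 4 * (1 / \<mu> + 1 / (\<mu> + 1)) \<le>
    pi / 4 * ((onorm (boundary_resolvent \<nu> \<sigma>))\<^sup>2 * ((\<nu>\<^sup>2 - \<mu>\<^sup>2)\<^sup>2 / \<mu> + (\<nu>\<^sup>2 - (\<mu> + 1)\<^sup>2)\<^sup>2 / (\<mu> + 1)))"
    unfolding boundary_resolvent_trial[OF assms] norm_bes_combination[OF b \<sigma>] e by (simp add: mult_ac)
  then show ?thesis by (simp add: mult_le_cancel_left)
qed

lemma onorm_boundary_resolvent_nonneg:
  "\<nu> > 0 \<Longrightarrow> \<sigma> = 1 \<or> \<sigma> = -1 \<Longrightarrow> 0 \<le> onorm (boundary_resolvent \<nu> \<sigma>)"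
  using onorm_boundary_resolvent(1)[of \<nu> \<sigma>] by (auto simp: bounded_clinear_def onorm_pos_le)

text \<open>Multiplying the trial inequality by \<mu> before the limit isolates the terms with the
  diverging norm 1/\<mu>; their quotient tends to 1/\<nu>^4.\<close>

lemma onorm_boundary_resolvent_ge_inverse_square:
  assumes \<nu>: "\<nu> > 0" and \<sigma>: "\<sigma> = 1 \<or> \<sigma> = -1"
  shows "1 / \<nu>\<^sup>2 \<le> onorm (boundary_resolvent \<nu> \<sigma>)"
proof -
  define N where "N = onorm (boundary_resolvent \<nu> \<sigma>)"
  have "1 + 0 / (0 + 1) \<le> N\<^sup>2 * ((\<nu>\<^sup>2 - 0\<^sup>2)\<^sup>2 + (\<nu>\<^sup>2 - (0 + 1)\<^sup>2)\<^sup>2 * (0 / (0 + 1)))"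
  proof (rule tendsto_le[OF trivial_limit_at_right_real])
    show "((\<lambda>\<mu>. N\<^sup>2 * ((\<nu>\<^sup>2 - \<mu>\<^sup>2)\<^sup>2 + (\<nu>\<^sup>2 - (\<mu> + 1)\<^sup>2)\<^sup>2 * (\<mu> / (\<mu> + 1)))) \<longlongrightarrow> N\<^sup>2 * ((\<nu>\<^sup>2 - 0\<^sup>2)\<^sup>2 + (\<nu>\<^sup>2 - (0 + 1)\<^sup>2)\<^sup>2 * (0 / (0 + 1)))) (at_right 0)"
      by (intro tendsto_mult tendsto_add tendsto_diff tendsto_power tendsto_divide tendsto_const tendsto_ident_at) auto
    show "((\<lambda>\<mu>. 1 + \<mu> / (\<mu> + 1)) \<longlongrightarrow> 1 + 0 / (0 + (1::real))) (at_right 0)"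
      by (intro tendsto_add tendsto_divide tendsto_const tendsto_ident_at) auto
    show "eventually (\<lambda>\<mu>. 1 + \<mu> / (\<mu> + 1) \<le> N\<^sup>2 * ((\<nu>\<^sup>2 - \<mu>\<^sup>2)\<^sup>2 + (\<nu>\<^sup>2 - (\<mu> + 1)\<^sup>2)\<^sup>2 * (\<mu> / (\<mu> + 1)))) (at_right 0)"
      unfolding eventually_at_right_field
    proof (intro exI[of _ 1] conjI allI impI)
      fix \<mu> :: real assume \<mu>: "0 < \<mu>"
      have "\<mu> * (1 / \<mu> + 1 / (\<mu> + 1)) \<le> \<mu> * (N\<^sup>2 * ((\<nu>\<^sup>2 - \<mu>\<^sup>2)\<^sup>2 / \<mu> + (\<nu>\<^sup>2 - (\<mu> + 1)\<^sup>2)\<^sup>2 / (\<mu> + 1)))"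
        by (rule mult_left_mono[OF onorm_boundary_resolvent_trial[OF \<nu> \<sigma> \<mu>, folded N_def]]) (use \<mu> in simp)
      moreover have "\<mu> * (1 / \<mu> + 1 / (\<mu> + 1)) = 1 + \<mu> / (\<mu> + 1)" using \<mu> by (simp add: distrib_left)
      moreover have "\<mu> * (N\<^sup>2 * (x / \<mu> + y / (\<mu> + 1))) = N\<^sup>2 * (x + y * (\<mu> / (\<mu> + 1)))" for x y
        using \<mu> by (simp add: distrib_left mult_ac)
      ultimately show "1 + \<mu> / (\<mu> + 1) \<le> N\<^sup>2 * ((\<nu>\<^sup>2 - \<mu>\<^sup>2)\<^sup>2 + (\<nu>\<^sup>2 - (\<mu> + 1)\<^sup>2)\<^sup>2 * (\<mu> / (\<mu> + 1)))" by simp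
    qed simp
  qed
  then have "1\<^sup>2 \<le> (N * \<nu>\<^sup>2)\<^sup>2" by (simp add: power_mult_distrib)
  then have "1 \<le> N * \<nu>\<^sup>2"
    by (rule power2_le_imp_le) (use onorm_boundary_resolvent_nonneg[OF assms] in \<open>simp add: N_def\<close>)
  then show ?thesis using \<nu> by (simp add: N_def pos_divide_le_eq)
qed

text \<open>For \<mu> = \<nu> - 1/2 the coefficients are \<nu> - 1/4 and -(\<nu> + 1/4). Bounding
  both by \<nu> + 1/4 in modulus makes the weights 1/\<mu> and 1/(\<mu>+1) cancel from the
  inequality.\<close>

lemma onorm_boundary_resolvent_ge:
  assumes \<nu>: "\<nu> > 1/2" and \<sigma>: "\<sigma> = 1 \<or> \<sigma> = -1"
  shows "1 / (\<nu> + 1/4) \<le> onorm (boundary_resolvent \<nu> \<sigma>)"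
proof -
  define N where "N = onorm (boundary_resolvent \<nu> \<sigma>)"
  define \<mu> where "\<mu> = \<nu> - 1/2"
  have \<nu>0: "\<nu> > 0" and \<mu>: "\<mu> > 0" using \<nu> by (simp_all add: \<mu>_def)
  have k: "(\<nu>\<^sup>2 - \<mu>\<^sup>2)\<^sup>2 \<le> (\<nu> + 1/4)\<^sup>2" "(\<nu>\<^sup>2 - (\<mu> + 1)\<^sup>2)\<^sup>2 = (\<nu> + 1/4)\<^sup>2"
  proof -
    have "\<nu>\<^sup>2 - \<mu>\<^sup>2 = \<nu> - 1/4" "\<nu>\<^sup>2 - (\<mu> + 1)\<^sup>2 = - (\<nu> + 1/4)"
      by (simp_all add: \<mu>_def power2_eq_square algebra_simps)
    then show "(\<nu>\<^sup>2 - \<mu>\<^sup>2)\<^sup>2 \<le> (\<nu> + 1/4)\<^sup>2" "(\<nu>\<^sup>2 - (\<mu> + 1)\<^sup>2)\<^sup>2 = (\<nu> + 1/4)\<^sup>2"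
      using \<nu> by (simp_all only: power2_minus) (intro power_mono, auto)
  qed
  have s: "1 / \<mu> + 1 / (\<mu> + 1) > 0" using \<mu> by (simp add: add_pos_pos)
  have "1 / \<mu> + 1 / (\<mu> + 1) \<le> N\<^sup>2 * ((\<nu>\<^sup>2 - \<mu>\<^sup>2)\<^sup>2 / \<mu> + (\<nu>\<^sup>2 - (\<mu> + 1)\<^sup>2)\<^sup>2 / (\<mu> + 1))"
    unfolding N_def by (rule onorm_boundary_resolvent_trial[OF \<nu>0 \<sigma> \<mu>])
  also have "\<dots> \<le> N\<^sup>2 * ((\<nu> + 1/4)\<^sup>2 / \<mu> + (\<nu> + 1/4)\<^sup>2 / (\<mu> + 1))"
    unfolding k(2) using \<mu> k(1) by (intro mult_left_mono add_mono divide_right_mono) auto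
  also have "\<dots> = (N * (\<nu> + 1/4))\<^sup>2 * (1 / \<mu> + 1 / (\<mu> + 1))"
    unfolding power_mult_distrib by (simp add: distrib_left)
  finally have "1\<^sup>2 \<le> (N * (\<nu> + 1/4))\<^sup>2" using s by simp
  then have "1 \<le> N * (\<nu> + 1/4)"
    by (rule power2_le_imp_le) (use onorm_boundary_resolvent_nonneg[OF \<nu>0 \<sigma>] \<nu>0 in \<open>simp add: N_def\<close>)
  then show ?thesis using \<nu>0 by (simp add: N_def pos_divide_le_eq)
qed

text \<open>Upper and lower bound each deviate from 1/\<nu> by at most 1/\<nu>^2, which is below
  \<nu>^(-3/2) for \<nu> >= 1.\<close>

lemma onorm_boundary_resolvent_asymp:
  assumes \<nu>: "\<nu> \<ge> 1" and \<sigma>: "\<sigma> = 1 \<or> \<sigma> = -1"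
  shows "\<bar>onorm (boundary_resolvent \<nu> \<sigma>) - 1 / \<nu>\<bar> \<le> \<nu> powr (-3/2)"
proof -
  define N where "N = onorm (boundary_resolvent \<nu> \<sigma>)"
  have \<nu>0: "\<nu> > 0" and sq: "1 \<le> \<nu>\<^sup>2" using \<nu> by simp_all
  have "1 / \<nu>\<^sup>2 \<le> \<nu> powr (-3/2)"
  proof -
    have "1 / \<nu>\<^sup>2 = \<nu> powr (- 2)" using \<nu>0 by (simp add: powr_minus_divide powr_numeral)
    also have "\<dots> \<le> \<nu> powr (-3/2)" using \<nu> by (intro powr_mono) auto
    finally show ?thesis .
  qed
  moreover have "1 / \<nu> - 1 / \<nu>\<^sup>2 \<le> N"
  proof -
    have "1 / \<nu> - 1 / \<nu>\<^sup>2 \<le> 1 / (\<nu> + 1/4)"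
      using \<nu> by (simp add: field_simps power2_eq_square)
    then show ?thesis using onorm_boundary_resolvent_ge[of \<nu>, OF _ \<sigma>] \<nu> by (simp add: N_def)
  qed
  moreover have "N \<le> 1 / \<nu> + 1 / \<nu>\<^sup>2"
  proof -
    have "N \<le> 1 / sqrt (\<nu>\<^sup>2 - 1/4)"
      using onorm_boundary_resolvent(2)[OF \<nu>0 \<sigma>] sq by (simp add: N_def bound_const_def)
    \<comment> \<open>The comparison value is chosen for its reciprocal, which is exactly 1/\<nu> +
      1/\<nu>^2.\<close>
    also have "\<dots> \<le> 1 / (\<nu>\<^sup>2 / (\<nu> + 1))"
    proof (rule divide_left_mono)
      have "\<nu> * 1 \<le> \<nu> * \<nu>" "(\<nu> * \<nu>) * 1 \<le> \<nu> * \<nu> * \<nu>" using \<nu> by (intro mult_left_mono; simp)+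
      moreover have "(4 * \<nu>\<^sup>2 - 1) * (\<nu> + 1)\<^sup>2 - 4 * (\<nu>\<^sup>2)\<^sup>2 = 8 * (\<nu> * \<nu> * \<nu>) + 3 * (\<nu> * \<nu>) - 2 * \<nu> - 1"
        by (simp add: power2_eq_square algebra_simps)
      ultimately have "4 * (\<nu>\<^sup>2)\<^sup>2 \<le> (4 * \<nu>\<^sup>2 - 1) * (\<nu> + 1)\<^sup>2" using \<nu> by linarith
      moreover have "(\<nu>\<^sup>2 - 1/4) * (\<nu> + 1)\<^sup>2 = (4 * \<nu>\<^sup>2 - 1) * (\<nu> + 1)\<^sup>2 / 4" by (simp add: left_diff_distrib diff_divide_distrib)
      ultimately have "(\<nu>\<^sup>2)\<^sup>2 \<le> (\<nu>\<^sup>2 - 1/4) * (\<nu> + 1)\<^sup>2" by linarith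
      then have "(\<nu>\<^sup>2 / (\<nu> + 1))\<^sup>2 \<le> \<nu>\<^sup>2 - 1/4" using \<nu> by (simp add: power_divide pos_divide_le_eq)
      then show "\<nu>\<^sup>2 / (\<nu> + 1) \<le> sqrt (\<nu>\<^sup>2 - 1/4)" by (rule real_le_rsqrt)
      then show "0 < sqrt (\<nu>\<^sup>2 - 1/4) * (\<nu>\<^sup>2 / (\<nu> + 1))" using \<nu>0 sq by (intro mult_pos_pos real_sqrt_gt_zero divide_pos_pos) (auto simp del: one_le_power)
    qed simp
    also have "\<dots> = 1 / \<nu> + 1 / \<nu>\<^sup>2" using \<nu>0 by (simp add: power2_eq_square add_divide_distrib)
    finally show ?thesis .
  qed
  ultimately show ?thesis unfolding N_def by linarith
qed

theorem theorem1p1: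
  fixes \<sigma> :: real
  assumes "\<sigma> = 1 \<or> \<sigma> = -1"
  shows "(\<forall>\<nu>>0. onorm (Im_op (boundary_resolvent \<nu> \<sigma>)) = pi / (4 * \<nu>)) \<and>
    (\<forall>\<nu>. 0 < \<nu> \<and> \<nu> \<le> 1/2 \<longrightarrow> onorm (boundary_resolvent \<nu> \<sigma>) = 1 / \<nu>\<^sup>2) \<and>
    (\<lambda>\<nu>. onorm (boundary_resolvent \<nu> \<sigma>) - 1 / \<nu>) \<in> O[at_top](\<lambda>\<nu>. \<nu> powr (-3/2)) \<and>
    (\<forall>\<nu>>0. onorm (boundary_resolvent \<nu> \<sigma>) \<le> C_bound \<nu>)"
proof (intro conjI allI impI)
  have upper: "onorm (boundary_resolvent \<nu> \<sigma>) \<le> C_bound \<nu>" if "\<nu> > 0" for \<nu>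
    using onorm_boundary_resolvent(2)[OF that assms] bound_const_le_C_bound[OF that] by linarith
  fix \<nu> :: real
  show "onorm (boundary_resolvent \<nu> \<sigma>) \<le> C_bound \<nu>" if "\<nu> > 0" by (rule upper[OF that])
  show "onorm (Im_op (boundary_resolvent \<nu> \<sigma>)) = pi / (4 * \<nu>)" if "\<nu> > 0"
  proof -
    have "\<nu> - 1/2 > -1/2" using that by simp
    from norm_bes[OF this] show ?thesis
      unfolding onorm_Im_boundary_resolvent[OF that assms] bes_def by simp
  qed
  show "onorm (boundary_resolvent \<nu> \<sigma>) = 1 / \<nu>\<^sup>2" if "0 < \<nu> \<and> \<nu> \<le> 1/2"
    using upper[of \<nu>] onorm_boundary_resolvent_ge_inverse_square[of \<nu>, OF _ assms] that
    by (auto simp: C_bound_def)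
next
  show "(\<lambda>\<nu>. onorm (boundary_resolvent \<nu> \<sigma>) - 1 / \<nu>) \<in> O[at_top](\<lambda>\<nu>. \<nu> powr (-3/2))"
  proof (rule bigoI[where c = 1])
    show "eventually (\<lambda>\<nu>. norm (onorm (boundary_resolvent \<nu> \<sigma>) - 1 / \<nu>) \<le> 1 * norm (\<nu> powr (-3/2))) at_top"
      using eventually_ge_at_top[of "1::real"]
    proof eventually_elim
      case (elim \<nu>)
      then show ?case using onorm_boundary_resolvent_asymp[OF elim assms] by simp
    qed
  qed
qed

end
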